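(* Let $T\colon X\to X$ be a two-sided subshift of finite type. Let $\mathbb{E}$ be a $d$-dimensional $\theta$-Hölder vector bundle over $X$. Let $\Phi$ be a spannable automorphism of $\mathbb{E}$ covering $T$. Then $$|\!|\!|u|\!|\!|:=\limsup_{n\to\infty}e^{-\beta(\Phi)n}\sup_{v\in\mathbb{W}^{\mathrm u}_{\mathrm{loc}}(u)}\|\Phi^n(v)\|$$ is a well-defined Barabanov norm on $\mathbb{E}$, namely an extremal norm (a Finsler norm with $\beta(\Phi)=\log\sup_{x}|\!|\!|\Phi_x|\!|\!|$) satisfying, for all $u\in\mathbb{E}$: (1) local $H^{\mathrm u}$-invariance: $|\!|\!|u|\!|\!|=|\!|\!|v|\!|\!|$ for all $v\in\mathbb{W}^{\mathrm u}_{\mathrm{loc}}(u)$; (2) calibration: there exists $v\in\mathbb{W}^{\mathrm u}_{\mathrm{loc}}(u)$ such that $|\!|\!|\Phi(v)|\!|\!|=e^{\beta(\Phi)}|\!|\!|v|\!|\!|$. Furthermore, $|\!|\!|\cdot|\!|\!|$ satisfies the following properties: (a) there exists $C_4>1$ with $C_4^{-1}\|u\|\le|\!|\!|u|\!|\!|\le C_4\|u\|$ for every $u\in\mathbb{E}$; (b) there is $C_5>0$ with $\big||\!|\!|I_{x'\gets x}|\!|\!|-1\big|\le C_5\,\mathrm{dist}(x,x')^{\theta_{\mathrm u}}$ for all $x,x'\in X$; (c) there is $C_6>0$ with $\big||\!|\!|H^{\mathrm u}_{x'\gets x}|\!|\!|-1\big|\le C_6\,\mathrm{dist}(x,x')^{\max\{\theta,1\}}$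 for all $x\in X$, $x'\in W^{\mathrm u}_{\epsilon_0}(x)$; and, if $\Phi\in\mathrm{Aut}^\theta_K(\mathbb{E},T)$, then for every sufficiently $C^0$-small perturbation of $\Phi$ in $\mathrm{Aut}^\theta_K(\mathbb{E},T)$ one can find an extremal norm for the perturbed automorphism satisfying (a), (b), (c) with the same constants $\theta_{\mathrm u},C_4,C_5,C_6$.
   Context: Subshifts. $X$ is the set of two-sided sequences $(x_n)_{n\in\mathbb{Z}}$ in an alphabet $\{0,\dots,N-1\}$ whose neighboring pairs are those allowed by a fixed 0-1 matrix, and $T$ is the left shift. The metric is $\mathrm{dist}(x,y)=e^{-\lambda k}$, $k=\min\{|n|:x_n\ne y_n\}$ (and $0$ if $x=y$), with $\lambda>0$ a fixed parameter. Put $\epsilon_0=e^{-\lambda}$ and constant hyperbolicity exponents $\lambda_{\mathrm u}=\lambda_{\mathrm s}=\lambda$. Local sets: $W^{\mathrm u}_{\mathrm{loc}}(x)=W^{\mathrm u}_{\epsilon_0}(x)=\{(y_n)\in X:y_n=x_n\ \forall n\le0\}$ and $W^{\mathrm s}_{\mathrm{loc}}(x)=W^{\mathrm s}_{\epsilon_0}(x)=\{(y_n)\in X:y_n=x_n\ \forall n\ge0\}$. Global sets: $W^{\mathrm u}(x)=\{y:\mathrm{dist}(T^{-n}y,T^{-n}x)\to0\}$, $W^{\mathrm s}(x)=\{y:\mathrm{dist}(T^{n}y,T^{n}x)\to0\}$ as $n\to+\infty$. Bundles. $\theta>0$. $\pi\colon\mathbb{E}\to X$ is a $\theta$-Hölder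 $d$-dimensional real vector bundle: there is a finite open cover $\{U_i\}$ and coordinate maps giving linear isomorphisms $h_i(x)\colon\mathbb{R}^d\to\mathbb{E}_x$, $x\in U_i$, with $x\mapsto h_j(x)^{-1}h_i(x)$ $\theta$-Hölder on $U_i\cap U_j$. A Finsler norm on $\mathbb{E}$ is a continuous function $\mathbb{E}\to\mathbb{R}$ restricting to a norm on each fiber; it is Riemannian if these norms come from inner products. For linear maps between fibers the same symbol denotes the operator norm. A $\theta$-Hölder Riemannian norm $\|\cdot\|$ (i.e. $x\in U_i\mapsto\|h_i(x)u\|$ is $\theta$-Hölder for each $i$, $u$) is fixed. Transport maps: fix linear maps $I_{y\gets x}\colon\mathbb{E}_x\to\mathbb{E}_y$ ($x,y\in X$) with $I_{x\gets x}=\mathrm{id}$ and $(x,y)\in U_i\times U_j\mapsto h_j(y)^{-1}I_{y\gets x}h_i(x)$ $\theta$-Hölder (such a family exists). Automorphisms. An automorphism $\Phi$ of $\mathbb{E}$ covering $T$ is a continuous map $\mathbb{E}\to\mathbb{E}$ with $\pi\circ\Phi=T\circ\pi$ whose restrictions $\Phi_x\colon\mathbb{E}_x\to\mathbb{E}_{Tx}$ are linear isomorphisms; it is $\theta$-Hölder if $x\in U_i\cap T^{-1}(U_j)\mapsto h_j(Tx)^{-1}\Phi_xh_i(x)$ is $\theta$-Hölder for all $i,j$. Put $\|\Phi\|_0=\sup_x\|\Phi_x\|$ ($C^0$ norm), $\|\Phi\|_\theta=\max\{\|\Phi\|_0,\sup_{x\ne y}\|I_{Ty\gets Tx}\Phi_x-\Phi_yI_{y\gets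 x}\|/\mathrm{dist}(x,y)^\theta\}$ (and similarly for $\Phi^{-1}$, which covers $T^{-1}$), and for $K\ge1$ let $\mathrm{Aut}^\theta_K(\mathbb{E},T)$ be the set of $\theta$-Hölder automorphisms covering $T$ with $\|\Phi\|_\theta\le K$, $\|\Phi^{-1}\|_\theta\le K$. Fiber-bunching and holonomies. For an isomorphism $L$ of inner product spaces, $\mathrm{bol}(L)=\|L\|\,\|L^{-1}\|$. A $\theta$-Hölder automorphism $\Phi$ covering $T$ is fiber-bunched if for some Riemannian norm, $\log\mathrm{bol}(\Phi_x)<\theta\lambda$ for all $x\in X$. Then set $H^{\mathrm s}_{y\gets x}=\lim_{n\to+\infty}(\Phi^n_y)^{-1}\circ I_{T^ny\gets T^nx}\circ\Phi^n_x$ for $y\in W^{\mathrm s}(x)$, and define $H^{\mathrm u}_{y\gets x}$ for $y\in W^{\mathrm u}(x)$ by the same formula with $n\to-\infty$ (the limits exist). For $u\in\mathbb{E}$ with $x=\pi(u)$, $\mathbb{W}^{\mathrm u}_{\mathrm{loc}}(u)=\{H^{\mathrm u}_{y\gets x}(u):y\in W^{\mathrm u}_{\mathrm{loc}}(x)\}$. The exponent $\theta_{\mathrm u}$. Let $\kappa_{\mathrm u}\in(0,1]$ be such that for some $C$, $\mathrm{dist}(y,y')\le C\,\mathrm{dist}(x,x')^{\kappa_{\mathrm u}}$ whenever $x'\in W^{\mathrm s}_{\epsilon_0}(x)$, $y'\in W^{\mathrm s}_{\epsilon_0}(y)$, $y\in W^{\mathrm u}_{\epsilon_0}(x)$, $y'\in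 W^{\mathrm u}_{\epsilon_0}(x')$. Then $\theta_{\mathrm u}\in(0,\theta\kappa_{\mathrm u}]$ is an exponent such that, for some $C>0$ and all such quadruples, $\|H^{\mathrm s}_{y'\gets y}\circ H^{\mathrm u}_{y\gets x}-H^{\mathrm u}_{y'\gets x'}\circ H^{\mathrm s}_{x'\gets x}\|\le C\,\mathrm{dist}(x,x')^{\theta_{\mathrm u}}$, with the same $\theta_{\mathrm u}$, $C$ valid for all automorphisms in a $C^0$-neighborhood of $\Phi$ in $\mathrm{Aut}^\theta_K(\mathbb{E},T)$ (such $\kappa_{\mathrm u},\theta_{\mathrm u}$ exist). Spannability. A fiber-bunched automorphism $\Phi$ is spannable if for all $x,y\in X$ and all nonzero $u\in\mathbb{E}_x$ there exist $x_1,\dots,x_d\in W^{\mathrm u}(x)$ and integers $n_1,\dots,n_d\ge0$ such that the points $y_i=T^{n_i}x_i$ all belong to $W^{\mathrm s}(y)$ and the vectors $v_i=H^{\mathrm s}_{y\gets y_i}\circ\Phi^{n_i}_{x_i}\circ H^{\mathrm u}_{x_i\gets x}(u)$ form a basis of $\mathbb{E}_y$. Maximal Lyapunov exponent. $\beta(\Phi)=\sup_\mu\chi_1(\Phi,\mu)$ over all $T$-invariant Borel probability measures $\mu$, where $\chi_1(\Phi,\mu)=\int\lim_{n\to\infty}\frac1n\log\|\Phi^n_x\|\,d\mu(x)$. *)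

theory Defs
  imports "HOL-Analysis.Analysis" "HOL-Probability.Probability"
begin

section \<open>Two-sided subshifts of finite type\<close>

type_synonym biseq = "int \<Rightarrow> nat"

record sft =
  nsym :: nat
  allowed :: "nat \<Rightarrow> nat \<Rightarrow> bool"
  rate :: real

definition spts :: "('m) sft_scheme \<Rightarrow> biseq set" where
  "spts B = {x. \<forall>n. x n < nsym B \<and> allowed B (x n) (x (n + 1))}"

text \<open>\<open>shift n\<close> is the power \<open>T\<^sup>n\<close> of the left shift, for any integer \<open>n\<close>.\<close>

definition shift :: "int \<Rightarrow> biseq \<Rightarrow> biseq" where
  "shift n x = (\<lambda>k. x (k + n))"

text \<open>The type \<^typ>\<open>biseq\<close> also carries the library metric of a countable product, which is
  not the one used here.\<close>

definition sdist :: "('m) sft_scheme \<Rightarrow> biseq \<Rightarrow> biseq \<Rightarrow> real" where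
  "sdist B x y = (if x = y then 0
     else exp (- rate B * real (LEAST k::nat. \<exists>n::int. \<bar>n\<bar> = int k \<and> x n \<noteq> y n)))"

lemma sdist_eq_exp:
  assumes "x \<noteq> y"
  obtains k :: nat and n where "sdist B x y = exp (- rate B * real k)" "\<bar>n\<bar> = int k" "x n \<noteq> y n"
    "\<And>j. x j \<noteq> y j \<Longrightarrow> int k \<le> \<bar>j\<bar>"
proof -
  define P where "P = (\<lambda>k::nat. \<exists>n::int. \<bar>n\<bar> = int k \<and> x n \<noteq> y n)"
  from assms obtain m where "x m \<noteq> y m" by blast
  then have "P (nat \<bar>m\<bar>)" unfolding P_def by auto
  then have "P (LEAST k. P k)" by (rule LeastI)
  then obtain n where n: "\<bar>n\<bar> = int (LEAST k. P k)" "x n \<noteq> y n" unfolding P_def by blast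
  have "int (LEAST k. P k) \<le> \<bar>j\<bar>" if "x j \<noteq> y j" for j
  proof -
    from that have "P (nat \<bar>j\<bar>)" unfolding P_def by auto
    then have "(LEAST k. P k) \<le> nat \<bar>j\<bar>" by (rule Least_le)
    then show ?thesis by linarith
  qed
  moreover have "sdist B x y = exp (- rate B * real (LEAST k. P k))"
    using assms by (simp add: sdist_def P_def)
  ultimately show ?thesis using n that by blast
qed

lemma sdist_ultra:
  assumes "rate B > 0"
  shows "sdist B x z \<le> max (sdist B x y) (sdist B y z)"
proof (cases "x = y \<or> y = z \<or> x = z")
  case True
  then show ?thesis by (auto simp: sdist_def le_max_iff_disj)
next
  case False
  obtain k n where k: "sdist B x z = exp (- rate B * real k)" "\<bar>n\<bar> = int k" "x n \<noteq> z n"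
    by (rule sdist_eq_exp[of x z B]) (use False in auto)
  obtain k1 where k1: "sdist B x y = exp (- rate B * real k1)" "\<And>j. x j \<noteq> y j \<Longrightarrow> int k1 \<le> \<bar>j\<bar>"
    by (rule sdist_eq_exp[of x y B]) (use False in auto)
  obtain k2 where k2: "sdist B y z = exp (- rate B * real k2)" "\<And>j. y j \<noteq> z j \<Longrightarrow> int k2 \<le> \<bar>j\<bar>"
    by (rule sdist_eq_exp[of y z B]) (use False in auto)
  have "x n \<noteq> y n \<or> y n \<noteq> z n" using k(3) by auto
  then have "k1 \<le> k \<or> k2 \<le> k" using k1(2)[of n] k2(2)[of n] k(2) by auto
  then show ?thesis using assms k(1) k1(1) k2(1) by (auto simp: le_max_iff_disj)
qed

lemma Metric_space_sdist:
  assumes "rate B > 0"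
  shows "Metric_space (spts B) (sdist B)"
proof
  show nn: "0 \<le> sdist B x y" for x y by (simp add: sdist_def)
  show "sdist B x y = sdist B y x" for x y
    unfolding sdist_def by (simp add: eq_commute)
  show "sdist B x y = 0 \<longleftrightarrow> x = y" for x y by (simp add: sdist_def)
  show "sdist B x z \<le> sdist B x y + sdist B y z" for x y z
    using sdist_ultra[OF assms, of x z y] nn[of x y] nn[of y z] by linarith
qed

definition stop :: "('m) sft_scheme \<Rightarrow> biseq topology" where
  "stop B = Metric_space.mtopology (spts B) (sdist B)"

definition Wu_loc :: "('m) sft_scheme \<Rightarrow> biseq \<Rightarrow> biseq set" where
  "Wu_loc B x = {y \<in> spts B. \<forall>n\<le>0. y n = x n}"

definition Ws_loc :: "('m) sft_scheme \<Rightarrow> biseq \<Rightarrow> biseq set" where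
  "Ws_loc B x = {y \<in> spts B. \<forall>n\<ge>0. y n = x n}"

definition Wu :: "('m) sft_scheme \<Rightarrow> biseq \<Rightarrow> biseq set" where
  "Wu B x = {y \<in> spts B. (\<lambda>n::nat. sdist B (shift (- int n) y) (shift (- int n) x)) \<longlonglongrightarrow> 0}"

definition Ws :: "('m) sft_scheme \<Rightarrow> biseq \<Rightarrow> biseq set" where
  "Ws B x = {y \<in> spts B. (\<lambda>n::nat. sdist B (shift (int n) y) (shift (int n) x)) \<longlonglongrightarrow> 0}"

text \<open>Local product quadruples: \<open>x, x'\<close> and \<open>y, y'\<close> on common local stable sets,
  \<open>x, y\<close> and \<open>x', y'\<close> on common local unstable sets.\<close>

definition quadruple :: "('m) sft_scheme \<Rightarrow> biseq \<Rightarrow> biseq \<Rightarrow> biseq \<Rightarrow> biseq \<Rightarrow> bool" where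
  "quadruple B x x' y y' \<longleftrightarrow> x \<in> spts B \<and> x' \<in> Ws_loc B x \<and> y' \<in> Ws_loc B y \<and>
     y \<in> Wu_loc B x \<and> y' \<in> Wu_loc B x'"

definition kappa_exponent :: "('m) sft_scheme \<Rightarrow> real \<Rightarrow> bool" where
  "kappa_exponent B \<kappa> \<longleftrightarrow> 0 < \<kappa> \<and> \<kappa> \<le> 1 \<and>
     (\<exists>C. \<forall>x x' y y'. quadruple B x x' y y' \<longrightarrow> sdist B y y' \<le> C * sdist B x x' powr \<kappa>)"

definition invariant_measures :: "('m) sft_scheme \<Rightarrow> biseq measure set" where
  "invariant_measures B = {\<mu>. prob_space \<mu> \<and> space \<mu> = spts B \<and>
     sets \<mu> = sigma_sets (spts B) {U. openin (stop B) U} \<and> distr \<mu> \<mu> (shift 1) = \<mu>}"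


section \<open>Vector bundles over a subshift\<close>

text \<open>The rank of the bundle is \<open>CARD('d)\<close>. The field \<open>tot\<close> is the total space with its
  topology; \<open>vadd\<close>, \<open>vscale\<close> and \<open>vzero\<close> are the fiberwise vector space operations;
  \<open>chart i x\<close> is the coordinate map \<open>h\<^sub>i(x)\<close>, used only for \<open>i < nch\<close> and
  \<open>x \<in> cdom i\<close>; \<open>transp y x\<close> is the transport map from the fiber of \<open>x\<close> to that
  of \<open>y\<close>; \<open>rnorm\<close> is the fixed Riemannian norm and \<open>hexp\<close> the Hoelder exponent
  \<open>\<theta>\<close>. Maps between fibers are functions on the type \<open>'e\<close>, of which only the values on
  the relevant fibers matter.\<close>

record ('e, 'd) hbundle = sft +
  hexp :: real
  tot :: "'e topology"
  proj :: "'e \<Rightarrow> biseq"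
  vadd :: "'e \<Rightarrow> 'e \<Rightarrow> 'e"
  vscale :: "real \<Rightarrow> 'e \<Rightarrow> 'e"
  vzero :: "biseq \<Rightarrow> 'e"
  nch :: nat
  cdom :: "nat \<Rightarrow> biseq set"
  chart :: "nat \<Rightarrow> biseq \<Rightarrow> real ^ 'd \<Rightarrow> 'e"
  transp :: "biseq \<Rightarrow> biseq \<Rightarrow> 'e \<Rightarrow> 'e"
  rnorm :: "'e \<Rightarrow> real"

definition vsub :: "('e, 'd::finite) hbundle \<Rightarrow> 'e \<Rightarrow> 'e \<Rightarrow> 'e" where
  "vsub B u v = vadd B u (vscale B (- 1) v)"

definition fiber :: "('e, 'd::finite) hbundle \<Rightarrow> biseq \<Rightarrow> 'e set" where
  "fiber B x = {u \<in> topspace (tot B). proj B u = x}"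

text \<open>Hoelder maps with values in the linear endomorphisms of \<open>\<real>\<^sup>d\<close>, for a distance \<open>\<rho>\<close>.\<close>

definition holder_op ::
    "real \<Rightarrow> ('p \<Rightarrow> 'p \<Rightarrow> real) \<Rightarrow> 'p set \<Rightarrow> ('p \<Rightarrow> real ^ 'd \<Rightarrow> real ^ 'd::finite) \<Rightarrow> bool" where
  "holder_op \<theta> \<rho> S g \<longleftrightarrow>
     (\<exists>C. \<forall>p\<in>S. \<forall>q\<in>S. onorm (\<lambda>v. g p v - g q v) \<le> C * \<rho> p q powr \<theta>)"

text \<open>The vector space axioms in each fiber follow from those of \<open>\<real>\<^sup>d\<close>, because the
  coordinate maps are bijections onto the fibers which respect the operations.\<close>

definition holder_vector_bundle :: "('e, 'd::finite) hbundle \<Rightarrow> bool" where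
  "holder_vector_bundle B \<longleftrightarrow>
     continuous_map (tot B) (stop B) (proj B) \<and>
     (\<Union>i<nch B. cdom B i) = spts B \<and>
     (\<forall>i<nch B. openin (stop B) (cdom B i) \<and>
        homeomorphic_map (prod_topology (subtopology (stop B) (cdom B i)) euclidean)
          (subtopology (tot B) {u \<in> topspace (tot B). proj B u \<in> cdom B i})
          (\<lambda>(x, v). chart B i x v) \<and>
        (\<forall>x\<in>cdom B i. bij_betw (chart B i x) UNIV (fiber B x) \<and>
           chart B i x 0 = vzero B x \<and>
           (\<forall>v w. chart B i x (v + w) = vadd B (chart B i x v) (chart B i x w)) \<and>
           (\<forall>c v. chart B i x (c *\<^sub>R v) = vscale B c (chart B i x v)))) \<and>
     (\<forall>i<nch B. \<forall>j<nch B. holder_op (hexp B) (sdist B) (cdom B i \<inter> cdom B j)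
        (\<lambda>x v. inv (chart B j x) (chart B i x v)))"

definition fiber_linear :: "('e, 'd::finite) hbundle \<Rightarrow> biseq \<Rightarrow> biseq \<Rightarrow> ('e \<Rightarrow> 'e) \<Rightarrow> bool" where
  "fiber_linear B x y L \<longleftrightarrow> L ` fiber B x \<subseteq> fiber B y \<and>
     (\<forall>u\<in>fiber B x. \<forall>v\<in>fiber B x. L (vadd B u v) = vadd B (L u) (L v)) \<and>
     (\<forall>c. \<forall>u\<in>fiber B x. L (vscale B c u) = vscale B c (L u))"

definition fiber_basis :: "('e, 'd::finite) hbundle \<Rightarrow> biseq \<Rightarrow> (nat \<Rightarrow> 'e) \<Rightarrow> bool" where
  "fiber_basis B y v \<longleftrightarrow>
     (let lincomb = (\<lambda>c::nat \<Rightarrow> real.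
            foldr (\<lambda>i w. vadd B (vscale B (c i) (v i)) w) [0..<CARD('d)] (vzero B y))
      in (\<forall>i<CARD('d). v i \<in> fiber B y) \<and>
         (\<forall>c. lincomb c = vzero B y \<longrightarrow> (\<forall>i<CARD('d). c i = 0)) \<and>
         (\<forall>w\<in>fiber B y. \<exists>c. lincomb c = w))"

subsection \<open>Norms\<close>

definition finsler_norm :: "('e, 'd::finite) hbundle \<Rightarrow> ('e \<Rightarrow> real) \<Rightarrow> bool" where
  "finsler_norm B f \<longleftrightarrow> continuous_map (tot B) euclideanreal f \<and>
     (\<forall>x\<in>spts B. \<forall>u\<in>fiber B x.
        0 \<le> f u \<and> (f u = 0 \<longleftrightarrow> u = vzero B x) \<and>
        (\<forall>c. f (vscale B c u) = \<bar>c\<bar> * f u) \<and>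
        (\<forall>v\<in>fiber B x. f (vadd B u v) \<le> f u + f v))"

definition fiber_inner :: "('e, 'd::finite) hbundle \<Rightarrow> biseq \<Rightarrow> ('e \<Rightarrow> 'e \<Rightarrow> real) \<Rightarrow> bool" where
  "fiber_inner B x p \<longleftrightarrow> (\<forall>u\<in>fiber B x. \<forall>v\<in>fiber B x.
     p u v = p v u \<and>
     (\<forall>w\<in>fiber B x. p (vadd B u v) w = p u w + p v w) \<and>
     (\<forall>c. p (vscale B c u) v = c * p u v)) \<and>
     (\<forall>u\<in>fiber B x. 0 \<le> p u u \<and> (p u u = 0 \<longleftrightarrow> u = vzero B x))"

definition riemannian_norm :: "('e, 'd::finite) hbundle \<Rightarrow> ('e \<Rightarrow> real) \<Rightarrow> bool" where
  "riemannian_norm B f \<longleftrightarrow> finsler_norm B f \<and>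
     (\<forall>x\<in>spts B. \<exists>p. fiber_inner B x p \<and> (\<forall>u\<in>fiber B x. f u = sqrt (p u u)))"

definition holder_norm :: "('e, 'd::finite) hbundle \<Rightarrow> ('e \<Rightarrow> real) \<Rightarrow> bool" where
  "holder_norm B f \<longleftrightarrow> (\<forall>i<nch B. \<forall>v. \<exists>C. \<forall>x\<in>cdom B i. \<forall>y\<in>cdom B i.
     \<bar>f (chart B i x v) - f (chart B i y v)\<bar> \<le> C * sdist B x y powr hexp B)"

text \<open>Operator norm, with respect to the Finsler norm \<open>f\<close>, of a linear map \<open>L\<close> from the
  fiber of \<open>x\<close> to another fiber.\<close>

definition fnorm :: "('e, 'd::finite) hbundle \<Rightarrow> ('e \<Rightarrow> real) \<Rightarrow> biseq \<Rightarrow> ('e \<Rightarrow> 'e) \<Rightarrow> real" where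
  "fnorm B f x L = (SUP u\<in>{u \<in> fiber B x. f u \<le> 1}. f (L u))"

definition transport_family :: "('e, 'd::finite) hbundle \<Rightarrow> bool" where
  "transport_family B \<longleftrightarrow>
     (\<forall>x\<in>spts B. \<forall>y\<in>spts B. fiber_linear B x y (transp B y x)) \<and>
     (\<forall>x\<in>spts B. \<forall>u\<in>fiber B x. transp B x x u = u) \<and>
     (\<forall>i<nch B. \<forall>j<nch B.
        holder_op (hexp B) (\<lambda>(x, y) (x', y'). max (sdist B x x') (sdist B y y'))
          (cdom B i \<times> cdom B j)
          (\<lambda>(x, y) v. inv (chart B j y) (transp B y x (chart B i x v))))"

text \<open>All the standing data: base, bundle, fixed norm and transport maps. For an empty subshift
  there is no invariant measure, hence no (finite) maximal Lyapunov exponent.\<close>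

definition bundle_setting :: "('e, 'd::finite) hbundle \<Rightarrow> bool" where
  "bundle_setting B \<longleftrightarrow> rate B > 0 \<and> spts B \<noteq> {} \<and> hexp B > 0 \<and>
     holder_vector_bundle B \<and> transport_family B \<and>
     riemannian_norm B (rnorm B) \<and> holder_norm B (rnorm B)"


section \<open>Automorphisms\<close>

definition automorphism :: "('e, 'd::finite) hbundle \<Rightarrow> ('e \<Rightarrow> 'e) \<Rightarrow> bool" where
  "automorphism B \<Phi> \<longleftrightarrow> continuous_map (tot B) (tot B) \<Phi> \<and>
     (\<forall>u\<in>topspace (tot B). proj B (\<Phi> u) = shift 1 (proj B u)) \<and>
     (\<forall>x\<in>spts B. fiber_linear B x (shift 1 x) \<Phi> \<and>
        bij_betw \<Phi> (fiber B x) (fiber B (shift 1 x)))"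

definition holder_automorphism :: "('e, 'd::finite) hbundle \<Rightarrow> ('e \<Rightarrow> 'e) \<Rightarrow> bool" where
  "holder_automorphism B \<Phi> \<longleftrightarrow> automorphism B \<Phi> \<and>
     (\<forall>i<nch B. \<forall>j<nch B.
        holder_op (hexp B) (sdist B) {x \<in> cdom B i. shift 1 x \<in> cdom B j}
          (\<lambda>x v. inv (chart B j (shift 1 x)) (\<Phi> (chart B i x v))))"

definition ainv :: "('e, 'd::finite) hbundle \<Rightarrow> ('e \<Rightarrow> 'e) \<Rightarrow> 'e \<Rightarrow> 'e" where
  "ainv B \<Phi> = inv_into (topspace (tot B)) \<Phi>"

definition apow :: "('e, 'd::finite) hbundle \<Rightarrow> ('e \<Rightarrow> 'e) \<Rightarrow> int \<Rightarrow> 'e \<Rightarrow> 'e" where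
  "apow B \<Phi> n = (if 0 \<le> n then \<Phi> ^^ nat n else ainv B \<Phi> ^^ nat (- n))"

definition c0norm :: "('e, 'd::finite) hbundle \<Rightarrow> ('e \<Rightarrow> 'e) \<Rightarrow> real" where
  "c0norm B \<Phi> = (SUP x\<in>spts B. fnorm B (rnorm B) x \<Phi>)"

definition c0dist :: "('e, 'd::finite) hbundle \<Rightarrow> ('e \<Rightarrow> 'e) \<Rightarrow> ('e \<Rightarrow> 'e) \<Rightarrow> real" where
  "c0dist B \<Phi> \<Psi> = c0norm B (\<lambda>u. vsub B (\<Phi> u) (\<Psi> u))"

text \<open>Hoelder norm of an automorphism \<open>\<Phi>\<close> which covers \<open>T\<^sup>n\<close>; it is extended real
  valued, so that the supremum is harmless if unbounded or taken over no pairs at all.\<close>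

definition holder_aut_norm :: "('e, 'd::finite) hbundle \<Rightarrow> int \<Rightarrow> ('e \<Rightarrow> 'e) \<Rightarrow> ereal" where
  "holder_aut_norm B n \<Phi> = max (ereal (c0norm B \<Phi>))
     (SUP (x, y)\<in>{(x, y). x \<in> spts B \<and> y \<in> spts B \<and> x \<noteq> y}.
        ereal (fnorm B (rnorm B) x
            (\<lambda>u. vsub B (transp B (shift n y) (shift n x) (\<Phi> u)) (\<Phi> (transp B y x u)))
          / sdist B x y powr hexp B))"

definition Aut :: "('e, 'd::finite) hbundle \<Rightarrow> real \<Rightarrow> ('e \<Rightarrow> 'e) set" where
  "Aut B K = {\<Phi>. holder_automorphism B \<Phi> \<and> holder_aut_norm B 1 \<Phi> \<le> ereal K \<and>
     holder_aut_norm B (- 1) (ainv B \<Phi>) \<le> ereal K}"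

definition bol :: "('e, 'd::finite) hbundle \<Rightarrow> ('e \<Rightarrow> real) \<Rightarrow> ('e \<Rightarrow> 'e) \<Rightarrow> biseq \<Rightarrow> real" where
  "bol B f \<Phi> x = fnorm B f x \<Phi> * fnorm B f (shift 1 x) (ainv B \<Phi>)"

definition fiber_bunched :: "('e, 'd::finite) hbundle \<Rightarrow> ('e \<Rightarrow> 'e) \<Rightarrow> bool" where
  "fiber_bunched B \<Phi> \<longleftrightarrow> holder_automorphism B \<Phi> \<and>
     (\<exists>f. riemannian_norm B f \<and> (\<forall>x\<in>spts B. ln (bol B f \<Phi> x) < hexp B * rate B))"

subsection \<open>Holonomies\<close>

definition hol_approx ::
    "('e, 'd::finite) hbundle \<Rightarrow> ('e \<Rightarrow> 'e) \<Rightarrow> biseq \<Rightarrow> biseq \<Rightarrow> int \<Rightarrow> 'e \<Rightarrow> 'e" where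
  "hol_approx B \<Phi> y x n u =
     apow B \<Phi> (- n) (transp B (shift n y) (shift n x) (apow B \<Phi> n u))"

text \<open>Linear maps between finite dimensional fibers converge iff they converge pointwise.
  The arguments are ordered as in \<open>H\<^bsub>y \<leftarrow> x\<^esub>\<close>.\<close>

definition Hs :: "('e, 'd::finite) hbundle \<Rightarrow> ('e \<Rightarrow> 'e) \<Rightarrow> biseq \<Rightarrow> biseq \<Rightarrow> 'e \<Rightarrow> 'e" where
  "Hs B \<Phi> y x u =
     (THE w. limitin (tot B) (\<lambda>n::nat. hol_approx B \<Phi> y x (int n) u) w sequentially)"

definition Hu :: "('e, 'd::finite) hbundle \<Rightarrow> ('e \<Rightarrow> 'e) \<Rightarrow> biseq \<Rightarrow> biseq \<Rightarrow> 'e \<Rightarrow> 'e" where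
  "Hu B \<Phi> y x u =
     (THE w. limitin (tot B) (\<lambda>n::nat. hol_approx B \<Phi> y x (- int n) u) w sequentially)"

definition WWu_loc :: "('e, 'd::finite) hbundle \<Rightarrow> ('e \<Rightarrow> 'e) \<Rightarrow> 'e \<Rightarrow> 'e set" where
  "WWu_loc B \<Phi> u = {Hu B \<Phi> y (proj B u) u | y. y \<in> Wu_loc B (proj B u)}"

definition holonomy_estimate ::
    "('e, 'd::finite) hbundle \<Rightarrow> ('e \<Rightarrow> 'e) \<Rightarrow> real \<Rightarrow> real \<Rightarrow> bool" where
  "holonomy_estimate B \<Phi> \<theta>u C \<longleftrightarrow> (\<forall>x x' y y'. quadruple B x x' y y' \<longrightarrow>
     fnorm B (rnorm B) x
       (\<lambda>u. vsub B (Hs B \<Phi> y' y (Hu B \<Phi> y x u)) (Hu B \<Phi> y' x' (Hs B \<Phi> x' x u)))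
     \<le> C * sdist B x x' powr \<theta>u)"

definition theta_u_exponent ::
    "('e, 'd::finite) hbundle \<Rightarrow> ('e \<Rightarrow> 'e) \<Rightarrow> real \<Rightarrow> real \<Rightarrow> real \<Rightarrow> bool" where
  "theta_u_exponent B \<Phi> K \<kappa> \<theta>u \<longleftrightarrow> 0 < \<theta>u \<and> \<theta>u \<le> hexp B * \<kappa> \<and>
     (\<exists>C>0. holonomy_estimate B \<Phi> \<theta>u C \<and>
        (\<exists>\<delta>>0. \<forall>\<Psi>\<in>Aut B K. c0dist B \<Psi> \<Phi> < \<delta> \<longrightarrow> holonomy_estimate B \<Psi> \<theta>u C))"

definition spannable :: "('e, 'd::finite) hbundle \<Rightarrow> ('e \<Rightarrow> 'e) \<Rightarrow> bool" where
  "spannable B \<Phi> \<longleftrightarrow> fiber_bunched B \<Phi> \<and>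
     (\<forall>x\<in>spts B. \<forall>y\<in>spts B. \<forall>u\<in>fiber B x. u \<noteq> vzero B x \<longrightarrow>
       (\<exists>(xs :: nat \<Rightarrow> biseq) (ns :: nat \<Rightarrow> nat).
          (\<forall>i<CARD('d). xs i \<in> Wu B x \<and> shift (int (ns i)) (xs i) \<in> Ws B y) \<and>
          fiber_basis B y (\<lambda>i. Hs B \<Phi> y (shift (int (ns i)) (xs i))
             ((\<Phi> ^^ ns i) (Hu B \<Phi> (xs i) x u)))))"

subsection \<open>Lyapunov exponents and extremal norms\<close>

definition lyap1 :: "('e, 'd::finite) hbundle \<Rightarrow> ('e \<Rightarrow> 'e) \<Rightarrow> biseq measure \<Rightarrow> real" where
  "lyap1 B \<Phi> \<mu> = (LINT x|\<mu>. lim (\<lambda>n. 1 / real n * ln (fnorm B (rnorm B) x (\<Phi> ^^ n))))"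

definition max_lyap :: "('e, 'd::finite) hbundle \<Rightarrow> ('e \<Rightarrow> 'e) \<Rightarrow> real" where
  "max_lyap B \<Phi> = (SUP \<mu>\<in>invariant_measures B. lyap1 B \<Phi> \<mu>)"

definition extremal_norm :: "('e, 'd::finite) hbundle \<Rightarrow> ('e \<Rightarrow> 'e) \<Rightarrow> ('e \<Rightarrow> real) \<Rightarrow> bool" where
  "extremal_norm B \<Phi> f \<longleftrightarrow> finsler_norm B f \<and>
     max_lyap B \<Phi> = ln (SUP x\<in>spts B. fnorm B f x \<Phi>)"

definition barabanov_norm :: "('e, 'd::finite) hbundle \<Rightarrow> ('e \<Rightarrow> 'e) \<Rightarrow> ('e \<Rightarrow> real) \<Rightarrow> bool" where
  "barabanov_norm B \<Phi> f \<longleftrightarrow> extremal_norm B \<Phi> f \<and>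
     (\<forall>u\<in>topspace (tot B). \<forall>v\<in>WWu_loc B \<Phi> u. f u = f v) \<and>
     (\<forall>u\<in>topspace (tot B). \<exists>v\<in>WWu_loc B \<Phi> u. f (\<Phi> v) = exp (max_lyap B \<Phi>) * f v)"

text \<open>The limsup formula is taken in the extended reals; that it is well-defined means that its
  values are finite, in which case \<open>bnorm\<close> is the corresponding real function.\<close>

definition ebnorm :: "('e, 'd::finite) hbundle \<Rightarrow> ('e \<Rightarrow> 'e) \<Rightarrow> 'e \<Rightarrow> ereal" where
  "ebnorm B \<Phi> u = limsup (\<lambda>n::nat. ereal (exp (- max_lyap B \<Phi> * real n)) *
     (SUP v\<in>WWu_loc B \<Phi> u. ereal (rnorm B ((\<Phi> ^^ n) v))))"

definition bnorm :: "('e, 'd::finite) hbundle \<Rightarrow> ('e \<Rightarrow> 'e) \<Rightarrow> 'e \<Rightarrow> real" where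
  "bnorm B \<Phi> u = real_of_ereal (ebnorm B \<Phi> u)"

definition comparable_norm :: "('e, 'd::finite) hbundle \<Rightarrow> ('e \<Rightarrow> real) \<Rightarrow> real \<Rightarrow> bool" where
  "comparable_norm B f C \<longleftrightarrow>
     (\<forall>u\<in>topspace (tot B). inverse C * rnorm B u \<le> f u \<and> f u \<le> C * rnorm B u)"

definition transport_bound ::
    "('e, 'd::finite) hbundle \<Rightarrow> ('e \<Rightarrow> real) \<Rightarrow> real \<Rightarrow> real \<Rightarrow> bool" where
  "transport_bound B f \<theta>u C \<longleftrightarrow> (\<forall>x\<in>spts B. \<forall>x'\<in>spts B.
     \<bar>fnorm B f x (transp B x' x) - 1\<bar> \<le> C * sdist B x x' powr \<theta>u)"

definition unstable_holonomy_bound ::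
    "('e, 'd::finite) hbundle \<Rightarrow> ('e \<Rightarrow> 'e) \<Rightarrow> ('e \<Rightarrow> real) \<Rightarrow> real \<Rightarrow> bool" where
  "unstable_holonomy_bound B \<Phi> f C \<longleftrightarrow> (\<forall>x\<in>spts B. \<forall>x'\<in>Wu_loc B x.
     \<bar>fnorm B f x (Hu B \<Phi> x' x) - 1\<bar> \<le> C * sdist B x x' powr max (hexp B) 1)"

end

theory Submission
  imports Defs
begin

text \<open>
  Over the totally disconnected base a Hoelder bundle is trivial, by charts chosen in a locally
  constant way, so that \<open>\<Phi>\<close> becomes a matrix cocycle. Fiber bunching gives the products in the
  definition of the holonomies a geometric rate of convergence, with the transport maps replaced
  by the identity.

  By compactness spannability is uniform: the connecting times and the basis constant are bounded,
  also for nearby automorphisms. Hence the growth of any vector along a stable set is dominated by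
  that of the given vector along its local unstable set, the maxima \<open>M n\<close> of \<open>\<parallel>\<Phi>\<^sup>n\<parallel>\<close> satisfy
  \<open>M n * M k \<le> C * M (n + k)\<close> besides submultiplicativity, and \<open>M n\<close> lies between \<open>exp (b * n)\<close>
  and a multiple of it. The upper limit is therefore finite, nonzero, and a norm. Calibration
  holds since \<open>T\<close> maps a local unstable set onto finitely many local unstable sets, one for each
  next symbol, and an upper limit of a finite maximum is the maximum of the upper limits.
  Continuity follows as stable and unstable holonomies nearly commute on small quadruples.

  Finally \<open>b\<close> is the maximal Lyapunov exponent: an orbit along which \<open>\<parallel>\<Phi>\<^sup>n\<parallel>\<close> is comparable to
  \<open>exp (b * n)\<close> from every starting time carries an invariant measure of exponent \<open>b\<close>, and the
  existence of the exponents is the subadditive ergodic theorem.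
\<close>

section \<open>The topology of a subshift\<close>

text \<open>Uniformity under perturbation shapes the bookkeeping. The estimates are proved in a
  locale whose numerical parameters bound norms and Hoelder constants, the bunching rate, a window
  \<open>m\<close> and a spanning constant \<open>D\<close>. Later constants are explicit
  expressions in these numbers and, for \<open>C5\<close>, in the constants of the transport maps
  and of the holonomy estimate. Automorphisms which satisfy the locale with the same numbers thus
  share \<open>C4\<close> and \<open>C5\<close>, and the extremal norm offered for a perturbation is
  its own limsup norm. The number \<open>max_lyap\<close> integrates limits that exist only almost
  everywhere, so growth estimates cannot be read off from it. The norm is therefore built with the
  growth rate \<open>b\<close> of the maxima, and \<open>b\<close> is identified with
  \<open>max_lyap\<close> afterwards, along an orbit that the norm itself produces. Continuity of
  the norm is claimed without any holonomy estimate; it rests on uniform continuity of the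
  holonomies, and \<open>\<theta>u\<close> enters only in (b).\<close>

lemma sdist_nonneg [simp]: "0 \<le> sdist B x y"
  by (simp add: sdist_def)

lemma sdist_self [simp]: "sdist B x x = 0"
  by (simp add: sdist_def)

lemma sdist_sym: "sdist B x y = sdist B y x"
  unfolding sdist_def by (simp add: eq_commute)

lemma sdist_le_iff:
  assumes "rate B > 0"
  shows "sdist B x y \<le> exp (- rate B * real k) \<longleftrightarrow> (\<forall>n. \<bar>n\<bar> < int k \<longrightarrow> x n = y n)"
proof (cases "x = y")
  case False
  obtain j n where j: "sdist B x y = exp (- rate B * real j)" "\<bar>n\<bar> = int j" "x n \<noteq> y n"
    "\<And>i. x i \<noteq> y i \<Longrightarrow> int j \<le> \<bar>i\<bar>"
    by (rule sdist_eq_exp[of x y B]) (use False in auto)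
  have "sdist B x y \<le> exp (- rate B * real k) \<longleftrightarrow> k \<le> j"
    using assms j(1) by simp
  also have "\<dots> \<longleftrightarrow> (\<forall>n. \<bar>n\<bar> < int k \<longrightarrow> x n = y n)"
    using j(2-4) by (metis not_le of_nat_le_iff order_less_le_trans)
  finally show ?thesis .
qed simp

lemma sdist_le_1:
  assumes "rate B > 0" shows "sdist B x y \<le> 1"
  using sdist_le_iff[OF assms, of x y 0] by simp

text \<open>The distance only records the radius of agreement around 0, so gaining \<open>c\<close>
  symbols of agreement is a factor \<open>exp (- rate B * c)\<close>. A negative \<open>c\<close>
  expresses a loss. Most estimates for shifts and brackets are instances.\<close>

lemma sdist_le_transfer:
  assumes "rate B > 0" and "\<And>k. (\<And>n. \<bar>n\<bar> < int k \<Longrightarrow> x n = y n) \<Longrightarrow>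
     (\<And>n. \<bar>n\<bar> < int k + c \<Longrightarrow> x' n = y' n)"
  shows "sdist B x' y' \<le> exp (- rate B * real_of_int c) * sdist B x y"
proof (cases "x = y")
  case True
  have "x' n = y' n" for n
    by (rule assms(2)[of "nat (\<bar>n\<bar> + \<bar>c\<bar> + 1)"]) (use True in auto)
  then have "x' = y'" by auto
  then show ?thesis by simp
next
  case False
  obtain j n where j: "sdist B x y = exp (- rate B * real j)" "\<bar>n\<bar> = int j" "x n \<noteq> y n"
    "\<And>i. x i \<noteq> y i \<Longrightarrow> int j \<le> \<bar>i\<bar>"
    by (rule sdist_eq_exp[of x y B]) (use False in auto)
  have *: "x' n = y' n" if "\<bar>n\<bar> < int j + c" for n
  proof (rule assms(2)[of j])
    show "x i = y i" if "\<bar>i\<bar> < int j" for i using j(4)[of i] that by linarith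
  qed (rule that)
  have "sdist B x' y' \<le> exp (- rate B * real_of_int (int j + c))"
  proof (cases "int j + c \<ge> 0")
    case True
    then obtain i where i: "int j + c = int i" using nonneg_int_cases by metis
    show ?thesis using sdist_le_iff[OF assms(1), of x' y' i] * by (simp add: i)
  next
    \<comment> \<open>A negative radius makes the bound at least 1, which no distance
      exceeds.\<close>
    case False
    then have "rate B * real_of_int (int j + c) \<le> 0" using assms(1) by (simp add: mult_le_0_iff)
    then have "1 \<le> exp (- rate B * real_of_int (int j + c))" by simp
    with sdist_le_1[OF assms(1), of x' y'] show ?thesis by linarith
  qed
  also have "\<dots> = exp (- rate B * real_of_int c) * sdist B x y"
    unfolding j(1) exp_add[symmetric] by (simp add: algebra_simps)
  finally show ?thesis .
qed

lemma sdist_shift_le: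
  assumes "rate B > 0"
  shows "sdist B (shift c x) (shift c y) \<le> exp (rate B * real_of_int \<bar>c\<bar>) * sdist B x y"
proof -
  have "sdist B (shift c x) (shift c y) \<le> exp (- rate B * real_of_int (- \<bar>c\<bar>)) * sdist B x y"
    by (rule sdist_le_transfer[OF assms]) (auto simp: shift_def)
  then show ?thesis by simp
qed

lemma sdist_shift_stable:
  assumes "rate B > 0" "\<forall>n\<ge>0. y n = x n"
  shows "sdist B (shift (int n) x) (shift (int n) y) \<le> exp (- rate B * real n) * sdist B x y"
proof -
  have "x i = y i" if "0 \<le> i" for i using assms(2) that by simp
  then have "sdist B (shift (int n) x) (shift (int n) y) \<le> exp (- rate B * real_of_int (int n)) * sdist B x y"
    by (intro sdist_le_transfer[OF assms(1)]) (auto simp: shift_def; smt (verit))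
  then show ?thesis by simp
qed

lemma sdist_shift_unstable:
  assumes "rate B > 0" "\<forall>n\<le>0. y n = x n"
  shows "sdist B (shift (- int n) x) (shift (- int n) y) \<le> exp (- rate B * real n) * sdist B x y"
proof -
  have "x i = y i" if "i \<le> 0" for i using assms(2) that by simp
  then have "sdist B (shift (- int n) x) (shift (- int n) y) \<le> exp (- rate B * real_of_int (int n)) * sdist B x y"
    by (intro sdist_le_transfer[OF assms(1)]) (auto simp: shift_def; smt (verit))
  then show ?thesis by simp
qed

text \<open>Contraction sets in only after \<open>m\<close> shifts; the factor
  \<open>exp (rate B * real m)\<close> pays for the wait, as distances never exceed 1.\<close>

lemma sdist_shift_stable':
  assumes "rate B > 0" "\<forall>n\<ge>int m. y n = x n"
  shows "sdist B (shift (int n) x) (shift (int n) y) \<le> exp (rate B * real m) * exp (- rate B * real n)"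
proof (cases "m \<le> n")
  case True
  then have "sdist B (shift (int n) x) (shift (int n) y) \<le> exp (- rate B * real (n - m))"
    using assms(2) by (subst sdist_le_iff[OF assms(1)]) (auto simp: shift_def)
  also have "\<dots> = exp (rate B * real m) * exp (- rate B * real n)"
    unfolding exp_add[symmetric] using True by (simp add: algebra_simps of_nat_diff)
  finally show ?thesis .
next
  case False
  have "1 \<le> exp (rate B * real m) * exp (- rate B * real n)"
    unfolding exp_add[symmetric] using False assms(1) by (simp add: algebra_simps)
  with sdist_le_1[OF assms(1)] show ?thesis by (meson order_trans)
qed

lemma sdist_shift_unstable':
  assumes "rate B > 0" "\<forall>n\<le>- int m. y n = x n"
  shows "sdist B (shift (- int n) x) (shift (- int n) y) \<le> exp (rate B * real m) * exp (- rate B * real n)"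
proof (cases "m \<le> n")
  case True
  then have "sdist B (shift (- int n) x) (shift (- int n) y) \<le> exp (- rate B * real (n - m))"
    using assms(2) by (subst sdist_le_iff[OF assms(1)]) (auto simp: shift_def)
  also have "\<dots> = exp (rate B * real m) * exp (- rate B * real n)"
    unfolding exp_add[symmetric] using True by (simp add: algebra_simps of_nat_diff)
  finally show ?thesis .
next
  case False
  have "1 \<le> exp (rate B * real m) * exp (- rate B * real n)"
    unfolding exp_add[symmetric] using False assms(1) by (simp add: algebra_simps)
  with sdist_le_1[OF assms(1)] show ?thesis by (meson order_trans)
qed

lemma sptsD: "x \<in> spts B \<Longrightarrow> x n < nsym B" "x \<in> spts B \<Longrightarrow> allowed B (x n) (x (n + 1))"
  by (simp_all add: spts_def)

lemma shift_shift [simp]: "shift a (shift b x) = shift (a + b) x"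
  by (auto simp: shift_def algebra_simps)

lemma shift_0 [simp]: "shift 0 x = x"
  by (auto simp: shift_def)

lemma shift_in_spts [simp]: "shift n x \<in> spts B \<longleftrightarrow> x \<in> spts B"
proof -
  have *: "shift n x \<in> spts B" if "x \<in> spts B" for x n
  proof -
    have "allowed B (x (k + n)) (x (k + 1 + n))" for k
    proof -
      have "allowed B (x (k + n)) (x (k + n + 1))" using that by (auto simp: spts_def)
      then show ?thesis by (simp add: algebra_simps)
    qed
    then show ?thesis using that by (auto simp: spts_def shift_def)
  qed
  show ?thesis using *[of x n] *[of "shift n x" "-n"] by auto
qed

lemma open_cylinder: "open {y::biseq. \<forall>n. \<bar>n\<bar> < int k \<longrightarrow> y n = x n}"
proof -
  have "{y::biseq. \<forall>n. \<bar>n\<bar> < int k \<longrightarrow> y n = x n}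
    = PiE UNIV (\<lambda>n. if \<bar>n\<bar> < int k then {x n} else UNIV)"
    by (auto simp: PiE_def Pi_def split: if_splits)
  also have "open \<dots>"
  proof (rule open_PiE)
    show "open (if \<bar>n\<bar> < int k then {x n} else UNIV)" for n
      by (cases "\<bar>n\<bar> < int k") (simp_all add: discrete_topology_class.open_discrete)
    have "{n. (if \<bar>n\<bar> < int k then {x n} else UNIV) \<noteq> UNIV} \<subseteq> {- int k..int k}"
      by (auto split: if_splits)
    then show "finite {n. (if \<bar>n\<bar> < int k then {x n} else UNIV) \<noteq> UNIV}"
      by (rule finite_subset) simp
  qed
  finally show ?thesis .
qed

text \<open>A basic open set of the product restricts finitely many coordinates only, so a central
  block that covers all of them suffices.\<close>

lemma open_contains_cylinder:
  assumes "open U" "x \<in> U"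
  obtains k :: nat where "\<And>y. (\<And>n. \<bar>n\<bar> < int k \<Longrightarrow> y n = (x::biseq) n) \<Longrightarrow> y \<in> U"
proof -
  have "openin (product_topology (\<lambda>i. euclidean) UNIV) U"
    using assms(1) by (simp add: euclidean_product_topology)
  from product_topology_open_contains_basis[OF this assms(2)]
  obtain X where X: "x \<in> PiE UNIV X" "finite {i. X i \<noteq> UNIV}" "PiE UNIV X \<subseteq> U"
    by auto
  define k where "k = nat (Max (insert 0 ((\<lambda>i. \<bar>i\<bar>) ` {i. X i \<noteq> UNIV})) + 1)"
  have k: "\<bar>i\<bar> < int k" if "X i \<noteq> UNIV" for i
    using Max_ge[of "insert 0 ((\<lambda>i. \<bar>i\<bar>) ` {i. X i \<noteq> UNIV})" "\<bar>i\<bar>"] X(2) that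
    unfolding k_def by fastforce
  show ?thesis
  proof (rule that)
    fix y assume y: "\<And>n. \<bar>n\<bar> < int k \<Longrightarrow> y n = x n"
    have "y n \<in> X n" for n
      using X(1) y[of n] k[of n] by (cases "X n = UNIV") (auto simp: PiE_def Pi_def)
    then show "y \<in> U" using X(3) by (auto simp: PiE_def Pi_def)
  qed
qed

text \<open>Balls of \<open>sdist\<close> are central cylinders, which also form a neighbourhood
  basis of the product topology. This makes the library topology on functions available for
  compactness, continuity and limits, although its metric is a different one.\<close>

lemma stop_eq:
  assumes "rate B > 0" shows "stop B = top_of_set (spts B)"
proof -
  interpret Metric_space "spts B" "sdist B" by (rule Metric_space_sdist[OF assms])
  have "openin mtopology U \<longleftrightarrow> openin (top_of_set (spts B)) U" for U
  proof
    assume U: "openin mtopology U"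
    then have sub: "U \<subseteq> spts B" by (simp add: openin_mtopology)
    have "\<exists>k. \<forall>y\<in>spts B. (\<forall>n. \<bar>n\<bar> < int k \<longrightarrow> y n = x n) \<longrightarrow> y \<in> U" if x: "x \<in> U" for x
    proof -
      from U x obtain r where r: "r > 0" "mball x r \<subseteq> U" by (auto simp: openin_mtopology)
      have "(\<lambda>k. exp (- rate B * real k)) \<longlonglongrightarrow> 0" using assms by real_asymp
      with r(1) obtain k where k: "exp (- rate B * real k) < r"
        by (metis (no_types, lifting) order_tendstoD(2) eventually_sequentially order_refl)
      have "y \<in> U" if y: "y \<in> spts B" "\<forall>n. \<bar>n\<bar> < int k \<longrightarrow> y n = x n" for y
      proof -
        have "sdist B x y \<le> exp (- rate B * real k)"
          using y(2) by (subst sdist_le_iff[OF assms]) auto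
        then show ?thesis using k r(2) y(1) x sub by (auto simp: mball_def)
      qed
      then show ?thesis by blast
    qed
    then obtain k where k: "\<And>x y. x \<in> U \<Longrightarrow> y \<in> spts B \<Longrightarrow> \<forall>n. \<bar>n\<bar> < int (k x) \<longrightarrow> y n = x n \<Longrightarrow> y \<in> U"
      by metis
    have "U = spts B \<inter> (\<Union>x\<in>U. {y. \<forall>n. \<bar>n\<bar> < int (k x) \<longrightarrow> y n = x n})"
      using sub k by auto
    moreover have "open (\<Union>x\<in>U. {y::biseq. \<forall>n. \<bar>n\<bar> < int (k x) \<longrightarrow> y n = x n})"
      by (intro open_UN ballI open_cylinder)
    ultimately show "openin (top_of_set (spts B)) U" unfolding openin_open by blast
  next
    assume "openin (top_of_set (spts B)) U"
    then obtain V where V: "open V" "U = spts B \<inter> V" by (auto simp: openin_open)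
    have "\<exists>r>0. mball x r \<subseteq> U" if x: "x \<in> U" for x
    proof -
      from V x obtain k where k: "\<And>y. (\<And>n. \<bar>n\<bar> < int k \<Longrightarrow> y n = x n) \<Longrightarrow> y \<in> V"
        using open_contains_cylinder[of V x] by auto
      have "y \<in> U" if "y \<in> spts B" "sdist B x y < exp (- rate B * real k)" for y
      proof -
        have "\<forall>n. \<bar>n\<bar> < int k \<longrightarrow> x n = y n"
          using less_imp_le[OF that(2)] by (simp only: sdist_le_iff[OF assms])
        then show ?thesis using k[of y] that(1) V(2) by auto
      qed
      then show ?thesis
        by (intro exI[of _ "exp (- rate B * real k)"]) (auto simp: mball_def)
    qed
    then show "openin mtopology U" using V(2) by (auto simp: openin_mtopology)
  qed
  then show ?thesis unfolding stop_def by (simp add: topology_eq)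
qed

lemma closed_spts: "closed (spts B)"
proof -
  have c: "continuous_on UNIV (\<lambda>x::biseq. x n)" for n by simp
  have "open (- spts B)"
  proof (subst open_subopen, intro ballI)
    fix x assume "x \<in> - spts B"
    then obtain n where n: "\<not> (x n < nsym B \<and> allowed B (x n) (x (n + 1)))"
      by (auto simp: spts_def)
    have "open ((\<lambda>x::biseq. x n) -` {x n} \<inter> (\<lambda>x::biseq. x (n + 1)) -` {x (n + 1)})"
      by (intro open_Int open_vimage c; rule discrete_topology_class.open_discrete)
    moreover have "(\<lambda>x::biseq. x n) -` {x n} \<inter> (\<lambda>x::biseq. x (n + 1)) -` {x (n + 1)} \<subseteq> - spts B"
    proof (intro subsetI ComplI)
      fix y assume "y \<in> (\<lambda>x::biseq. x n) -` {x n} \<inter> (\<lambda>x::biseq. x (n + 1)) -` {x (n + 1)}" "y \<in> spts B"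
      then have "y n = x n" "y (n + 1) = x (n + 1)" "y n < nsym B \<and> allowed B (y n) (y (n + 1))"
        using sptsD[of y B n] by simp_all
      with n show False by simp
    qed
    ultimately show "\<exists>T. open T \<and> x \<in> T \<and> T \<subseteq> - spts B" by blast
  qed
  then show ?thesis by (simp add: closed_def)
qed

text \<open>Tychonoff for the finite alphabet, and closedness of the transition rule.\<close>

lemma compact_spts: "compact (spts B)"
proof -
  have "compactin (product_topology (\<lambda>i::int. euclidean) UNIV) (PiE UNIV (\<lambda>i. {..<nsym B}))"
    by (simp add: compactin_PiE finite_imp_compact)
  then have "compact (PiE (UNIV::int set) (\<lambda>i. {..<nsym B}))"
    by (simp add: euclidean_product_topology)
  moreover have "spts B \<subseteq> PiE UNIV (\<lambda>i. {..<nsym B})"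
    by (auto simp: spts_def PiE_def)
  ultimately show ?thesis
    using closed_spts compact_Int_closed inf.absorb2 by metis
qed

lemma sdist_tendsto_0:
  assumes "rate B > 0" "(f \<longlongrightarrow> (x::biseq)) F"
  shows "((\<lambda>i. sdist B (f i) x) \<longlongrightarrow> 0) F"
proof (rule tendstoI)
  fix e :: real assume "e > 0"
  have "(\<lambda>k. exp (- rate B * real k)) \<longlonglongrightarrow> 0" using assms(1) by real_asymp
  with \<open>e > 0\<close> obtain k where k: "exp (- rate B * real k) < e"
    by (metis (no_types, lifting) order_tendstoD(2) eventually_sequentially order_refl)
  have "\<forall>\<^sub>F i in F. f i \<in> {y. \<forall>n. \<bar>n\<bar> < int k \<longrightarrow> y n = x n}"
    by (rule topological_tendstoD[OF assms(2) open_cylinder]) simp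
  then show "\<forall>\<^sub>F i in F. dist (sdist B (f i) x) 0 < e"
  proof eventually_elim
    case (elim i)
    then have "sdist B (f i) x \<le> exp (- rate B * real k)"
      by (subst sdist_le_iff[OF assms(1)]) auto
    then show ?case using k by simp
  qed
qed

lemma tendsto_biseq_iff:
  "(f \<longlongrightarrow> (x::biseq)) F \<longleftrightarrow> (\<forall>n. \<forall>\<^sub>F i in F. f i n = x n)"
proof
  assume *: "(f \<longlongrightarrow> x) F"
  show "\<forall>n. \<forall>\<^sub>F i in F. f i n = x n"
  proof
    fix n
    have "\<forall>\<^sub>F i in F. f i \<in> {y. \<forall>j. \<bar>j\<bar> < int (nat (\<bar>n\<bar> + 1)) \<longrightarrow> y j = x j}"
      by (rule topological_tendstoD[OF * open_cylinder]) simp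
    then show "\<forall>\<^sub>F i in F. f i n = x n" by eventually_elim auto
  qed
next
  assume *: "\<forall>n. \<forall>\<^sub>F i in F. f i n = x n"
  show "(f \<longlongrightarrow> x) F"
  proof (rule topological_tendstoI)
    fix S assume "open S" "x \<in> S"
    then obtain k where k: "\<And>y. (\<And>n. \<bar>n\<bar> < int k \<Longrightarrow> y n = x n) \<Longrightarrow> y \<in> S"
      using open_contains_cylinder[of S x] by auto
    have "\<forall>\<^sub>F i in F. \<forall>n\<in>{- int k..int k}. f i n = x n"
      using * by (subst eventually_ball_finite_distrib) auto
    then show "\<forall>\<^sub>F i in F. f i \<in> S"
      by (rule eventually_mono) (rule k, force)
  qed
qed

lemma continuous_on_shift: "continuous_on S (shift n)"
  unfolding shift_def
  by (intro continuous_on_coordinatewise_then_product continuous_on_subset[OF continuous_on_product_coordinates]) auto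

lemma tendsto_shift: "(f \<longlongrightarrow> x) F \<Longrightarrow> ((\<lambda>i. shift n (f i)) \<longlongrightarrow> shift n x) F"
  by (auto simp: tendsto_biseq_iff shift_def)

lemma holder_imp_continuous_on:
  fixes g :: "biseq \<Rightarrow> 'b::real_normed_vector"
  assumes "rate B > 0" "\<theta> > 0"
    and h: "\<And>x y. x \<in> S \<Longrightarrow> y \<in> S \<Longrightarrow> norm (g x - g y) \<le> C * sdist B x y powr \<theta>"
  shows "continuous_on S g"
  unfolding continuous_on_def
proof
  fix x assume x: "x \<in> S"
  have "((\<lambda>y. sdist B y x) \<longlongrightarrow> 0) (at x within S)"
    by (rule sdist_tendsto_0[OF assms(1)]) (rule tendsto_ident_at)
  then have "((\<lambda>y. C * sdist B y x powr \<theta>) \<longlongrightarrow> C * 0) (at x within S)"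
    using assms(2) by (intro tendsto_mult tendsto_const tendsto_zero_powrI) auto
  then have "((\<lambda>y. C * sdist B y x powr \<theta>) \<longlongrightarrow> 0) (at x within S)" by simp
  then have "((\<lambda>y. g y - g x) \<longlongrightarrow> 0) (at x within S)"
    by (rule Lim_null_comparison[rotated]) (auto simp: eventually_at_filter x intro!: h always_eventually)
  then show "(g \<longlongrightarrow> g x) (at x within S)" using LIM_zero_cancel by blast
qed

text \<open>The metric is discrete in its values: a distance of at most
  \<open>exp (- rate B)\<close> already means equality of the symbols at 0. Convergence of the
  distances to 0 therefore forces exact equality of the two pasts from some index on.\<close>

lemma Wu_level:
  assumes "rate B > 0" "y \<in> Wu B x"
  obtains m :: nat where "\<forall>n\<le>- int m. y n = x n"
proof -
  have "(\<lambda>n::nat. sdist B (shift (- int n) y) (shift (- int n) x)) \<longlonglongrightarrow> 0"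
    using assms(2) by (simp add: Wu_def)
  then have "\<forall>\<^sub>F n in sequentially. sdist B (shift (- int n) y) (shift (- int n) x) < exp (- rate B * real 1)"
    by (rule order_tendstoD) simp
  then obtain m where m: "\<And>n. n \<ge> m \<Longrightarrow> sdist B (shift (- int n) y) (shift (- int n) x) \<le> exp (- rate B * real 1)"
    unfolding eventually_sequentially by (meson less_imp_le)
  have "y n = x n" if "n \<le> - int m" for n
  proof -
    have "\<forall>j. \<bar>j\<bar> < int 1 \<longrightarrow> shift (- int (nat (- n))) y j = shift (- int (nat (- n))) x j"
      using m[of "nat (- n)"] that by (subst sdist_le_iff[OF assms(1), symmetric]) auto
    then show ?thesis using that by (auto simp: shift_def)
  qed
  then show ?thesis using that by blast
qed

lemma Ws_level:
  assumes "rate B > 0" "y \<in> Ws B x"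
  obtains m :: nat where "\<forall>n\<ge>int m. y n = x n"
proof -
  have "(\<lambda>n::nat. sdist B (shift (int n) y) (shift (int n) x)) \<longlonglongrightarrow> 0"
    using assms(2) by (simp add: Ws_def)
  then have "\<forall>\<^sub>F n in sequentially. sdist B (shift (int n) y) (shift (int n) x) < exp (- rate B * real 1)"
    by (rule order_tendstoD) simp
  then obtain m where m: "\<And>n. n \<ge> m \<Longrightarrow> sdist B (shift (int n) y) (shift (int n) x) \<le> exp (- rate B * real 1)"
    unfolding eventually_sequentially by (meson less_imp_le)
  have "y n = x n" if "n \<ge> int m" for n
  proof -
    have "\<forall>j. \<bar>j\<bar> < int 1 \<longrightarrow> shift (int (nat n)) y j = shift (int (nat n)) x j"
      using m[of "nat n"] that by (subst sdist_le_iff[OF assms(1), symmetric]) auto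
    then show ?thesis using that by (auto simp: shift_def)
  qed
  then show ?thesis using that by blast
qed

section \<open>Local product structure\<close>

definition bracket :: "biseq \<Rightarrow> biseq \<Rightarrow> biseq" where
  "bracket x y = (\<lambda>n. if n \<le> 0 then x n else y n)"

lemma bracket_in_spts:
  assumes "x \<in> spts B" "y \<in> spts B" "x 0 = y 0"
  shows "bracket x y \<in> spts B"
proof -
  have "bracket x y n < nsym B \<and> allowed B (bracket x y n) (bracket x y (n + 1))" for n
  proof -
    consider "n < 0" | "n = 0" | "n > 0" by linarith
    then show ?thesis
    proof cases
      case 2
      have "allowed B (y 0) (y (0 + 1))" by (rule sptsD[OF assms(2)])
      then show ?thesis using assms 2 by (auto simp: bracket_def spts_def)
    qed (use assms in \<open>auto simp: bracket_def spts_def\<close>)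
  qed
  then show ?thesis by (auto simp: spts_def)
qed

text \<open>This is the Smale bracket, the meeting point of a local unstable and a local stable set.
  Equality of the symbols at 0 makes the transition from index 0 to index 1 admissible.\<close>

lemma bracket_local:
  assumes "x \<in> spts B" "y \<in> spts B" "x 0 = y 0"
  shows "bracket x y \<in> Wu_loc B x" "bracket x y \<in> Ws_loc B y"
  using bracket_in_spts[OF assms] assms(3) by (auto simp: bracket_def Wu_loc_def Ws_loc_def)

lemma quadruple_bracket:
  assumes "x \<in> spts B" "x' \<in> Ws_loc B x" "y \<in> Wu_loc B x"
  shows "quadruple B x x' y (bracket x' y)"
  using bracket_local[of x' B y] assms by (auto simp: quadruple_def Wu_loc_def Ws_loc_def)

lemma sdist_bracket_le:
  assumes "rate B > 0" "x \<in> spts B" "y \<in> spts B" "x 0 = y 0"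
  shows "sdist B x (bracket x y) \<le> sdist B x y" "sdist B (bracket x y) y \<le> sdist B x y"
proof -
  have "sdist B x (bracket x y) \<le> exp (- rate B * real_of_int 0) * sdist B x y"
    using assms(4) by (intro sdist_le_transfer[OF assms(1)]) (auto simp: bracket_def)
  then show "sdist B x (bracket x y) \<le> sdist B x y" by simp
  have "sdist B (bracket x y) y \<le> exp (- rate B * real_of_int 0) * sdist B x y"
    using assms(4) by (intro sdist_le_transfer[OF assms(1)]) (auto simp: bracket_def)
  then show "sdist B (bracket x y) y \<le> sdist B x y" by simp
qed

lemma sdist_eq_1_imp:
  assumes "rate B > 0" "x 0 \<noteq> y 0" shows "sdist B x y = 1"
proof -
  have "(LEAST k::nat. \<exists>n::int. \<bar>n\<bar> = int k \<and> x n \<noteq> y n) = 0"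
    by (rule Least_equality) (use assms(2) in auto)
  then show ?thesis using assms(2) by (auto simp: sdist_def)
qed

lemma Wu_locD: "y \<in> Wu_loc B x \<Longrightarrow> y \<in> spts B" "y \<in> Wu_loc B x \<Longrightarrow> n \<le> 0 \<Longrightarrow> y n = x n"
  by (auto simp: Wu_loc_def)

lemma Ws_locD: "y \<in> Ws_loc B x \<Longrightarrow> y \<in> spts B" "y \<in> Ws_loc B x \<Longrightarrow> 0 \<le> n \<Longrightarrow> y n = x n"
  by (auto simp: Ws_loc_def)

lemma Wu_loc_refl: "x \<in> spts B \<Longrightarrow> x \<in> Wu_loc B x"
  by (auto simp: Wu_loc_def)

lemma Wu_loc_eq: "y \<in> Wu_loc B x \<Longrightarrow> Wu_loc B y = Wu_loc B x"
  by (auto simp: Wu_loc_def)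

section \<open>Holonomies of matrix cocycles\<close>

type_synonym 'd mat = "(real ^ 'd) \<Rightarrow>\<^sub>L (real ^ 'd)"

primrec cpr :: "int \<Rightarrow> (biseq \<Rightarrow> 'd::finite mat) \<Rightarrow> nat \<Rightarrow> biseq \<Rightarrow> 'd mat" where
  "cpr e C 0 x = id_blinfun"
| "cpr e C (Suc n) x = C (shift (e * int n) x) o\<^sub>L cpr e C n x"

text \<open>The factors stand in the opposite order, so that with the pointwise inverses as factors
  this is the inverse of \<open>cpr\<close>.\<close>

primrec cpi :: "int \<Rightarrow> (biseq \<Rightarrow> 'd::finite mat) \<Rightarrow> nat \<Rightarrow> biseq \<Rightarrow> 'd mat" where
  "cpi e C 0 x = id_blinfun"
| "cpi e C (Suc n) x = cpi e C n x o\<^sub>L C (shift (e * int n) x)"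

text \<open>The holonomy with the identity as transport, meaningful because both fibers are the same
  coordinate space. Transports that are Hoelder close to the identity give the same limit by
  \<open>hol_via_transport\<close>.\<close>

definition hol :: "int \<Rightarrow> (biseq \<Rightarrow> 'd::finite mat) \<Rightarrow> (biseq \<Rightarrow> 'd mat) \<Rightarrow> biseq \<Rightarrow> biseq \<Rightarrow> 'd mat" where
  "hol e C Ci y x = lim (\<lambda>n. cpi e Ci n y o\<^sub>L cpr e C n x)"

lemma id_compose [simp]: "id_blinfun o\<^sub>L f = f" "f o\<^sub>L id_blinfun = f"
  by (auto intro!: blinfun_eqI)

lemma compose_assoc: "(f o\<^sub>L g) o\<^sub>L h = f o\<^sub>L (g o\<^sub>L h)"
  by (auto intro!: blinfun_eqI)

lemma compose_cancel:
  "f o\<^sub>L g = id_blinfun \<Longrightarrow> f o\<^sub>L (g o\<^sub>L h) = h"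
  by (metis compose_assoc id_compose(1))

lemma norm_id_mat [simp]: "norm (id_blinfun :: 'd::finite mat) = 1"
  by (rule norm_blinfun_id)

lemma norm_compose_le:
  "norm f \<le> a \<Longrightarrow> norm g \<le> b \<Longrightarrow> norm (f o\<^sub>L g) \<le> a * b"
  by (meson norm_blinfun_compose mult_mono norm_ge_zero order_trans)

lemma norm_apply_le: "norm f \<le> a \<Longrightarrow> norm (blinfun_apply f x) \<le> a * norm x"
  by (meson norm_blinfun mult_right_mono norm_ge_zero order_trans)

lemma cpr_Suc2: "cpr e C (Suc n) x = cpr e C n (shift e x) o\<^sub>L C x"
  by (induction n) (simp_all add: compose_assoc[symmetric] algebra_simps)

lemma cpi_Suc2: "cpi e C (Suc n) x = C x o\<^sub>L cpi e C n (shift e x)"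
  by (induction n) (simp_all add: compose_assoc algebra_simps)

lemma cpr_add: "cpr e C (m + n) x = cpr e C m (shift (e * int n) x) o\<^sub>L cpr e C n x"
  by (induction m) (simp_all add: compose_assoc algebra_simps)

lemma cpi_add: "cpi e C (m + n) x = cpi e C n x o\<^sub>L cpi e C m (shift (e * int n) x)"
  by (induction m) (simp_all add: compose_assoc algebra_simps)

lemma tendsto_compose_blinfun:
  fixes f :: "'a \<Rightarrow> 'd::finite mat"
  shows "(f \<longlongrightarrow> a) F \<Longrightarrow> (g \<longlongrightarrow> b) F \<Longrightarrow> ((\<lambda>x. f x o\<^sub>L g x) \<longlongrightarrow> a o\<^sub>L b) F"
  by (rule bounded_bilinear.tendsto[OF bounded_bilinear_blinfun_compose])

lemma compose_diff_left: "(f - g) o\<^sub>L h = (f o\<^sub>L h) - (g o\<^sub>L (h :: 'd::finite mat))"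
  by (rule bounded_bilinear.diff_left[OF bounded_bilinear_blinfun_compose])

lemma compose_diff_right: "h o\<^sub>L (f - g) = (h o\<^sub>L f) - ((h :: 'd::finite mat) o\<^sub>L g)"
  by (rule bounded_bilinear.diff_right[OF bounded_bilinear_blinfun_compose])

lemma norm_diff3_le:
  fixes f :: "'a::real_normed_vector"
  shows "norm (f - h) \<le> norm (f - f') + norm (f' - h') + norm (h - h')"
proof -
  have "f - h = ((f - f') + (f' - h')) - (h - h')" by simp
  then have "norm (f - h) \<le> norm ((f - f') + (f' - h')) + norm (h - h')" by (metis norm_triangle_ineq4)
  then show ?thesis using norm_triangle_ineq[of "f - f'" "f' - h'"] by linarith
qed

lemma geometric_limit:
  fixes P :: "nat \<Rightarrow> 'a::banach"
  assumes step: "\<And>n. norm (P (Suc n) - P n) \<le> G * r ^ n" and r: "0 \<le> r" "r < 1"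
  shows "convergent P" "norm (lim P - P n) \<le> G * r ^ n / (1 - r)"
proof -
  have G: "0 \<le> G" using order_trans[OF norm_ge_zero step[of 0]] by simp
  have d: "norm (P (n + k) - P n) \<le> G * r ^ n * (\<Sum>i<k. r ^ i)" for n k
  proof (induction k)
    case (Suc k)
    have "norm (P (n + Suc k) - P n) \<le> norm (P (Suc (n + k)) - P (n + k)) + norm (P (n + k) - P n)"
      using norm_triangle_ineq[of "P (Suc (n + k)) - P (n + k)" "P (n + k) - P n"] by simp
    also have "\<dots> \<le> G * r ^ (n + k) + G * r ^ n * (\<Sum>i<k. r ^ i)"
      using step[of "n + k"] Suc by linarith
    finally show ?case by (simp add: power_add algebra_simps)
  qed simp
  have d': "norm (P (n + k) - P n) \<le> G * r ^ n / (1 - r)" for n k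
  proof -
    have "(\<Sum>i<k. r ^ i) \<le> 1 / (1 - r)"
    proof -
      have "(1 - r) * (\<Sum>i<k. r ^ i) = 1 - r ^ k" by (simp add: one_diff_power_eq)
      also have "\<dots> \<le> 1" using r by simp
      finally show ?thesis using r by (simp add: field_simps)
    qed
    then have "G * r ^ n * (\<Sum>i<k. r ^ i) \<le> G * r ^ n * (1 / (1 - r))"
      using G r by (intro mult_left_mono) auto
    with d[of n k] show ?thesis by simp
  qed
  have lim0: "(\<lambda>n. G * r ^ n / (1 - r)) \<longlonglongrightarrow> 0"
    using tendsto_mult[OF tendsto_const[of "G / (1 - r)"] LIMSEQ_power_zero[of r]] r by simp
  have "Cauchy P"
  proof (rule CauchyI')
    fix \<epsilon> :: real assume "0 < \<epsilon>"
    then have "\<forall>\<^sub>F n in sequentially. G * r ^ n / (1 - r) < \<epsilon>"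
      by (rule order_tendstoD(2)[OF lim0])
    then obtain M where M: "\<And>n. n \<ge> M \<Longrightarrow> G * r ^ n / (1 - r) < \<epsilon>"
      unfolding eventually_sequentially by blast
    have "dist (P m) (P n) < \<epsilon>" if "m \<ge> M" "n > m" for m n
      using d'[of m "n - m"] M[OF that(1)] that by (simp add: dist_norm norm_minus_commute)
    then show "\<exists>M. \<forall>m\<ge>M. \<forall>n>m. dist (P m) (P n) < \<epsilon>" by blast
  qed
  then show c: "convergent P" by (rule Cauchy_convergent)
  then have "P \<longlonglongrightarrow> lim P" by (simp add: convergent_LIMSEQ_iff)
  then have "(\<lambda>k. P (n + k)) \<longlonglongrightarrow> lim P" using LIMSEQ_ignore_initial_segment[of P _ n] by (simp add: add.commute)
  then have "(\<lambda>k. norm (P (n + k) - P n)) \<longlonglongrightarrow> norm (lim P - P n)"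
    by (intro tendsto_norm tendsto_diff tendsto_const)
  then show "norm (lim P - P n) \<le> G * r ^ n / (1 - r)"
    by (rule LIMSEQ_le_const2) (use d' in blast)
qed

text \<open>Taking \<open>e = 1\<close> and \<open>e = -1\<close> treats stable and unstable holonomies at once.\<close>

definition adm :: "('m) sft_scheme \<Rightarrow> int \<Rightarrow> real \<Rightarrow> real \<Rightarrow> biseq \<Rightarrow> biseq \<Rightarrow> bool" where
  "adm B e \<theta> F x y \<longleftrightarrow> x \<in> spts B \<and> y \<in> spts B \<and> 0 \<le> F \<and>
     (\<forall>n. sdist B (shift (e * int n) x) (shift (e * int n) y) powr \<theta> \<le> F * exp (- rate B * \<theta>) ^ n)"

lemma exp_power_powr: "(E * exp (- a * real n)) powr \<theta> = E powr \<theta> * exp (- a * \<theta>) ^ n" if "0 \<le> E"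
proof -
  have "(E * exp (- a * real n)) powr \<theta> = E powr \<theta> * exp (- a * real n) powr \<theta>"
    using that by (simp add: powr_mult)
  also have "exp (- a * real n) powr \<theta> = exp (- a * \<theta>) ^ n"
    by (simp add: powr_def exp_of_nat_mult[symmetric] algebra_simps)
  finally show ?thesis .
qed

lemma admI:
  assumes "x \<in> spts B" "y \<in> spts B" "0 \<le> E" "\<theta> > 0"
    and "\<And>n. sdist B (shift (e * int n) x) (shift (e * int n) y) \<le> E * exp (- rate B * real n)"
  shows "adm B e \<theta> (E powr \<theta>) x y"
  unfolding adm_def
proof (intro conjI allI)
  fix n
  have "sdist B (shift (e * int n) x) (shift (e * int n) y) powr \<theta> \<le> (E * exp (- rate B * real n)) powr \<theta>"
    using assms(4) assms(5)[of n] by (intro powr_mono2) auto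
  then show "sdist B (shift (e * int n) x) (shift (e * int n) y) powr \<theta> \<le> E powr \<theta> * exp (- rate B * \<theta>) ^ n"
    by (simp only: exp_power_powr[OF assms(3)])
qed (use assms in auto)

text \<open>Within a local set the admissible constant is itself a power of the distance. This is
  what makes local holonomies Hoelder close to the identity.\<close>

lemma adm_stable:
  assumes "rate B > 0" "\<theta> > 0" "x \<in> spts B" "y \<in> spts B" "\<forall>n\<ge>0. y n = x n"
  shows "adm B 1 \<theta> (sdist B x y powr \<theta>) x y"
  using sdist_shift_stable[OF assms(1,5)] assms(2-4) by (intro admI) (auto simp: mult.commute)

lemma adm_unstable:
  assumes "rate B > 0" "\<theta> > 0" "x \<in> spts B" "y \<in> spts B" "\<forall>n\<le>0. y n = x n"
  shows "adm B (- 1) \<theta> (sdist B x y powr \<theta>) x y"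
  using sdist_shift_unstable[OF assms(1,5)] assms(2-4) by (intro admI) (auto simp: mult.commute)

text \<open>On a global stable set only a constant depending on the level \<open>m\<close> is
  available: the holonomies stay bounded but need not be close to the identity.\<close>

lemma adm_stable_level:
  assumes "rate B > 0" "\<theta> > 0" "x \<in> spts B" "y \<in> spts B" "\<forall>n\<ge>int m. y n = x n"
  shows "adm B 1 \<theta> (exp (rate B * real m) powr \<theta>) x y"
  using sdist_shift_stable'[OF assms(1,5)] assms(2-4) by (intro admI) auto

lemma adm_unstable_level:
  assumes "rate B > 0" "\<theta> > 0" "x \<in> spts B" "y \<in> spts B" "\<forall>n\<le>- int m. y n = x n"
  shows "adm B (- 1) \<theta> (exp (rate B * real m) powr \<theta>) x y"
  using sdist_shift_unstable'[OF assms(1,5)] assms(2-4) by (intro admI) auto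

lemma adm_mono: "adm B e \<theta> F x y \<Longrightarrow> F \<le> F' \<Longrightarrow> adm B e \<theta> F' x y"
  unfolding adm_def by (meson exp_ge_zero mult_right_mono order_trans zero_le_power)

lemma adm_refl: "x \<in> spts B \<Longrightarrow> 0 \<le> F \<Longrightarrow> adm B e \<theta> F x x"
  unfolding adm_def by simp

lemma adm_shift:
  assumes "adm B e \<theta> F x y"
  shows "adm B e \<theta> (F * exp (- rate B * \<theta>) ^ k) (shift (e * int k) x) (shift (e * int k) y)"
  unfolding adm_def
proof (intro conjI allI)
  fix n
  have "sdist B (shift (e * int (n + k)) x) (shift (e * int (n + k)) y) powr \<theta>
      \<le> F * exp (- rate B * \<theta>) ^ (n + k)"
    using assms unfolding adm_def by blast
  then show "sdist B (shift (e * int n) (shift (e * int k) x)) (shift (e * int n) (shift (e * int k) y)) powr \<theta>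
     \<le> F * exp (- rate B * \<theta>) ^ k * exp (- rate B * \<theta>) ^ n"
    by (simp add: power_add algebra_simps)
qed (use assms in \<open>auto simp: adm_def\<close>)

lemma adm_trans:
  assumes "rate B > 0" "\<theta> > 0" "adm B e \<theta> F x y" "adm B e \<theta> F y z"
  shows "adm B e \<theta> F x z"
  unfolding adm_def
proof (intro conjI allI)
  fix n
  let ?s = "shift (e * int n)"
  have "sdist B (?s x) (?s z) \<le> max (sdist B (?s x) (?s y)) (sdist B (?s y) (?s z))"
    by (rule sdist_ultra[OF assms(1)])
  then consider "sdist B (?s x) (?s z) \<le> sdist B (?s x) (?s y)" | "sdist B (?s x) (?s z) \<le> sdist B (?s y) (?s z)"
    by linarith
  then show "sdist B (?s x) (?s z) powr \<theta> \<le> F * exp (- rate B * \<theta>) ^ n"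
  proof cases
    case 1
    then have "sdist B (?s x) (?s z) powr \<theta> \<le> sdist B (?s x) (?s y) powr \<theta>"
      using assms(2) by (intro powr_mono2) auto
    also have "\<dots> \<le> F * exp (- rate B * \<theta>) ^ n" using assms(3) by (auto simp: adm_def)
    finally show ?thesis .
  next
    case 2
    then have "sdist B (?s x) (?s z) powr \<theta> \<le> sdist B (?s y) (?s z) powr \<theta>"
      using assms(2) by (intro powr_mono2) auto
    also have "\<dots> \<le> F * exp (- rate B * \<theta>) ^ n" using assms(4) by (auto simp: adm_def)
    finally show ?thesis .
  qed
qed (use assms in \<open>auto simp: adm_def\<close>)

text \<open>One time direction of a cocycle. Bunching is demanded of products of \<open>n\<close>
  factors and up to a constant \<open>Cb\<close>, a form which does not depend on the norm in which
  the single steps are bunched.\<close>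

locale halfc =
  fixes B :: "('m) sft_scheme" and e :: int and C Ci :: "biseq \<Rightarrow> 'd::finite mat"
    and K Hc Cb q \<theta> :: real
  assumes rate_pos: "rate B > 0" and \<theta>_pos: "\<theta> > 0" and K_ge1: "K \<ge> 1" and Hc_nn: "Hc \<ge> 0"
    and Cb_ge1: "Cb \<ge> 1" and q_pos: "q > 0" and bunched: "q * exp (- rate B * \<theta>) < 1"
    and C_Ci: "x \<in> spts B \<Longrightarrow> C x o\<^sub>L Ci x = id_blinfun"
    and Ci_C: "x \<in> spts B \<Longrightarrow> Ci x o\<^sub>L C x = id_blinfun"
    and norm_C: "x \<in> spts B \<Longrightarrow> norm (C x) \<le> K"
    and norm_Ci: "x \<in> spts B \<Longrightarrow> norm (Ci x) \<le> K"
    and C_holder: "x \<in> spts B \<Longrightarrow> y \<in> spts B \<Longrightarrow> norm (C x - C y) \<le> Hc * sdist B x y powr \<theta>"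
    and Ci_holder: "x \<in> spts B \<Longrightarrow> y \<in> spts B \<Longrightarrow> norm (Ci x - Ci y) \<le> Hc * sdist B x y powr \<theta>"
    and bunch: "x \<in> spts B \<Longrightarrow> norm (cpr e C n x) * norm (cpi e Ci n x) \<le> Cb * q ^ n"

definition hrate :: "('m) sft_scheme \<Rightarrow> real \<Rightarrow> real \<Rightarrow> real" where
  "hrate B q \<theta> = q * exp (- rate B * \<theta>)"

text \<open>Bounds the product of the factors \<open>1 + a * F * r ^ n\<close> by the exponential of
  the geometric series.\<close>

definition hbd :: "real \<Rightarrow> real \<Rightarrow> real \<Rightarrow> real" where
  "hbd a r F = exp (a * F / (1 - r))"

text \<open>The sum of all increments \<open>hbd a r F * a * F * r ^ n\<close>, hence the distance
  of the limit from the approximation of order 0, which is the identity.\<close>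

definition herr :: "real \<Rightarrow> real \<Rightarrow> real \<Rightarrow> real" where
  "herr a r F = hbd a r F * a * F / (1 - r)"

lemma herr_le:
  assumes "0 \<le> a" "r < 1" "0 \<le> F" "F \<le> F1"
  shows "herr a r F \<le> hbd a r F1 * a / (1 - r) * F"
proof -
  have "hbd a r F \<le> hbd a r F1"
    unfolding hbd_def using assms by (auto intro!: divide_right_mono mult_left_mono)
  then have "hbd a r F * (a * F / (1 - r)) \<le> hbd a r F1 * (a * F / (1 - r))"
    using assms by (intro mult_right_mono) auto
  then show ?thesis by (simp add: herr_def)
qed

context halfc
begin

abbreviation "r \<equiv> hrate B q \<theta>"
abbreviation "a \<equiv> K * Hc * Cb"
abbreviation "Hol \<equiv> hol e C Ci"
abbreviation "P n y x \<equiv> cpi e Ci n y o\<^sub>L cpr e C n x"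

lemma r_bounds: "0 < r" "r < 1"
  using q_pos bunched by (simp_all add: hrate_def)

lemma a_nn: "0 \<le> a"
  using K_ge1 Hc_nn Cb_ge1 by simp

lemma cpr_cpi: "x \<in> spts B \<Longrightarrow> cpr e C n x o\<^sub>L cpi e Ci n x = id_blinfun"
proof (induction n)
  case (Suc n)
  have "cpr e C (Suc n) x o\<^sub>L cpi e Ci (Suc n) x
      = C (shift (e * int n) x) o\<^sub>L ((cpr e C n x o\<^sub>L cpi e Ci n x) o\<^sub>L Ci (shift (e * int n) x))"
    by (simp add: compose_assoc)
  then show ?case using Suc by (simp add: C_Ci)
qed simp

lemma cpi_cpr: "x \<in> spts B \<Longrightarrow> cpi e Ci n x o\<^sub>L cpr e C n x = id_blinfun"
proof (induction n)
  case (Suc n)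
  have "cpi e Ci (Suc n) x o\<^sub>L cpr e C (Suc n) x
      = cpi e Ci n x o\<^sub>L ((Ci (shift (e * int n) x) o\<^sub>L C (shift (e * int n) x)) o\<^sub>L cpr e C n x)"
    by (simp add: compose_assoc)
  then show ?case using Suc by (simp add: Ci_C)
qed simp

lemma norm_cpr_le: "x \<in> spts B \<Longrightarrow> norm (cpr e C n x) \<le> K ^ n"
proof (induction n)
  case (Suc n)
  then show ?case using norm_compose_le[OF norm_C[of "shift (e * int n) x"] Suc.IH] by simp
qed simp

lemma norm_cpi_le: "x \<in> spts B \<Longrightarrow> norm (cpi e Ci n x) \<le> K ^ n"
proof (induction n)
  case (Suc n)
  then show ?case using norm_compose_le[OF Suc.IH norm_Ci[of "shift (e * int n) x"]]
    by (simp add: mult.commute)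
qed simp

text \<open>Bunching concerns both products at one and the same point. The approximation
  \<open>P n y x\<close> carries the inverse product from \<open>y\<close> to \<open>x\<close>, so
  that the bound at \<open>x\<close> can be used.\<close>

lemma norm_cpi_via:
  assumes "x \<in> spts B" shows "norm (cpi e Ci n y) \<le> norm (P n y x) * norm (cpi e Ci n x)"
proof -
  have "cpi e Ci n y = P n y x o\<^sub>L cpi e Ci n x"
    using cpr_cpi[OF assms] by (simp add: compose_assoc)
  then show ?thesis by (metis norm_blinfun_compose)
qed

text \<open>An error of size \<open>exp (- rate B * \<theta>) ^ n\<close> between the two products
  is blown up by at most \<open>q ^ n\<close>; the two rates combine to
  \<open>r < 1\<close>.\<close>

lemma sandwich:
  assumes "x \<in> spts B" "norm L \<le> l * exp (- rate B * \<theta>) ^ n" "0 \<le> l"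
  shows "norm (cpi e Ci n y o\<^sub>L (L o\<^sub>L cpr e C n x)) \<le> norm (P n y x) * (Cb * l * r ^ n)"
proof -
  have "norm (cpi e Ci n y o\<^sub>L (L o\<^sub>L cpr e C n x)) \<le> norm (cpi e Ci n y) * (norm L * norm (cpr e C n x))"
    by (intro norm_compose_le order_refl norm_blinfun_compose)
  also have "\<dots> \<le> (norm (P n y x) * norm (cpi e Ci n x)) * ((l * exp (- rate B * \<theta>) ^ n) * norm (cpr e C n x))"
    using assms by (intro mult_mono norm_cpi_via mult_right_mono) auto
  also have "\<dots> = norm (P n y x) * (l * exp (- rate B * \<theta>) ^ n) * (norm (cpr e C n x) * norm (cpi e Ci n x))"
    by simp
  also have "\<dots> \<le> norm (P n y x) * (l * exp (- rate B * \<theta>) ^ n) * (Cb * q ^ n)"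
    using assms by (intro mult_left_mono bunch) auto
  also have "\<dots> = norm (P n y x) * (Cb * l * r ^ n)"
    by (simp add: hrate_def power_mult_distrib)
  finally show ?thesis .
qed

text \<open>The increment is measured by the current approximation itself, so that no bound on the
  approximations is presupposed.\<close>

lemma P_step0:
  assumes "adm B e \<theta> F x y"
  shows "norm (P (Suc n) y x - P n y x) \<le> norm (P n y x) * (a * F * r ^ n)"
proof -
  have xy: "x \<in> spts B" "y \<in> spts B" "0 \<le> F" using assms by (auto simp: adm_def)
  let ?x = "shift (e * int n) x" and ?y = "shift (e * int n) y"
  let ?L = "Ci ?y o\<^sub>L (C ?x - C ?y)"
  have "?L = (Ci ?y o\<^sub>L C ?x) - id_blinfun"
    using xy by (simp add: compose_diff_right Ci_C)
  then have eq: "P (Suc n) y x - P n y x = cpi e Ci n y o\<^sub>L (?L o\<^sub>L cpr e C n x)"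
    by (simp add: compose_diff_right compose_diff_left compose_assoc)
  have "norm ?L \<le> K * (Hc * (F * exp (- rate B * \<theta>) ^ n))"
  proof (intro norm_compose_le norm_Ci)
    have "norm (C ?x - C ?y) \<le> Hc * sdist B ?x ?y powr \<theta>" using xy by (intro C_holder) auto
    also have "\<dots> \<le> Hc * (F * exp (- rate B * \<theta>) ^ n)"
      using assms Hc_nn by (intro mult_left_mono) (auto simp: adm_def)
    finally show "norm (C ?x - C ?y) \<le> Hc * (F * exp (- rate B * \<theta>) ^ n)" .
  qed (use xy in simp)
  then have "norm ?L \<le> (K * Hc * F) * exp (- rate B * \<theta>) ^ n" by (simp add: mult.assoc)
  from sandwich[OF xy(1) this, of y] show ?thesis
    unfolding eq using K_ge1 Hc_nn xy(3) by (simp add: algebra_simps)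
qed

text \<open>A discrete Gronwall argument: each step multiplies the norm by at most
  \<open>1 + a * F * r ^ n\<close>, and these factors have a convergent product.\<close>

lemma P_bound:
  assumes "adm B e \<theta> F x y"
  shows "norm (P n y x) \<le> hbd a r F"
proof -
  have F: "0 \<le> F" using assms by (auto simp: adm_def)
  have "norm (P n y x) \<le> exp (a * F * (\<Sum>i<n. r ^ i))"
  proof (induction n)
    case (Suc n)
    have "norm (P (Suc n) y x) \<le> norm (P n y x) + norm (P (Suc n) y x - P n y x)"
      by (rule norm_triangle_sub)
    also have "\<dots> \<le> norm (P n y x) * (1 + a * F * r ^ n)"
      using P_step0[OF assms, of n] by (simp add: algebra_simps)
    also have "\<dots> \<le> exp (a * F * (\<Sum>i<n. r ^ i)) * exp (a * F * r ^ n)"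
      using Suc a_nn F r_bounds by (intro mult_mono exp_ge_add_one_self) auto
    also have "\<dots> = exp (a * F * (\<Sum>i<Suc n. r ^ i))"
      by (simp add: exp_add[symmetric] algebra_simps)
    finally show ?case .
  qed simp
  also have "\<dots> \<le> hbd a r F"
  proof -
    have "(1 - r) * (\<Sum>i<n. r ^ i) = 1 - r ^ n" by (simp add: one_diff_power_eq)
    also have "\<dots> \<le> 1" using r_bounds by simp
    finally have "(\<Sum>i<n. r ^ i) \<le> 1 / (1 - r)" using r_bounds by (simp add: field_simps)
    then have "a * F * (\<Sum>i<n. r ^ i) \<le> a * F * (1 / (1 - r))"
      using a_nn F by (intro mult_left_mono) auto
    then show ?thesis by (simp add: hbd_def)
  qed
  finally show ?thesis .
qed

lemma P_step:
  assumes "adm B e \<theta> F x y"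
  shows "norm (P (Suc n) y x - P n y x) \<le> (hbd a r F * a * F) * r ^ n"
proof -
  have F: "0 \<le> F" using assms by (auto simp: adm_def)
  have "norm (P n y x) * (a * F * r ^ n) \<le> hbd a r F * (a * F * r ^ n)"
    using F a_nn r_bounds by (intro mult_right_mono P_bound assms) auto
  with P_step0[OF assms, of n] show ?thesis by (simp add: mult.assoc)
qed

lemma P_lim: "adm B e \<theta> F x y \<Longrightarrow> (\<lambda>n. P n y x) \<longlonglongrightarrow> Hol y x"
  unfolding hol_def
  using geometric_limit(1)[OF P_step[of F x y]] r_bounds by (simp add: convergent_LIMSEQ_iff)

lemma hol_rate: "adm B e \<theta> F x y \<Longrightarrow> norm (Hol y x - P n y x) \<le> herr a r F * r ^ n"
  unfolding hol_def herr_def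
  using geometric_limit(2)[OF P_step[of F x y], of n] r_bounds by simp

lemma hol_near_id: "adm B e \<theta> F x y \<Longrightarrow> norm (Hol y x - id_blinfun) \<le> herr a r F"
  using hol_rate[of F x y 0] by simp

lemma hol_bound: "adm B e \<theta> F x y \<Longrightarrow> norm (Hol y x) \<le> hbd a r F"
  by (rule LIMSEQ_le_const2[OF tendsto_norm[OF P_lim]]) (auto intro: P_bound)

lemma hol_self [simp]: "x \<in> spts B \<Longrightarrow> Hol x x = id_blinfun"
  using P_lim[OF adm_refl[of x B 0]] by (simp add: cpi_cpr LIMSEQ_const_iff)

lemma hol_trans:
  assumes "adm B e \<theta> F x y" "adm B e \<theta> F y z"
  shows "Hol z y o\<^sub>L Hol y x = Hol z x"
proof (rule LIMSEQ_unique)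
  have y: "y \<in> spts B" using assms by (auto simp: adm_def)
  have "P n z y o\<^sub>L P n y x = P n z x" for n
  proof -
    have "P n z y o\<^sub>L P n y x = cpi e Ci n z o\<^sub>L (cpr e C n y o\<^sub>L (cpi e Ci n y o\<^sub>L cpr e C n x))"
      by (simp add: compose_assoc)
    then show ?thesis by (simp add: compose_cancel[OF cpr_cpi[OF y]])
  qed
  with tendsto_compose_blinfun[OF P_lim[OF assms(2)] P_lim[OF assms(1)]]
  show "(\<lambda>n. P n z x) \<longlonglongrightarrow> (Hol z y o\<^sub>L Hol y x)" by simp
  show "(\<lambda>n. P n z x) \<longlonglongrightarrow> Hol z x"
    by (rule P_lim[OF adm_trans[OF rate_pos \<theta>_pos assms]])
qed

text \<open>The identity is exact between the approximation of order \<open>n + 1\<close> over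
  \<open>x\<close>, \<open>y\<close> and the one of order \<open>n\<close> over their images, and
  passes to the limit.\<close>

lemma hol_equiv:
  assumes "adm B e \<theta> F x y"
  shows "C y o\<^sub>L Hol y x = Hol (shift e y) (shift e x) o\<^sub>L C x"
proof (rule LIMSEQ_unique)
  have y: "y \<in> spts B" using assms by (auto simp: adm_def)
  have adm': "adm B e \<theta> (F * exp (- rate B * \<theta>) ^ 1) (shift e x) (shift e y)"
    using adm_shift[OF assms, of 1] by simp
  have "C y o\<^sub>L P (Suc n) y x = P n (shift e y) (shift e x) o\<^sub>L C x" for n
    unfolding cpr_Suc2 cpi_Suc2 by (simp add: compose_assoc compose_cancel[OF C_Ci[OF y]])
  with tendsto_compose_blinfun[OF tendsto_const[of "C y"] LIMSEQ_Suc[OF P_lim[OF assms]]]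
  show "(\<lambda>n. P n (shift e y) (shift e x) o\<^sub>L C x) \<longlonglongrightarrow> (C y o\<^sub>L Hol y x)" by simp
  show "(\<lambda>n. P n (shift e y) (shift e x) o\<^sub>L C x) \<longlonglongrightarrow> (Hol (shift e y) (shift e x) o\<^sub>L C x)"
    by (intro tendsto_compose_blinfun tendsto_const P_lim[OF adm'])
qed

lemma hol_equiv_n:
  assumes "adm B e \<theta> F x y"
  shows "cpr e C n y o\<^sub>L Hol y x = Hol (shift (e * int n) y) (shift (e * int n) x) o\<^sub>L cpr e C n x"
proof (induction n)
  case (Suc n)
  let ?x = "shift (e * int n) x" and ?y = "shift (e * int n) y"
  have "cpr e C (Suc n) y o\<^sub>L Hol y x = C ?y o\<^sub>L (Hol ?y ?x o\<^sub>L cpr e C n x)"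
    using Suc by (simp add: compose_assoc)
  also have "\<dots> = (Hol (shift e ?y) (shift e ?x) o\<^sub>L C ?x) o\<^sub>L cpr e C n x"
    using hol_equiv[OF adm_shift[OF assms, of n]] by (metis compose_assoc)
  finally show ?case by (simp add: compose_assoc algebra_simps)
qed simp

text \<open>Transport maps which are Hoelder close to the identity do not change the limit.\<close>

lemma hol_via_transport:
  assumes "adm B e \<theta> F x y" "0 \<le> l" and J: "\<And>n. norm (J n - id_blinfun) \<le> l * exp (- rate B * \<theta>) ^ n"
  shows "(\<lambda>n. cpi e Ci n y o\<^sub>L (J n o\<^sub>L cpr e C n x)) \<longlonglongrightarrow> Hol y x"
proof -
  have x: "x \<in> spts B" using assms by (auto simp: adm_def)
  have b: "norm ((cpi e Ci n y o\<^sub>L (J n o\<^sub>L cpr e C n x)) - P n y x) \<le> (hbd a r F * (Cb * l)) * r ^ n" for n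
  proof -
    have "norm ((cpi e Ci n y o\<^sub>L (J n o\<^sub>L cpr e C n x)) - P n y x)
       = norm (cpi e Ci n y o\<^sub>L ((J n - id_blinfun) o\<^sub>L cpr e C n x))"
      by (simp add: compose_diff_right compose_diff_left)
    also have "\<dots> \<le> norm (P n y x) * (Cb * l * r ^ n)" by (rule sandwich[OF x J assms(2)])
    also have "\<dots> \<le> hbd a r F * (Cb * l * r ^ n)"
      using Cb_ge1 assms(2) r_bounds by (intro mult_right_mono P_bound assms) auto
    finally show ?thesis by (simp add: mult.assoc)
  qed
  have t: "(\<lambda>n. (hbd a r F * (Cb * l)) * r ^ n) \<longlonglongrightarrow> 0"
    using tendsto_mult[OF tendsto_const LIMSEQ_power_zero[of r]] r_bounds by fastforce
  have "(\<lambda>n. (cpi e Ci n y o\<^sub>L (J n o\<^sub>L cpr e C n x)) - P n y x) \<longlonglongrightarrow> 0"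
    by (rule Lim_null_comparison[OF always_eventually[OF allI[OF b]] t])
  from tendsto_add[OF this P_lim[OF assms(1)]] show ?thesis by simp
qed

section \<open>Continuity of finite products and of holonomies\<close>

lemma holder_compose:
  fixes f g :: "biseq \<Rightarrow> 'd mat"
  assumes f: "\<And>x y. x \<in> spts B \<Longrightarrow> y \<in> spts B \<Longrightarrow> norm (f x - f y) \<le> L * sdist B x y powr \<theta>"
    and g: "\<And>x y. x \<in> spts B \<Longrightarrow> y \<in> spts B \<Longrightarrow> norm (g x - g y) \<le> M * sdist B x y powr \<theta>"
    and bf: "\<And>x. x \<in> spts B \<Longrightarrow> norm (f x) \<le> b" and bg: "\<And>x. x \<in> spts B \<Longrightarrow> norm (g x) \<le> c"
    and "x \<in> spts B" "y \<in> spts B" "0 \<le> L" "0 \<le> M"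
  shows "norm ((f x o\<^sub>L g x) - (f y o\<^sub>L g y)) \<le> (L * c + b * M) * sdist B x y powr \<theta>"
proof -
  have "(f x o\<^sub>L g x) - (f y o\<^sub>L g y) = ((f x - f y) o\<^sub>L g x) + (f y o\<^sub>L (g x - g y))"
    by (simp add: compose_diff_left compose_diff_right)
  then have "norm ((f x o\<^sub>L g x) - (f y o\<^sub>L g y)) \<le> norm ((f x - f y) o\<^sub>L g x) + norm (f y o\<^sub>L (g x - g y))"
    by (metis norm_triangle_ineq)
  also have "\<dots> \<le> (L * sdist B x y powr \<theta>) * c + b * (M * sdist B x y powr \<theta>)"
    using assms by (intro add_mono norm_compose_le) auto
  finally show ?thesis by (simp add: algebra_simps)
qed

lemma shift_powr_le:
  "sdist B (shift i x) (shift i y) powr \<theta> \<le> exp (rate B * real_of_int \<bar>i\<bar>) powr \<theta> * sdist B x y powr \<theta>"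
proof -
  have "sdist B (shift i x) (shift i y) powr \<theta> \<le> (exp (rate B * real_of_int \<bar>i\<bar>) * sdist B x y) powr \<theta>"
    using \<theta>_pos by (intro powr_mono2 sdist_shift_le rate_pos) auto
  then show ?thesis by (simp add: powr_mult)
qed

lemma holder_shift:
  assumes f: "\<And>x y. x \<in> spts B \<Longrightarrow> y \<in> spts B \<Longrightarrow> norm (f x - f y) \<le> Hc * sdist B x y powr \<theta>"
    and "x \<in> spts B" "y \<in> spts B"
  shows "norm (f (shift i x) - f (shift i y)) \<le> Hc * exp (rate B * real_of_int \<bar>i\<bar>) powr \<theta> * sdist B x y powr \<theta>"
proof -
  have "norm (f (shift i x) - f (shift i y)) \<le> Hc * sdist B (shift i x) (shift i y) powr \<theta>"
    using assms by (intro f) auto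
  also have "\<dots> \<le> Hc * (exp (rate B * real_of_int \<bar>i\<bar>) powr \<theta> * sdist B x y powr \<theta>)"
    by (intro mult_left_mono Hc_nn shift_powr_le)
  finally show ?thesis by (simp add: mult.assoc)
qed

text \<open>The Hoelder constant deteriorates with \<open>n\<close>; the lemma is applied at one
  fixed \<open>n\<close> at a time.\<close>

lemma cpr_holder:
  "\<exists>L\<ge>0. \<forall>x\<in>spts B. \<forall>y\<in>spts B. norm (cpr e C n x - cpr e C n y) \<le> L * sdist B x y powr \<theta>"
proof (induction n)
  case (Suc n)
  then obtain L where L: "L \<ge> 0"
    "\<And>x y. x \<in> spts B \<Longrightarrow> y \<in> spts B \<Longrightarrow> norm (cpr e C n x - cpr e C n y) \<le> L * sdist B x y powr \<theta>"
    by blast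
  let ?M = "Hc * exp (rate B * real_of_int \<bar>e * int n\<bar>) powr \<theta>"
  have "norm (cpr e C (Suc n) x - cpr e C (Suc n) y) \<le> (?M * K ^ n + K * L) * sdist B x y powr \<theta>"
    if "x \<in> spts B" "y \<in> spts B" for x y
    unfolding cpr.simps
    by (rule holder_compose[OF holder_shift[OF C_holder]])
      (use that L Hc_nn in \<open>auto intro: norm_C norm_cpr_le\<close>)
  moreover have "0 \<le> ?M * K ^ n + K * L" using L(1) Hc_nn K_ge1 by simp
  ultimately show ?case by blast
qed (auto intro!: exI[of _ 0])

lemma cpi_holder:
  "\<exists>L\<ge>0. \<forall>x\<in>spts B. \<forall>y\<in>spts B. norm (cpi e Ci n x - cpi e Ci n y) \<le> L * sdist B x y powr \<theta>"
proof (induction n)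
  case (Suc n)
  then obtain L where L: "L \<ge> 0"
    "\<And>x y. x \<in> spts B \<Longrightarrow> y \<in> spts B \<Longrightarrow> norm (cpi e Ci n x - cpi e Ci n y) \<le> L * sdist B x y powr \<theta>"
    by blast
  let ?M = "Hc * exp (rate B * real_of_int \<bar>e * int n\<bar>) powr \<theta>"
  have "norm (cpi e Ci (Suc n) x - cpi e Ci (Suc n) y) \<le> (L * K + K ^ n * ?M) * sdist B x y powr \<theta>"
    if "x \<in> spts B" "y \<in> spts B" for x y
    unfolding cpi.simps
    by (rule holder_compose[OF _ holder_shift[OF Ci_holder]])
      (use that L Hc_nn in \<open>auto intro: norm_Ci norm_cpi_le\<close>)
  moreover have "0 \<le> L * K + K ^ n * ?M" using L(1) Hc_nn K_ge1 by simp
  ultimately show ?case by blast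
qed (auto intro!: exI[of _ 0])

lemma cpr_continuous: "continuous_on (spts B) (cpr e C n)"
  using cpr_holder[of n] holder_imp_continuous_on[OF rate_pos \<theta>_pos, of "spts B" "cpr e C n"] by blast

lemma hol_rate_tendsto_0: "(\<lambda>n. herr a r F * r ^ n) \<longlonglongrightarrow> 0"
  using tendsto_mult[OF tendsto_const LIMSEQ_power_zero[of r]] r_bounds by fastforce

text \<open>The rate of convergence depends on \<open>F\<close> only, so the holonomy is a uniform
  limit of the maps \<open>P n\<close>, each of which is Hoelder. First \<open>n\<close> is fixed by
  the rate, then \<open>\<delta>\<close> by the Hoelder constants at that \<open>n\<close>.\<close>

lemma hol_uniform:
  assumes "\<epsilon> > 0" "0 \<le> F"
  shows "\<exists>\<delta>>0. \<forall>x y x' y'. adm B e \<theta> F x y \<and> adm B e \<theta> F x' y' \<and> sdist B x x' < \<delta> \<and> sdist B y y' < \<delta>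
     \<longrightarrow> norm (Hol y x - Hol y' x') < \<epsilon>"
proof -
  have "\<forall>\<^sub>F n in sequentially. herr a r F * r ^ n < \<epsilon> / 3"
    using assms by (intro order_tendstoD(2)[OF hol_rate_tendsto_0]) auto
  then obtain n where n: "herr a r F * r ^ n < \<epsilon> / 3"
    unfolding eventually_sequentially by blast
  obtain L where L: "L \<ge> 0"
    "\<And>x y. x \<in> spts B \<Longrightarrow> y \<in> spts B \<Longrightarrow> norm (cpr e C n x - cpr e C n y) \<le> L * sdist B x y powr \<theta>"
    using cpr_holder[of n] by blast
  obtain M where M: "M \<ge> 0"
    "\<And>x y. x \<in> spts B \<Longrightarrow> y \<in> spts B \<Longrightarrow> norm (cpi e Ci n x - cpi e Ci n y) \<le> M * sdist B x y powr \<theta>"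
    using cpi_holder[of n] by blast
  \<comment> \<open>\<open>Z - 1\<close> is the Hoelder constant of \<open>P n\<close> in both
    variables together; the added 1 makes it divisible by.\<close>
  define Z where "Z = (M + L) * K ^ n + 1"
  have Z: "Z > 0" unfolding Z_def using L(1) M(1) K_ge1 by (intro add_nonneg_pos) auto
  define \<delta> where "\<delta> = (\<epsilon> / (3 * Z)) powr (1 / \<theta>)"
  have \<delta>: "\<delta> > 0" unfolding \<delta>_def using assms(1) Z by simp
  have "norm (Hol y x - Hol y' x') < \<epsilon>"
    if ad: "adm B e \<theta> F x y" "adm B e \<theta> F x' y'" and d: "sdist B x x' < \<delta>" "sdist B y y' < \<delta>" for x y x' y'
  proof -
    have pw: "t powr \<theta> \<le> \<epsilon> / (3 * Z)" if "0 \<le> t" "t < \<delta>" for t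
    proof -
      have "t powr \<theta> \<le> \<delta> powr \<theta>" using that \<theta>_pos by (intro powr_mono2) auto
      also have "\<delta> powr \<theta> = \<epsilon> / (3 * Z)" unfolding \<delta>_def using assms(1) Z \<theta>_pos by (simp add: powr_powr)
      finally show ?thesis .
    qed
    have s: "x \<in> spts B" "y \<in> spts B" "x' \<in> spts B" "y' \<in> spts B" using ad by (auto simp: adm_def)
    have "P n y x - P n y' x' = ((cpi e Ci n y - cpi e Ci n y') o\<^sub>L cpr e C n x)
        + (cpi e Ci n y' o\<^sub>L (cpr e C n x - cpr e C n x'))"
      by (simp add: compose_diff_left compose_diff_right)
    then have "norm (P n y x - P n y' x') \<le> norm ((cpi e Ci n y - cpi e Ci n y') o\<^sub>L cpr e C n x)
       + norm (cpi e Ci n y' o\<^sub>L (cpr e C n x - cpr e C n x'))" by (metis norm_triangle_ineq)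
    also have "\<dots> \<le> (M * sdist B y y' powr \<theta>) * K ^ n + K ^ n * (L * sdist B x x' powr \<theta>)"
      using s L M by (intro add_mono norm_compose_le norm_cpr_le norm_cpi_le) auto
    also have "\<dots> \<le> (M * (\<epsilon> / (3 * Z))) * K ^ n + K ^ n * (L * (\<epsilon> / (3 * Z)))"
      using d L(1) M(1) K_ge1 by (intro add_mono mult_right_mono mult_left_mono pw) auto
    also have "\<dots> = (Z - 1) * (\<epsilon> / (3 * Z))" by (simp add: Z_def algebra_simps add_divide_distrib)
    also have "\<dots> < Z * (\<epsilon> / (3 * Z))" using assms(1) Z by (intro mult_strict_right_mono) auto
    also have "\<dots> = \<epsilon> / 3" using Z by simp
    finally have 1: "norm (P n y x - P n y' x') < \<epsilon> / 3" .
    have 2: "norm (Hol y x - P n y x) < \<epsilon> / 3" "norm (Hol y' x' - P n y' x') < \<epsilon> / 3"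
      using hol_rate[OF ad(1), of n] hol_rate[OF ad(2), of n] n by linarith+
    with 1 norm_diff3_le[of "Hol y x" "Hol y' x'" "P n y x" "P n y' x'"] show ?thesis by linarith
  qed
  with \<delta> show ?thesis by blast
qed

end

text \<open>Here the cocycle varies together with the points. Since all cocycles satisfy
  \<open>halfc\<close> with the same numbers, the tails are uniformly small and the two limits may
  be exchanged.\<close>

lemma hol_tendsto:
  fixes C Ci :: "biseq \<Rightarrow> 'd::finite mat"
  assumes "halfc B e C Ci K Hc Cb q \<theta>" "\<And>k. halfc B e (Ck k) (Cik k) K Hc Cb q \<theta>"
    and ad: "adm B e \<theta> F x y" "\<And>k. adm B e \<theta> F (xk k) (yk k)"
    and cv: "\<And>j. (\<lambda>k. Ck k (shift (e * int j) (xk k))) \<longlonglongrightarrow> C (shift (e * int j) x)"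
      "\<And>j. (\<lambda>k. Cik k (shift (e * int j) (yk k))) \<longlonglongrightarrow> Ci (shift (e * int j) y)"
  shows "(\<lambda>k. hol e (Ck k) (Cik k) (yk k) (xk k)) \<longlonglongrightarrow> hol e C Ci y x"
proof (rule LIMSEQ_I)
  fix \<epsilon> :: real assume \<epsilon>: "0 < \<epsilon>"
  interpret h: halfc B e C Ci K Hc Cb q \<theta> by fact
  have c1: "(\<lambda>k. cpr e (Ck k) n (xk k)) \<longlonglongrightarrow> cpr e C n x" for n
    by (induction n) (auto intro!: tendsto_compose_blinfun cv)
  have c2: "(\<lambda>k. cpi e (Cik k) n (yk k)) \<longlonglongrightarrow> cpi e Ci n y" for n
    by (induction n) (auto intro!: tendsto_compose_blinfun cv)
  have "\<forall>\<^sub>F n in sequentially. herr h.a h.r F * h.r ^ n < \<epsilon> / 3"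
    using \<epsilon> by (intro order_tendstoD(2)[OF h.hol_rate_tendsto_0]) auto
  then obtain n where n: "herr h.a h.r F * h.r ^ n < \<epsilon> / 3"
    unfolding eventually_sequentially by blast
  let ?Pk = "\<lambda>k. cpi e (Cik k) n (yk k) o\<^sub>L cpr e (Ck k) n (xk k)"
  have "?Pk \<longlonglongrightarrow> h.P n y x" by (intro tendsto_compose_blinfun c1 c2)
  then obtain N where N: "\<And>k. k \<ge> N \<Longrightarrow> norm (?Pk k - h.P n y x) < \<epsilon> / 3"
    using LIMSEQ_D[of ?Pk "h.P n y x" "\<epsilon> / 3"] \<epsilon> by auto
  have "norm (hol e (Ck k) (Cik k) (yk k) (xk k) - hol e C Ci y x) < \<epsilon>" if "k \<ge> N" for k
  proof -
    interpret k: halfc B e "Ck k" "Cik k" K Hc Cb q \<theta> by fact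
    have 2: "norm (k.Hol (yk k) (xk k) - ?Pk k) < \<epsilon> / 3" "norm (h.Hol y x - h.P n y x) < \<epsilon> / 3"
      using k.hol_rate[OF ad(2)[of k], of n] h.hol_rate[OF ad(1), of n] n by linarith+
    with N[OF that] norm_diff3_le[of "k.Hol (yk k) (xk k)" "h.Hol y x" "?Pk k" "h.P n y x"]
    show ?thesis by linarith
  qed
  then show "\<exists>N. \<forall>k\<ge>N. norm (hol e (Ck k) (Cik k) (yk k) (xk k) - hol e C Ci y x) < \<epsilon>" by blast
qed

section \<open>Both time directions of one cocycle\<close>

locale cocyc =
  fixes B :: "('m) sft_scheme" and A Ai :: "biseq \<Rightarrow> 'd::finite mat" and K Hc Cb q \<theta> :: real
  assumes half: "halfc B 1 A Ai K Hc Cb q \<theta>"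
begin

definition "Hc' = Hc * exp (rate B) powr \<theta>"

sublocale S: halfc B 1 A Ai K Hc Cb q \<theta> by (rule half)

abbreviation "An n x \<equiv> cpr 1 A n x"
abbreviation "Bu \<equiv> \<lambda>x. Ai (shift (- 1) x)"
abbreviation "Bui \<equiv> \<lambda>x. A (shift (- 1) x)"

lemma cpr_backward: "cpr (- 1) Bu n x = cpi 1 Ai n (shift (- int n) x)"
proof (induction n arbitrary: x)
  case (Suc n)
  then show ?case unfolding cpi_Suc2 by (simp add: algebra_simps)
qed simp

lemma cpi_backward: "cpi (- 1) Bui n x = cpr 1 A n (shift (- int n) x)"
proof (induction n arbitrary: x)
  case (Suc n)
  then show ?case unfolding cpr_Suc2 by (simp add: algebra_simps)
qed simp

text \<open>Products in negative time are the inverse products in positive time based at the shifted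
  point. Bunching is thus inherited with its two factors exchanged; only the Hoelder constant
  changes, by the effect of one shift.\<close>

lemma half_unstable: "halfc B (- 1) Bu Bui K Hc' Cb q \<theta>"
proof (rule halfc.intro)
  fix x n assume x: "x \<in> spts B"
  show "norm (cpr (- 1) Bu n x) * norm (cpi (- 1) Bui n x) \<le> Cb * q ^ n"
    unfolding cpr_backward cpi_backward
    using S.bunch[of "shift (- int n) x" n] x by (simp add: mult.commute)
next
  fix x y assume "x \<in> spts B" "y \<in> spts B"
  then show "norm (Bu x - Bu y) \<le> Hc' * sdist B x y powr \<theta>" "norm (Bui x - Bui y) \<le> Hc' * sdist B x y powr \<theta>"
    using S.holder_shift[OF S.Ci_holder, of x y "- 1"] S.holder_shift[OF S.C_holder, of x y "- 1"]
    by (simp_all add: Hc'_def)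
qed (use S.rate_pos S.\<theta>_pos S.K_ge1 S.Hc_nn S.Cb_ge1 S.q_pos S.bunched in
  \<open>auto simp: Hc'_def S.C_Ci S.Ci_C S.norm_C S.norm_Ci\<close>)

sublocale U: halfc B "- 1" Bu Bui K Hc' Cb q \<theta> by (rule half_unstable)

abbreviation "HS \<equiv> hol 1 A Ai"
abbreviation "HU \<equiv> hol (- 1) Bu Bui"

end

section \<open>Upper limits of bounded real sequences\<close>

text \<open>The upper limit as the infimum of the eventual upper bounds. Staying in the reals lets
  the norm axioms be proved by real arithmetic; \<open>limsup_eq_rl\<close> returns to the extended
  reals for bounded sequences.\<close>

definition rl :: "(nat \<Rightarrow> real) \<Rightarrow> real" where
  "rl f = Inf {c. \<forall>\<^sub>F n in sequentially. f n \<le> c}"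

definition bddseq :: "(nat \<Rightarrow> real) \<Rightarrow> bool" where
  "bddseq f \<longleftrightarrow> (\<exists>C. \<forall>n. \<bar>f n\<bar> \<le> C)"

lemma rl_le_iff:
  assumes "bddseq f"
  shows "rl f \<le> c \<longleftrightarrow> (\<forall>\<epsilon>>0. \<forall>\<^sub>F n in sequentially. f n \<le> c + \<epsilon>)"
proof -
  obtain C where C: "\<And>n. \<bar>f n\<bar> \<le> C" using assms by (auto simp: bddseq_def)
  let ?S = "{c. \<forall>\<^sub>F n in sequentially. f n \<le> c}"
  have lo: "- C \<le> d" if "d \<in> ?S" for d
  proof -
    from that obtain n where "f n \<le> d" unfolding eventually_sequentially by auto
    with C[of n] show ?thesis by linarith
  qed
  have "f n \<le> C" for n using C[of n] by linarith
  then have ne: "C \<in> ?S" by simp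
  have bdd: "bdd_below ?S" using lo by (auto simp: bdd_below_def)
  show ?thesis
  proof
    assume le: "rl f \<le> c"
    show "\<forall>\<epsilon>>0. \<forall>\<^sub>F n in sequentially. f n \<le> c + \<epsilon>"
    proof (intro allI impI)
      fix \<epsilon> :: real assume "\<epsilon> > 0"
      then have "Inf ?S < c + \<epsilon>" using le by (simp add: rl_def)
      then obtain d where d: "\<forall>\<^sub>F n in sequentially. f n \<le> d" "d < c + \<epsilon>"
        using cInf_less_iff[of ?S "c + \<epsilon>"] ne bdd by auto
      show "\<forall>\<^sub>F n in sequentially. f n \<le> c + \<epsilon>"
        using d(1) by (rule eventually_mono) (use d(2) in auto)
    qed
  next
    assume *: "\<forall>\<epsilon>>0. \<forall>\<^sub>F n in sequentially. f n \<le> c + \<epsilon>"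
    show "rl f \<le> c"
    proof (rule field_le_epsilon)
      fix \<epsilon> :: real assume "\<epsilon> > 0"
      then have "c + \<epsilon> \<in> ?S" using * by auto
      then show "rl f \<le> c + \<epsilon>" unfolding rl_def by (rule cInf_lower[OF _ bdd])
    qed
  qed
qed

lemma rl_eventually:
  assumes "bddseq f" "\<epsilon> > 0"
  shows "\<forall>\<^sub>F n in sequentially. f n \<le> rl f + \<epsilon>"
  using rl_le_iff[OF assms(1), of "rl f"] assms(2) by simp

lemma rl_leI:
  assumes "bddseq f" "\<And>\<epsilon>. \<epsilon> > 0 \<Longrightarrow> \<forall>\<^sub>F n in sequentially. f n \<le> c + \<epsilon>"
  shows "rl f \<le> c"
  using assms by (simp add: rl_le_iff)

lemma rl_ge:
  assumes "bddseq f" "\<And>n. c \<le> f n" shows "c \<le> rl f"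
proof (rule field_le_epsilon)
  fix \<epsilon> :: real assume "\<epsilon> > 0"
  from rl_eventually[OF assms(1) this] obtain n where "f n \<le> rl f + \<epsilon>"
    unfolding eventually_sequentially by auto
  with assms(2)[of n] show "c \<le> rl f + \<epsilon>" by linarith
qed

lemma rl_le: "bddseq f \<Longrightarrow> (\<And>n. f n \<le> c) \<Longrightarrow> rl f \<le> c"
proof (rule rl_leI)
  fix \<epsilon> :: real assume "\<epsilon> > 0" "\<And>n. f n \<le> c"
  then have "f n \<le> c + \<epsilon>" for n by (meson add_increasing2 less_imp_le)
  then show "\<forall>\<^sub>F n in sequentially. f n \<le> c + \<epsilon>" by simp
qed

lemma rl_mono_add:
  assumes "bddseq f" "bddseq g" "bddseq h" "e \<longlonglongrightarrow> 0" "\<And>n. f n \<le> g n + h n + e n"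
  shows "rl f \<le> rl g + rl h"
proof (rule rl_leI[OF assms(1)])
  fix \<epsilon> :: real assume "\<epsilon> > 0"
  then have "\<epsilon> / 3 > 0" by simp
  show "\<forall>\<^sub>F n in sequentially. f n \<le> rl g + rl h + \<epsilon>"
    using rl_eventually[OF assms(2) \<open>\<epsilon> / 3 > 0\<close>] rl_eventually[OF assms(3) \<open>\<epsilon> / 3 > 0\<close>]
      order_tendstoD(2)[OF assms(4) \<open>\<epsilon> / 3 > 0\<close>]
  proof eventually_elim
    case (elim n)
    then show ?case using assms(5)[of n] by argo
  qed
qed

lemma bddseq_const [simp]: "bddseq (\<lambda>n. c)"
  by (auto simp: bddseq_def)

lemma rl_const [simp]: "rl (\<lambda>n. c) = c"
  by (intro antisym rl_le rl_ge) auto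

lemma rl_mono_const:
  assumes "bddseq f" "bddseq g" "e \<longlonglongrightarrow> 0" "\<And>n. f n \<le> g n + c + e n"
  shows "rl f \<le> rl g + c"
  using rl_mono_add[OF assms(1,2) bddseq_const assms(3), of c] assms(4) by simp

lemma rl_mono: "bddseq f \<Longrightarrow> bddseq g \<Longrightarrow> (\<And>n. f n \<le> g n) \<Longrightarrow> rl f \<le> rl g"
  using rl_mono_const[of f g "\<lambda>n. 0" 0] by simp

lemma bddseq_cmult: "bddseq f \<Longrightarrow> bddseq (\<lambda>n. c * f n)"
  unfolding bddseq_def abs_mult by (metis abs_ge_zero mult_left_mono)

lemma rl_cmult_le:
  assumes "bddseq f" "0 \<le> c" shows "rl (\<lambda>n. c * f n) \<le> c * rl f"
proof (rule rl_leI[OF bddseq_cmult[OF assms(1)]])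
  fix \<epsilon> :: real assume e: "\<epsilon> > 0"
  then have "\<epsilon> / (c + 1) > 0" using assms(2) by simp
  from rl_eventually[OF assms(1) this]
  show "\<forall>\<^sub>F n in sequentially. c * f n \<le> c * rl f + \<epsilon>"
  proof eventually_elim
    case (elim n)
    then have "c * f n \<le> c * (rl f + \<epsilon> / (c + 1))" using assms(2) by (rule mult_left_mono)
    also have "\<dots> = c * rl f + (c / (c + 1)) * \<epsilon>" by (simp add: algebra_simps)
    also have "\<dots> \<le> c * rl f + 1 * \<epsilon>"
      using e assms(2) by (intro add_left_mono mult_right_mono) auto
    finally show ?case by simp
  qed
qed

lemma rl_cmult:
  assumes "bddseq f" "0 \<le> c" shows "rl (\<lambda>n. c * f n) = c * rl f"
proof (cases "c = 0")
  case False
  have "rl (\<lambda>n. inverse c * (c * f n)) \<le> inverse c * rl (\<lambda>n. c * f n)"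
    using assms by (intro rl_cmult_le bddseq_cmult) auto
  then have "rl f \<le> inverse c * rl (\<lambda>n. c * f n)" using False by (simp add: mult.assoc[symmetric])
  then have "c * rl f \<le> c * (inverse c * rl (\<lambda>n. c * f n))" using assms(2) by (rule mult_left_mono)
  then have "c * rl f \<le> rl (\<lambda>n. c * f n)" using False by (simp add: mult.assoc[symmetric])
  with rl_cmult_le[OF assms] show ?thesis by linarith
qed simp

lemma rl_Suc: "rl (\<lambda>n. f (Suc n)) = rl f"
  unfolding rl_def using eventually_sequentially_Suc[of "\<lambda>n. f n \<le> c" for c] by simp

text \<open>The index that bounds \<open>f n\<close> may change with \<open>n\<close>. If all upper
  limits of the finitely many \<open>g i\<close> were smaller than that of \<open>f\<close>, their
  maximum would bound \<open>f\<close> eventually up to any error.\<close>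

lemma rl_finite_max:
  assumes "finite I" "bddseq f" "\<And>i. i \<in> I \<Longrightarrow> bddseq (g i)" "\<And>n. \<exists>i\<in>I. f n \<le> g i n"
  shows "\<exists>i\<in>I. rl f \<le> rl (g i)"
proof (rule ccontr)
  assume "\<not> ?thesis"
  then have lt: "rl (g i) < rl f" if "i \<in> I" for i using that by (meson not_le)
  have ne: "I \<noteq> {}" using assms(4) by auto
  define c where "c = Max ((\<lambda>i. rl (g i)) ` I)"
  have c: "c < rl f" unfolding c_def using lt assms(1) ne by (subst Max_less_iff) auto
  have ci: "rl (g i) \<le> c" if "i \<in> I" for i unfolding c_def using assms(1) that by (intro Max_ge) auto
  have "rl f \<le> c"
  proof (rule rl_leI[OF assms(2)])
    fix \<epsilon> :: real assume "\<epsilon> > 0"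
    have "\<forall>\<^sub>F n in sequentially. \<forall>i\<in>I. g i n \<le> c + \<epsilon>"
      unfolding eventually_ball_finite_distrib[OF assms(1)]
    proof
      fix i assume i: "i \<in> I"
      show "\<forall>\<^sub>F n in sequentially. g i n \<le> c + \<epsilon>"
        using rl_eventually[OF assms(3)[OF i] \<open>\<epsilon> > 0\<close>] by (rule eventually_mono) (use ci[OF i] in auto)
    qed
    then show "\<forall>\<^sub>F n in sequentially. f n \<le> c + \<epsilon>"
    proof eventually_elim
      case (elim n)
      then show ?case using assms(4)[of n] by force
    qed
  qed
  with c show False by linarith
qed

lemma limsup_eq_rl:
  assumes "bddseq f" shows "limsup (\<lambda>n. ereal (f n)) = ereal (rl f)"
proof (rule antisym)
  show "limsup (\<lambda>n. ereal (f n)) \<le> ereal (rl f)"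
  proof (rule ereal_le_epsilon2)
    fix \<epsilon> :: real assume "\<epsilon> > 0"
    from rl_eventually[OF assms this]
    show "limsup (\<lambda>n. ereal (f n)) \<le> ereal (rl f) + ereal \<epsilon>"
      by (intro Limsup_bounded) (auto elim: eventually_mono)
  qed
  obtain C where C: "\<And>n. \<bar>f n\<bar> \<le> C" using assms by (auto simp: bddseq_def)
  show "ereal (rl f) \<le> limsup (\<lambda>n. ereal (f n))"
  proof (rule dense_ge)
    fix y assume y: "limsup (\<lambda>n. ereal (f n)) < y"
    then have ev: "\<forall>\<^sub>F n in sequentially. ereal (f n) < y" by (rule Limsup_lessD)
    show "ereal (rl f) \<le> y"
    proof (cases y)
      case (real s)
      have "rl f \<le> s"
      proof (rule rl_leI[OF assms])
        fix \<epsilon> :: real assume "\<epsilon> > 0"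
        show "\<forall>\<^sub>F n in sequentially. f n \<le> s + \<epsilon>"
          using ev by (rule eventually_mono) (use \<open>\<epsilon> > 0\<close> real in auto)
      qed
      then show ?thesis using real by simp
    next
      case MInf
      with ev show ?thesis unfolding eventually_sequentially by auto
    qed auto
  qed
qed

lemma Wu_loc_shift_back:
  assumes "w \<in> Wu_loc B (shift (int k) x)" shows "shift (- int k) w \<in> Wu_loc B x"
proof -
  have "shift (- int k) w n = x n" if "n \<le> 0" for n
    using Wu_locD(2)[OF assms, of "n - int k"] that by (simp add: shift_def)
  then show ?thesis using Wu_locD(1)[OF assms] by (simp add: Wu_loc_def)
qed

section \<open>Growth of uniformly spannable cocycles\<close>

text \<open>That the \<open>CARD('d)\<close> transported vectors form a basis is expressed quantitatively: a linear
  map is controlled by its values on them.\<close>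

definition span_data ::
  "('m) sft_scheme \<Rightarrow> (biseq \<Rightarrow> 'd::finite mat) \<Rightarrow> (biseq \<Rightarrow> 'd mat) \<Rightarrow> nat \<Rightarrow> real \<Rightarrow> biseq \<Rightarrow> biseq
    \<Rightarrow> real ^ 'd \<Rightarrow> (nat \<Rightarrow> biseq) \<Rightarrow> (nat \<Rightarrow> nat) \<Rightarrow> bool" where
  "span_data B A Ai m D x y u p k \<longleftrightarrow> (\<forall>i<CARD('d). k i \<le> m \<and> p i \<in> spts B \<and>
      (\<forall>n\<le>- int m. p i n = x n) \<and> (\<forall>n\<ge>int m. shift (int (k i)) (p i) n = y n)) \<and>
      (\<forall>L :: 'd mat. norm L * norm u \<le> D * (\<Sum>i<CARD('d). norm (blinfun_apply L
        (blinfun_apply (hol 1 A Ai y (shift (int (k i)) (p i)))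
          (blinfun_apply (cpr 1 A (k i) (p i))
            (blinfun_apply (hol (- 1) (\<lambda>x. Ai (shift (- 1) x)) (\<lambda>x. A (shift (- 1) x)) (p i) x) u))))))"

text \<open>Including \<open>u = 0\<close> costs nothing, because \<open>span_data\<close> survives
  any rescaling of the vector.\<close>

definition unif_span ::
  "('m) sft_scheme \<Rightarrow> (biseq \<Rightarrow> 'd::finite mat) \<Rightarrow> (biseq \<Rightarrow> 'd mat) \<Rightarrow> nat \<Rightarrow> real \<Rightarrow> bool" where
  "unif_span B A Ai m D \<longleftrightarrow> (\<forall>x\<in>spts B. \<forall>y\<in>spts B. \<forall>u. \<exists>p k. span_data B A Ai m D x y u p k)"

text \<open>\<open>N\<close> stands for the fixed norm read in coordinates. Uniform continuity in
  the base point is enough here, because norms at different points are compared only after iteration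
  has merged the points.\<close>

locale spann = cocyc B A Ai K Hc Cb q \<theta>
  for B :: "('m) sft_scheme" and A Ai :: "biseq \<Rightarrow> 'd::finite mat" and K Hc Cb q \<theta> +
  fixes m :: nat and D N0 :: real and N :: "biseq \<Rightarrow> real ^ 'd \<Rightarrow> real"
  assumes nonempty: "spts B \<noteq> {}" and D_ge1: "D \<ge> 1" and span: "unif_span B A Ai m D"
    and N0_ge1: "N0 \<ge> 1"
    and N_le: "x \<in> spts B \<Longrightarrow> N x v \<le> N0 * norm v"
    and N_ge: "x \<in> spts B \<Longrightarrow> norm v \<le> N0 * N x v"
    and N_add: "x \<in> spts B \<Longrightarrow> N x (v + w) \<le> N x v + N x w"
    and N_scale: "x \<in> spts B \<Longrightarrow> N x (c *\<^sub>R v) = \<bar>c\<bar> * N x v"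
    and N_unif: "\<epsilon> > 0 \<Longrightarrow> \<exists>\<delta>>0. \<forall>x\<in>spts B. \<forall>y\<in>spts B. sdist B x y < \<delta> \<longrightarrow>
        (\<forall>v. \<bar>N x v - N y v\<bar> \<le> \<epsilon> * norm v)"
begin

definition "Fm = exp (rate B * real m) powr \<theta>"
definition "HB = hbd U.a U.r 1"
definition "HSm = hbd S.a S.r Fm"
text \<open>Of the \<open>3 * m\<close> factors, \<open>m\<close> undo the passage from
  \<open>x\<close> to its \<open>m\<close>-th image, and at most \<open>2 * m\<close> account for
  the time lag between a connecting orbit and the orbit of its pullback.\<close>

definition "Ck = K ^ (3 * m) * (D * (real CARD('d) * HSm))"
definition "C2 = Ck * HB"

abbreviation "app f x \<equiv> blinfun_apply f x"

lemma compose_eqD: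
  fixes f g h k :: "'d mat"
  assumes "f o\<^sub>L g = h o\<^sub>L k" shows "app f (app g z) = app h (app k z)"
  using arg_cong[OF assms, of "\<lambda>L. app L z"] by simp

lemma powr_sdist_le_1: "sdist B x y powr \<theta> \<le> 1"
  using powr_mono2[OF less_imp_le[OF S.\<theta>_pos] sdist_nonneg sdist_le_1[OF S.rate_pos, of x y]] by simp

lemma hbd_ge1: "0 \<le> a \<Longrightarrow> r < 1 \<Longrightarrow> 0 \<le> F \<Longrightarrow> 1 \<le> hbd a r F"
  by (simp add: hbd_def)

lemma HB_ge1: "1 \<le> HB"
  unfolding HB_def by (intro hbd_ge1 U.a_nn U.r_bounds) simp

lemma Fm_nn: "0 \<le> Fm" by (simp add: Fm_def)

lemma HSm_ge1: "1 \<le> HSm"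
  unfolding HSm_def by (intro hbd_ge1 S.a_nn S.r_bounds Fm_nn)

lemma Ck_ge1: "1 \<le> Ck"
proof -
  have "1 \<le> real CARD('d)" by (simp add: Suc_leI)
  then have "1 * (1 * (1 * 1)) \<le> Ck"
    unfolding Ck_def using S.K_ge1 D_ge1 HSm_ge1 by (intro mult_mono one_le_power) auto
  then show ?thesis by simp
qed

lemma C2_ge1: "1 \<le> C2"
  unfolding C2_def using mult_mono[OF Ck_ge1 HB_ge1] Ck_ge1 by simp

lemma adm_Wu:
  assumes "x \<in> spts B" "y \<in> Wu_loc B x"
  shows "adm B (- 1) \<theta> (sdist B x y powr \<theta>) x y"
  using assms by (intro adm_unstable S.rate_pos S.\<theta>_pos) (auto simp: Wu_loc_def)

lemma adm_Wu1: "x \<in> spts B \<Longrightarrow> y \<in> Wu_loc B x \<Longrightarrow> adm B (- 1) \<theta> 1 x y"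
  by (rule adm_mono[OF adm_Wu powr_sdist_le_1])

lemma adm_Ws:
  assumes "x \<in> spts B" "y \<in> Ws_loc B x"
  shows "adm B 1 \<theta> (sdist B x y powr \<theta>) x y"
  using assms by (intro adm_stable S.rate_pos S.\<theta>_pos) (auto simp: Ws_loc_def)

lemma HU_bound: "x \<in> spts B \<Longrightarrow> y \<in> Wu_loc B x \<Longrightarrow> norm (HU y x) \<le> HB"
  unfolding HB_def by (rule U.hol_bound[OF adm_Wu1])

lemma HU_trans:
  assumes "x \<in> spts B" "y \<in> Wu_loc B x" "z \<in> Wu_loc B x"
  shows "HU z y o\<^sub>L HU y x = HU z x"
proof (rule U.hol_trans)
  show "adm B (- 1) \<theta> 1 x y" by (rule adm_Wu1) (use assms in auto)
  show "adm B (- 1) \<theta> 1 y z"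
    by (rule adm_Wu1) (use assms in \<open>auto simp: Wu_loc_def\<close>)
qed

text \<open>Moving forward adds one earlier term to the backward orbit and so costs a factor
  \<open>exp (rate B * \<theta>)\<close>. The loss is harmless: equivariance only asks for some
  admissible constant.\<close>

lemma adm_forward:
  assumes "adm B (- 1) \<theta> F x y"
  shows "adm B (- 1) \<theta> (F * exp (rate B * \<theta>)) (shift 1 x) (shift 1 y)"
  unfolding adm_def
proof (intro conjI allI)
  have F: "0 \<le> F" using assms by (auto simp: adm_def)
  fix n
  show "sdist B (shift (- 1 * int n) (shift 1 x)) (shift (- 1 * int n) (shift 1 y)) powr \<theta>
      \<le> F * exp (rate B * \<theta>) * exp (- rate B * \<theta>) ^ n"
  proof (cases n)
    case 0
    have "sdist B x y powr \<theta> \<le> F" using assms unfolding adm_def by (auto dest: spec[of _ 0])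
    then have "exp (rate B * 1) powr \<theta> * sdist B x y powr \<theta> \<le> exp (rate B * \<theta>) * F"
      by (intro mult_mono) (auto simp: powr_def mult.commute)
    with S.shift_powr_le[of 1 x y] show ?thesis using 0 by (simp add: mult.commute)
  next
    case (Suc k)
    have "sdist B (shift (- 1 * int k) x) (shift (- 1 * int k) y) powr \<theta> \<le> F * exp (- rate B * \<theta>) ^ k"
      using assms unfolding adm_def by blast
    moreover have "F * exp (rate B * \<theta>) * exp (- rate B * \<theta>) ^ n = F * exp (- rate B * \<theta>) ^ k"
    proof -
      have "exp (rate B * \<theta>) * exp (- rate B * \<theta>) = 1" by (simp add: exp_add[symmetric])
      then have "F * (exp (rate B * \<theta>) * exp (- rate B * \<theta>)) * exp (- rate B * \<theta>) ^ k = F * exp (- rate B * \<theta>) ^ k"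
        by (simp only: mult_1_right)
      then show ?thesis by (simp only: Suc power_Suc mult.assoc)
    qed
    moreover have "shift (- 1 * int n) (shift 1 z) = shift (- 1 * int k) z" for z by (simp add: Suc)
    ultimately show ?thesis by (simp only:)
  qed
qed (use assms in \<open>auto simp: adm_def\<close>)

text \<open>\<open>hol_equiv\<close> in direction -1 is equivariance under the inverse cocycle;
  multiplying by \<open>A\<close> from both sides turns it around.\<close>

lemma HU_forward:
  assumes "adm B (- 1) \<theta> F x y"
  shows "HU (shift 1 y) (shift 1 x) o\<^sub>L A x = A y o\<^sub>L HU y x"
proof -
  have xy: "x \<in> spts B" "y \<in> spts B" using assms by (auto simp: adm_def)
  have e: "Ai y o\<^sub>L HU (shift 1 y) (shift 1 x) = HU y x o\<^sub>L Ai x"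
    using U.hol_equiv[OF adm_forward[OF assms]] by simp
  have "A y o\<^sub>L ((HU y x o\<^sub>L Ai x) o\<^sub>L A x) = A y o\<^sub>L HU y x"
    by (simp add: compose_assoc S.Ci_C[OF xy(1)])
  moreover have "A y o\<^sub>L ((Ai y o\<^sub>L HU (shift 1 y) (shift 1 x)) o\<^sub>L A x) = HU (shift 1 y) (shift 1 x) o\<^sub>L A x"
    by (simp add: compose_assoc compose_cancel[OF S.C_Ci[OF xy(2)]])
  ultimately show ?thesis using e by simp
qed

lemma HU_forward_n:
  assumes "adm B (- 1) \<theta> F x y"
  shows "HU (shift (int n) y) (shift (int n) x) o\<^sub>L An n x = An n y o\<^sub>L HU y x"
proof -
  have "HU (shift (int n) y) (shift (int n) x) o\<^sub>L An n x = An n y o\<^sub>L HU y x \<and>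
    (\<exists>F. adm B (- 1) \<theta> F (shift (int n) x) (shift (int n) y))"
  proof (induction n)
    case 0
    show ?case using assms by auto
  next
    case (Suc n)
    then obtain F where F: "adm B (- 1) \<theta> F (shift (int n) x) (shift (int n) y)" by blast
    let ?x = "shift (int n) x" and ?y = "shift (int n) y"
    have "HU (shift 1 ?y) (shift 1 ?x) o\<^sub>L (A ?x o\<^sub>L An n x) = (A ?y o\<^sub>L HU ?y ?x) o\<^sub>L An n x"
      using HU_forward[OF F] by (simp add: compose_assoc[symmetric])
    also have "\<dots> = A ?y o\<^sub>L (An n y o\<^sub>L HU y x)" using Suc by (simp add: compose_assoc)
    finally show ?case using adm_forward[OF F] by (auto simp: compose_assoc add.commute)
  qed
  then show ?thesis by blast
qed

lemma adm_stable_shift_bound: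
  assumes "adm B 1 \<theta> F x y"
  shows "norm (HS (shift (int n) y) (shift (int n) x)) \<le> hbd S.a S.r F"
proof -
  have "0 \<le> F" "exp (- rate B * \<theta>) ^ n \<le> 1"
    using assms S.rate_pos S.\<theta>_pos by (auto simp: adm_def intro: power_le_one)
  then have "F * exp (- rate B * \<theta>) ^ n \<le> F" by (rule mult_left_le[rotated])
  from S.hol_bound[OF adm_mono[OF adm_shift[OF assms, of n] this]] show ?thesis by simp
qed

text \<open>Spannability is applied at the \<open>m\<close>-th image of \<open>x\<close> to the
  image of \<open>u\<close>, so that the connecting points, pulled back \<open>m\<close> times, fall
  into the local unstable set of \<open>x\<close>. By equivariance of the stable holonomy, the
  product over \<open>y\<close> on each connecting vector is, up to a bounded factor, the product
  along the orbit of such a pullback. The spanning inequality turns these \<open>CARD('d)\<close>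
  bounds into one for the operator norm at \<open>y\<close>, and \<open>w\<close> is the pullback
  with the largest value.\<close>

lemma key:
  assumes x: "x \<in> spts B" and y: "y \<in> spts B"
  shows "\<exists>w\<in>Wu_loc B x. norm (An n y) * norm u \<le> Ck * norm (app (An n w) (app (HU w x) u))"
proof -
  let ?x = "shift (int m) x" and ?u = "app (An m x) u"
  have x': "?x \<in> spts B" using x by simp
  from span x' y obtain p k where sd: "span_data B A Ai m D ?x y ?u p k"
    unfolding unif_span_def by blast
  then have pk: "\<And>i. i < CARD('d) \<Longrightarrow> k i \<le> m" "\<And>i. i < CARD('d) \<Longrightarrow> p i \<in> spts B"
      "\<And>i j. i < CARD('d) \<Longrightarrow> j \<le> - int m \<Longrightarrow> p i j = ?x j"
      "\<And>i j. i < CARD('d) \<Longrightarrow> j \<ge> int m \<Longrightarrow> shift (int (k i)) (p i) j = y j"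
    unfolding span_data_def by simp_all
  have sp: "norm L * norm ?u \<le> D * (\<Sum>i<CARD('d). norm (app L
        (app (HS y (shift (int (k i)) (p i))) (app (An (k i) (p i)) (app (HU (p i) ?x) ?u)))))" for L :: "'d mat"
    using sd unfolding span_data_def by (elim conjE) (erule spec)
  \<comment> \<open>Agreement of the pasts up to index \<open>- m\<close> becomes agreement up to
    index 0.\<close>
  define w where "w i = shift (- int m) (p i)" for i
  define t where "t i = norm (app (An n (w i)) (app (HU (w i) x) u))" for i
  have w: "w i \<in> Wu_loc B x" if "i < CARD('d)" for i
    using pk(2)[OF that] pk(3)[OF that, of "j - int m" for j]
    by (auto simp: Wu_loc_def w_def) (auto simp: shift_def)
  have bnd: "norm (app (An n y) (app (HS y (shift (int (k i)) (p i))) (app (An (k i) (p i)) (app (HU (p i) ?x) ?u))))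
     \<le> HSm * K ^ (2 * m) * t i" if i: "i < CARD('d)" for i
  proof -
    let ?s = "shift (int (k i)) (p i)"
    let ?v = "app (An n (w i)) (app (HU (w i) x) u)"
    have s: "?s \<in> spts B" and wi: "w i \<in> spts B" using pk(2)[OF i] w[OF i] by (auto simp: w_def)
    have ad: "adm B 1 \<theta> Fm ?s y"
      unfolding Fm_def using pk(4)[OF i] s y by (intro adm_stable_level S.rate_pos S.\<theta>_pos) auto
    have "An n y o\<^sub>L HS y ?s = HS (shift (int n) y) (shift (int n) ?s) o\<^sub>L An n ?s"
      using S.hol_equiv_n[OF ad, of n] by simp
    then have e1: "app (An n y) (app (HS y ?s) z) = app (HS (shift (int n) y) (shift (int n) ?s)) (app (An n ?s) z)" for z
      by (rule compose_eqD)
    have hf: "HU (shift (int m) (w i)) (shift (int m) x) o\<^sub>L An m x = An m (w i) o\<^sub>L HU (w i) x"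
      by (rule HU_forward_n[OF adm_Wu1[OF x w[OF i]]])
    have e2: "app (HU (p i) ?x) ?u = app (An m (w i)) (app (HU (w i) x) u)"
      using compose_eqD[OF hf, of u] by (simp add: w_def)
    \<comment> \<open>The same product of \<open>n + k i + m\<close> matrices along the orbit of
      \<open>w i\<close>, cut once after \<open>k i + m\<close> and once after \<open>n\<close>
      steps.\<close>
    have e3: "An n ?s o\<^sub>L (An (k i) (p i) o\<^sub>L An m (w i)) = An (k i + m) (shift (int n) (w i)) o\<^sub>L An n (w i)"
    proof -
      have pw: "p i = shift (int m) (w i)" by (simp add: w_def)
      have "An n ?s o\<^sub>L (An (k i) (p i) o\<^sub>L An m (w i)) = An (n + (k i + m)) (w i)"
        unfolding cpr_add by (simp add: pw compose_assoc algebra_simps)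
      also have "\<dots> = An ((k i + m) + n) (w i)" by (simp add: algebra_simps)
      also have "\<dots> = An (k i + m) (shift (int n) (w i)) o\<^sub>L An n (w i)"
        by (simp only: cpr_add) simp
      finally show ?thesis .
    qed
    have "app (An n y) (app (HS y ?s) (app (An (k i) (p i)) (app (HU (p i) ?x) ?u)))
        = app (HS (shift (int n) y) (shift (int n) ?s)) (app (An n ?s o\<^sub>L (An (k i) (p i) o\<^sub>L An m (w i))) (app (HU (w i) x) u))"
      unfolding e1 e2 by simp
    also have "\<dots> = app (HS (shift (int n) y) (shift (int n) ?s)) (app (An (k i + m) (shift (int n) (w i))) ?v)"
      unfolding e3 by simp
    finally have eq: "app (An n y) (app (HS y ?s) (app (An (k i) (p i)) (app (HU (p i) ?x) ?u)))
      = app (HS (shift (int n) y) (shift (int n) ?s)) (app (An (k i + m) (shift (int n) (w i))) ?v)" .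
    have "norm (app (HS (shift (int n) y) (shift (int n) ?s)) (app (An (k i + m) (shift (int n) (w i))) ?v)) \<le> HSm * (K ^ (2 * m) * norm ?v)"
    proof -
      have 1: "norm (HS (shift (int n) y) (shift (int n) ?s)) \<le> HSm"
        unfolding HSm_def by (rule adm_stable_shift_bound[OF ad])
      have "norm (An (k i + m) (shift (int n) (w i))) \<le> K ^ (k i + m)"
        by (rule S.norm_cpr_le) (simp only: shift_in_spts wi)
      also have "\<dots> \<le> K ^ (2 * m)" by (rule power_increasing[OF _ S.K_ge1]) (use pk(1)[OF i] in linarith)
      finally have 2: "norm (app (An (k i + m) (shift (int n) (w i))) ?v) \<le> K ^ (2 * m) * norm ?v"
        by (rule norm_apply_le)
      show ?thesis
        by (rule order_trans[OF norm_apply_le[OF 1] mult_left_mono[OF 2]]) (use HSm_ge1 in linarith)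
    qed
    then show ?thesis unfolding eq t_def by (simp only: mult.assoc)
  qed
  obtain j where j: "j < CARD('d)" "\<And>i. i < CARD('d) \<Longrightarrow> t i \<le> t j"
  proof -
    have fin: "finite (t ` {..<CARD('d)})" "t ` {..<CARD('d)} \<noteq> {}" by (auto simp: lessThan_empty_iff)
    from Max_in[OF this] obtain j where "j < CARD('d)" "t j = Max (t ` {..<CARD('d)})" by auto
    then show ?thesis using that[of j] Max_ge[OF fin(1)] by auto
  qed
  have "norm (An n y) * norm ?u \<le> D * (\<Sum>i<CARD('d). HSm * K ^ (2 * m) * t i)"
  proof (rule order_trans[OF sp mult_left_mono[OF sum_mono]])
    fix i assume "i \<in> {..<CARD('d)}"
    then have i: "i < CARD('d)" by simp
    show "norm (app (An n y) (app (HS y (shift (int (k i)) (p i))) (app (An (k i) (p i)) (app (HU (p i) ?x) ?u))))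
        \<le> HSm * K ^ (2 * m) * t i" by (rule bnd[OF i])
  qed (use D_ge1 in simp)
  also have "\<dots> \<le> D * (\<Sum>i<CARD('d). HSm * K ^ (2 * m) * t j)"
    using D_ge1 HSm_ge1 S.K_ge1 j by (intro mult_left_mono sum_mono) auto
  also have "\<dots> = D * (real CARD('d) * HSm) * K ^ (2 * m) * t j" by simp
  finally have main: "norm (An n y) * norm ?u \<le> D * (real CARD('d) * HSm) * K ^ (2 * m) * t j" .
  \<comment> \<open>The last factor \<open>K ^ m\<close> pays for returning from \<open>?u\<close>
    to \<open>u\<close>.\<close>
  have "u = app (cpi 1 Ai m x) ?u"
    using arg_cong[OF S.cpi_cpr[OF x, of m], of "\<lambda>L. app L u"] by simp
  then have "norm u \<le> K ^ m * norm ?u" using norm_apply_le[OF S.norm_cpi_le[OF x, of m]] by metis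
  then have "norm (An n y) * norm u \<le> norm (An n y) * (K ^ m * norm ?u)" by (rule mult_left_mono) simp
  also have "\<dots> = K ^ m * (norm (An n y) * norm ?u)" by simp
  also have "\<dots> \<le> K ^ m * (D * (real CARD('d) * HSm) * K ^ (2 * m) * t j)"
    using S.K_ge1 by (intro mult_left_mono main) auto
  also have "\<dots> = Ck * t j" by (simp add: Ck_def power_add[symmetric] mult_ac)
  finally show ?thesis using w[OF j(1)] unfolding t_def by blast
qed

section \<open>Growth of the maximal norms\<close>

definition "M n = (SUP x\<in>spts B. norm (An n x))"

lemma M_bdd: "bdd_above ((\<lambda>x. norm (An n x)) ` spts B)"
  by (rule bdd_aboveI[of _ "K ^ n"]) (auto intro: S.norm_cpr_le)

lemma le_M: "x \<in> spts B \<Longrightarrow> norm (An n x) \<le> M n"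
  unfolding M_def by (rule cSUP_upper[OF _ M_bdd])

lemma M_le: "(\<And>x. x \<in> spts B \<Longrightarrow> norm (An n x) \<le> c) \<Longrightarrow> M n \<le> c"
  unfolding M_def by (rule cSUP_least[OF nonempty])

lemma norm_An_pos:
  assumes "x \<in> spts B" shows "0 < norm (An n x)"
proof -
  have "An n x \<noteq> 0"
  proof
    assume "An n x = 0"
    with S.cpi_cpr[OF assms, of n] have "(id_blinfun :: 'd mat) = 0" by simp
    then show False by (metis norm_id_mat norm_zero zero_neq_one)
  qed
  then show ?thesis by simp
qed

lemma M_pos: "0 < M n"
  using nonempty norm_An_pos le_M by (metis ex_in_conv order_less_le_trans)

lemma M_0: "M 0 = 1"
  unfolding M_def using nonempty by simp

lemma M_submult: "M (n + k) \<le> M n * M k"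
proof (rule M_le)
  fix x assume x: "x \<in> spts B"
  have "norm (An n (shift (1 * int k) x) o\<^sub>L An k x) \<le> M n * M k"
    using x by (intro norm_compose_le le_M) auto
  then show "norm (An (n + k) x) \<le> M n * M k" by (simp only: cpr_add)
qed

text \<open>\<open>key\<close> is applied to the vector already reached after \<open>k\<close>
  steps. Its witness, pulled back \<open>k\<close> times, lies in the local unstable set of the
  starting point, and the two products join to one of length \<open>n + k\<close>; \<open>HB\<close>
  bounds the holonomy used there.\<close>

lemma M_supermult: "M n * M k \<le> C2 * M (n + k)"
proof -
  have "norm (An n y) * norm (An k x) \<le> C2 * M (n + k)" if x: "x \<in> spts B" and y: "y \<in> spts B" for x y
  proof -
    have y0: "0 < norm (An n y)" by (rule norm_An_pos[OF y])
    have "norm (app (An k x) u) \<le> (C2 * M (n + k) / norm (An n y)) * norm u" for u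
    proof -
      let ?x = "shift (int k) x" and ?v = "app (An k x) u"
      have x': "?x \<in> spts B" using x by simp
      from key[OF x' y, of n ?v] obtain w where
        w: "w \<in> Wu_loc B ?x" "norm (An n y) * norm ?v \<le> Ck * norm (app (An n w) (app (HU w ?x) ?v))" by blast
      let ?w = "shift (- int k) w"
      have w': "?w \<in> Wu_loc B x" by (rule Wu_loc_shift_back[OF w(1)])
      have "HU w ?x o\<^sub>L An k x = An k ?w o\<^sub>L HU ?w x"
        using HU_forward_n[OF adm_Wu1[OF x w'], of k] by simp
      then have "app (HU w ?x) ?v = app (An k ?w) (app (HU ?w x) u)"
        by (rule compose_eqD)
      then have "app (An n w) (app (HU w ?x) ?v) = app (An n w) (app (An k ?w) (app (HU ?w x) u))"
        by simp
      also have "\<dots> = app (An (n + k) ?w) (app (HU ?w x) u)"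
        by (simp add: cpr_add)
      finally have eq: "app (An n w) (app (HU w ?x) ?v) = app (An (n + k) ?w) (app (HU ?w x) u)" .
      have "norm (app (An (n + k) ?w) (app (HU ?w x) u)) \<le> M (n + k) * (HB * norm u)"
        using norm_apply_le[OF le_M, of ?w "n + k" "app (HU ?w x) u"]
          mult_left_mono[OF norm_apply_le[OF HU_bound[OF x w'], of u] less_imp_le[OF M_pos[of "n + k"]]] Wu_locD(1)[OF w']
        by linarith
      then have "norm (app (An n w) (app (HU w ?x) ?v)) \<le> M (n + k) * (HB * norm u)" unfolding eq .
      then have "Ck * norm (app (An n w) (app (HU w ?x) ?v)) \<le> Ck * (M (n + k) * (HB * norm u))"
        using Ck_ge1 by (intro mult_left_mono) auto
      with w(2) have "norm (An n y) * norm ?v \<le> C2 * M (n + k) * norm u"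
        by (simp add: C2_def mult_ac)
      then show ?thesis using y0 by (simp add: field_simps)
    qed
    then have "norm (An k x) \<le> C2 * M (n + k) / norm (An n y)"
      using C2_ge1 M_pos[of "n + k"] by (intro norm_blinfun_bound) auto
    then show ?thesis using y0 by (simp add: field_simps)
  qed
  \<comment> \<open>The suprema over \<open>y\<close> and over \<open>x\<close> are taken one after
    the other, each time dividing by the positive norm held fixed.\<close>
  then have *: "norm (An n y) \<le> C2 * M (n + k) / norm (An k x)" if "x \<in> spts B" "y \<in> spts B" for x y
    using that norm_An_pos[OF that(1), of k] by (simp add: field_simps)
  have "norm (An k x) \<le> C2 * M (n + k) / M n" if x: "x \<in> spts B" for x
  proof -
    have "M n \<le> C2 * M (n + k) / norm (An k x)" by (rule M_le) (rule *[OF x])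
    then show ?thesis using norm_An_pos[OF x, of k] M_pos[of n] by (simp add: field_simps)
  qed
  then have "M k \<le> C2 * M (n + k) / M n" by (rule M_le)
  then show ?thesis using M_pos[of n] by (simp add: field_simps)
qed

text \<open>The limit in Fekete's lemma, written as an infimum. Together with
  near-supermultiplicativity it describes \<open>M n\<close> up to a constant factor, not just up to
  subexponential errors.\<close>

definition "b = (INF n\<in>{1..}. ln (M n) / real n)"

lemma M_power_le: "M (j * n) \<le> M j ^ n"
proof (induction n)
  case (Suc n)
  have "M (j * Suc n) \<le> M j * M (j * n)" using M_submult[of j "j * n"] by simp
  also have "\<dots> \<le> M j * M j ^ n" using Suc M_pos[of j] by (intro mult_left_mono) auto
  finally show ?case by simp
qed (simp add: M_0)

lemma M_power_ge: "M n ^ j \<le> C2 ^ j * M (j * n)"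
proof (induction j)
  case (Suc j)
  have "M n ^ Suc j \<le> M n * (C2 ^ j * M (j * n))"
    using Suc M_pos[of n] by (simp add: mult_left_mono)
  also have "\<dots> = C2 ^ j * (M n * M (j * n))" by simp
  also have "\<dots> \<le> C2 ^ j * (C2 * M (n + j * n))"
    using C2_ge1 by (intro mult_left_mono M_supermult) auto
  finally show ?case by (simp add: mult_ac)
qed (simp add: M_0)

text \<open>\<open>M n ^ j\<close> and \<open>M j ^ n\<close> are both compared with
  \<open>M (j * n)\<close>, one by the lower and one by the upper product estimate. Taking
  \<open>j\<close>-th roots leaves a single factor \<open>C2\<close>, independent of
  \<open>j\<close>.\<close>

lemma ln_M_le: 
  assumes "j \<ge> 1" shows "ln (M n) \<le> ln C2 + real n * (ln (M j) / real j)"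
proof -
  have "M n ^ j \<le> C2 ^ j * M j ^ n"
    using M_power_ge[of n j] M_power_le[of j n] C2_ge1
    by (meson mult_left_mono order_trans zero_le_one zero_le_power)
  then have "ln (M n ^ j) \<le> ln (C2 ^ j * M j ^ n)"
    using M_pos C2_ge1 by (intro ln_mono) (auto intro: zero_less_power)
  also have "\<dots> = ln (C2 ^ j) + ln (M j ^ n)"
    using M_pos[of j] C2_ge1 by (intro ln_mult_pos) auto
  finally have "real j * ln (M n) \<le> real j * ln C2 + real n * ln (M j)"
    using M_pos C2_ge1 by (simp add: ln_realpow)
  then show ?thesis using assms by (simp add: field_simps)
qed

lemma b_bdd: "bdd_below ((\<lambda>n. ln (M n) / real n) ` {1..})"
proof (rule bdd_belowI2)
  fix n :: nat assume "n \<in> {1..}"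
  then show "ln (M 1) - ln C2 \<le> ln (M n) / real n"
    using ln_M_le[of n 1] by simp
qed

lemma M_ge: "exp (b * real n) \<le> M n"
proof (cases "n = 0")
  case False
  then have "b \<le> ln (M n) / real n" unfolding b_def by (intro cINF_lower b_bdd) auto
  then have "b * real n \<le> ln (M n)" using False by (simp add: field_simps)
  then show ?thesis using M_pos[of n] by (simp add: ln_ge_iff)
qed (simp add: M_0)

lemma M_le_exp: "M n \<le> C2 * exp (b * real n)"
proof (cases "n = 0")
  case False
  have "(ln (M n) - ln C2) / real n \<le> b"
    unfolding b_def
  proof (rule cINF_greatest)
    fix j :: nat assume "j \<in> {1..}"
    then have "ln (M n) \<le> ln C2 + real n * (ln (M j) / real j)" by (intro ln_M_le) auto
    then have "ln (M n) - ln C2 \<le> (ln (M j) / real j) * real n" by (simp add: mult.commute)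
    then show "(ln (M n) - ln C2) / real n \<le> ln (M j) / real j"
      using False by (subst pos_divide_le_eq) auto
  qed auto
  then have "ln (M n) \<le> ln C2 + b * real n" using False by (simp add: field_simps)
  then have "exp (ln (M n)) \<le> exp (ln C2 + b * real n)" by simp
  then show ?thesis using M_pos[of n] C2_ge1 by (simp add: exp_add)
qed (use C2_ge1 in \<open>simp add: M_0\<close>)

end

section \<open>The Barabanov norm of a cocycle\<close>

lemma rl_mono_ev:
  assumes "bddseq f" "bddseq g" "\<forall>\<^sub>F n in sequentially. f n \<le> g n + c"
  shows "rl f \<le> rl g + c"
proof (rule rl_leI[OF assms(1)])
  fix \<epsilon> :: real assume "\<epsilon> > 0"
  show "\<forall>\<^sub>F n in sequentially. f n \<le> rl g + c + \<epsilon>"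
    using rl_eventually[OF assms(2) \<open>\<epsilon> > 0\<close>] assms(3) by eventually_elim linarith
qed

lemma le_of_eps_mult:
  fixes a b k :: real
  assumes "0 \<le> k" "\<And>\<epsilon>. \<epsilon> > 0 \<Longrightarrow> a \<le> b + \<epsilon> * k"
  shows "a \<le> b"
proof (rule field_le_epsilon)
  fix e :: real assume e: "e > 0"
  have "a \<le> b + e / (k + 1) * k" using e assms(1) by (intro assms(2)) auto
  also have "e / (k + 1) * k = e * (k / (k + 1))" by simp
  also have "b + \<dots> \<le> b + e * 1" using e assms(1) by (intro add_left_mono mult_left_mono) auto
  finally show "a \<le> b + e" by simp
qed

lemma Wu_loc_shift_forward:
  assumes "y \<in> Wu_loc B x" "z \<in> Wu_loc B x" "y 1 = z 1"
  shows "shift 1 y \<in> Wu_loc B (shift 1 z)"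
proof -
  have "y (n + 1) = z (n + 1)" if "n \<le> 0" for n
    using Wu_locD(2)[OF assms(1), of "n + 1"] Wu_locD(2)[OF assms(2), of "n + 1"] assms(3) that
    by (cases "n = 0") auto
  then have "shift 1 y n = shift 1 z n" if "n \<le> 0" for n using that by (simp add: shift_def)
  then show ?thesis using Wu_locD(1)[OF assms(1)] by (simp add: Wu_loc_def)
qed

lemma compose_eq1:
  fixes f g h :: "'d::finite mat"
  assumes "f o\<^sub>L g = h" shows "blinfun_apply f (blinfun_apply g z) = blinfun_apply h z"
  using arg_cong[OF assms, of "\<lambda>L. blinfun_apply L z"] by simp

context spann
begin

text \<open>With the next three definitions, the limsup norm in coordinates. The normalization uses
  \<open>b\<close>, which is identified with the maximal Lyapunov exponent only later.\<close>

definition "val n x u y = N (shift (int n) y) (app (An n y) (app (HU y x) u))"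
definition "Sn n x u = (SUP y\<in>Wu_loc B x. val n x u y)"
definition "En n x u = exp (- b * real n) * Sn n x u"
definition "bn x u = rl (\<lambda>n. En n x u)"
definition "Cu = N0 * C2 * HB"

lemma N_nn: "x \<in> spts B \<Longrightarrow> 0 \<le> N x v"
  using N_ge[of x v] N0_ge1 norm_ge_zero[of v] by (smt (verit) mult_less_0_iff)

lemma Cu_ge1: "1 \<le> Cu"
  unfolding Cu_def using mult_mono[OF mult_mono[OF N0_ge1 C2_ge1] HB_ge1] N0_ge1 C2_ge1 HB_ge1 by simp

lemma norm_An_HU_le:
  assumes "x \<in> spts B" "y \<in> Wu_loc B x"
  shows "norm (app (An n y) (app (HU y x) u)) \<le> M n * (HB * norm u)"
proof -
  have "norm (app (An n y) (app (HU y x) u)) \<le> M n * norm (app (HU y x) u)"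
    using Wu_locD(1)[OF assms(2)] by (intro norm_apply_le le_M)
  also have "\<dots> \<le> M n * (HB * norm u)"
    by (rule mult_left_mono[OF norm_apply_le[OF HU_bound[OF assms]]]) (use M_pos[of n] in simp)
  finally show ?thesis .
qed

lemma val_le:
  assumes "x \<in> spts B" "y \<in> Wu_loc B x"
  shows "val n x u y \<le> N0 * (M n * (HB * norm u))"
proof -
  have "val n x u y \<le> N0 * norm (app (An n y) (app (HU y x) u))"
    unfolding val_def using Wu_locD(1)[OF assms(2)] by (intro N_le) simp
  also have "\<dots> \<le> N0 * (M n * (HB * norm u))"
    using N0_ge1 by (intro mult_left_mono norm_An_HU_le assms) auto
  finally show ?thesis .
qed

lemma Sn_bdd: "x \<in> spts B \<Longrightarrow> bdd_above (val n x u ` Wu_loc B x)"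
  by (rule bdd_aboveI2) (rule val_le)

lemma val_le_Sn: "x \<in> spts B \<Longrightarrow> y \<in> Wu_loc B x \<Longrightarrow> val n x u y \<le> Sn n x u"
  unfolding Sn_def by (rule cSUP_upper[OF _ Sn_bdd])

lemma Sn_le:
  assumes "x \<in> spts B" "\<And>y. y \<in> Wu_loc B x \<Longrightarrow> val n x u y \<le> c"
  shows "Sn n x u \<le> c"
  unfolding Sn_def by (rule cSUP_least) (use assms Wu_loc_refl in auto)

lemma Sn_nn: "x \<in> spts B \<Longrightarrow> 0 \<le> Sn n x u"
  using val_le_Sn[OF _ Wu_loc_refl, of x n u] N_nn[of "shift (int n) x"]
  unfolding val_def by (meson order_trans shift_in_spts)

lemma exp_M: "exp (- b * real n) * M n \<le> C2"
  using mult_left_mono[OF M_le_exp[of n], of "exp (- b * real n)"]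
  by (simp add: exp_minus field_simps)

lemma En_nn: "x \<in> spts B \<Longrightarrow> 0 \<le> En n x u"
  unfolding En_def by (intro mult_nonneg_nonneg Sn_nn) auto

lemma En_le:
  assumes "x \<in> spts B" shows "En n x u \<le> Cu * norm u"
proof -
  have "En n x u \<le> exp (- b * real n) * (N0 * (M n * (HB * norm u)))"
    unfolding En_def using assms by (intro mult_left_mono Sn_le val_le) auto
  also have "\<dots> = N0 * (exp (- b * real n) * M n) * (HB * norm u)" by simp
  also have "\<dots> \<le> N0 * C2 * (HB * norm u)"
    using N0_ge1 HB_ge1 by (intro mult_right_mono mult_left_mono exp_M) auto
  finally show ?thesis by (simp add: Cu_def)
qed

text \<open>\<open>key\<close> dominates the norm at every point \<open>y\<close>, hence
  \<open>M n\<close>, and \<open>M n\<close> is at least \<open>exp (b * real n)\<close> at every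
  time. No subsequence is involved, so the upper limit inherits the bound.\<close>

lemma En_ge:
  assumes "x \<in> spts B" shows "norm u \<le> N0 * Ck * En n x u"
proof (cases "u = 0")
  case False
  have "norm (An n y) \<le> Ck * N0 * Sn n x u / norm u" if y: "y \<in> spts B" for y
  proof -
    from key[OF assms y, of n u] obtain w where w: "w \<in> Wu_loc B x"
      "norm (An n y) * norm u \<le> Ck * norm (app (An n w) (app (HU w x) u))" by blast
    have "norm (app (An n w) (app (HU w x) u)) \<le> N0 * val n x u w"
      unfolding val_def using Wu_locD(1)[OF w(1)] by (intro N_ge) simp
    also have "\<dots> \<le> N0 * Sn n x u"
      using N0_ge1 by (intro mult_left_mono val_le_Sn assms w) auto
    finally have "Ck * norm (app (An n w) (app (HU w x) u)) \<le> Ck * (N0 * Sn n x u)"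
      using Ck_ge1 by (intro mult_left_mono) auto
    with w(2) show ?thesis using False by (simp add: field_simps)
  qed
  then have "M n \<le> Ck * N0 * Sn n x u / norm u" by (rule M_le)
  then have "exp (b * real n) \<le> Ck * N0 * Sn n x u / norm u" using M_ge[of n] by linarith
  then have "exp (b * real n) * norm u \<le> Ck * N0 * Sn n x u" using False by (simp add: field_simps)
  then have "exp (- b * real n) * (exp (b * real n) * norm u) \<le> exp (- b * real n) * (Ck * N0 * Sn n x u)"
    by (intro mult_left_mono) auto
  then show ?thesis by (simp add: En_def mult.assoc[symmetric] exp_add[symmetric]) (simp add: mult_ac)
qed (use assms En_nn N0_ge1 Ck_ge1 in simp)

lemma En_bdd: "x \<in> spts B \<Longrightarrow> bddseq (\<lambda>n. En n x u)"
  unfolding bddseq_def by (rule exI[of _ "Cu * norm u"]) (use En_nn En_le in simp)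

lemma bn_le: "x \<in> spts B \<Longrightarrow> bn x u \<le> Cu * norm u"
  unfolding bn_def by (intro rl_le En_bdd En_le)

lemma bn_ge:
  assumes "x \<in> spts B" shows "norm u \<le> N0 * Ck * bn x u"
proof -
  have p: "0 < N0 * Ck" using N0_ge1 Ck_ge1 by simp
  have "norm u / (N0 * Ck) \<le> bn x u"
    unfolding bn_def using En_ge[OF assms, of u] p
    by (intro rl_ge En_bdd assms) (simp add: field_simps)
  then show ?thesis using p by (simp add: field_simps)
qed

lemma bn_nn: "x \<in> spts B \<Longrightarrow> 0 \<le> bn x u"
  unfolding bn_def by (intro rl_ge En_bdd En_nn)

lemma val_add:
  assumes "y \<in> spts B" shows "val n x (u + v) y \<le> val n x u y + val n x v y"
  unfolding val_def blinfun.add_right using assms by (intro N_add) simp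

lemma val_scale: "y \<in> spts B \<Longrightarrow> val n x (c *\<^sub>R u) y = \<bar>c\<bar> * val n x u y"
  unfolding val_def blinfun.scaleR_right by (intro N_scale) simp

lemma bn_add:
  assumes x: "x \<in> spts B" shows "bn x (u + v) \<le> bn x u + bn x v"
proof -
  have "Sn n x (u + v) \<le> Sn n x u + Sn n x v" for n
  proof (rule Sn_le[OF x])
    fix y assume y: "y \<in> Wu_loc B x"
    show "val n x (u + v) y \<le> Sn n x u + Sn n x v"
      using val_add[OF Wu_locD(1)[OF y], of n x u v] val_le_Sn[OF x y, of n u] val_le_Sn[OF x y, of n v] by linarith
  qed
  then have "En n x (u + v) \<le> En n x u + En n x v + 0" for n
    unfolding En_def by (simp add: distrib_left[symmetric])
  then show ?thesis unfolding bn_def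
    by (rule rl_mono_add[OF En_bdd[OF x] En_bdd[OF x] En_bdd[OF x] tendsto_const])
qed

lemma bn_scale:
  assumes x: "x \<in> spts B" shows "bn x (c *\<^sub>R u) = \<bar>c\<bar> * bn x u"
proof -
  have le: "Sn n x (c *\<^sub>R u) \<le> \<bar>c\<bar> * Sn n x u" for n c u
    by (rule Sn_le[OF x]) (auto simp: val_scale[OF Wu_locD(1)] intro!: mult_left_mono val_le_Sn x)
  have "En n x (c *\<^sub>R u) = \<bar>c\<bar> * En n x u" for n
  proof (cases "c = 0")
    case True
    then show ?thesis using le[of n 0 u] Sn_nn[OF x, of n 0] by (simp add: En_def)
  next
    case False
    have "Sn n x u \<le> \<bar>inverse c\<bar> * Sn n x (c *\<^sub>R u)" using le[of n "inverse c" "c *\<^sub>R u"] False by simp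
    then have "\<bar>c\<bar> * Sn n x u \<le> Sn n x (c *\<^sub>R u)" using False by (simp add: field_simps abs_inverse)
    with le[of n c u] show ?thesis by (simp add: En_def)
  qed
  then show ?thesis unfolding bn_def by (simp add: rl_cmult[OF En_bdd[OF x]])
qed

lemma bn_diff_le:
  assumes "x \<in> spts B" shows "bn x u \<le> bn x v + Cu * norm (u - v)"
  using bn_add[OF assms, of v "u - v"] bn_le[OF assms, of "u - v"] by simp

text \<open>The supremum runs over the whole local unstable set of the vector, which does not change
  when the vector moves inside that set. Equality thus holds at each time already.\<close>

lemma bn_HU:
  assumes x: "x \<in> spts B" and y: "y \<in> Wu_loc B x"
  shows "bn y (app (HU y x) u) = bn x u"
proof -
  have "val n y (app (HU y x) u) z = val n x u z" if "z \<in> Wu_loc B x" for n z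
    using compose_eq1[OF HU_trans[OF x y that], of u] unfolding val_def by simp
  then have "Sn n y (app (HU y x) u) = Sn n x u" for n
    unfolding Sn_def Wu_loc_eq[OF y] by (intro SUP_cong) auto
  then show ?thesis by (simp add: bn_def En_def)
qed

text \<open>Transitivity and equivariance of the unstable holonomies let the first of the
  \<open>n + 1\<close> steps be taken at \<open>y\<close> and absorbed into the vector.\<close>

lemma val_Suc:
  assumes x: "x \<in> spts B" and y: "y \<in> Wu_loc B x" and z: "z \<in> Wu_loc B x" and zy: "z 1 = y 1"
  shows "val (Suc n) x u z = val n (shift 1 y) (app (A y) (app (HU y x) u)) (shift 1 z)"
proof -
  have ys: "y \<in> spts B" using y by (rule Wu_locD)
  have zy': "z \<in> Wu_loc B y" using z Wu_loc_eq[OF y] by simp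
  have f: "HU (shift 1 z) (shift 1 y) o\<^sub>L A y = A z o\<^sub>L HU z y"
    by (rule HU_forward[OF adm_Wu1[OF ys zy']])
  have t: "app (HU z y) (app (HU y x) u) = app (HU z x) u"
    by (rule compose_eq1[OF HU_trans[OF x y z]])
  have e: "app (HU (shift 1 z) (shift 1 y)) (app (A y) (app (HU y x) u)) = app (A z) (app (HU z x) u)"
    using compose_eqD[OF f, of "app (HU y x) u"] t by simp
  show ?thesis unfolding val_def e cpr_Suc2 by (simp add: add.commute)
qed

lemma En_Suc: "En (Suc n) x u = exp (- b) * (exp (- b * real n) * Sn (Suc n) x u)"
  unfolding En_def by (simp add: algebra_simps exp_add[symmetric] exp_diff exp_minus field_simps)

lemma rl_En_Suc: "rl (\<lambda>n. En (Suc n) x u) = bn x u"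
  unfolding bn_def by (rule rl_Suc)

text \<open>Pulled back by one step, the local unstable set of \<open>shift 1 x\<close> is the part
  of that of \<open>x\<close> with next symbol \<open>x 1\<close>. The supremum over a part is no
  larger, and the change of normalization gives \<open>exp b\<close>.\<close>

lemma bn_A_le:
  assumes x: "x \<in> spts B" shows "bn (shift 1 x) (app (A x) u) \<le> exp b * bn x u"
proof -
  have s: "shift 1 x \<in> spts B" using x by simp
  have "Sn n (shift 1 x) (app (A x) u) \<le> Sn (Suc n) x u" for n
  proof (rule Sn_le[OF s])
    fix w assume w: "w \<in> Wu_loc B (shift 1 x)"
    have z: "shift (- 1) w \<in> Wu_loc B x" using Wu_loc_shift_back[of w B 1 x] w by simp
    have "w 0 = shift 1 x 0" using Wu_locD(2)[OF w] by simp
    then have "shift (- 1) w 1 = x 1" by (simp add: shift_def)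
    from val_Suc[OF x Wu_loc_refl[OF x] z this, of n u]
    have "val n (shift 1 x) (app (A x) u) w = val (Suc n) x u (shift (- 1) w)"
      using U.hol_self[OF x] by simp
    then show "val n (shift 1 x) (app (A x) u) w \<le> Sn (Suc n) x u"
      using val_le_Sn[OF x z, of "Suc n" u] by simp
  qed
  then have "exp (- b) * En n (shift 1 x) (app (A x) u) \<le> En (Suc n) x u" for n
    unfolding En_Suc unfolding En_def by simp
  then have "rl (\<lambda>n. exp (- b) * En n (shift 1 x) (app (A x) u)) \<le> rl (\<lambda>n. En (Suc n) x u)"
    by (intro rl_mono bddseq_cmult En_bdd s) (use En_bdd[OF x, of u] in \<open>auto simp: bddseq_def\<close>)
  then have "exp (- b) * bn (shift 1 x) (app (A x) u) \<le> bn x u"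
    unfolding rl_En_Suc unfolding bn_def by (simp add: rl_cmult[OF En_bdd[OF s]])
  then show ?thesis by (simp add: exp_minus field_simps)
qed

lemma bn_calibrated:
  assumes x: "x \<in> spts B"
  shows "\<exists>y\<in>Wu_loc B x. bn (shift 1 y) (app (A y) (app (HU y x) u)) = exp b * bn x u"
proof -
  define I where "I = (\<lambda>y. y 1) ` Wu_loc B x"
  have "I \<subseteq> {..<nsym B}" unfolding I_def by (auto simp: Wu_loc_def spts_def)
  then have fin: "finite I" by (rule finite_subset) simp
  have ne: "I \<noteq> {}" using Wu_loc_refl[OF x] by (auto simp: I_def)
  have "\<forall>s\<in>I. \<exists>y. y \<in> Wu_loc B x \<and> y 1 = s" by (auto simp: I_def)
  \<comment> \<open>One representative for each possible next symbol; its image carries the whole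
    local unstable set that belongs to this symbol.\<close>
  then obtain Y where Y: "\<And>s. s \<in> I \<Longrightarrow> Y s \<in> Wu_loc B x" "\<And>s. s \<in> I \<Longrightarrow> Y s 1 = s" by metis
  have Ys: "shift 1 (Y s) \<in> spts B" if "s \<in> I" for s using Wu_locD(1)[OF Y(1)[OF that]] by simp
  define v where "v s = app (A (Y s)) (app (HU (Y s) x) u)" for s
  have ex: "\<exists>s\<in>I. En (Suc n) x u \<le> exp (- b) * En n (shift 1 (Y s)) (v s)" for n
  proof -
    define g where "g s = Sn n (shift 1 (Y s)) (v s)" for s
    have "Max (g ` I) \<in> g ` I" using fin ne by (intro Max_in) auto
    then obtain s0 where s0: "s0 \<in> I" "Max (g ` I) = g s0" by auto
    have "Sn (Suc n) x u \<le> g s0"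
    proof (rule Sn_le[OF x])
      fix z assume z: "z \<in> Wu_loc B x"
      then have s: "z 1 \<in> I" by (auto simp: I_def)
      have "val (Suc n) x u z = val n (shift 1 (Y (z 1))) (v (z 1)) (shift 1 z)"
        unfolding v_def by (rule val_Suc[OF x Y(1)[OF s] z]) (simp add: Y(2)[OF s])
      also have "\<dots> \<le> g (z 1)" unfolding g_def
        by (rule val_le_Sn[OF Ys[OF s]], rule Wu_loc_shift_forward[OF z Y(1)[OF s]])
          (simp add: Y(2)[OF s])
      also have "\<dots> \<le> Max (g ` I)" using fin s by (intro Max_ge) auto
      finally show "val (Suc n) x u z \<le> g s0" using s0 by simp
    qed
    then have "En (Suc n) x u \<le> exp (- b) * En n (shift 1 (Y s0)) (v s0)"
      unfolding En_Suc unfolding En_def g_def by simp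
    with s0(1) show ?thesis by blast
  qed
  have "\<exists>s\<in>I. rl (\<lambda>n. En (Suc n) x u) \<le> rl (\<lambda>n. exp (- b) * En n (shift 1 (Y s)) (v s))"
  proof (rule rl_finite_max[OF fin])
    show "bddseq (\<lambda>n. En (Suc n) x u)" using En_bdd[OF x, of u] by (auto simp: bddseq_def)
    show "bddseq (\<lambda>n. exp (- b) * En n (shift 1 (Y s)) (v s))" if "s \<in> I" for s
      by (rule bddseq_cmult[OF En_bdd[OF Ys[OF that]]])
    show "\<exists>s\<in>I. En (Suc n) x u \<le> exp (- b) * En n (shift 1 (Y s)) (v s)" for n by (rule ex)
  qed
  then obtain s where s: "s \<in> I" "rl (\<lambda>n. En (Suc n) x u) \<le> rl (\<lambda>n. exp (- b) * En n (shift 1 (Y s)) (v s))" by blast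
  have "bn x u \<le> exp (- b) * bn (shift 1 (Y s)) (v s)"
    using s(2) unfolding rl_En_Suc bn_def[of "shift 1 (Y s)"] by (simp add: rl_cmult[OF En_bdd[OF Ys[OF s(1)]]])
  then have "exp b * bn x u \<le> bn (shift 1 (Y s)) (v s)" by (simp add: exp_minus field_simps)
  moreover have "bn (shift 1 (Y s)) (v s) \<le> exp b * bn x u"
    unfolding v_def using bn_A_le[OF Wu_locD(1)[OF Y(1)[OF s(1)]]] bn_HU[OF x Y(1)[OF s(1)]] by metis
  ultimately show ?thesis using Y(1)[OF s(1)] unfolding v_def by force
qed

text \<open>Here \<open>bracket x' y\<close> follows \<open>x'\<close> in the past and \<open>y\<close> in the future, so that
  \<open>x, y, x', bracket x' y\<close> is a quadruple as in the definition of \<open>theta_u_exponent\<close>.\<close>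

definition comm_le where
  "comm_le \<eta> x x' \<longleftrightarrow> (\<forall>y\<in>Wu_loc B x. norm ((HS (bracket x' y) y o\<^sub>L HU y x)
     - (HU (bracket x' y) x' o\<^sub>L HS x' x)) \<le> \<eta>)"

text \<open>The slope of the error bound for stable holonomies with admissible constant at most 1,
  from \<open>herr_le\<close>.\<close>

definition "HE = hbd S.a S.r 1 * S.a / (1 - S.r)"

lemma HE_nn: "0 \<le> HE"
  unfolding HE_def using S.a_nn S.r_bounds by (simp add: hbd_def)

lemma HS_near_id:
  assumes "adm B 1 \<theta> F x y" "F \<le> 1"
  shows "norm (HS y x - id_blinfun) \<le> HE * F"
proof -
  have F: "0 \<le> F" using assms(1) by (simp add: adm_def)
  show ?thesis unfolding HE_def
    using S.hol_near_id[OF assms(1)] herr_le[OF S.a_nn S.r_bounds(2) F assms(2)] by linarith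
qed

definition "HEU = hbd U.a U.r 1 * U.a / (1 - U.r)"

lemma HEU_nn: "0 \<le> HEU"
  unfolding HEU_def using U.a_nn U.r_bounds by (simp add: hbd_def)

lemma HU_near_id:
  assumes "adm B (- 1) \<theta> F x y" "F \<le> 1"
  shows "norm (HU y x - id_blinfun) \<le> HEU * F"
proof -
  have F: "0 \<le> F" using assms(1) by (simp add: adm_def)
  show ?thesis unfolding HEU_def
    using U.hol_near_id[OF assms(1)] herr_le[OF U.a_nn U.r_bounds(2) F assms(2)] by linarith
qed

lemma bracket_quad:
  assumes "x \<in> spts B" "x' \<in> Ws_loc B x" "y \<in> Wu_loc B x"
  shows "bracket x' y \<in> Wu_loc B x'" "bracket x' y \<in> Ws_loc B y"
  using quadruple_bracket[OF assms] by (auto simp: quadruple_def)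

lemma sdist_bracket_quad:
  assumes "x \<in> spts B" "x' \<in> Ws_loc B x" "y \<in> Wu_loc B x"
  shows "sdist B y (bracket x' y) \<le> sdist B x x'"
proof -
  have "sdist B y (bracket x' y) \<le> exp (- rate B * real_of_int 0) * sdist B x x'"
    using Wu_locD(2)[OF assms(3)] Ws_locD(2)[OF assms(2)]
    by (intro sdist_le_transfer[OF S.rate_pos]) (auto simp: bracket_def)
  then show ?thesis by simp
qed

lemma rho_tendsto: "(\<lambda>n. exp (- rate B * \<theta>) ^ n) \<longlonglongrightarrow> 0"
  using S.rate_pos S.\<theta>_pos by (intro LIMSEQ_power_zero) simp

lemma rate_tendsto: "(\<lambda>n. exp (- rate B * real n)) \<longlonglongrightarrow> 0"
proof -
  have "(\<lambda>n. exp (- rate B) ^ n) \<longlonglongrightarrow> 0" using S.rate_pos by (intro LIMSEQ_power_zero) simp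
  then show ?thesis by (simp add: exp_of_nat_mult[symmetric] mult.commute)
qed

text \<open>Each \<open>y\<close> in the local unstable set of \<open>x\<close> is paired with
  \<open>bracket x' y\<close>, which shares its future. After \<open>n\<close> steps the base points
  have merged, so the norms there and the stable holonomy between them contribute an error that
  vanishes with \<open>n\<close>. The defect of commutation survives, but it is amplified by at most
  \<open>M n\<close>, and the normalization leaves the factor \<open>C2\<close>.\<close>

lemma bn_compare_stable:
  assumes x: "x \<in> spts B" and x': "x' \<in> Ws_loc B x" and \<eta>: "0 \<le> \<eta>" "comm_le \<eta> x x'"
  shows "bn x u \<le> bn x' (app (HS x' x) u) + N0 * C2 * \<eta> * norm u"
proof (rule le_of_eps_mult)
  show "0 \<le> 2 * (C2 * (HB * norm u))" using C2_ge1 HB_ge1 by simp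
  fix \<epsilon> :: real assume \<epsilon>: "\<epsilon> > 0"
  have xs': "x' \<in> spts B" using x' by (rule Ws_locD)
  let ?v = "app (HS x' x) u"
  obtain \<delta> where \<delta>: "\<delta> > 0" "\<And>y z v. y \<in> spts B \<Longrightarrow> z \<in> spts B \<Longrightarrow> sdist B y z < \<delta> \<Longrightarrow>
     \<bar>N y v - N z v\<bar> \<le> \<epsilon> * norm v" using N_unif[OF \<epsilon>] by blast
  have e1: "\<forall>\<^sub>F n in sequentially. exp (- rate B * real n) < \<delta>"
    using rate_tendsto \<delta>(1) by (rule order_tendstoD)
  have e2: "\<forall>\<^sub>F n in sequentially. N0 * HE * exp (- rate B * \<theta>) ^ n < \<epsilon>"
    using tendsto_mult_right_zero[OF rho_tendsto, of "N0 * HE"] \<epsilon> by (rule order_tendstoD)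
  have "\<forall>\<^sub>F n in sequentially. En n x u \<le> En n x' ?v + (N0 * C2 * \<eta> * norm u + \<epsilon> * (2 * (C2 * (HB * norm u))))"
    using e1 e2
  proof eventually_elim
    case (elim n)
    let ?err = "N0 * (M n * \<eta> * norm u) + 2 * \<epsilon> * (M n * (HB * norm u))"
    have "Sn n x u \<le> Sn n x' ?v + ?err"
    proof (rule Sn_le[OF x])
      fix y assume y: "y \<in> Wu_loc B x"
      define y' where "y' = bracket x' y"
      have y': "y' \<in> Wu_loc B x'" "y' \<in> Ws_loc B y" unfolding y'_def using bracket_quad[OF x x' y] by auto
      have ys: "y \<in> spts B" "y' \<in> spts B" using y y' by (auto dest: Wu_locD)
      let ?Ty = "shift (int n) y" and ?Ty' = "shift (int n) y'"
      have Ts: "?Ty \<in> spts B" "?Ty' \<in> spts B" using ys by auto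
      have ad: "adm B 1 \<theta> 1 y y'" by (rule adm_mono[OF adm_Ws[OF ys(1) y'(2)] powr_sdist_le_1])
      let ?V = "app (An n y) (app (HU y x) u)"
      let ?V' = "app (HS ?Ty' ?Ty) ?V"
      let ?W = "app (An n y') (app (HU y' x') ?v)"
      have nV: "norm ?V \<le> M n * (HB * norm u)" by (rule norm_An_HU_le[OF x y])
      have eq: "An n y' o\<^sub>L HS y' y = HS ?Ty' ?Ty o\<^sub>L An n y" using S.hol_equiv_n[OF ad, of n] by simp
      have V': "?V' = app (An n y') (app (HS y' y) (app (HU y x) u))"
        using compose_eqD[OF eq, of "app (HU y x) u"] by simp
      \<comment> \<open>the norms at \<open>T\<^sup>n y\<close> and \<open>T\<^sup>n y'\<close>, then the vectors, merge along the stable set\<close>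
      have "sdist B ?Ty ?Ty' \<le> exp (- rate B * real n) * sdist B y y'"
        using y'(2) by (intro sdist_shift_stable S.rate_pos) (auto simp: Ws_loc_def)
      also have "\<dots> \<le> exp (- rate B * real n) * 1" by (intro mult_left_mono sdist_le_1 S.rate_pos) auto
      finally have "sdist B ?Ty ?Ty' < \<delta>" using elim(1) by linarith
      from \<delta>(2)[OF Ts this, of ?V] have s1: "N ?Ty ?V \<le> N ?Ty' ?V + \<epsilon> * norm ?V" by linarith
      have tri: "N z v \<le> N z w + N0 * norm (v - w)" if "z \<in> spts B" for z v w
        using N_add[OF that, of w "v - w"] N_le[OF that, of "v - w"] by simp
      have s2: "N ?Ty' ?V \<le> N ?Ty' ?V' + \<epsilon> * norm ?V"
      proof -
        have ad': "adm B 1 \<theta> (exp (- rate B * \<theta>) ^ n) ?Ty ?Ty'" using adm_shift[OF ad, of n] by simp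
        have le1: "exp (- rate B * \<theta>) ^ n \<le> 1" using S.rate_pos S.\<theta>_pos by (intro power_le_one) auto
        have "?V - ?V' = - app (HS ?Ty' ?Ty - id_blinfun) ?V" by (simp add: blinfun.diff_left)
        then have "norm (?V - ?V') = norm (app (HS ?Ty' ?Ty - id_blinfun) ?V)" by (simp only: norm_minus_cancel)
        also have "\<dots> \<le> HE * exp (- rate B * \<theta>) ^ n * norm ?V"
          by (rule norm_apply_le[OF HS_near_id[OF ad' le1]])
        finally have "N0 * norm (?V - ?V') \<le> N0 * (HE * exp (- rate B * \<theta>) ^ n * norm ?V)"
          using N0_ge1 by (intro mult_left_mono) auto
        also have "\<dots> = (N0 * HE * exp (- rate B * \<theta>) ^ n) * norm ?V" by simp
        also have "\<dots> \<le> \<epsilon> * norm ?V" using elim(2) by (intro mult_right_mono) auto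
        finally show ?thesis using tri[OF Ts(2), of ?V ?V'] by linarith
      qed
      \<comment> \<open>The persistent error: the defect of commutation at time 0, carried along the
        orbit of \<open>y'\<close>.\<close>
      have s3: "N ?Ty' ?V' \<le> N ?Ty' ?W + N0 * (M n * \<eta> * norm u)"
      proof -
        let ?L = "(HS y' y o\<^sub>L HU y x) - (HU y' x' o\<^sub>L HS x' x)"
        have "?V' - ?W = app (An n y') (app ?L u)"
          unfolding V' by (simp add: blinfun.diff_left blinfun.diff_right)
        also have "norm (app (An n y') (app ?L u)) \<le> M n * (\<eta> * norm u)"
        proof -
          have "norm ?L \<le> \<eta>" using \<eta>(2) y unfolding comm_le_def y'_def by blast
          then have "norm (app ?L u) \<le> \<eta> * norm u" by (rule norm_apply_le)
          then have "M n * norm (app ?L u) \<le> M n * (\<eta> * norm u)" using M_pos[of n] by (intro mult_left_mono) auto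
          then show ?thesis using norm_apply_le[OF le_M[OF ys(2), of n], of "app ?L u"] by linarith
        qed
        finally have "N0 * norm (?V' - ?W) \<le> N0 * (M n * (\<eta> * norm u))"
          using N0_ge1 by (intro mult_left_mono) auto
        then show ?thesis using tri[OF Ts(2), of ?V' ?W] by (simp add: mult.assoc)
      qed
      have s4: "N ?Ty' ?W \<le> Sn n x' ?v"
        using val_le_Sn[OF xs' y'(1), of n ?v] unfolding val_def .
      have "\<epsilon> * norm ?V \<le> \<epsilon> * (M n * (HB * norm u))" using \<epsilon> by (intro mult_left_mono nV) auto
      with s1 s2 s3 s4 show "val n x u y \<le> Sn n x' ?v + ?err" unfolding val_def by linarith
    qed
    then have "En n x u \<le> exp (- b * real n) * (Sn n x' ?v + ?err)" unfolding En_def by simp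
    also have "\<dots> = En n x' ?v + (exp (- b * real n) * M n) * (N0 * \<eta> * norm u + 2 * \<epsilon> * (HB * norm u))"
      unfolding En_def by (simp add: algebra_simps)
    also have "\<dots> \<le> En n x' ?v + C2 * (N0 * \<eta> * norm u + 2 * \<epsilon> * (HB * norm u))"
      using N0_ge1 \<eta>(1) \<epsilon> HB_ge1 by (intro add_left_mono mult_right_mono exp_M) auto
    finally show ?case by (simp add: algebra_simps)
  qed
  from rl_mono_ev[OF En_bdd[OF x] En_bdd[OF xs'] this]
  show "bn x u \<le> bn x' ?v + N0 * C2 * \<eta> * norm u + \<epsilon> * (2 * (C2 * (HB * norm u)))"
    unfolding bn_def by linarith
qed

definition "C7 = N0 * C2 * HB + Cu * (HE * HB + HEU)"

lemma C7_nn: "0 \<le> C7"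
  unfolding C7_def using N0_ge1 C2_ge1 HB_ge1 Cu_ge1 HE_nn HEU_nn by simp

text \<open>The path leads from \<open>x\<close> to the bracket along an unstable set, which leaves
  \<open>bn\<close> unchanged, and on to \<open>x'\<close> along a stable set, where
  \<open>bn_compare_stable\<close> applies. The vector arrives displaced by two holonomies close to
  the identity, which costs a multiple of the distance to the power \<open>\<theta>\<close>.\<close>

lemma bn_compare:
  assumes x: "x \<in> spts B" "x' \<in> spts B" "x 0 = x' 0" and \<eta>: "0 \<le> \<eta>" "comm_le \<eta> (bracket x x') x'"
  shows "bn x u \<le> bn x' u + C7 * (\<eta> + sdist B x x' powr \<theta>) * norm u"
proof -
  define z where "z = bracket x x'"
  have z: "z \<in> Wu_loc B x" "z \<in> Ws_loc B x'" unfolding z_def by (rule bracket_local[OF x])+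
  have zs: "z \<in> spts B" using z by (auto dest: Wu_locD)
  have x'z: "x' \<in> Ws_loc B z" using z(2) x(2) by (auto simp: Ws_loc_def)
  let ?d = "sdist B x x' powr \<theta>"
  have d1: "sdist B x z powr \<theta> \<le> ?d" "sdist B z x' powr \<theta> \<le> ?d"
    unfolding z_def using sdist_bracket_le[OF S.rate_pos x] S.\<theta>_pos by (auto intro!: powr_mono2)
  have "norm (HU z x - id_blinfun) \<le> HEU * sdist B x z powr \<theta>"
    by (rule HU_near_id[OF adm_Wu[OF x(1) z(1)] powr_sdist_le_1])
  also have "\<dots> \<le> HEU * ?d" by (rule mult_left_mono[OF d1(1) HEU_nn])
  finally have h1: "norm (app (HU z x - id_blinfun) u) \<le> HEU * ?d * norm u" by (rule norm_apply_le)
  let ?w = "app (HU z x) u"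
  have nw: "norm ?w \<le> HB * norm u" by (rule norm_apply_le[OF HU_bound[OF x(1) z(1)]])
  have "norm (HS x' z - id_blinfun) \<le> HE * sdist B z x' powr \<theta>"
    by (rule HS_near_id[OF adm_Ws[OF zs x'z] powr_sdist_le_1])
  also have "\<dots> \<le> HE * ?d" by (rule mult_left_mono[OF d1(2) HE_nn])
  finally have "norm (app (HS x' z - id_blinfun) ?w) \<le> HE * ?d * norm ?w" by (rule norm_apply_le)
  also have "\<dots> \<le> HE * ?d * (HB * norm u)" using HE_nn by (intro mult_left_mono nw) auto
  finally have h2: "norm (app (HS x' z - id_blinfun) ?w) \<le> HE * ?d * (HB * norm u)" .
  have "app (HS x' z) ?w - u = app (HS x' z - id_blinfun) ?w + app (HU z x - id_blinfun) u"
    by (simp add: blinfun.diff_left)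
  then have "norm (app (HS x' z) ?w - u) \<le> norm (app (HS x' z - id_blinfun) ?w) + norm (app (HU z x - id_blinfun) u)"
    by (simp only: norm_triangle_ineq)
  also have "\<dots> \<le> (HE * HB + HEU) * ?d * norm u" using h1 h2 by (simp add: algebra_simps)
  finally have "Cu * norm (app (HS x' z) ?w - u) \<le> Cu * ((HE * HB + HEU) * ?d * norm u)"
    using Cu_ge1 by (intro mult_left_mono) auto
  with bn_diff_le[OF x(2), of "app (HS x' z) ?w" u]
  have a: "bn x' (app (HS x' z) ?w) \<le> bn x' u + Cu * (HE * HB + HEU) * ?d * norm u" by (simp add: mult.assoc)
  have "bn x u = bn z ?w" by (rule bn_HU[OF x(1) z(1), symmetric])
  also have "\<dots> \<le> bn x' (app (HS x' z) ?w) + N0 * C2 * \<eta> * norm ?w"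
    using \<eta> unfolding z_def[symmetric] by (rule bn_compare_stable[OF zs x'z])
  also have "N0 * C2 * \<eta> * norm ?w \<le> N0 * C2 * \<eta> * (HB * norm u)"
    using N0_ge1 C2_ge1 \<eta>(1) by (intro mult_left_mono nw) auto
  finally have "bn x u \<le> bn x' u + (Cu * (HE * HB + HEU) * ?d + N0 * C2 * HB * \<eta>) * norm u"
    using a by (simp add: algebra_simps)
  also have "(Cu * (HE * HB + HEU) * ?d + N0 * C2 * HB * \<eta>) * norm u \<le> C7 * (\<eta> + ?d) * norm u"
  proof (rule mult_right_mono)
    have "0 \<le> N0 * C2 * HB * ?d" "0 \<le> Cu * (HE * HB + HEU) * \<eta>"
      using N0_ge1 C2_ge1 HB_ge1 Cu_ge1 HE_nn HEU_nn \<eta>(1) by simp_all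
    then show "Cu * (HE * HB + HEU) * ?d + N0 * C2 * HB * \<eta> \<le> C7 * (\<eta> + ?d)"
      unfolding C7_def by (simp add: algebra_simps)
  qed simp
  finally show ?thesis by simp
qed

text \<open>Stable holonomies over short distances are close to the identity and unstable ones are
  uniformly continuous, so both sides of the quadruple differ little. No exponent is obtained;
  continuity of the norm needs none.\<close>

lemma comm_small:
  assumes \<epsilon>: "\<epsilon> > 0"
  shows "\<exists>\<delta>>0. \<forall>x\<in>spts B. \<forall>x'\<in>Ws_loc B x. sdist B x x' < \<delta> \<longrightarrow> comm_le \<epsilon> x x'"
proof -
  obtain \<delta>1 where \<delta>1: "\<delta>1 > 0" "\<And>x y x' y'. adm B (- 1) \<theta> 1 x y \<Longrightarrow> adm B (- 1) \<theta> 1 x' y' \<Longrightarrow>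
    sdist B x x' < \<delta>1 \<Longrightarrow> sdist B y y' < \<delta>1 \<Longrightarrow> norm (HU y x - HU y' x') < \<epsilon> / 2"
    using U.hol_uniform[of "\<epsilon> / 2" 1] \<epsilon> by auto
  \<comment> \<open>The two stable holonomies, each composed with an unstable one, have total weight
    \<open>Z - 1\<close>; they are given one half of \<open>\<epsilon>\<close>, the unstable
    difference the other half.\<close>
  define Z where "Z = 2 * HE * HB + 1"
  have Z: "Z > 0" unfolding Z_def using HE_nn HB_ge1 by (intro add_nonneg_pos) auto
  define \<delta>2 where "\<delta>2 = (\<epsilon> / (2 * Z)) powr (1 / \<theta>)"
  have \<delta>2: "\<delta>2 > 0" unfolding \<delta>2_def using \<epsilon> Z by simp
  show ?thesis
  proof (intro exI[of _ "min \<delta>1 \<delta>2"] conjI ballI impI)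
    show "0 < min \<delta>1 \<delta>2" using \<delta>1 \<delta>2 by simp
    fix x x' assume x: "x \<in> spts B" and x': "x' \<in> Ws_loc B x" and d: "sdist B x x' < min \<delta>1 \<delta>2"
    have xs': "x' \<in> spts B" using x' by (rule Ws_locD)
    have pw: "t powr \<theta> \<le> \<epsilon> / (2 * Z)" if "0 \<le> t" "t \<le> sdist B x x'" for t
    proof -
      have "t powr \<theta> \<le> \<delta>2 powr \<theta>" using that d S.\<theta>_pos by (intro powr_mono2) auto
      also have "\<delta>2 powr \<theta> = \<epsilon> / (2 * Z)" unfolding \<delta>2_def using \<epsilon> Z S.\<theta>_pos by (simp add: powr_powr)
      finally show ?thesis .
    qed
    show "comm_le \<epsilon> x x'"
      unfolding comm_le_def
    proof
      fix y assume y: "y \<in> Wu_loc B x"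
      define y' where "y' = bracket x' y"
      have y': "y' \<in> Wu_loc B x'" "y' \<in> Ws_loc B y" unfolding y'_def using bracket_quad[OF x x' y] by auto
      have ys: "y \<in> spts B" "y' \<in> spts B" using y y' by (auto dest: Wu_locD)
      have dy: "sdist B y y' \<le> sdist B x x'" unfolding y'_def by (rule sdist_bracket_quad[OF x x' y])
      have n1: "norm (HS y' y - id_blinfun) \<le> HE * (\<epsilon> / (2 * Z))"
        using HS_near_id[OF adm_Ws[OF ys(1) y'(2)] powr_sdist_le_1] mult_left_mono[OF pw[OF _ dy] HE_nn] by force
      have n2: "norm (HS x' x - id_blinfun) \<le> HE * (\<epsilon> / (2 * Z))"
        using HS_near_id[OF adm_Ws[OF x x'] powr_sdist_le_1] mult_left_mono[OF pw[of "sdist B x x'"] HE_nn] by force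
      have n3: "norm (HU y x - HU y' x') \<le> \<epsilon> / 2"
        using \<delta>1(2)[OF adm_Wu1[OF x y] adm_Wu1[OF xs' y'(1)]] d dy by linarith
      have "(HS y' y o\<^sub>L HU y x) - (HU y' x' o\<^sub>L HS x' x)
         = ((HS y' y - id_blinfun) o\<^sub>L HU y x) + (HU y x - HU y' x') - (HU y' x' o\<^sub>L (HS x' x - id_blinfun))"
        by (simp add: compose_diff_left compose_diff_right)
      then have "norm ((HS y' y o\<^sub>L HU y x) - (HU y' x' o\<^sub>L HS x' x))
        \<le> norm ((HS y' y - id_blinfun) o\<^sub>L HU y x) + norm (HU y x - HU y' x') + norm (HU y' x' o\<^sub>L (HS x' x - id_blinfun))"
        using norm_triangle_ineq4 norm_triangle_ineq by (smt (verit))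
      also have "\<dots> \<le> (HE * (\<epsilon> / (2 * Z))) * HB + \<epsilon> / 2 + HB * (HE * (\<epsilon> / (2 * Z)))"
        by (intro add_mono norm_compose_le n1 n2 n3 HU_bound x y xs' y'(1))
      also have "\<dots> = (Z - 1) * (\<epsilon> / (2 * Z)) + \<epsilon> / 2" by (simp add: Z_def)
      also have "\<dots> \<le> Z * (\<epsilon> / (2 * Z)) + \<epsilon> / 2"
        using \<epsilon> Z by (intro add_right_mono mult_right_mono) auto
      also have "\<dots> = \<epsilon>" using Z by simp
      finally show "norm ((HS (bracket x' y) y o\<^sub>L HU y x) - (HU (bracket x' y) x' o\<^sub>L HS x' x)) \<le> \<epsilon>"
        by (simp only: y'_def)
    qed
  qed
qed

text \<open>A distance below 1 forces equal symbols at 0, so that the bracket exists; this is the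
  reason for the bound 1 in the choice of \<open>\<delta>\<close>. The rest is
  \<open>bn_compare\<close> in both directions.\<close>

lemma bn_uniform:
  assumes \<epsilon>: "\<epsilon> > 0"
  shows "\<exists>\<delta>>0. \<forall>x\<in>spts B. \<forall>x'\<in>spts B. sdist B x x' < \<delta> \<longrightarrow> (\<forall>u. \<bar>bn x u - bn x' u\<bar> \<le> \<epsilon> * norm u)"
proof -
  define Z where "Z = 2 * (C7 + 1)"
  have Z: "Z > 0" using C7_nn by (simp add: Z_def)
  obtain \<delta>1 where \<delta>1: "\<delta>1 > 0" "\<And>x x'. x \<in> spts B \<Longrightarrow> x' \<in> Ws_loc B x \<Longrightarrow> sdist B x x' < \<delta>1 \<Longrightarrow> comm_le (\<epsilon> / Z) x x'"
    using comm_small[of "\<epsilon> / Z"] \<epsilon> Z by auto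
  define \<delta>2 where "\<delta>2 = (\<epsilon> / Z) powr (1 / \<theta>)"
  have \<delta>2: "\<delta>2 > 0" unfolding \<delta>2_def using \<epsilon> Z by simp
  have one: "bn x u \<le> bn x' u + \<epsilon> * norm u"
    if x: "x \<in> spts B" "x' \<in> spts B" and d: "sdist B x x' < min 1 (min \<delta>1 \<delta>2)" for x x' u
  proof -
    have x0: "x 0 = x' 0" using d sdist_eq_1_imp[OF S.rate_pos, of x x'] by auto
    have z: "bracket x x' \<in> Ws_loc B x'" "bracket x x' \<in> spts B"
      using bracket_local[OF x x0] by (auto dest: Ws_locD)
    have "x' \<in> Ws_loc B (bracket x x')" using z x(2) by (auto simp: Ws_loc_def)
    moreover have "sdist B (bracket x x') x' < \<delta>1" using sdist_bracket_le(2)[OF S.rate_pos x x0] d by linarith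
    ultimately have "comm_le (\<epsilon> / Z) (bracket x x') x'" by (intro \<delta>1(2) z)
    from bn_compare[OF x x0 _ this, of u]
    have "bn x u \<le> bn x' u + C7 * (\<epsilon> / Z + sdist B x x' powr \<theta>) * norm u" using \<epsilon> Z by simp
    also have "sdist B x x' powr \<theta> \<le> \<delta>2 powr \<theta>" using d S.\<theta>_pos by (intro powr_mono2) auto
    also have "\<delta>2 powr \<theta> = \<epsilon> / Z" unfolding \<delta>2_def using \<epsilon> Z S.\<theta>_pos by (simp add: powr_powr)
    finally have "bn x u \<le> bn x' u + C7 * (\<epsilon> / Z + \<epsilon> / Z) * norm u"
      using C7_nn by (simp add: mult_left_mono mult_right_mono)
    also have "C7 * (\<epsilon> / Z + \<epsilon> / Z) = \<epsilon> * (2 * C7 / Z)" using Z by (simp add: field_simps)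
    also have "\<epsilon> * (2 * C7 / Z) * norm u \<le> \<epsilon> * 1 * norm u"
      using \<epsilon> C7_nn by (intro mult_right_mono mult_left_mono) (auto simp: Z_def)
    finally show ?thesis by simp
  qed
  have "\<bar>bn x u - bn x' u\<bar> \<le> \<epsilon> * norm u"
    if "x \<in> spts B" "x' \<in> spts B" "sdist B x x' < min 1 (min \<delta>1 \<delta>2)" for x x' u
  proof -
    have "sdist B x' x < min 1 (min \<delta>1 \<delta>2)" using that(3) by (simp add: sdist_sym)
    from one[OF that, of u] one[OF that(2,1) this, of u] show ?thesis
      by (simp only: abs_le_iff) linarith
  qed
  then show ?thesis using \<delta>1 \<delta>2 by (intro exI[of _ "min 1 (min \<delta>1 \<delta>2)"]) auto
qed

section \<open>Orbits of maximal growth\<close>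

lemma calibrated_orbit:
  assumes x: "x \<in> spts B"
  shows "\<exists>y\<in>Wu_loc B x. \<forall>j\<le>k. bn (shift (int j) y) (app (An j y) (app (HU y x) u)) = exp (b * real j) * bn x u"
  using x
proof (induction k arbitrary: x u)
  case 0
  then show ?case using Wu_loc_refl[of x B] U.hol_self[of x] by (intro bexI[of _ x]) auto
next
  case (Suc k)
  from bn_calibrated[OF Suc.prems, of u] obtain y1 where
    y1: "y1 \<in> Wu_loc B x" "bn (shift 1 y1) (app (A y1) (app (HU y1 x) u)) = exp b * bn x u" by blast
  let ?x1 = "shift 1 y1" and ?u1 = "app (A y1) (app (HU y1 x) u)"
  have x1: "?x1 \<in> spts B" using Wu_locD(1)[OF y1(1)] by simp
  from Suc.IH[OF x1, of ?u1] obtain y' where y': "y' \<in> Wu_loc B ?x1"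
    "\<And>j. j \<le> k \<Longrightarrow> bn (shift (int j) y') (app (An j y') (app (HU y' ?x1) ?u1)) = exp (b * real j) * bn ?x1 ?u1" by blast
  \<comment> \<open>Later calibrations replace the orbit point by another one, but the pullback
    stays in the local unstable set of \<open>y1\<close>. Invariance of the norm then keeps the
    values obtained before.\<close>
  define y where "y = shift (- 1) y'"
  have yy1: "y \<in> Wu_loc B y1" using Wu_loc_shift_back[of y' B 1 y1] y'(1) by (simp add: y_def)
  then have y: "y \<in> Wu_loc B x" using Wu_loc_eq[OF y1(1)] by simp
  have sy: "shift 1 y = y'" by (simp add: y_def)
  have f: "HU y' ?x1 o\<^sub>L A y1 = A y o\<^sub>L HU y y1"
    using HU_forward[OF adm_Wu1[OF Wu_locD(1)[OF y1(1)] yy1]] sy by simp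
  have t: "app (HU y y1) (app (HU y1 x) u) = app (HU y x) u"
    by (rule compose_eq1[OF HU_trans[OF Suc.prems y1(1) y]])
  have e: "app (HU y' ?x1) ?u1 = app (A y) (app (HU y x) u)"
    using compose_eqD[OF f, of "app (HU y1 x) u"] t by simp
  have "bn (shift (int j) y) (app (An j y) (app (HU y x) u)) = exp (b * real j) * bn x u" if "j \<le> Suc k" for j
  proof (cases j)
    case 0
    then show ?thesis using bn_HU[OF Suc.prems y] by simp
  next
    case (Suc i)
    have "bn (shift (int i) y') (app (An i y') (app (HU y' ?x1) ?u1)) = exp (b * real i) * bn ?x1 ?u1"
      using that Suc by (intro y'(2)) simp
    then have "bn (shift (int j) y) (app (An j y) (app (HU y x) u)) = exp (b * real i) * (exp b * bn x u)"
      unfolding Suc cpr_Suc2 e using y1(2) by (simp add: sy[symmetric] add.commute)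
    also have "\<dots> = exp (b * real j) * bn x u" by (simp add: Suc algebra_simps exp_add)
    finally show ?thesis .
  qed
  with y show ?case by blast
qed

text \<open>Along a calibrated orbit segment the norm \<open>bn\<close> of the vector grows exactly
  by \<open>exp b\<close> at each step, so every window inside the segment has an operator norm of
  at least \<open>exp (b * real n)\<close> up to the two comparison constants with the Euclidean
  norm. Compactness yields one point for windows of every length and every forward starting
  time.\<close>

lemma maximizing_orbit:
  "\<exists>y\<in>spts B. \<forall>j n. exp (b * real n) \<le> N0 * Ck * Cu * norm (An n (shift (int j) y))"
proof -
  obtain x where x: "x \<in> spts B" using nonempty by blast
  obtain u :: "real ^ 'd" where u: "norm u = 1" using norm_Basis nonempty_Basis by (metis ex_in_conv)
  have "\<exists>y\<in>spts B. \<forall>j n. j + n \<le> k \<longrightarrow> exp (b * real n) \<le> N0 * Ck * Cu * norm (An n (shift (int j) y))" for k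
  proof -
    from calibrated_orbit[OF x, of k u] obtain y where y: "y \<in> Wu_loc B x"
      "\<And>j. j \<le> k \<Longrightarrow> bn (shift (int j) y) (app (An j y) (app (HU y x) u)) = exp (b * real j) * bn x u" by blast
    have ys: "y \<in> spts B" using y(1) by (rule Wu_locD)
    have "exp (b * real n) \<le> N0 * Ck * Cu * norm (An n (shift (int j) y))" if jn: "j + n \<le> k" for j n
    proof -
      let ?v = "app (An j y) (app (HU y x) u)" and ?y = "shift (int j) y"
      have bx: "0 < bn x u"
      proof -
        have "1 \<le> N0 * Ck * bn x u" using bn_ge[OF x, of u] u by simp
        then show ?thesis using bn_nn[OF x, of u] by (cases "bn x u = 0") auto
      qed
      have 1: "bn ?y ?v = exp (b * real j) * bn x u" using jn by (intro y(2)) simp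
      have "bn (shift (int (n + j)) y) (app (An (n + j) y) (app (HU y x) u)) = exp (b * real (n + j)) * bn x u"
        using jn by (intro y(2)) simp
      then have 2: "bn (shift (int n) ?y) (app (An n ?y) ?v) = exp (b * real n) * bn ?y ?v"
        unfolding 1 cpr_add by (simp add: algebra_simps exp_add)
      have v0: "0 < norm ?v"
      proof -
        have "?v \<noteq> 0"
        proof
          assume "?v = 0"
          then have "bn ?y ?v \<le> 0" using bn_le[of ?y ?v] ys by simp
          then show False using 1 bx by (simp add: mult_le_0_iff)
        qed
        then show ?thesis by simp
      qed
      have "norm ?v \<le> N0 * Ck * bn ?y ?v" using ys by (intro bn_ge) simp
      then have "exp (b * real n) * norm ?v \<le> exp (b * real n) * (N0 * Ck * bn ?y ?v)" by (intro mult_left_mono) auto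
      also have "\<dots> = N0 * Ck * bn (shift (int n) ?y) (app (An n ?y) ?v)" unfolding 2 by simp
      also have "\<dots> \<le> N0 * Ck * (Cu * norm (app (An n ?y) ?v))"
        using ys N0_ge1 Ck_ge1 by (intro mult_left_mono bn_le) auto
      also have "\<dots> \<le> N0 * Ck * (Cu * (norm (An n ?y) * norm ?v))"
        using N0_ge1 Ck_ge1 Cu_ge1 by (intro mult_left_mono norm_blinfun) auto
      finally have "exp (b * real n) * norm ?v \<le> (N0 * Ck * Cu * norm (An n ?y)) * norm ?v" by (simp add: mult.assoc)
      then show ?thesis using v0 by (rule mult_right_le_imp_le)
    qed
    with ys show ?thesis by blast
  qed
  then obtain Y where Y: "\<And>k. Y k \<in> spts B"
    "\<And>k j n. j + n \<le> k \<Longrightarrow> exp (b * real n) \<le> N0 * Ck * Cu * norm (An n (shift (int j) (Y k)))" by metis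
  \<comment> \<open>For fixed \<open>j\<close> and \<open>n\<close> the bound is a closed condition
    that holds along all but finitely many members of the sequence.\<close>
  obtain y f where y: "y \<in> spts B" "strict_mono f" "(Y \<circ> f) \<longlonglongrightarrow> y"
    using compact_imp_seq_compact[OF compact_spts, of B] Y(1) unfolding seq_compact_def by meson
  have "exp (b * real n) \<le> N0 * Ck * Cu * norm (An n (shift (int j) y))" for j n
  proof (rule tendsto_lowerbound)
    have "(\<lambda>k. shift (int j) ((Y \<circ> f) k)) \<longlonglongrightarrow> shift (int j) y" by (rule tendsto_shift[OF y(3)])
    then have "(\<lambda>k. An n (shift (int j) ((Y \<circ> f) k))) \<longlonglongrightarrow> An n (shift (int j) y)"
      by (rule continuous_on_tendsto_compose[OF S.cpr_continuous]) (use y(1) Y(1) in auto)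
    then show "(\<lambda>k. N0 * Ck * Cu * norm (An n (shift (int j) ((Y \<circ> f) k)))) \<longlonglongrightarrow> N0 * Ck * Cu * norm (An n (shift (int j) y))"
      by (intro tendsto_mult tendsto_const tendsto_norm)
    show "\<forall>\<^sub>F k in sequentially. exp (b * real n) \<le> N0 * Ck * Cu * norm (An n (shift (int j) ((Y \<circ> f) k)))"
      unfolding eventually_sequentially
      by (rule exI[of _ "j + n"]) (auto intro!: Y(2) order_trans[OF _ strict_mono_imp_increasing[OF y(2)]])
  qed simp
  with y(1) show ?thesis by blast
qed

end

section \<open>Uniformity of spannability\<close>

lemma span_data_scale:
  fixes A Ai :: "biseq \<Rightarrow> 'a::finite mat"
  assumes "span_data B A Ai m D x y w p k"
  shows "span_data B A Ai m D x y (c *\<^sub>R w) p k"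
proof -
  have "norm L * norm (c *\<^sub>R w) \<le> D * (\<Sum>i<CARD('a). norm (blinfun_apply L
        (blinfun_apply (hol 1 A Ai y (shift (int (k i)) (p i)))
          (blinfun_apply (cpr 1 A (k i) (p i))
            (blinfun_apply (hol (- 1) (\<lambda>x. Ai (shift (- 1) x)) (\<lambda>x. A (shift (- 1) x)) (p i) x) (c *\<^sub>R w))))))"
    (is "_ \<le> D * ?R") for L :: "'a mat"
  proof -
    have "norm L * norm w \<le> D * (\<Sum>i<CARD('a). norm (blinfun_apply L
        (blinfun_apply (hol 1 A Ai y (shift (int (k i)) (p i)))
          (blinfun_apply (cpr 1 A (k i) (p i))
            (blinfun_apply (hol (- 1) (\<lambda>x. Ai (shift (- 1) x)) (\<lambda>x. A (shift (- 1) x)) (p i) x) w)))))"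
      (is "_ \<le> D * ?R'")
      using assms unfolding span_data_def by (elim conjE) (erule spec)
    then have "\<bar>c\<bar> * (norm L * norm w) \<le> \<bar>c\<bar> * (D * ?R')" by (rule mult_left_mono) simp
    moreover have "?R = \<bar>c\<bar> * ?R'" by (simp add: blinfun.scaleR_right sum_distrib_left)
    ultimately show ?thesis by (simp add: mult_ac)
  qed
  then show ?thesis using assms unfolding span_data_def by simp
qed

text \<open>Carries a connecting orbit over to nearby endpoints without enlarging its window:
  whatever \<open>x\<close> and \<open>y\<close> do outside, they are followed exactly
  there.\<close>

definition splice :: "nat \<Rightarrow> nat \<Rightarrow> biseq \<Rightarrow> biseq \<Rightarrow> biseq \<Rightarrow> biseq" where
  "splice m k x p y = (\<lambda>n. if n \<le> - int m then x n else if n \<ge> int m + int k then y (n - int k) else p n)"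

lemma splice_in_spts:
  assumes "x \<in> spts B" "y \<in> spts B" "p \<in> spts B" "m \<ge> 1"
    "x (- int m) = p (- int m)" "y (int m) = p (int m + int k)"
  shows "splice m k x p y \<in> spts B"
proof -
  let ?z = "splice m k x p y"
  have "?z n < nsym B" for n
    using assms(1-3) by (simp add: splice_def sptsD)
  moreover have "allowed B (?z n) (?z (n + 1))" for n
  proof -
    consider "n + 1 \<le> - int m" | "n = - int m" | "- int m < n" "n < int m + int k - 1"
      | "n = int m + int k - 1" | "int m + int k \<le> n" by linarith
    then show ?thesis
    proof cases
      case 1
      then show ?thesis using sptsD(2)[OF assms(1), of n] by (simp add: splice_def)
    next
      case 2
      then show ?thesis using sptsD(2)[OF assms(3), of n] assms(4,5) by (simp add: splice_def)
    next
      case 3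
      then show ?thesis using sptsD(2)[OF assms(3), of n] by (simp add: splice_def)
    next
      case 4
      then show ?thesis using sptsD(2)[OF assms(3), of n] assms(4,6) by (simp add: splice_def)
    next
      case 5
      have e: "n + 1 - int k = n - int k + 1" by simp
      have "allowed B (y (n - int k)) (y (n + 1 - int k))" unfolding e by (rule sptsD(2)[OF assms(2)])
      then show ?thesis using 5 assms(4) by (simp add: splice_def)
    qed
  qed
  ultimately show ?thesis by (simp add: spts_def)
qed

lemma tendsto_splice:
  assumes "X \<longlonglongrightarrow> x" "Y \<longlonglongrightarrow> y" "\<forall>n\<le>- int m. p n = x n" "\<forall>n\<ge>int m. shift (int k) p n = y n"
  shows "(\<lambda>i. splice m k (X i) p (Y i)) \<longlonglongrightarrow> p"
  unfolding tendsto_biseq_iff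
proof
  fix n
  have "\<forall>\<^sub>F i in sequentially. X i n = x n" "\<forall>\<^sub>F i in sequentially. Y i (n - int k) = y (n - int k)"
    using assms(1,2) by (auto simp: tendsto_biseq_iff)
  then show "\<forall>\<^sub>F i in sequentially. splice m k (X i) p (Y i) n = p n"
  proof eventually_elim
    case (elim i)
    have "p n = y (n - int k)" if "int m + int k \<le> n"
      using assms(4)[rule_format, of "n - int k"] that by (simp add: shift_def)
    then show ?case using elim assms(3) by (simp add: splice_def)
  qed
qed

lemma tendsto_of_uniform:
  fixes C :: "biseq \<Rightarrow> 'd::finite mat"
  assumes "continuous_on S C" "\<And>k z. z \<in> S \<Longrightarrow> norm (Ck k z - C z) \<le> \<delta> k" "\<delta> \<longlonglongrightarrow> 0"
    "zk \<longlonglongrightarrow> z" "z \<in> S" "\<And>k. zk k \<in> S"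
  shows "(\<lambda>k. Ck k (zk k)) \<longlonglongrightarrow> C z"
proof -
  have b: "norm (Ck k (zk k) - C (zk k)) \<le> \<delta> k" for k by (rule assms(2)[OF assms(6)])
  have 1: "(\<lambda>k. Ck k (zk k) - C (zk k)) \<longlonglongrightarrow> 0"
    by (rule Lim_null_comparison[OF always_eventually[OF allI[OF b]] assms(3)])
  have 2: "(\<lambda>k. C (zk k)) \<longlonglongrightarrow> C z"
    by (rule continuous_on_tendsto_compose[OF assms(1,4,5)]) (use assms(6) in simp)
  from tendsto_add[OF 1 2] show ?thesis by simp
qed

lemma spanning_bound:
  fixes v :: "nat \<Rightarrow> real ^ 'd::finite"
  assumes "\<And>w. \<exists>c. w = (\<Sum>i<n. c i *\<^sub>R v i)"
  shows "\<exists>D>0. \<forall>L::'d mat. norm L \<le> D * (\<Sum>i<n. norm (blinfun_apply L (v i)))"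
proof -
  from assms have "\<forall>w. \<exists>c. w = (\<Sum>i<n. c i *\<^sub>R v i)" by blast
  then obtain c where c: "\<And>w. w = (\<Sum>i<n. c w i *\<^sub>R v i)" by metis
  define D where "D = (\<Sum>e\<in>(Basis :: (real ^ 'd) set). \<Sum>i<n. \<bar>c e i\<bar>) + 1"
  have D0: "0 \<le> (\<Sum>e\<in>(Basis :: (real ^ 'd) set). \<Sum>i<n. \<bar>c e i\<bar>)" by (intro sum_nonneg) auto
  have "norm L \<le> D * (\<Sum>i<n. norm (blinfun_apply L (v i)))" for L :: "'d mat"
  proof -
    let ?S = "\<Sum>i<n. norm (blinfun_apply L (v i))"
    have S0: "0 \<le> ?S" by (intro sum_nonneg) auto
    have e: "norm (blinfun_apply L e) \<le> (\<Sum>i<n. \<bar>c e i\<bar>) * ?S" for e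
    proof -
      have "blinfun_apply L e = (\<Sum>i<n. c e i *\<^sub>R blinfun_apply L (v i))"
        by (subst c[of e]) (simp add: blinfun.sum_right blinfun.scaleR_right)
      then have "norm (blinfun_apply L e) \<le> (\<Sum>i<n. norm (c e i *\<^sub>R blinfun_apply L (v i)))"
        by (simp only: norm_sum)
      also have "\<dots> \<le> (\<Sum>i<n. \<bar>c e i\<bar> * ?S)"
      proof (rule sum_mono)
        fix i assume "i \<in> {..<n}"
        then have "norm (blinfun_apply L (v i)) \<le> ?S" by (intro member_le_sum) auto
        then show "norm (c e i *\<^sub>R blinfun_apply L (v i)) \<le> \<bar>c e i\<bar> * ?S" by (simp add: mult_left_mono)
      qed
      finally show ?thesis by (simp add: sum_distrib_right)
    qed
    have "norm L \<le> (\<Sum>e\<in>Basis. norm (blinfun_apply L e))" by (rule norm_blinfun_euclidean_le)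
    also have "\<dots> \<le> (\<Sum>e\<in>Basis. (\<Sum>i<n. \<bar>c e i\<bar>) * ?S)" by (intro sum_mono e)
    also have "\<dots> = (D - 1) * ?S" by (simp add: D_def sum_distrib_right)
    also have "\<dots> \<le> D * ?S" using S0 by (intro mult_right_mono) auto
    finally show ?thesis .
  qed
  moreover have "D > 0" using D0 by (simp add: D_def)
  ultimately show ?thesis by blast
qed

text \<open>The error of replacing \<open>v\<close> by \<open>v'\<close> is at most half of
  \<open>norm L\<close> and is absorbed on the left, which doubles the constant.\<close>

lemma perturbed_spanning:
  fixes v v' :: "nat \<Rightarrow> real ^ 'd::finite" and L :: "'d mat"
  assumes "norm L \<le> D * (\<Sum>i<n. norm (blinfun_apply L (v i)))" "D > 0"
    "(\<Sum>i<n. norm (v i - v' i)) \<le> 1 / (2 * D)"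
  shows "norm L \<le> 2 * D * (\<Sum>i<n. norm (blinfun_apply L (v' i)))"
proof -
  have "norm (blinfun_apply L (v i)) \<le> norm (blinfun_apply L (v' i)) + norm L * norm (v i - v' i)" for i
    using norm_triangle_sub[of "blinfun_apply L (v i)" "blinfun_apply L (v' i)"] norm_blinfun[of L "v i - v' i"]
    by (simp add: blinfun.diff_right)
  then have "(\<Sum>i<n. norm (blinfun_apply L (v i))) \<le> (\<Sum>i<n. norm (blinfun_apply L (v' i)) + norm L * norm (v i - v' i))"
    by (intro sum_mono)
  also have "\<dots> = (\<Sum>i<n. norm (blinfun_apply L (v' i))) + norm L * (\<Sum>i<n. norm (v i - v' i))"
    by (simp add: sum.distrib sum_distrib_left)
  also have "norm L * (\<Sum>i<n. norm (v i - v' i)) \<le> norm L * (1 / (2 * D))"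
    by (intro mult_left_mono assms) auto
  finally have "D * (\<Sum>i<n. norm (blinfun_apply L (v i))) \<le> D * ((\<Sum>i<n. norm (blinfun_apply L (v' i))) + norm L * (1 / (2 * D)))"
    using assms(2) by (intro mult_left_mono) auto
  then have "norm L \<le> D * (\<Sum>i<n. norm (blinfun_apply L (v' i))) + norm L / 2"
    using assms(1,2) by (simp add: distrib_left)
  then show ?thesis by simp
qed

context cocyc
begin

abbreviation "appm f x \<equiv> blinfun_apply f x"

text \<open>Counterexamples with ever larger window and constant and ever closer to \<open>A\<close>
  would accumulate at endpoints \<open>x\<close>, \<open>y\<close> and a unit vector. The connecting
  points for these limits, spliced to the actual endpoints, yield vectors which converge to a basis,
  and this quantitative spanning property persists nearby.\<close>

lemma uniformly_spannable:
  assumes sp: "\<And>x y u. x \<in> spts B \<Longrightarrow> y \<in> spts B \<Longrightarrow> u \<noteq> 0 \<Longrightarrow>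
    \<exists>p k. (\<forall>i<CARD('d). p i \<in> Wu B x \<and> shift (int (k i)) (p i) \<in> Ws B y) \<and>
      (\<forall>w. \<exists>c. w = (\<Sum>i<CARD('d). c i *\<^sub>R
         appm (HS y (shift (int (k i)) (p i))) (appm (An (k i) (p i)) (appm (HU (p i) x) u))))"
  shows "\<exists>m D \<delta>. 1 \<le> D \<and> 0 < \<delta> \<and> (\<forall>A' Ai'. cocyc B A' Ai' K Hc Cb q \<theta> \<longrightarrow>
    (\<forall>x\<in>spts B. norm (A' x - A x) \<le> \<delta> \<and> norm (Ai' x - Ai x) \<le> \<delta>) \<longrightarrow> unif_span B A' Ai' m D)"
proof (rule ccontr)
  assume neg: "\<not> ?thesis"
  \<comment> \<open>A single index serves as window, as spanning constant and as inverse distance to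
    \<open>A\<close>, so that one contradictory index is enough. Unit length of \<open>w\<close>
    provides compactness.\<close>
  define bad where "bad N A' Ai' x y w \<longleftrightarrow> cocyc B A' Ai' K Hc Cb q \<theta> \<and>
      (\<forall>x\<in>spts B. norm (A' x - A x) \<le> 1 / real (Suc N) \<and> norm (Ai' x - Ai x) \<le> 1 / real (Suc N)) \<and>
      x \<in> spts B \<and> y \<in> spts B \<and> norm w = 1 \<and> (\<forall>p k. \<not> span_data B A' Ai' N (real (Suc N)) x y w p k)"
    for N :: nat and A' Ai' :: "biseq \<Rightarrow> 'd mat" and x y and w :: "real ^ 'd"
  have "\<exists>A' Ai' x y w. bad N A' Ai' x y w" for N
  proof -
    have "\<not> (\<forall>A' Ai'. cocyc B A' Ai' K Hc Cb q \<theta> \<longrightarrow>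
      (\<forall>x\<in>spts B. norm (A' x - A x) \<le> 1 / real (Suc N) \<and> norm (Ai' x - Ai x) \<le> 1 / real (Suc N)) \<longrightarrow> unif_span B A' Ai' N (real (Suc N)))"
    proof
      assume "\<forall>A' Ai'. cocyc B A' Ai' K Hc Cb q \<theta> \<longrightarrow>
      (\<forall>x\<in>spts B. norm (A' x - A x) \<le> 1 / real (Suc N) \<and> norm (Ai' x - Ai x) \<le> 1 / real (Suc N)) \<longrightarrow> unif_span B A' Ai' N (real (Suc N))"
      then have "\<exists>m D \<delta>. 1 \<le> D \<and> 0 < \<delta> \<and> (\<forall>A' Ai'. cocyc B A' Ai' K Hc Cb q \<theta> \<longrightarrow>
        (\<forall>x\<in>spts B. norm (A' x - A x) \<le> \<delta> \<and> norm (Ai' x - Ai x) \<le> \<delta>) \<longrightarrow> unif_span B A' Ai' m D)"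
        by (intro exI[of _ N] exI[of _ "real (Suc N)"] exI[of _ "1 / real (Suc N)"] conjI) simp_all
      with neg show False by (rule notE)
    qed
    then obtain A' Ai' where A': "cocyc B A' Ai' K Hc Cb q \<theta>"
      "\<forall>x\<in>spts B. norm (A' x - A x) \<le> 1 / real (Suc N) \<and> norm (Ai' x - Ai x) \<le> 1 / real (Suc N)"
      "\<not> unif_span B A' Ai' N (real (Suc N))" by blast
    from A'(3) obtain x y u where xyu: "x \<in> spts B" "y \<in> spts B"
      "\<And>p k. \<not> span_data B A' Ai' N (real (Suc N)) x y u p k"
      unfolding unif_span_def by blast
    obtain e :: "real ^ 'd" where e: "norm e = 1" using norm_Basis nonempty_Basis by (metis ex_in_conv)
    define w where "w = (if u = 0 then e else u /\<^sub>R norm u)"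
    have w: "norm w = 1" "u = norm u *\<^sub>R w" using e by (auto simp: w_def)
    have "\<not> span_data B A' Ai' N (real (Suc N)) x y w p k" for p k
      using span_data_scale[of B A' Ai' N "real (Suc N)" x y w p k "norm u"] xyu(3)[of p k] w(2) by auto
    then have "bad N A' Ai' x y w" unfolding bad_def using A'(1,2) xyu(1,2) w(1) by blast
    then show ?thesis by blast
  qed
  then obtain As Ais xs ys ws where bad: "\<And>N. bad N (As N) (Ais N) (xs N) (ys N) (ws N)" by metis
  have coc: "cocyc B (As N) (Ais N) K Hc Cb q \<theta>" and xs: "xs N \<in> spts B" and ys: "ys N \<in> spts B"
    and ws: "norm (ws N) = 1" and nsp: "\<not> span_data B (As N) (Ais N) N (real (Suc N)) (xs N) (ys N) (ws N) p k"
    and cA: "\<And>x. x \<in> spts B \<Longrightarrow> norm (As N x - A x) \<le> 1 / real (Suc N)"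
    and cAi: "\<And>x. x \<in> spts B \<Longrightarrow> norm (Ais N x - Ai x) \<le> 1 / real (Suc N)" for N p k
    using bad[of N] unfolding bad_def by blast+
  have "compact (spts B \<times> spts B \<times> sphere (0 :: real ^ 'd) 1)"
    by (intro compact_Times compact_spts) simp
  then have "seq_compact (spts B \<times> spts B \<times> sphere (0 :: real ^ 'd) 1)" by (rule compact_imp_seq_compact)
  moreover have "\<forall>N. (xs N, ys N, ws N) \<in> spts B \<times> spts B \<times> sphere 0 1" using xs ys ws by simp
  ultimately obtain l r where l: "l \<in> spts B \<times> spts B \<times> sphere (0 :: real ^ 'd) 1" and r: "strict_mono r"
    and lim: "((\<lambda>N. (xs N, ys N, ws N)) \<circ> r) \<longlonglongrightarrow> l" unfolding seq_compact_def by meson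
  obtain x y w where lxy: "l = (x, y, w)" by (cases l) auto
  have x: "x \<in> spts B" and y: "y \<in> spts B" and w: "norm w = 1" using l lxy by auto
  have limx: "(\<lambda>N. xs (r N)) \<longlonglongrightarrow> x" using tendsto_fst[OF lim] by (simp add: lxy o_def)
  have limy: "(\<lambda>N. ys (r N)) \<longlonglongrightarrow> y" using tendsto_fst[OF tendsto_snd[OF lim]] by (simp add: lxy o_def)
  have limw: "(\<lambda>N. ws (r N)) \<longlonglongrightarrow> w" using tendsto_snd[OF tendsto_snd[OF lim]] by (simp add: lxy o_def)
  have "w \<noteq> 0" using w by auto
  from sp[OF x y this] obtain p k where p: "\<And>i. i < CARD('d) \<Longrightarrow> p i \<in> Wu B x"
    "\<And>i. i < CARD('d) \<Longrightarrow> shift (int (k i)) (p i) \<in> Ws B y"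
    and gen: "\<And>z. \<exists>c. z = (\<Sum>i<CARD('d). c i *\<^sub>R
         appm (HS y (shift (int (k i)) (p i))) (appm (An (k i) (p i)) (appm (HU (p i) x) w)))" by blast
  define v where "v i = appm (HS y (shift (int (k i)) (p i))) (appm (An (k i) (p i)) (appm (HU (p i) x) w))" for i
  have ps: "p i \<in> spts B" if "i < CARD('d)" for i using p(1)[OF that] by (simp add: Wu_def)
  have "\<exists>m. (\<forall>n\<le>- int m. p i n = x n) \<and> (\<forall>n\<ge>int m. shift (int (k i)) (p i) n = y n)" if i: "i < CARD('d)" for i
  proof -
    obtain m1 where m1: "\<forall>n\<le>- int m1. p i n = x n" by (rule Wu_level[OF S.rate_pos p(1)[OF i]])
    obtain m2 where m2: "\<forall>n\<ge>int m2. shift (int (k i)) (p i) n = y n" by (rule Ws_level[OF S.rate_pos p(2)[OF i]])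
    show ?thesis using m1 m2 by (intro exI[of _ "m1 + m2"]) auto
  qed
  then obtain mm where mm: "\<And>i. i < CARD('d) \<Longrightarrow> \<forall>n\<le>- int (mm i). p i n = x n"
    "\<And>i. i < CARD('d) \<Longrightarrow> \<forall>n\<ge>int (mm i). shift (int (k i)) (p i) n = y n" by metis
  \<comment> \<open>A common window which also dominates every time \<open>k i\<close>. The last
    summand gives \<open>m >= 1\<close> and keeps the two seams of \<open>splice\<close>
    apart.\<close>
  define m where "m = (\<Sum>i<CARD('d). mm i + k i) + 1"
  have m_ge: "mm i + k i \<le> m" if "i < CARD('d)" for i
    unfolding m_def using member_le_sum[of i "{..<CARD('d)}" "\<lambda>i. mm i + k i"] that by simp
  have m1: "m \<ge> 1" by (simp add: m_def)
  have lev: "\<forall>n\<le>- int m. p i n = x n" "\<forall>n\<ge>int m. shift (int (k i)) (p i) n = y n" if "i < CARD('d)" for i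
    using mm[OF that] m_ge[OF that] by auto
  have "\<forall>\<^sub>F N in sequentially. xs (r N) (- int m) = x (- int m)" "\<forall>\<^sub>F N in sequentially. ys (r N) (int m) = y (int m)"
    using limx limy by (auto simp: tendsto_biseq_iff)
  then have "\<forall>\<^sub>F N in sequentially. xs (r N) (- int m) = x (- int m) \<and> ys (r N) (int m) = y (int m)"
    by (rule eventually_conj)
  then obtain N1 where N1: "\<And>N. N \<ge> N1 \<Longrightarrow> xs (r N) (- int m) = x (- int m)" "\<And>N. N \<ge> N1 \<Longrightarrow> ys (r N) (int m) = y (int m)"
    unfolding eventually_sequentially by blast
  define s where "s N = r (N + N1)" for N
  have sN: "N \<le> s N" for N
    unfolding s_def using strict_mono_imp_increasing[OF r, of "N + N1"] by simp
  have slim: "(\<lambda>N. f (s N)) \<longlonglongrightarrow> c" if "(\<lambda>N. f (r N)) \<longlonglongrightarrow> c" for f :: "nat \<Rightarrow> 'z::topological_space" and c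
    unfolding s_def using LIMSEQ_ignore_initial_segment[OF that, of N1] .
  have dlim: "(\<lambda>N. 1 / real (Suc (s N))) \<longlonglongrightarrow> 0"
    unfolding s_def
    using LIMSEQ_ignore_initial_segment[OF LIMSEQ_subseq_LIMSEQ[OF LIMSEQ_Suc[OF lim_1_over_n] r], of N1] by (simp add: o_def)
  have limx: "(\<lambda>N. xs (s N)) \<longlonglongrightarrow> x" and limy: "(\<lambda>N. ys (s N)) \<longlonglongrightarrow> y" and limw: "(\<lambda>N. ws (s N)) \<longlonglongrightarrow> w"
    by (rule slim[of xs, OF limx], rule slim[of ys, OF limy], rule slim[of ws, OF limw])
  \<comment> \<open>The window of these points is \<open>m\<close> for every \<open>N\<close>, so
    all their holonomies share one admissible constant and \<open>hol_tendsto\<close>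
    applies.\<close>
  define P where "P N i = splice m (k i) (xs (s N)) (p i) (ys (s N))" for N i
  have Ps: "P N i \<in> spts B" if i: "i < CARD('d)" for N i
    unfolding P_def
  proof (rule splice_in_spts[OF xs ys ps[OF i] m1])
    have "N1 \<le> N + N1" by simp
    note N1' = N1[OF this]
    show "xs (s N) (- int m) = p i (- int m)" using N1' lev(1)[OF i] by (simp add: s_def)
    show "ys (s N) (int m) = p i (int m + int (k i))" using N1' lev(2)[OF i] by (simp add: s_def shift_def)
  qed
  have Plim: "(\<lambda>N. P N i) \<longlonglongrightarrow> p i" if i: "i < CARD('d)" for i
    unfolding P_def by (rule tendsto_splice[OF limx limy lev[OF i]])
  have Plev1: "\<forall>n\<le>- int m. P N i n = xs (s N) n" for N i
    by (auto simp: P_def splice_def)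
  have Plev2: "\<forall>n\<ge>int m. shift (int (k i)) (P N i) n = ys (s N) n" for N i
    using m1 by (auto simp: P_def splice_def shift_def)
  have contA: "continuous_on (spts B) A" by (rule holder_imp_continuous_on[OF S.rate_pos S.\<theta>_pos S.C_holder])
  have contAi: "continuous_on (spts B) Ai" by (rule holder_imp_continuous_on[OF S.rate_pos S.\<theta>_pos S.Ci_holder])
  have limA: "(\<lambda>N. As (s N) (zk N)) \<longlonglongrightarrow> A z" if "zk \<longlonglongrightarrow> z" "z \<in> spts B" "\<And>N. zk N \<in> spts B" for zk z
    by (rule tendsto_of_uniform[OF contA cA dlim that])
  have limAi: "(\<lambda>N. Ais (s N) (zk N)) \<longlonglongrightarrow> Ai z" if "zk \<longlonglongrightarrow> z" "z \<in> spts B" "\<And>N. zk N \<in> spts B" for zk z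
    by (rule tendsto_of_uniform[OF contAi cAi dlim that])
  define V where "V N i = appm (hol 1 (As (s N)) (Ais (s N)) (ys (s N)) (shift (int (k i)) (P N i)))
      (appm (cpr 1 (As (s N)) (k i) (P N i))
        (appm (hol (- 1) (\<lambda>x. Ais (s N) (shift (- 1) x)) (\<lambda>x. As (s N) (shift (- 1) x)) (P N i) (xs (s N))) (ws (s N))))" for N i
  define F where "F = exp (rate B * real m) powr \<theta>"
  have Vlim: "(\<lambda>N. V N i) \<longlonglongrightarrow> v i" if i: "i < CARD('d)" for i
  proof -
    have hS: "(\<lambda>N. hol 1 (As (s N)) (Ais (s N)) (ys (s N)) (shift (int (k i)) (P N i))) \<longlonglongrightarrow> HS y (shift (int (k i)) (p i))"
    proof (rule hol_tendsto[OF half])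
      show "halfc B 1 (As (s N)) (Ais (s N)) K Hc Cb q \<theta>" for N using coc[of "s N"] by (simp add: cocyc_def)
      show "adm B 1 \<theta> F (shift (int (k i)) (p i)) y" unfolding F_def
        using lev(2)[OF i] ps[OF i] y by (intro adm_stable_level S.rate_pos S.\<theta>_pos) auto
      show "adm B 1 \<theta> F (shift (int (k i)) (P N i)) (ys (s N))" for N unfolding F_def
        using Plev2[of i N] Ps[OF i] ys by (intro adm_stable_level S.rate_pos S.\<theta>_pos) auto
    qed (auto intro!: limA limAi tendsto_shift Plim i limy ps Ps y ys simp del: shift_shift)
    have hU: "(\<lambda>N. hol (- 1) (\<lambda>x. Ais (s N) (shift (- 1) x)) (\<lambda>x. As (s N) (shift (- 1) x)) (P N i) (xs (s N))) \<longlonglongrightarrow> HU (p i) x"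
    proof (rule hol_tendsto[OF half_unstable])
      show "halfc B (- 1) (\<lambda>x. Ais (s N) (shift (- 1) x)) (\<lambda>x. As (s N) (shift (- 1) x)) K Hc' Cb q \<theta>" for N
        using cocyc.half_unstable[OF coc[of "s N"]] .
      show "adm B (- 1) \<theta> F x (p i)" unfolding F_def
        using lev(1)[OF i] ps[OF i] x by (intro adm_unstable_level S.rate_pos S.\<theta>_pos) auto
      show "adm B (- 1) \<theta> F (xs (s N)) (P N i)" for N unfolding F_def
        using Plev1[of N i] Ps[OF i] xs by (intro adm_unstable_level S.rate_pos S.\<theta>_pos) auto
    qed (auto intro!: limA limAi tendsto_shift Plim i limx ps Ps x xs simp del: shift_shift)
    have hA: "(\<lambda>N. cpr 1 (As (s N)) n (P N i)) \<longlonglongrightarrow> An n (p i)" for n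
      by (induction n) (auto intro!: tendsto_compose_blinfun limA tendsto_shift Plim i ps Ps)
    show ?thesis unfolding V_def v_def
      by (intro bounded_bilinear.tendsto[OF bounded_bilinear_blinfun_apply] hS hU hA limw)
  qed
  obtain D0 where D0: "D0 > 0" "\<And>L::'d mat. norm L \<le> D0 * (\<Sum>i<CARD('d). norm (appm L (v i)))"
    using spanning_bound[of v "CARD('d)"] gen unfolding v_def by blast
  have "(\<lambda>N. \<Sum>i<CARD('d). norm (v i - V N i)) \<longlonglongrightarrow> (\<Sum>i<CARD('d). norm (v i - v i))"
    by (intro tendsto_sum tendsto_norm tendsto_diff tendsto_const Vlim) auto
  then have "(\<lambda>N. \<Sum>i<CARD('d). norm (v i - V N i)) \<longlonglongrightarrow> 0" by simp
  then have "\<forall>\<^sub>F N in sequentially. (\<Sum>i<CARD('d). norm (v i - V N i)) < 1 / (2 * D0)"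
    using D0(1) by (intro order_tendstoD) auto
  then obtain N2 where N2: "\<And>N. N \<ge> N2 \<Longrightarrow> (\<Sum>i<CARD('d). norm (v i - V N i)) < 1 / (2 * D0)"
    unfolding eventually_sequentially by blast
  define N where "N = N2 + m + nat \<lceil>2 * D0\<rceil>"
  have big: "m \<le> s N" "2 * D0 \<le> real (Suc (s N))"
  proof -
    show "m \<le> s N" using sN[of N] unfolding N_def by linarith
    have "2 * D0 \<le> real (nat \<lceil>2 * D0\<rceil>)" by linarith
    also have "\<dots> \<le> real (Suc (s N))" using sN[of N] unfolding N_def by simp
    finally show "2 * D0 \<le> real (Suc (s N))" .
  qed
  have "span_data B (As (s N)) (Ais (s N)) (s N) (real (Suc (s N))) (xs (s N)) (ys (s N)) (ws (s N)) (P N) k"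
    unfolding span_data_def
  proof (intro conjI allI impI)
    fix i assume i: "i < CARD('d)"
    show "k i \<le> s N" using m_ge[OF i] big(1) by linarith
    show "P N i \<in> spts B" by (rule Ps[OF i])
    show "P N i n = xs (s N) n" if "n \<le> - int (s N)" for n using Plev1[of N i] that big(1) by auto
    show "shift (int (k i)) (P N i) n = ys (s N) n" if "n \<ge> int (s N)" for n
      using Plev2[of i N] that big(1) by auto
  next
    fix L :: "'d mat"
    have "norm L \<le> 2 * D0 * (\<Sum>i<CARD('d). norm (appm L (V N i)))"
      by (rule perturbed_spanning[OF D0(2) D0(1) less_imp_le[OF N2]]) (simp add: N_def)
    also have "\<dots> \<le> real (Suc (s N)) * (\<Sum>i<CARD('d). norm (appm L (V N i)))"
      by (intro mult_right_mono big sum_nonneg) auto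
    finally show "norm L * norm (ws (s N)) \<le> real (Suc (s N)) * (\<Sum>i<CARD('d). norm (appm L
      (appm (hol 1 (As (s N)) (Ais (s N)) (ys (s N)) (shift (int (k i)) (P N i)))
      (appm (cpr 1 (As (s N)) (k i) (P N i))
        (appm (hol (- 1) (\<lambda>x. Ais (s N) (shift (- 1) x)) (\<lambda>x. As (s N) (shift (- 1) x)) (P N i) (xs (s N))) (ws (s N)))))))"
      unfolding V_def by (simp add: ws)
  qed
  with nsp show False by blast
qed

end

section \<open>Bounded subadditive processes\<close>

lemma rl_measurable [measurable (raw)]:
  assumes "\<And>n. f n \<in> borel_measurable \<mu>" "\<And>x. x \<in> space \<mu> \<Longrightarrow> bddseq (\<lambda>n. f n x)"
  shows "(\<lambda>x. rl (\<lambda>n. f n x)) \<in> borel_measurable \<mu>"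
proof -
  have "(\<lambda>x. real_of_ereal (limsup (\<lambda>n. ereal (f n x)))) \<in> borel_measurable \<mu>"
    using assms(1) by measurable
  moreover have "real_of_ereal (limsup (\<lambda>n. ereal (f n x))) = rl (\<lambda>n. f n x)" if "x \<in> space \<mu>" for x
    by (simp add: limsup_eq_rl[OF assms(2)[OF that]])
  ultimately show ?thesis by (simp cong: measurable_cong)
qed

lemma rl_shift_eq:
  assumes "bddseq f" "bddseq g" "\<And>n. \<bar>f n - g n\<bar> \<le> e n" "e \<longlonglongrightarrow> 0"
  shows "rl f = rl g"
proof (rule antisym)
  have "f n \<le> g n + 0 + e n" "g n \<le> f n + 0 + e n" for n using assms(3)[of n] by linarith+
  then show "rl f \<le> rl g" "rl g \<le> rl f"
    using rl_mono_const[OF assms(1,2,4), of 0] rl_mono_const[OF assms(2,1,4), of 0] by simp_all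
qed

text \<open>The bounds are pointwise, as they are for the logarithm of the norm of a product of
  matrices with bounded inverses. They make the lower limit of the averages invariant at every point
  and all the functions integrable.\<close>

locale subadd_process = prob_space \<mu> for \<mu> :: "'a measure" +
  fixes T :: "'a \<Rightarrow> 'a" and f :: "nat \<Rightarrow> 'a \<Rightarrow> real" and M :: real
  assumes T_meas [measurable]: "T \<in> measurable \<mu> \<mu>" and T_inv: "distr \<mu> \<mu> T = \<mu>"
    and f_meas [measurable]: "\<And>n. f n \<in> borel_measurable \<mu>"
    and f_bd: "\<And>x n. x \<in> space \<mu> \<Longrightarrow> \<bar>f n x\<bar> \<le> M * real n"
    and M_nn: "0 \<le> M"
    and f_sub: "\<And>x m n. x \<in> space \<mu> \<Longrightarrow> f (m + n) x \<le> f m x + f n ((T ^^ m) x)"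
    and f_shift: "\<And>x n. x \<in> space \<mu> \<Longrightarrow> \<bar>f n (T x) - f (Suc n) x\<bar> \<le> M"
    and f_step: "\<And>x n. x \<in> space \<mu> \<Longrightarrow> \<bar>f (Suc n) x - f n x\<bar> \<le> M"
begin

text \<open>The lower limit of the averages, written through \<open>rl\<close>.\<close>

definition "g x = - rl (\<lambda>n. - (f n x / real n))"

lemma T_pow_meas [measurable]: "T ^^ n \<in> measurable \<mu> \<mu>"
proof (induction n)
  case (Suc n)
  show ?case unfolding funpow.simps by (rule measurable_comp[OF Suc T_meas])
qed (simp add: id_def)

lemma T_space: "x \<in> space \<mu> \<Longrightarrow> (T ^^ n) x \<in> space \<mu>"
  using measurable_space[OF T_pow_meas] .

lemma T_pow_inv: "distr \<mu> \<mu> (T ^^ n) = \<mu>"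
proof (induction n)
  case 0
  show ?case by (simp add: id_def distr_id)
next
  case (Suc n)
  have "distr \<mu> \<mu> (T \<circ> (T ^^ n)) = distr (distr \<mu> \<mu> (T ^^ n)) \<mu> T" by (subst distr_distr) auto
  then show ?case using Suc T_inv by (simp del: comp_apply)
qed

lemma integral_T_pow:
  assumes [measurable]: "h \<in> borel_measurable \<mu>"
  shows "(\<integral>x. h ((T ^^ n) x) \<partial>\<mu>) = (\<integral>x. h x \<partial>\<mu> :: real)"
proof -
  have "(\<integral>x. h x \<partial>distr \<mu> \<mu> (T ^^ n)) = (\<integral>x. h ((T ^^ n) x) \<partial>\<mu>)"
    by (rule integral_distr[OF T_pow_meas assms])
  then show ?thesis by (simp only: T_pow_inv)
qed

lemma avg_bd: "x \<in> space \<mu> \<Longrightarrow> \<bar>f n x / real n\<bar> \<le> M"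
  using f_bd[of x n] M_nn by (cases "n = 0") (simp_all add: abs_divide pos_divide_le_eq)

lemma avg_bddseq: "x \<in> space \<mu> \<Longrightarrow> bddseq (\<lambda>n. f n x / real n)"
  unfolding bddseq_def using avg_bd by blast

lemma neg_avg_bddseq: "x \<in> space \<mu> \<Longrightarrow> bddseq (\<lambda>n. - (f n x / real n))"
  unfolding bddseq_def abs_minus_cancel using avg_bd by blast

lemma g_meas [measurable]: "g \<in> borel_measurable \<mu>"
proof -
  have "(\<lambda>x. rl (\<lambda>n. - (f n x / real n))) \<in> borel_measurable \<mu>"
    by (rule rl_measurable) (auto intro: neg_avg_bddseq)
  then show ?thesis unfolding g_def[abs_def] by simp
qed

lemma g_bd: assumes "x \<in> space \<mu>" shows "\<bar>g x\<bar> \<le> M"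
proof -
  have "rl (\<lambda>n. - (f n x / real n)) \<le> M" "- M \<le> rl (\<lambda>n. - (f n x / real n))"
  proof -
    show "rl (\<lambda>n. - (f n x / real n)) \<le> M"
    proof (rule rl_le[OF neg_avg_bddseq[OF assms]])
      show "- (f n x / real n) \<le> M" for n using avg_bd[OF assms, of n] by (simp only: abs_le_iff)
    qed
    show "- M \<le> rl (\<lambda>n. - (f n x / real n))"
    proof (rule rl_ge[OF neg_avg_bddseq[OF assms]])
      show "- M \<le> - (f n x / real n)" for n using avg_bd[OF assms, of n] by (simp only: abs_le_iff neg_le_iff_le)
    qed
  qed
  then show ?thesis by (simp add: g_def)
qed

lemma inverse_Suc_tendsto: "(\<lambda>n. c * (1 / real (Suc n))) \<longlonglongrightarrow> 0"
  using tendsto_mult_right_zero[OF LIMSEQ_Suc[OF lim_1_over_n], of c] by simp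

lemma abs_diff_avg: "0 < c \<Longrightarrow> \<bar>- (p / c) - - (q / c)\<bar> = \<bar>p - q\<bar> * (1 / c)" for p q c :: real
  by (simp add: diff_divide_distrib[symmetric] abs_divide abs_minus_commute)

lemma g_invariant1: assumes x: "x \<in> space \<mu>" shows "g (T x) = g x"
proof -
  have Tx: "T x \<in> space \<mu>" using T_space[OF x, of 1] by simp
  have "rl (\<lambda>n. - (f (Suc n) (T x) / real (Suc n))) = rl (\<lambda>n. - (f (Suc n) x / real (Suc n)))"
  proof (rule rl_shift_eq)
    show "bddseq (\<lambda>n. - (f (Suc n) (T x) / real (Suc n)))"
      using avg_bd[OF Tx, of "Suc n" for n] unfolding bddseq_def abs_minus_cancel by blast
    show "bddseq (\<lambda>n. - (f (Suc n) x / real (Suc n)))"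
      using avg_bd[OF x, of "Suc n" for n] unfolding bddseq_def abs_minus_cancel by blast
    fix n
    have "\<bar>f (Suc n) (T x) - f (Suc n) x\<bar> \<le> 2 * M"
      using f_shift[OF x, of n] f_step[OF Tx, of n] by linarith
    then show "\<bar>- (f (Suc n) (T x) / real (Suc n)) - - (f (Suc n) x / real (Suc n))\<bar> \<le> 2 * M * (1 / real (Suc n))"
      unfolding abs_diff_avg[OF of_nat_0_less_iff[THEN iffD2, OF zero_less_Suc]]
      by (intro mult_right_mono) auto
  qed (rule inverse_Suc_tendsto)
  then show ?thesis unfolding g_def
    using rl_Suc[of "\<lambda>n. - (f n (T x) / real n)"] rl_Suc[of "\<lambda>n. - (f n x / real n)"] by simp
qed

lemma g_invariant: "x \<in> space \<mu> \<Longrightarrow> g ((T ^^ n) x) = g x"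
  by (induction n) (simp_all add: g_invariant1 T_space)

definition "bad e N = {x \<in> space \<mu>. \<forall>n\<in>{1..N}. real n * (g x + e) < f n x}"

lemma bad_meas [measurable]: "bad e N \<in> sets \<mu>"
  unfolding bad_def by measurable

lemma bad_empty: assumes "e > 0" shows "(\<Inter>N. bad e N) = {}"
proof -
  have False if x: "x \<in> (\<Inter>N. bad e N)" for x
  proof -
    have xs: "x \<in> space \<mu>" using x by (auto simp: bad_def)
    have "rl (\<lambda>n. - (f n x / real n)) \<le> - (g x + e)"
    proof (rule rl_leI[OF neg_avg_bddseq[OF xs]])
      fix \<epsilon> :: real assume "\<epsilon> > 0"
      show "\<forall>\<^sub>F n in sequentially. - (f n x / real n) \<le> - (g x + e) + \<epsilon>"
        unfolding eventually_sequentially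
      proof (intro exI[of _ 1] allI impI)
        fix n :: nat assume n: "1 \<le> n"
        have "x \<in> bad e n" using x by blast
        then have "real n * (g x + e) < f n x" using n by (auto simp: bad_def)
        then have "g x + e < f n x / real n" using n by (simp add: field_simps)
        then show "- (f n x / real n) \<le> - (g x + e) + \<epsilon>" using \<open>\<epsilon> > 0\<close> by linarith
      qed
    qed
    then show False using assms by (simp add: g_def)
  qed
  then show ?thesis by blast
qed

lemma bad_small: assumes "e > 0" "d > 0" shows "\<exists>N. measure \<mu> (bad e N) < d"
proof -
  have "decseq (bad e)" unfolding decseq_def bad_def by auto
  then have "(\<lambda>N. measure \<mu> (bad e N)) \<longlonglongrightarrow> measure \<mu> (\<Inter>N. bad e N)"
    by (intro finite_Lim_measure_decseq) auto
  then have "(\<lambda>N. measure \<mu> (bad e N)) \<longlonglongrightarrow> 0" using bad_empty[OF assms(1)] by simp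
  from order_tendstoD(2)[OF this assms(2)] show ?thesis unfolding eventually_sequentially by blast
qed

text \<open>Since \<open>g\<close> is at least \<open>- M\<close>, the summand \<open>2 * M\<close>
  raises the value on the bad set above \<open>M\<close>, the price of a single step.\<close>

definition "hh e N x = g x + e + 2 * M * indicator (bad e N) x"

lemma hh_meas [measurable]: "hh e N \<in> borel_measurable \<mu>"
  unfolding hh_def[abs_def] by measurable

lemma hh_ge: assumes "x \<in> space \<mu>" "e > 0" shows "- M \<le> hh e N x" "g x + e \<le> hh e N x"
  using g_bd[OF assms(1)] assms(2) M_nn by (auto simp: hh_def abs_le_iff indicator_def)

lemma f_0: "x \<in> space \<mu> \<Longrightarrow> f 0 x = 0"
  using f_bd[of x 0] by simp

text \<open>Cut the orbit segment greedily: away from the bad set use the first time at which the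
  average is close to its lower limit, on the bad set make a single step.\<close>

lemma pointwise_bound:
  assumes e: "e > 0"
  shows "x \<in> space \<mu> \<Longrightarrow> f m x \<le> (\<Sum>j<m. hh e N ((T ^^ j) x)) + 2 * real N * M"
proof (induction m arbitrary: x rule: less_induct)
  case (less m)
  note x = less.prems
  have split: "f m x \<le> (\<Sum>j<m. hh e N ((T ^^ j) x)) + 2 * real N * M"
    if n: "1 \<le> n" "n \<le> m" and fn: "f n x \<le> (\<Sum>j<n. hh e N ((T ^^ j) x))" for n
  proof -
    have "f m x \<le> f n x + f (m - n) ((T ^^ n) x)" using f_sub[OF x, of n "m - n"] n by simp
    also have "f (m - n) ((T ^^ n) x) \<le> (\<Sum>j<m - n. hh e N ((T ^^ j) ((T ^^ n) x))) + 2 * real N * M"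
      using n by (intro less.IH T_space[OF x]) auto
    also have "(\<Sum>j<m - n. hh e N ((T ^^ j) ((T ^^ n) x))) = (\<Sum>j\<in>{n..<m}. hh e N ((T ^^ j) x))"
      using sum.shift_bounds_nat_ivl[of "\<lambda>j. hh e N ((T ^^ j) x)" 0 n "m - n"] n
      by (simp add: funpow_add atLeast0LessThan)
    also have "f n x \<le> (\<Sum>j\<in>{..<n}. hh e N ((T ^^ j) x))" by (rule fn)
    also have "(\<Sum>j\<in>{..<n}. hh e N ((T ^^ j) x)) + ((\<Sum>j\<in>{n..<m}. hh e N ((T ^^ j) x)) + 2 * real N * M)
       = (\<Sum>j\<in>{..<m}. hh e N ((T ^^ j) x)) + 2 * real N * M"
      using sum.atLeastLessThan_concat[of 0 n m "\<lambda>j. hh e N ((T ^^ j) x)"] n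
      by (simp add: atLeast0LessThan)
    finally show ?thesis by simp
  qed
  show ?case
  proof (cases "m \<le> N")
    case True
    have "f m x \<le> M * real m" using f_bd[OF x, of m] by linarith
    moreover have "- (M * real m) \<le> (\<Sum>j<m. hh e N ((T ^^ j) x))"
      using sum_mono[of "{..<m}" "\<lambda>_. - M" "\<lambda>j. hh e N ((T ^^ j) x)"] hh_ge(1)[OF T_space[OF x] e]
      by (simp add: mult.commute)
    moreover have "M * real m \<le> M * real N" using True M_nn by (intro mult_left_mono) auto
    ultimately show ?thesis by (simp add: mult.commute)
  next
    case False
    show ?thesis
    proof (cases "x \<in> bad e N")
      case True
      have "f 1 x \<le> M" using f_bd[OF x, of 1] by simp
      also have "M \<le> hh e N x" using True g_bd[OF x] e by (simp add: hh_def abs_le_iff)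
      finally show ?thesis using False by (intro split[of 1]) auto
    next
      case nb: False
      then obtain n where n: "1 \<le> n" "n \<le> N" "f n x \<le> real n * (g x + e)" using x by (auto simp: bad_def not_less)
      have "real n * (g x + e) = (\<Sum>j<n. g ((T ^^ j) x) + e)" by (simp add: g_invariant[OF x])
      also have "\<dots> \<le> (\<Sum>j<n. hh e N ((T ^^ j) x))" by (intro sum_mono hh_ge(2) T_space x e)
      finally show ?thesis using n False by (intro split[of n]) auto
    qed
  qed
qed

lemma integrable_bounded:
  assumes "h \<in> borel_measurable \<mu>" "\<And>x. x \<in> space \<mu> \<Longrightarrow> \<bar>h x\<bar> \<le> (c::real)"
  shows "integrable \<mu> h"
  using assms by (intro integrable_const_bound[of h c]) auto

lemma integrable_f: "integrable \<mu> (f n)"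
  using f_bd by (intro integrable_bounded) auto

lemma integrable_g: "integrable \<mu> g"
  using g_bd by (intro integrable_bounded) auto

lemma integral_hh_sum:
  assumes e: "e > 0"
  shows "(\<integral>x. f m x \<partial>\<mu>) \<le> real m * ((\<integral>x. g x \<partial>\<mu>) + e + 2 * M * measure \<mu> (bad e N)) + 2 * real N * M"
proof -
  have ii: "integrable \<mu> (indicator (bad e N) :: 'a \<Rightarrow> real)"
    by (intro integrable_bounded[of _ 1]) (auto simp: indicator_def)
  have ih: "integrable \<mu> (hh e N)" unfolding hh_def[abs_def]
    by (intro Bochner_Integration.integrable_add integrable_g integrable_mult_right ii) auto
  have ihT: "integrable \<mu> (\<lambda>x. hh e N ((T ^^ j) x))" for j
    using ih integrable_distr_eq[of "T ^^ j" \<mu> \<mu> "hh e N"] by (simp add: T_pow_inv)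
  have "(\<integral>x. f m x \<partial>\<mu>) \<le> (\<integral>x. (\<Sum>j<m. hh e N ((T ^^ j) x)) + 2 * real N * M \<partial>\<mu>)"
    by (intro integral_mono integrable_f Bochner_Integration.integrable_add Bochner_Integration.integrable_sum ihT
        pointwise_bound[OF e]) auto
  also have "\<dots> = (\<Sum>j<m. \<integral>x. hh e N ((T ^^ j) x) \<partial>\<mu>) + 2 * real N * M"
    by (subst Bochner_Integration.integral_add)
      (auto intro!: Bochner_Integration.integrable_sum ihT simp: Bochner_Integration.integral_sum[OF ihT] prob_space)
  also have "\<dots> = real m * (\<integral>x. hh e N x \<partial>\<mu>) + 2 * real N * M" by (simp add: integral_T_pow)
  also have "(\<integral>x. hh e N x \<partial>\<mu>) = (\<integral>x. g x \<partial>\<mu>) + e + 2 * M * measure \<mu> (bad e N)"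
  proof -
    have "(\<integral>x. hh e N x \<partial>\<mu>) = (\<integral>x. g x + e \<partial>\<mu>) + (\<integral>x. 2 * M * indicator (bad e N) x \<partial>\<mu>)"
      unfolding hh_def by (intro Bochner_Integration.integral_add Bochner_Integration.integrable_add
          integrable_g integrable_mult_right ii) auto
    also have "(\<integral>x. g x + e \<partial>\<mu>) = (\<integral>x. g x \<partial>\<mu>) + e"
      using Bochner_Integration.integral_add[OF integrable_g, of "\<lambda>_. e"] by (simp add: prob_space)
    also have "(\<integral>x. 2 * M * indicator (bad e N) x \<partial>\<mu>) = 2 * M * measure \<mu> (bad e N)" by simp
    finally show ?thesis .
  qed
  finally show ?thesis .
qed

text \<open>One half of the subadditive ergodic theorem. In the integrated pointwise bound the term
  \<open>2 * real N * M\<close> disappears on dividing by a large \<open>m\<close>, and then the bad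
  set and \<open>e\<close> are made small.\<close>

lemma integral_lower:
  assumes "\<And>n. c * real n \<le> (\<integral>x. f n x \<partial>\<mu>)"
  shows "c \<le> (\<integral>x. g x \<partial>\<mu>)"
proof (rule le_of_eps_mult)
  show "0 \<le> 1 + 2 * M" using M_nn by simp
  fix e :: real assume e: "e > 0"
  from bad_small[OF e e] obtain N where N: "measure \<mu> (bad e N) < e" by blast
  define G where "G = (\<integral>x. g x \<partial>\<mu>) + e + 2 * M * measure \<mu> (bad e N)"
  have le: "c * real m \<le> real m * G + 2 * real N * M" for m
    using assms[of m] integral_hh_sum[OF e, of m N] unfolding G_def by linarith
  have "c \<le> G"
  proof (rule le_of_eps_mult)
    show "0 \<le> 2 * real N * M" using M_nn by simp
    fix d :: real assume d: "d > 0"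
    obtain m :: nat where m: "1 / d < real m" using reals_Archimedean2 by blast
    then have m0: "0 < real m" using d by (meson less_trans zero_less_divide_1_iff)
    have "c * real m \<le> (G + (1 / real m) * (2 * real N * M)) * real m"
    proof -
      have "(G + (1 / real m) * (2 * real N * M)) * real m = real m * G + 2 * real N * M"
        using m0 by (simp add: distrib_right)
      then show ?thesis using le[of m] by simp
    qed
    then have "c \<le> G + (1 / real m) * (2 * real N * M)" using m0 by (rule mult_right_le_imp_le)
    also have "(1 / real m) * (2 * real N * M) \<le> d * (2 * real N * M)"
      using m m0 d M_nn by (intro mult_right_mono) (auto simp: field_simps)
    finally show "c \<le> G + d * (2 * real N * M)" by simp
  qed
  then show "c \<le> (\<integral>x. g x \<partial>\<mu>) + e * (1 + 2 * M)" unfolding G_def using mult_left_mono[OF less_imp_le[OF N], of "2 * M"] M_nn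
    by (simp add: algebra_simps)
qed

section \<open>Upper limits of the averages\<close>

definition "gu x = rl (\<lambda>n. f n x / real n)"

lemma gu_meas [measurable]: "gu \<in> borel_measurable \<mu>"
  unfolding gu_def[abs_def] by (rule rl_measurable) (auto intro: avg_bddseq)

lemma gu_bd: assumes "x \<in> space \<mu>" shows "\<bar>gu x\<bar> \<le> M"
proof -
  have "gu x \<le> M" unfolding gu_def
  proof (rule rl_le[OF avg_bddseq[OF assms]])
    show "f n x / real n \<le> M" for n using avg_bd[OF assms, of n] by (simp only: abs_le_iff)
  qed
  moreover have "- M \<le> gu x" unfolding gu_def
  proof (rule rl_ge[OF avg_bddseq[OF assms]])
    show "- M \<le> f n x / real n" for n using avg_bd[OF assms, of n] by linarith
  qed
  ultimately show ?thesis by (simp add: abs_le_iff)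
qed

lemma g_le_gu: assumes "x \<in> space \<mu>" shows "g x \<le> gu x"
proof -
  have "rl (\<lambda>n. 0) \<le> rl (\<lambda>n. f n x / real n) + rl (\<lambda>n. - (f n x / real n))"
    by (rule rl_mono_add[OF bddseq_const avg_bddseq[OF assms] neg_avg_bddseq[OF assms] tendsto_const[of 0]]) simp
  then show ?thesis by (simp add: g_def gu_def)
qed

lemma convergent_if_eq:
  assumes x: "x \<in> space \<mu>" and eq: "g x = gu x"
  shows "(\<lambda>n. f n x / real n) \<longlonglongrightarrow> gu x"
proof (rule tendstoI)
  fix e :: real assume "e > 0"
  then have e2: "e / 2 > 0" by simp
  show "\<forall>\<^sub>F n in sequentially. dist (f n x / real n) (gu x) < e"
    using rl_eventually[OF avg_bddseq[OF x] e2] rl_eventually[OF neg_avg_bddseq[OF x] e2]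
  proof eventually_elim
    case (elim n)
    then have "f n x / real n \<le> gu x + e / 2" "- (f n x / real n) \<le> - gu x + e / 2"
      using eq by (simp_all add: g_def gu_def)
    then show ?case using \<open>e > 0\<close> by (simp add: dist_real_def abs_less_iff)
  qed
qed

end

text \<open>The upper limit is controlled by applying the lower bound to the additive process generated
  by \<open>- f k\<close> under \<open>T\<^sup>k\<close>.\<close>

context subadd_process
begin

definition "bs k n x = - (\<Sum>i<n. f k ((T ^^ (k * i)) x))"

lemma funpow_mult_eq: "((T ^^ k) ^^ n) x = (T ^^ (k * n)) x"
  by (simp add: funpow_mult)

lemma T_add: "(T ^^ i) ((T ^^ j) x) = (T ^^ (i + j)) x"
  by (simp add: funpow_add)

lemma sum_shift: "(\<Sum>i\<in>{m..<m + n}. h i) = (\<Sum>i<n. h (i + m :: nat) :: real)"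
  using sum.shift_bounds_nat_ivl[of h 0 m n] by (simp add: add.commute atLeast0LessThan)

text \<open>An additive process is subadditive with either sign. The negative sign is taken because
  the lower limit of these averages is minus the upper limit of the block averages of
  \<open>f k\<close>.\<close>

lemma bs_process: assumes "k \<ge> 1" shows "subadd_process \<mu> (T ^^ k) (bs k) (M * real k)"
proof
  show "T ^^ k \<in> measurable \<mu> \<mu>" by simp
  show "distr \<mu> \<mu> (T ^^ k) = \<mu>" by (rule T_pow_inv)
  show "bs k n \<in> borel_measurable \<mu>" for n unfolding bs_def[abs_def] by measurable
  show "0 \<le> M * real k" using M_nn by simp
  fix x assume x: "x \<in> space \<mu>"
  have fk: "\<bar>f k ((T ^^ j) x)\<bar> \<le> M * real k" for j by (rule f_bd[OF T_space[OF x]])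
  show "\<bar>bs k n x\<bar> \<le> M * real k * real n" for n
  proof -
    have "\<bar>bs k n x\<bar> \<le> (\<Sum>i<n. \<bar>f k ((T ^^ (k * i)) x)\<bar>)" unfolding bs_def abs_minus_cancel by (rule sum_abs)
    also have "\<dots> \<le> (\<Sum>i<n. M * real k)" by (intro sum_mono fk)
    finally show ?thesis by (simp add: mult.commute)
  qed
  show "bs k (m + n) x \<le> bs k m x + bs k n (((T ^^ k) ^^ m) x)" for m n
  proof -
    have "(\<Sum>i<m + n. f k ((T ^^ (k * i)) x)) = (\<Sum>i<m. f k ((T ^^ (k * i)) x)) + (\<Sum>i\<in>{m..<m + n}. f k ((T ^^ (k * i)) x))"
      using sum.atLeastLessThan_concat[of 0 m "m + n" "\<lambda>i. f k ((T ^^ (k * i)) x)"] by (simp add: atLeast0LessThan)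
    also have "(\<Sum>i\<in>{m..<m + n}. f k ((T ^^ (k * i)) x)) = (\<Sum>i<n. f k ((T ^^ (k * i)) ((T ^^ (k * m)) x)))"
      unfolding sum_shift T_add by (simp add: add_mult_distrib2)
    finally show ?thesis by (simp add: bs_def funpow_mult_eq)
  qed
  show "\<bar>bs k n ((T ^^ k) x) - bs k (Suc n) x\<bar> \<le> M * real k" for n
  proof -
    have "(\<Sum>i<n. f k ((T ^^ (k * i)) ((T ^^ k) x))) = (\<Sum>i<n. f k ((T ^^ (k * Suc i)) x))"
      unfolding T_add by (simp add: add.commute)
    then have "bs k n ((T ^^ k) x) - bs k (Suc n) x = f k x"
      unfolding bs_def sum.lessThan_Suc_shift by simp
    then show ?thesis using fk[of 0] by simp
  qed
  show "\<bar>bs k (Suc n) x - bs k n x\<bar> \<le> M * real k" for n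
    using fk[of "k * n"] by (simp add: bs_def)
qed

lemma f_mult_le: "x \<in> space \<mu> \<Longrightarrow> f (k * n) x \<le> - bs k n x"
proof (induction n)
  case (Suc n)
  have "f (k * n + k) x \<le> f (k * n) x + f k ((T ^^ (k * n)) x)" by (rule f_sub[OF Suc.prems])
  then show ?case using Suc by (simp add: bs_def add.commute)
qed (simp add: bs_def f_0)

lemma gu_le_avg:
  assumes k: "k \<ge> 1" and x: "x \<in> space \<mu>"
  shows "gu x \<le> rl (\<lambda>n. - (bs k n x / real n)) / real k"
proof -
  interpret bs: subadd_process \<mu> "T ^^ k" "bs k" "M * real k" by (rule bs_process[OF k])
  define R where "R = rl (\<lambda>n. - (bs k n x / real n))"
  show ?thesis
    unfolding R_def[symmetric]
  proof (rule le_of_eps_mult[of "1 / real k + 1"])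
    fix e :: real assume e: "e > 0"
    have "\<forall>\<^sub>F n in sequentially. - (bs k n x / real n) \<le> R + e"
      unfolding R_def by (rule rl_eventually[OF bs.neg_avg_bddseq[OF x] e])
    then obtain n0 where n0: "\<And>n. n \<ge> n0 \<Longrightarrow> - (bs k n x / real n) \<le> R + e"
      unfolding eventually_sequentially by blast
    \<comment> \<open>Both costs of the remainder of \<open>m\<close> modulo \<open>k\<close>: the
      value of \<open>f\<close> on it, and replacing the number of blocks by
      \<open>m / k\<close>.\<close>
    define Z where "Z = \<bar>R + e\<bar> + M * real k"
    have "\<forall>\<^sub>F m in sequentially. Z * (1 / real m) < e"
      using tendsto_mult_right_zero[OF lim_1_over_n, of Z] e by (rule order_tendstoD)
    then obtain m0 where m0: "\<And>m. m \<ge> m0 \<Longrightarrow> Z * (1 / real m) < e" unfolding eventually_sequentially by blast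
    show "gu x \<le> R / real k + e * (1 / real k + 1)"
      unfolding gu_def
    proof (rule rl_leI[OF avg_bddseq[OF x]])
      fix d :: real assume d: "d > 0"
      show "\<forall>\<^sub>F m in sequentially. f m x / real m \<le> R / real k + e * (1 / real k + 1) + d"
        unfolding eventually_sequentially
      proof (intro exI[of _ "m0 + k * (n0 + 1)"] allI impI)
        fix m assume m: "m0 + k * (n0 + 1) \<le> m"
        define n where "n = m div k"
        define s where "s = m mod k"
        have mns: "m = k * n + s" "s < k" using k by (auto simp: n_def s_def)
        have "k * (n0 + 1) \<le> m" using m by linarith
        then have "n0 + 1 \<le> n" unfolding n_def using k by (simp add: less_eq_div_iff_mult_less_eq mult.commute)
        then have n: "n \<ge> n0" "n \<ge> 1" by auto
        have mpos: "0 < real m" using m k by auto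
        have "f m x \<le> f (k * n) x + f s ((T ^^ (k * n)) x)" unfolding mns(1) by (rule f_sub[OF x])
        also have "f s ((T ^^ (k * n)) x) \<le> M * real s" using f_bd[OF T_space[OF x], of s "k * n"] by linarith
        also have "M * real s \<le> M * real k" using mns(2) M_nn by (intro mult_left_mono) auto
        also have "f (k * n) x \<le> - bs k n x" by (rule f_mult_le[OF x])
        also have "- bs k n x \<le> (R + e) * real n" using n0[OF n(1)] n(2) by (simp add: field_simps)
        finally have 1: "f m x \<le> (R + e) * real n + M * real k" by simp
        have mk: "real m = real k * real n + real s" using mns(1) by simp
        have "(R + e) * real n = (R + e) / real k * real m - (R + e) * (real s / real k)"
          unfolding mk using k by (simp add: field_simps)
        also have "\<dots> \<le> (R + e) / real k * real m + \<bar>R + e\<bar> * 1"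
        proof -
          have "- ((R + e) * (real s / real k)) \<le> \<bar>(R + e) * (real s / real k)\<bar>" by (rule abs_ge_minus_self)
          also have "\<dots> = \<bar>R + e\<bar> * (real s / real k)" by (simp add: abs_mult)
          also have "\<dots> \<le> \<bar>R + e\<bar> * 1" using mns(2) by (intro mult_left_mono) auto
          finally show ?thesis by simp
        qed
        finally have "f m x \<le> (R + e) / real k * real m + Z" using 1 unfolding Z_def by simp
        then have "f m x / real m \<le> (R + e) / real k + Z * (1 / real m)" using mpos by (simp add: field_simps)
        also have "Z * (1 / real m) < e" by (rule m0) (use m in linarith)
        finally show "f m x / real m \<le> R / real k + e * (1 / real k + 1) + d" using d by (simp add: algebra_simps add_divide_distrib)
      qed
    qed
  qed (use k in simp)
qed

lemma integral_gu_le: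
  assumes k: "k \<ge> 1" shows "(\<integral>x. gu x \<partial>\<mu>) \<le> (\<integral>x. f k x \<partial>\<mu>) / real k"
proof -
  interpret bs: subadd_process \<mu> "T ^^ k" "bs k" "M * real k" by (rule bs_process[OF k])
  have ifT: "integrable \<mu> (\<lambda>x. f k ((T ^^ j) x))" for j
    using integrable_f[of k] integrable_distr_eq[of "T ^^ j" \<mu> \<mu> "f k"] by (simp add: T_pow_inv)
  have "(\<integral>x. bs k n x \<partial>\<mu>) = - (\<integral>x. f k x \<partial>\<mu>) * real n" for n
    unfolding bs_def by (simp add: Bochner_Integration.integral_sum[OF ifT] integral_T_pow)
  then have "- (\<integral>x. f k x \<partial>\<mu>) \<le> (\<integral>x. bs.g x \<partial>\<mu>)" by (intro bs.integral_lower) simp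
  moreover have "(\<integral>x. gu x \<partial>\<mu>) \<le> (\<integral>x. - bs.g x / real k \<partial>\<mu>)"
  proof (rule integral_mono)
    show "integrable \<mu> gu" using gu_bd by (intro integrable_bounded) auto
    show "integrable \<mu> (\<lambda>x. - bs.g x / real k)" using bs.integrable_g by simp
    show "gu x \<le> - bs.g x / real k" if "x \<in> space \<mu>" for x
      using gu_le_avg[OF k that] by (simp add: bs.g_def)
  qed
  moreover have "(\<integral>x. - bs.g x / real k \<partial>\<mu>) = - (\<integral>x. bs.g x \<partial>\<mu>) / real k" by simp
  moreover have "- (\<integral>x. bs.g x \<partial>\<mu>) / real k \<le> (\<integral>x. f k x \<partial>\<mu>) / real k"
    using calculation(1) by (intro divide_right_mono) auto
  ultimately show ?thesis by linarith
qed

text \<open>The integral of the upper limit is at most every average integral of \<open>f n\<close>,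
  and therefore, by the lower half, at most the integral of the lower limit. As the upper limit
  dominates pointwise, the two agree almost everywhere.\<close>

theorem kingman: "AE x in \<mu>. (\<lambda>n. f n x / real n) \<longlonglongrightarrow> gu x"
proof -
  have gui: "integrable \<mu> gu" using gu_bd by (intro integrable_bounded) auto
  have "(\<integral>x. gu x \<partial>\<mu>) \<le> (\<integral>x. g x \<partial>\<mu>)"
  proof (rule integral_lower)
    fix n
    show "(\<integral>x. gu x \<partial>\<mu>) * real n \<le> (\<integral>x. f n x \<partial>\<mu>)"
    proof (cases "n = 0")
      case True
      then show ?thesis using Bochner_Integration.integral_cong[OF refl f_0, of \<mu>] by simp
    next
      case False
      then show ?thesis using integral_gu_le[of n] by (simp add: field_simps)
    qed
  qed
  then have "(\<integral>x. gu x - g x \<partial>\<mu>) \<le> 0" using gui integrable_g by simp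
  moreover have nn: "AE x in \<mu>. 0 \<le> gu x - g x" using g_le_gu by (intro AE_I2) simp
  ultimately have "(\<integral>x. gu x - g x \<partial>\<mu>) = 0" using integral_nonneg_AE[OF nn] by linarith
  then have "AE x in \<mu>. gu x - g x = 0"
    using integral_nonneg_eq_0_iff_AE[OF Bochner_Integration.integrable_diff[OF gui integrable_g] nn] by simp
  then show ?thesis
    using AE_space
  proof eventually_elim
    case (elim x)
    show ?case by (rule convergent_if_eq) (use elim in simp_all)
  qed
qed

end

section \<open>Invariant measures\<close>

text \<open>Tychonoff for an arbitrary index set. Since it is applied with all sets of sequences as
  indices, the limit is taken along a filter and not along a subsequence.\<close>

lemma filter_cluster:
  fixes e :: "nat \<Rightarrow> 'i \<Rightarrow> real"
  assumes "\<And>n i. e n i \<in> {0..1}"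
  obtains G L where "G \<noteq> bot" "G \<le> sequentially" "\<And>i. ((\<lambda>n. e n i) \<longlongrightarrow> L i) G"
proof -
  have "compactin (product_topology (\<lambda>i::'i. euclidean) UNIV) (PiE UNIV (\<lambda>i. {0..1::real}))"
    by (simp add: compactin_PiE)
  then have c: "compact (PiE (UNIV :: 'i set) (\<lambda>i. {0..1::real}))"
    by (simp add: euclidean_product_topology)
  have "\<forall>\<^sub>F x in filtermap e sequentially. x \<in> PiE UNIV (\<lambda>i. {0..1})"
    using assms by (simp add: eventually_filtermap PiE_def Pi_def)
  moreover have "filtermap e sequentially \<noteq> bot" by (simp add: filtermap_bot_iff)
  ultimately obtain L where L: "inf (nhds L) (filtermap e sequentially) \<noteq> bot"
    using c unfolding compact_filter by blast
  define G where "G = inf (filtercomap e (nhds L)) sequentially"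
  have "G \<noteq> bot"
  proof
    assume "G = bot"
    then have "eventually (\<lambda>x. False) G" by simp
    then obtain Q R where QR: "eventually Q (filtercomap e (nhds L))" "eventually R sequentially"
      "\<And>n. Q n \<Longrightarrow> R n \<Longrightarrow> False"
      unfolding G_def eventually_inf by blast
    from QR(1) obtain P where P: "eventually P (nhds L)" "\<And>n. P (e n) \<Longrightarrow> Q n"
      unfolding eventually_filtercomap by blast
    have "eventually (\<lambda>x. \<not> P x) (filtermap e sequentially)"
      unfolding eventually_filtermap using QR(2) by (rule eventually_mono) (use P(2) QR(3) in blast)
    with P(1) have "eventually (\<lambda>x. False) (inf (nhds L) (filtermap e sequentially))"
      unfolding eventually_inf by blast
    then show False using L by (simp add: eventually_False)
  qed
  moreover have "G \<le> sequentially" by (simp add: G_def)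
  moreover have "((\<lambda>n. e n i) \<longlongrightarrow> L i) G" for i
  proof -
    have "filterlim e (nhds L) G"
      unfolding G_def by (rule filterlim_mono[OF filterlim_filtercomap order_refl inf_le1])
    moreover have "((\<lambda>x. x i) \<longlongrightarrow> L i) (nhds L)"
    proof (rule topological_tendstoI)
      fix S :: "real set" assume S: "open S" "L i \<in> S"
      have "open ((\<lambda>x. x i) -` S)"
        by (rule open_vimage[OF S(1)]) (rule continuous_on_product_coordinates)
      then show "\<forall>\<^sub>F x in nhds L. x i \<in> S" using S(2) by (auto simp: eventually_nhds)
    qed
    ultimately show ?thesis using filterlim_compose[of "\<lambda>x. x i" "nhds (L i)" "nhds L" e G] by simp
  qed
  ultimately show ?thesis using that by blast
qed

section \<open>Clopen sets and measures carried by an orbit\<close>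

definition clopens :: "('m) sft_scheme \<Rightarrow> biseq set set" where
  "clopens B = {U. U \<subseteq> spts B \<and> openin (top_of_set (spts B)) U \<and> openin (top_of_set (spts B)) (spts B - U)}"

lemma algebra_clopens: "algebra (spts B) (clopens B)"
  unfolding algebra_iff_Un
proof (intro conjI ballI)
  show "clopens B \<subseteq> Pow (spts B)" by (auto simp: clopens_def)
  show "{} \<in> clopens B" by (simp add: clopens_def)
  show "spts B - U \<in> clopens B" if "U \<in> clopens B" for U
    using that by (auto simp: clopens_def double_diff)
  show "U \<union> V \<in> clopens B" if "U \<in> clopens B" "V \<in> clopens B" for U V
  proof -
    have "spts B - (U \<union> V) = (spts B - U) \<inter> (spts B - V)" by blast
    then show ?thesis using that by (simp add: clopens_def openin_Un openin_Int)
  qed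
qed

lemma clopen_determined:
  assumes "U \<subseteq> spts B" "\<And>x y. x \<in> U \<Longrightarrow> y \<in> spts B \<Longrightarrow> (\<And>n. \<bar>n\<bar> < int k \<Longrightarrow> y n = x n) \<Longrightarrow> y \<in> U"
  shows "U \<in> clopens B"
proof -
  have op: "openin (top_of_set (spts B)) V"
    if "V \<subseteq> spts B" "\<And>x y. x \<in> V \<Longrightarrow> y \<in> spts B \<Longrightarrow> (\<And>n. \<bar>n\<bar> < int k \<Longrightarrow> y n = x n) \<Longrightarrow> y \<in> V" for V
  proof -
    have "V = spts B \<inter> (\<Union>x\<in>V. {y. \<forall>n. \<bar>n\<bar> < int k \<longrightarrow> y n = x n})"
      using that by auto
    moreover have "open (\<Union>x\<in>V. {y::biseq. \<forall>n. \<bar>n\<bar> < int k \<longrightarrow> y n = x n})"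
      by (intro open_UN ballI open_cylinder)
    ultimately show ?thesis unfolding openin_open by blast
  qed
  have "openin (top_of_set (spts B)) (spts B - U)"
  proof (rule op)
    fix x y assume "x \<in> spts B - U" "y \<in> spts B" and e: "\<And>n. \<bar>n\<bar> < int k \<Longrightarrow> y n = x n"
    then show "y \<in> spts B - U" using assms(2)[of y x] by auto
  qed auto
  then show ?thesis using op[OF assms] assms(1) by (simp add: clopens_def)
qed

lemma open_eq_UN_clopens:
  assumes "openin (top_of_set (spts B)) U"
  obtains V :: "nat \<Rightarrow> biseq set" where "\<And>k. V k \<in> clopens B" "U = (\<Union>k. V k)"
proof
  obtain W where W: "open W" "U = spts B \<inter> W" using assms unfolding openin_open by blast
  define V where "V k = {x \<in> spts B. \<forall>y\<in>spts B. (\<forall>n. \<bar>n\<bar> < int k \<longrightarrow> y n = x n) \<longrightarrow> y \<in> U}" for k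
  show "V k \<in> clopens B" for k
  proof (rule clopen_determined[of _ _ k])
    fix x y assume x: "x \<in> V k" and y: "y \<in> spts B" and e: "\<And>n. \<bar>n\<bar> < int k \<Longrightarrow> y n = x n"
    show "y \<in> V k" unfolding V_def
    proof (intro CollectI conjI ballI impI y)
      fix z assume "z \<in> spts B" "\<forall>n. \<bar>n\<bar> < int k \<longrightarrow> z n = y n"
      then show "z \<in> U" using x e by (simp add: V_def)
    qed
  qed (auto simp: V_def)
  show "U = (\<Union>k. V k)"
  proof (intro subset_antisym subsetI)
    fix x assume x: "x \<in> U"
    then have "x \<in> W" "x \<in> spts B" using W by auto
    from open_contains_cylinder[OF W(1) this(1)] obtain k where
      k: "\<And>y. (\<And>n. \<bar>n\<bar> < int k \<Longrightarrow> y n = x n) \<Longrightarrow> y \<in> W" by blast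
    then have "x \<in> V k" using W(2) \<open>x \<in> spts B\<close> by (simp add: V_def)
    then show "x \<in> (\<Union>k. V k)" by blast
  qed (auto simp: V_def)
qed

lemma sigma_clopens:
  "sigma_sets (spts B) (clopens B) = sigma_sets (spts B) {U. openin (top_of_set (spts B)) U}"
proof (rule sigma_sets_eqI)
  fix U assume "U \<in> clopens B"
  then show "U \<in> sigma_sets (spts B) {U. openin (top_of_set (spts B)) U}"
    by (intro sigma_sets.Basic) (simp add: clopens_def)
next
  fix U assume "U \<in> {U. openin (top_of_set (spts B)) U}"
  then have "openin (top_of_set (spts B)) U" by simp
  then obtain V :: "nat \<Rightarrow> biseq set" where V: "\<And>k. V k \<in> clopens B" "U = (\<Union>k. V k)"
    by (rule open_eq_UN_clopens) (rule that)
  have "V k \<in> sigma_sets (spts B) (clopens B)" for k by (rule sigma_sets.Basic[OF V(1)])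
  then show "U \<in> sigma_sets (spts B) (clopens B)" unfolding V(2) by (rule sigma_sets.Union)
qed

lemma shift_clopens:
  assumes "U \<in> clopens B" shows "shift 1 -` U \<inter> spts B \<in> clopens B"
proof -
  have op: "openin (top_of_set (spts B)) (shift 1 -` V \<inter> spts B)" if V: "openin (top_of_set (spts B)) V" for V
  proof -
    have "openin (top_of_set (spts B)) (spts B \<inter> shift 1 -` V)"
      by (rule continuous_openin_preimage[OF continuous_on_shift _ V]) auto
    then show ?thesis by (simp only: Int_commute)
  qed
  have eq: "spts B - (shift 1 -` U \<inter> spts B) = shift 1 -` (spts B - U) \<inter> spts B"
    by (intro set_eqI) (simp, blast)
  have U: "openin (top_of_set (spts B)) U" "openin (top_of_set (spts B)) (spts B - U)"
    using assms unfolding clopens_def by blast+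
  show ?thesis unfolding clopens_def
    by (intro CollectI conjI Int_lower2 op[OF U(1)]) (unfold eq, rule op[OF U(2)])
qed

text \<open>Clopen sets are compact, so a decreasing sequence with empty intersection is empty from
  some index on. This is the continuity at the empty set that Caratheodory's extension asks
  for.\<close>

lemma decseq_clopens_empty:
  assumes "range A \<subseteq> clopens B" "decseq A" "(\<Inter>i. A i) = {}"
  shows "\<exists>N. A N = {}"
proof (rule ccontr)
  assume "\<not> ?thesis"
  then have "\<forall>n. \<exists>x. x \<in> A n" by blast
  then obtain x where x: "\<And>n. x n \<in> A n" by metis
  have cl: "A n \<subseteq> spts B" "openin (top_of_set (spts B)) (spts B - A n)" for n
    using assms(1) by (auto simp: clopens_def)
  have "\<forall>n. x n \<in> spts B" using x cl(1) by blast
  with compact_imp_seq_compact[OF compact_spts, of B] obtain l r where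
    l: "l \<in> spts B" and r: "strict_mono r" and lim: "(x \<circ> r) \<longlonglongrightarrow> l" unfolding seq_compact_def by meson
  have "l \<in> A n" for n
  proof (rule ccontr)
    assume "l \<notin> A n"
    obtain W where W: "open W" "spts B - A n = spts B \<inter> W" using cl(2)[of n] unfolding openin_open by blast
    have "l \<in> W" using W(2) l \<open>l \<notin> A n\<close> by blast
    from topological_tendstoD[OF lim W(1) this] obtain N where N: "\<And>k. k \<ge> N \<Longrightarrow> x (r k) \<in> W"
      unfolding eventually_sequentially by auto
    have "n \<le> r (N + n)" using strict_mono_imp_increasing[OF r, of "N + n"] by simp
    then have "x (r (N + n)) \<in> A n" using x[of "r (N + n)"] assms(2) by (auto simp: decseq_def)
    moreover have "x (r (N + n)) \<in> W" by (rule N) simp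
    ultimately show False using W(2) cl(1)[of n] by blast
  qed
  then show False using assms(3) by blast
qed

text \<open>Krylov--Bogoliubov: a cluster point of the empirical measures of an orbit, as functions on
  sets, is finitely additive and hence, by compactness, countably additive on clopen sets.\<close>

lemma orbit_measure:
  assumes rate: "rate B > 0" and y: "y \<in> spts B"
  obtains \<mu> where "\<mu> \<in> invariant_measures B"
    "\<And>U. U \<in> clopens B \<Longrightarrow> (\<And>j::nat. shift (int j) y \<notin> U) \<Longrightarrow> emeasure \<mu> U = 0"
proof -
  define e where "e n U = (\<Sum>j<Suc n. indicator U (shift (int j) y)) / real (Suc n)" for n and U :: "biseq set"
  have e01: "e n U \<in> {0..1}" for n U
  proof -
    have "(\<Sum>j<Suc n. indicator U (shift (int j) y)) \<le> (\<Sum>j<Suc n. 1 :: real)"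
      by (intro sum_mono) (simp add: indicator_def)
    then have "(\<Sum>j<Suc n. indicator U (shift (int j) y)) \<le> real (Suc n)" by simp
    moreover have "0 \<le> (\<Sum>j<Suc n. indicator U (shift (int j) y) :: real)" by (intro sum_nonneg) simp
    ultimately show ?thesis unfolding e_def by (simp only: atLeastAtMost_iff) (simp del: sum.lessThan_Suc)
  qed
  obtain G L where G: "G \<noteq> bot" "G \<le> sequentially" and L: "\<And>U. ((\<lambda>n. e n U) \<longlongrightarrow> L U) G"
    by (rule filter_cluster[of e, OF e01]) (rule that)
  have uniq: "L U = c" if "((\<lambda>n. e n U) \<longlongrightarrow> c) G" for U c
    by (rule tendsto_unique[OF G(1) L that])
  have L_nn: "0 \<le> L U" for U
    by (rule tendsto_lowerbound[OF L _ G(1)]) (use e01 in simp)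
  have L_empty: "L {} = 0" by (rule uniq) (simp add: e_def)
  have L_un: "L (U \<union> V) = L U + L V" if "U \<inter> V = {}" for U V
  proof (rule uniq)
    have "e n (U \<union> V) = e n U + e n V" for n
      unfolding e_def by (simp only: indicator_add[OF that, symmetric] sum.distrib add_divide_distrib)
    then show "((\<lambda>n. e n (U \<union> V)) \<longlongrightarrow> L U + L V) G" using tendsto_add[OF L L] by simp
  qed
  have L_top: "L (spts B) = 1"
  proof (rule uniq)
    have "e n (spts B) = 1" for n using y by (simp add: e_def del: sum.lessThan_Suc)
    then show "((\<lambda>n. e n (spts B)) \<longlongrightarrow> 1) G" by simp
  qed
  \<comment> \<open>The empirical sums of a set and of its preimage differ in their first and last
    terms only.\<close>
  have L_shift: "L (shift 1 -` U \<inter> spts B) = L U" for U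
  proof (rule uniq)
    have b: "norm (e n (shift 1 -` U \<inter> spts B) - e n U) \<le> 1 * (1 / real (Suc n))" for n
    proof -
      let ?i = "\<lambda>j. indicator U (shift (int j) y) :: real"
      have "(\<Sum>j<Suc n. indicator (shift 1 -` U \<inter> spts B) (shift (int j) y)) = (\<Sum>j<Suc n. ?i (Suc j))"
        using y by (intro sum.cong) (auto simp: indicator_def algebra_simps)
      also have "\<dots> = (\<Sum>j<Suc n. ?i j) + ?i (Suc n) - ?i 0"
        using sum.lessThan_Suc_shift[of ?i "Suc n"] by simp
      finally have "e n (shift 1 -` U \<inter> spts B) - e n U = (?i (Suc n) - ?i 0) / real (Suc n)"
        unfolding e_def by (simp only: diff_divide_distrib add_divide_distrib)
      moreover have "\<bar>?i (Suc n) - ?i 0\<bar> \<le> 1" by (auto simp: indicator_def)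
      ultimately show ?thesis by (simp only: real_norm_def abs_divide abs_of_nat) (simp add: divide_right_mono)
    qed
    have s: "(\<lambda>n. 1 * (1 / real (Suc n))) \<longlonglongrightarrow> 0"
      using tendsto_mult_right_zero[OF LIMSEQ_Suc[OF lim_1_over_n], of 1] by simp
    have "(\<lambda>n. e n (shift 1 -` U \<inter> spts B) - e n U) \<longlonglongrightarrow> 0"
      by (rule Lim_null_comparison[OF always_eventually[OF allI[OF b]] s])
    then have "((\<lambda>n. e n (shift 1 -` U \<inter> spts B) - e n U) \<longlongrightarrow> 0) G" by (rule tendsto_mono[OF G(2)])
    from tendsto_add[OF this L[of U]] show "((\<lambda>n. e n (shift 1 -` U \<inter> spts B)) \<longlongrightarrow> L U) G" by simp
  qed
  interpret algebra "spts B" "clopens B" by (rule algebra_clopens)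
  define F where "F U = ennreal (L U)" for U
  have "\<exists>\<mu>'. (\<forall>s\<in>clopens B. \<mu>' s = F s) \<and> measure_space (spts B) (sigma_sets (spts B) (clopens B)) \<mu>'"
  proof (rule caratheodory_empty_continuous)
    show "positive (clopens B) F" by (simp add: positive_def F_def L_empty)
    show "additive (clopens B) F" by (simp add: additive_def F_def L_un ennreal_plus L_nn)
    show "F A \<noteq> \<infinity>" for A by (simp add: F_def)
    fix A :: "nat \<Rightarrow> biseq set" assume A: "range A \<subseteq> clopens B" "decseq A" "(\<Inter>i. A i) = {}"
    from decseq_clopens_empty[OF A] obtain N where "A N = {}" by blast
    then have "A n = {}" if "n \<ge> N" for n using A(2) that unfolding decseq_def by blast
    then have "\<forall>\<^sub>F n in sequentially. F (A n) = 0"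
      unfolding eventually_sequentially by (auto simp: F_def L_empty intro!: exI[of _ N])
    then show "(\<lambda>i. F (A i)) \<longlonglongrightarrow> 0" by (rule tendsto_eventually)
  qed
  then obtain \<mu>' where \<mu>': "\<And>s. s \<in> clopens B \<Longrightarrow> \<mu>' s = F s"
    "measure_space (spts B) (sigma_sets (spts B) (clopens B)) \<mu>'" by blast
  define \<mu> where "\<mu> = measure_of (spts B) (clopens B) \<mu>'"
  have cp: "clopens B \<subseteq> Pow (spts B)" by (rule space_closed)
  have sp: "space \<mu> = spts B" and st: "sets \<mu> = sigma_sets (spts B) (clopens B)"
    unfolding \<mu>_def by (rule space_measure_of[OF cp], rule sets_measure_of[OF cp])
  have em: "emeasure \<mu> U = F U" if "U \<in> clopens B" for U
  proof -
    have "emeasure \<mu> U = \<mu>' U"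
    proof (rule emeasure_measure_of[OF \<mu>_def cp])
      show "positive (sets \<mu>) \<mu>'" "countably_additive (sets \<mu>) \<mu>'" using \<mu>'(2) by (auto simp: st measure_space_def)
      show "U \<in> sets \<mu>" using that by (auto simp: st)
    qed
    then show ?thesis using \<mu>'(1)[OF that] by simp
  qed
  have meas: "shift 1 \<in> measurable \<mu> \<mu>"
  proof (rule measurable_sigma_sets[OF st cp])
    show "shift 1 \<in> space \<mu> \<rightarrow> spts B" by (simp add: sp)
    show "shift 1 -` U \<inter> space \<mu> \<in> sets \<mu>" if "U \<in> clopens B" for U
      using shift_clopens[OF that] by (auto simp: st sp)
  qed
  have "distr \<mu> \<mu> (shift 1) = \<mu>"
  proof (rule measure_eqI_generator_eq[where E = "clopens B" and \<Omega> = "spts B" and A = "\<lambda>_. spts B"])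
    show "Int_stable (clopens B)" by (rule Int_stableI) (rule Int)
    show "clopens B \<subseteq> Pow (spts B)" by (rule cp)
    show "emeasure (distr \<mu> \<mu> (shift 1)) U = emeasure \<mu> U" if "U \<in> clopens B" for U
    proof -
      have "emeasure (distr \<mu> \<mu> (shift 1)) U = emeasure \<mu> (shift 1 -` U \<inter> space \<mu>)"
        using that by (intro emeasure_distr meas) (auto simp: st)
      also have "\<dots> = F U" unfolding sp em[OF shift_clopens[OF that]] by (simp add: F_def L_shift)
      finally show ?thesis by (simp add: em[OF that])
    qed
    show "emeasure (distr \<mu> \<mu> (shift 1)) (spts B) \<noteq> \<infinity>"
      using emeasure_distr[OF meas, of "spts B"] top by (simp add: st sp em F_def vimage_def)
  qed (use top in \<open>auto simp: st\<close>)
  moreover have "prob_space \<mu>"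
    by (rule prob_spaceI) (simp add: sp em[OF top] F_def L_top)
  ultimately have "\<mu> \<in> invariant_measures B"
    unfolding invariant_measures_def using sp st by (simp add: stop_eq[OF rate] sigma_clopens)
  moreover have "emeasure \<mu> U = 0" if "U \<in> clopens B" "\<And>j::nat. shift (int j) y \<notin> U" for U
  proof -
    have "L U = 0" by (rule uniq) (simp add: e_def that(2))
    then show ?thesis by (simp add: em[OF that(1)] F_def)
  qed
  ultimately show ?thesis using that by blast
qed

section \<open>The maximal Lyapunov exponent\<close>

lemma invariant_measuresD:
  assumes "rate B > 0" "\<mu> \<in> invariant_measures B"
  shows "prob_space \<mu>" "space \<mu> = spts B" "distr \<mu> \<mu> (shift 1) = \<mu>"
    "sets \<mu> = sigma_sets (spts B) {U. openin (top_of_set (spts B)) U}"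
  using assms(2) by (auto simp: invariant_measures_def stop_eq[OF assms(1)])

lemma measurable_of_continuous:
  fixes h :: "biseq \<Rightarrow> real"
  assumes "rate B > 0" "\<mu> \<in> invariant_measures B" "continuous_on (spts B) h"
  shows "h \<in> borel_measurable \<mu>"
proof (rule borel_measurableI)
  fix S :: "real set" assume S: "open S"
  have "openin (top_of_set (spts B)) (spts B \<inter> h -` S)"
    by (rule continuous_openin_preimage_gen[OF assms(3) S])
  then show "h -` S \<inter> space \<mu> \<in> sets \<mu>"
    unfolding invariant_measuresD(2,4)[OF assms(1,2)] by (auto simp: Int_commute)
qed

lemma measurable_shift:
  assumes "rate B > 0" "\<mu> \<in> invariant_measures B"
  shows "shift 1 \<in> measurable \<mu> \<mu>"
proof (rule measurable_sigma_sets[OF invariant_measuresD(4)[OF assms]])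
  show "{U. openin (top_of_set (spts B)) U} \<subseteq> Pow (spts B)" by (auto dest: openin_imp_subset)
  show "shift 1 \<in> space \<mu> \<rightarrow> spts B" by (simp add: invariant_measuresD(2)[OF assms])
  fix U assume "U \<in> {U. openin (top_of_set (spts B)) U}"
  then have "openin (top_of_set (spts B)) (spts B \<inter> shift 1 -` U)"
    by (intro continuous_openin_preimage[OF continuous_on_shift]) auto
  then show "shift 1 -` U \<inter> space \<mu> \<in> sets \<mu>"
    unfolding invariant_measuresD(4)[OF assms] invariant_measuresD(2)[OF assms]
    by (intro sigma_sets.Basic) (simp add: Int_commute)
qed

lemma funpow_shift: "(shift 1 ^^ n) x = shift (int n) x"
  by (induction n) (simp_all add: add.commute)

context spann
begin

definition "F n x = ln (norm (An n x))"
definition "lyap \<mu> = (\<integral>x. lim (\<lambda>n. F n x / real n) \<partial>\<mu>)"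

lemma norm_An_bounds:
  assumes x: "x \<in> spts B"
  shows "norm (An (i + n) x) \<le> norm (An n (shift (int i) x)) * norm (An i x)"
    "norm (An i x) \<le> K ^ n * norm (An (i + n) x)"
    "norm (An n (shift (int i) x)) \<le> K ^ i * norm (An (i + n) x)"
proof -
  have e: "An (i + n) x = An n (shift (int i) x) o\<^sub>L An i x"
    using cpr_add[of 1 A n i x] by (simp add: add.commute)
  show "norm (An (i + n) x) \<le> norm (An n (shift (int i) x)) * norm (An i x)"
    unfolding e by (rule norm_blinfun_compose)
  have s: "shift (int i) x \<in> spts B" using x by simp
  have "An i x = cpi 1 Ai n (shift (int i) x) o\<^sub>L An (i + n) x"
    unfolding e by (rule compose_cancel[OF S.cpi_cpr[OF s], symmetric])
  then show "norm (An i x) \<le> K ^ n * norm (An (i + n) x)"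
    using norm_compose_le[OF S.norm_cpi_le[OF s, of n] order_refl] by metis
  have "An n (shift (int i) x) = An (i + n) x o\<^sub>L cpi 1 Ai i x"
    unfolding e by (simp add: compose_assoc S.cpr_cpi[OF x])
  then show "norm (An n (shift (int i) x)) \<le> K ^ i * norm (An (i + n) x)"
    using norm_compose_le[OF order_refl S.norm_cpi_le[OF x, of i], of "An (i + n) x"] by (simp add: mult.commute)
qed

lemma ln_le_of_le: "0 < p \<Longrightarrow> 0 < c \<Longrightarrow> 0 < w \<Longrightarrow> p \<le> c * w \<Longrightarrow> ln p \<le> ln c + ln w" for p c w :: real
  using ln_mono[of p "c * w"] by (simp add: ln_mult_pos)

text \<open>The bounded inverse matrices make all the bounds two-sided and valid at every point, as
  \<open>subadd_process\<close> demands.\<close>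

lemma F_props:
  assumes x: "x \<in> spts B"
  shows "\<bar>F n x\<bar> \<le> ln K * real n" "F (i + n) x \<le> F i x + F n (shift (int i) x)"
    "\<bar>F n (shift 1 x) - F (Suc n) x\<bar> \<le> ln K" "\<bar>F (Suc n) x - F n x\<bar> \<le> ln K"
proof -
  have K: "0 < K" using S.K_ge1 by simp
  then have Kn: "0 < K ^ n" by simp
  have s: "shift (int j) x \<in> spts B" for j using x by simp
  have s1: "shift 1 x \<in> spts B" using x by simp
  note p = norm_An_pos[OF x] and ps = norm_An_pos[OF s] and p1 = norm_An_pos[OF s1]
  have "norm (An n x) \<le> K ^ n" by (rule S.norm_cpr_le[OF x])
  then have "F n x \<le> ln (K ^ n)" unfolding F_def by (rule ln_mono) (rule p)
  moreover have "1 \<le> K ^ n * norm (An n x)" using norm_An_bounds(2)[OF x, of 0 n] by simp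
  then have "ln 1 \<le> ln (K ^ n) + F n x" unfolding F_def by (rule ln_le_of_le[OF zero_less_one Kn p])
  ultimately show "\<bar>F n x\<bar> \<le> ln K * real n" using K by (simp add: ln_realpow abs_le_iff mult.commute)
  have "ln (norm (An (i + n) x)) \<le> ln (norm (An n (shift (int i) x))) + ln (norm (An i x))"
    by (rule ln_le_of_le[OF p ps p norm_An_bounds(1)[OF x]])
  then show "F (i + n) x \<le> F i x + F n (shift (int i) x)" by (simp add: F_def)
  have A1: "norm (An 1 z) \<le> K" if "z \<in> spts B" for z using S.norm_cpr_le[OF that, of 1] by simp
  have Ki: "K ^ 1 = K" by simp
  have "norm (An n (shift (int 1) x)) \<le> K ^ 1 * norm (An (1 + n) x)" by (rule norm_An_bounds(3)[OF x])
  then have "norm (An n (shift 1 x)) \<le> K * norm (An (Suc n) x)" by (simp only: Ki plus_1_eq_Suc of_nat_1)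
  then have 1: "F n (shift 1 x) \<le> ln K + F (Suc n) x" unfolding F_def by (rule ln_le_of_le[OF p1 K p])
  have "norm (An (1 + n) x) \<le> norm (An n (shift (int 1) x)) * norm (An 1 x)" by (rule norm_An_bounds(1)[OF x])
  also have "\<dots> \<le> norm (An n (shift (int 1) x)) * K" by (intro mult_left_mono A1 x) simp
  finally have "norm (An (Suc n) x) \<le> K * norm (An n (shift 1 x))" by (simp only: plus_1_eq_Suc of_nat_1 mult.commute)
  then have "F (Suc n) x \<le> ln K + F n (shift 1 x)" unfolding F_def by (rule ln_le_of_le[OF p K p1])
  with 1 show "\<bar>F n (shift 1 x) - F (Suc n) x\<bar> \<le> ln K" by (simp add: abs_le_iff)
  have "norm (An n x) \<le> K ^ 1 * norm (An (n + 1) x)" by (rule norm_An_bounds(2)[OF x])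
  then have "norm (An n x) \<le> K * norm (An (Suc n) x)" by (simp only: Ki Suc_eq_plus1)
  then have 2: "F n x \<le> ln K + F (Suc n) x" unfolding F_def by (rule ln_le_of_le[OF p K p])
  have "norm (An (n + 1) x) \<le> norm (An 1 (shift (int n) x)) * norm (An n x)" by (rule norm_An_bounds(1)[OF x])
  also have "\<dots> \<le> K * norm (An n x)" by (intro mult_right_mono A1 s) simp
  finally have "norm (An (Suc n) x) \<le> K * norm (An n x)" by (simp only: Suc_eq_plus1)
  then have "F (Suc n) x \<le> ln K + F n x" unfolding F_def by (rule ln_le_of_le[OF p K p])
  with 2 show "\<bar>F (Suc n) x - F n x\<bar> \<le> ln K" by (simp add: abs_le_iff)
qed

lemma F_meas: assumes "\<mu> \<in> invariant_measures B" shows "F n \<in> borel_measurable \<mu>"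
proof (rule measurable_of_continuous[OF S.rate_pos assms])
  show "continuous_on (spts B) (F n)" unfolding F_def
    by (intro continuous_on_ln continuous_on_norm S.cpr_continuous) (use norm_An_pos in fastforce)
qed

lemma F_process: assumes "\<mu> \<in> invariant_measures B" shows "subadd_process \<mu> (shift 1) F (ln K)"
proof -
  note D = invariant_measuresD[OF S.rate_pos assms]
  interpret prob_space \<mu> by (rule D(1))
  show ?thesis
    by unfold_locales
      (use F_props D S.K_ge1 F_meas[OF assms] measurable_shift[OF S.rate_pos assms] in \<open>auto simp: funpow_shift\<close>)
qed

lemma F_le: assumes "x \<in> spts B" shows "F n x \<le> ln C2 + b * real n"
proof -
  have "norm (An n x) \<le> C2 * exp (b * real n)" by (rule order_trans[OF le_M[OF assms] M_le_exp])
  then have "F n x \<le> ln C2 + ln (exp (b * real n))" unfolding F_def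
    by (rule ln_le_of_le[OF norm_An_pos[OF assms], rotated 2]) (use C2_ge1 in auto)
  then show ?thesis by simp
qed

lemma avg_upper:
  assumes "x \<in> spts B" "1 \<le> n" shows "F n x / real n \<le> ln C2 * (1 / real n) + b"
proof -
  have "F n x / real n \<le> (ln C2 + b * real n) / real n" by (intro divide_right_mono F_le assms) auto
  then show ?thesis using assms(2) by (simp add: add_divide_distrib)
qed

lemma avg_bounds:
  assumes "c * 1 + b * real n \<le> p" "1 \<le> n" shows "c * (1 / real n) + b \<le> p / real n"
  using assms by (simp add: pos_le_divide_eq distrib_right)

lemma C2_avg_tendsto: "(\<lambda>n. c * (1 / real n) + b) \<longlonglongrightarrow> b"
  using tendsto_add[OF tendsto_mult_right_zero[OF lim_1_over_n, of c] tendsto_const[of b]] by simp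

lemma lyap_le: assumes \<mu>: "\<mu> \<in> invariant_measures B" shows "lyap \<mu> \<le> b"
proof -
  interpret subadd_process \<mu> "shift 1" F "ln K" by (rule F_process[OF \<mu>])
  note sp = invariant_measuresD(2)[OF S.rate_pos \<mu>]
  \<comment> \<open>Where the averages diverge, \<open>lim\<close> has no meaning;
    \<open>kingman\<close> shows that this is a null set.\<close>
  have lim: "AE x in \<mu>. lim (\<lambda>n. F n x / real n) = gu x"
    using kingman by eventually_elim (rule limI)
  have "lyap \<mu> = (\<integral>x. gu x \<partial>\<mu>)"
    unfolding lyap_def by (rule integral_cong_AE) (use lim F_meas[OF \<mu>] in measurable)
  also have "\<dots> \<le> b"
  proof (rule integral_le_const)
    show "integrable \<mu> gu" using gu_bd by (intro integrable_bounded) auto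
    show "AE x in \<mu>. gu x \<le> b"
    proof (rule AE_I2)
      fix x assume x: "x \<in> space \<mu>"
      have "rl (\<lambda>n. F (Suc n) x / real (Suc n)) \<le> rl (\<lambda>n. 0) + b"
      proof (rule rl_mono_const)
        show "bddseq (\<lambda>n. F (Suc n) x / real (Suc n))"
          using avg_bd[OF x, of "Suc n" for n] unfolding bddseq_def by blast
        show "F (Suc n) x / real (Suc n) \<le> 0 + b + ln C2 * (1 / real (Suc n))" for n
          using avg_upper[of x "Suc n"] x sp by (simp only: le_add1 plus_1_eq_Suc add_0 add.commute)
        show "(\<lambda>n. ln C2 * (1 / real (Suc n))) \<longlonglongrightarrow> 0" by (rule inverse_Suc_tendsto)
      qed simp
      then show "gu x \<le> b" unfolding gu_def using rl_Suc[of "\<lambda>n. F n x / real n"] by simp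
    qed
  qed
  finally show ?thesis .
qed

text \<open>The points at which the growth bound fails for a given \<open>n\<close> form an open
  set, a countable union of clopen sets that the maximizing orbit never meets, hence a null set of
  its orbit measure. For almost every point the bound thus holds for all \<open>n\<close>, and with
  the general upper bound the averages converge to \<open>b\<close>.\<close>

lemma lyap_attained: "\<exists>\<mu>\<in>invariant_measures B. lyap \<mu> = b"
proof -
  define Cq where "Cq = N0 * Ck * Cu"
  have Cq: "Cq > 0" unfolding Cq_def using N0_ge1 Ck_ge1 Cu_ge1 by simp
  obtain y where y: "y \<in> spts B" "\<And>j n. exp (b * real n) \<le> Cq * norm (An n (shift (int j) y))"
    using maximizing_orbit unfolding Cq_def by blast
  obtain \<mu> where \<mu>: "\<mu> \<in> invariant_measures B"
    "\<And>U. U \<in> clopens B \<Longrightarrow> (\<And>j::nat. shift (int j) y \<notin> U) \<Longrightarrow> emeasure \<mu> U = 0"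
    by (rule orbit_measure[OF S.rate_pos y(1)]) (rule that, assumption, blast)
  interpret subadd_process \<mu> "shift 1" F "ln K" by (rule F_process[OF \<mu>(1)])
  note sp = invariant_measuresD(2)[OF S.rate_pos \<mu>(1)] and st = invariant_measuresD(4)[OF S.rate_pos \<mu>(1)]
  define h where "h n x = Cq * norm (An n x)" for n x
  have hc: "continuous_on (spts B) (h n)" for n
    unfolding h_def by (intro continuous_on_mult continuous_on_const continuous_on_norm S.cpr_continuous)
  have "AE x in \<mu>. exp (b * real n) \<le> h n x" for n
  proof -
    have "openin (top_of_set (spts B)) (spts B \<inter> h n -` {..<exp (b * real n)})"
      by (rule continuous_openin_preimage_gen[OF hc]) simp
    then obtain V where V: "\<And>k::nat. V k \<in> clopens B"
      "spts B \<inter> h n -` {..<exp (b * real n)} = (\<Union>k. V k)" by (rule open_eq_UN_clopens) (rule that)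
    have "emeasure \<mu> (V k) = 0" for k
    proof (rule \<mu>(2)[OF V(1)])
      fix j :: nat
      show "shift (int j) y \<notin> V k"
      proof
        assume "shift (int j) y \<in> V k"
        then have "h n (shift (int j) y) < exp (b * real n)" using V(2) by blast
        then show False using y(2)[of n j] by (simp add: h_def)
      qed
    qed
    then have "V k \<in> null_sets \<mu>" for k
      using V(1)[of k] by (auto simp: null_sets_def st sigma_clopens[symmetric])
    then have "(\<Union>k. V k) \<in> null_sets \<mu>" by (intro null_sets_UN) auto
    then show ?thesis
    proof (rule AE_I')
      show "{x \<in> space \<mu>. \<not> exp (b * real n) \<le> h n x} \<subseteq> (\<Union>k. V k)"
        unfolding V(2)[symmetric] sp by (auto simp: not_le)
    qed
  qed
  then have ae: "AE x in \<mu>. \<forall>n. exp (b * real n) \<le> h n x" by (simp add: AE_all_countable)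
  have "AE x in \<mu>. lim (\<lambda>n. F n x / real n) = b"
    using ae AE_space
  proof eventually_elim
    case (elim x)
    then have x: "x \<in> spts B" using sp by simp
    have lo: "b * real n - ln Cq \<le> F n x" for n
    proof -
      have "ln (exp (b * real n)) \<le> ln Cq + ln (norm (An n x))"
        using elim(1) Cq norm_An_pos[OF x, of n] by (intro ln_le_of_le) (auto simp: h_def)
      then show ?thesis by (simp add: F_def)
    qed
    have "(\<lambda>n. F n x / real n) \<longlonglongrightarrow> b"
    proof (rule tendsto_sandwich)
      show "(\<lambda>n. (- ln Cq) * (1 / real n) + b) \<longlonglongrightarrow> b" "(\<lambda>n. ln C2 * (1 / real n) + b) \<longlonglongrightarrow> b"
        by (rule C2_avg_tendsto)+
      show "\<forall>\<^sub>F n in sequentially. (- ln Cq) * (1 / real n) + b \<le> F n x / real n"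
        unfolding eventually_sequentially
      proof (intro exI[of _ 1] allI impI)
        fix n :: nat assume n: "1 \<le> n"
        show "(- ln Cq) * (1 / real n) + b \<le> F n x / real n" using lo[of n] n by (intro avg_bounds) auto
      qed
      show "\<forall>\<^sub>F n in sequentially. F n x / real n \<le> ln C2 * (1 / real n) + b"
        unfolding eventually_sequentially
      proof (intro exI[of _ 1] allI impI)
        fix n :: nat assume n: "1 \<le> n"
        show "F n x / real n \<le> ln C2 * (1 / real n) + b" by (rule avg_upper[OF x n])
      qed
    qed
    then show ?case by (rule limI)
  qed
  then have "lyap \<mu> = (\<integral>x. b \<partial>\<mu>)"
    unfolding lyap_def by (intro integral_cong_AE) (use F_meas[OF \<mu>(1)] in measurable)
  then have "lyap \<mu> = b" by (simp add: prob_space)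
  with \<mu>(1) show ?thesis by blast
qed

lemma max_lyap_eq: "(SUP \<mu>\<in>invariant_measures B. lyap \<mu>) = b"
proof (rule antisym)
  show "(SUP \<mu>\<in>invariant_measures B. lyap \<mu>) \<le> b"
    by (rule cSUP_least) (use lyap_attained lyap_le in auto)
  obtain \<mu> where \<mu>: "\<mu> \<in> invariant_measures B" "lyap \<mu> = b" using lyap_attained by blast
  have "lyap \<mu> \<le> (SUP \<mu>\<in>invariant_measures B. lyap \<mu>)"
    by (rule cSUP_upper[OF \<mu>(1)]) (auto intro: bdd_aboveI2 lyap_le)
  then show "b \<le> (SUP \<mu>\<in>invariant_measures B. lyap \<mu>)" using \<mu>(2) by simp
qed

end

section \<open>Trivialization of the bundle\<close>

definition agree :: "nat \<Rightarrow> biseq \<Rightarrow> biseq \<Rightarrow> bool" where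
  "agree k x y \<longleftrightarrow> (\<forall>n. \<bar>n\<bar> < int k \<longrightarrow> y n = x n)"

lemma agree_refl [simp]: "agree k x x"
  by (simp add: agree_def)

lemma agree_mono: "agree k x y \<Longrightarrow> j \<le> k \<Longrightarrow> agree j x y"
  by (simp add: agree_def)

lemma agree_shift: "agree (Suc k) x y \<Longrightarrow> agree k (shift 1 x) (shift 1 y)"
  by (auto simp: agree_def shift_def)

lemma not_agree_sdist:
  assumes "rate B > 0" "\<not> agree k x y" shows "exp (- rate B * real k) \<le> sdist B x y"
  using assms(2) sdist_le_iff[OF assms(1), of x y k] unfolding agree_def by (metis linear)

locale vbundle =
  fixes B :: "('e, 'd::finite) hbundle"
  assumes setting: "bundle_setting B"
begin

lemma rate_pos: "rate B > 0" and nonempty: "spts B \<noteq> {}" and hexp_pos: "hexp B > 0"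
  and hvb: "holder_vector_bundle B" and tf: "transport_family B"
  and riem: "riemannian_norm B (rnorm B)"
  using setting unfolding bundle_setting_def by blast+

lemma stop_top: "stop B = top_of_set (spts B)"
  by (rule stop_eq[OF rate_pos])

lemma proj_cont: "continuous_map (tot B) (top_of_set (spts B)) (proj B)"
  using hvb unfolding holder_vector_bundle_def stop_top by blast

lemma cdom_cover: "(\<Union>i<nch B. cdom B i) = spts B"
  using hvb unfolding holder_vector_bundle_def by blast

lemma cdom_open: "i < nch B \<Longrightarrow> openin (top_of_set (spts B)) (cdom B i)"
  using hvb unfolding holder_vector_bundle_def stop_top by blast

lemma chart_homeo: "i < nch B \<Longrightarrow> homeomorphic_map (prod_topology (subtopology (top_of_set (spts B)) (cdom B i)) euclidean)
          (subtopology (tot B) {u \<in> topspace (tot B). proj B u \<in> cdom B i}) (\<lambda>(x, v). chart B i x v)"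
  using hvb unfolding holder_vector_bundle_def stop_top by blast

lemma chart_props:
  assumes "i < nch B" "x \<in> cdom B i"
  shows "bij_betw (chart B i x) UNIV (fiber B x)" "chart B i x 0 = vzero B x"
    "chart B i x (v + w) = vadd B (chart B i x v) (chart B i x w)"
    "chart B i x (c *\<^sub>R v) = vscale B c (chart B i x v)"
  using hvb assms unfolding holder_vector_bundle_def by blast+

text \<open>A Lebesgue number of the cover by chart domains, expressed as the length of a central
  block.\<close>

lemma lebesgue: "\<exists>k. \<forall>x\<in>spts B. \<exists>i<nch B. \<forall>y\<in>spts B. agree k x y \<longrightarrow> y \<in> cdom B i"
proof (rule ccontr)
  assume "\<not> ?thesis"
  then have "\<forall>k. \<exists>x. x \<in> spts B \<and> (\<forall>i<nch B. \<exists>y\<in>spts B. agree k x y \<and> y \<notin> cdom B i)" by blast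
  then obtain x where x: "\<And>k. x k \<in> spts B" "\<And>k i. i < nch B \<Longrightarrow> \<exists>y\<in>spts B. agree k (x k) y \<and> y \<notin> cdom B i"
    by metis
  have "\<forall>k. x k \<in> spts B" using x(1) by blast
  with compact_imp_seq_compact[OF compact_spts, of B] obtain l r where
    l: "l \<in> spts B" and r: "strict_mono r" and lim: "(x \<circ> r) \<longlonglongrightarrow> l" unfolding seq_compact_def by meson
  obtain i where i: "i < nch B" "l \<in> cdom B i" using l cdom_cover by blast
  obtain W where W: "open W" "cdom B i = spts B \<inter> W" using cdom_open[OF i(1)] unfolding openin_open by blast
  have "l \<in> W" using W(2) i(2) by blast
  from open_contains_cylinder[OF W(1) this] obtain k where
    k: "\<And>y. (\<And>n. \<bar>n\<bar> < int k \<Longrightarrow> y n = l n) \<Longrightarrow> y \<in> W" by blast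
  have "\<forall>\<^sub>F m in sequentially. (x \<circ> r) m \<in> {y. \<forall>n. \<bar>n\<bar> < int k \<longrightarrow> y n = l n}"
    by (rule topological_tendstoD[OF lim open_cylinder]) simp
  then obtain m0 where m0: "\<And>m n. m \<ge> m0 \<Longrightarrow> \<bar>n\<bar> < int k \<Longrightarrow> x (r m) n = l n"
    unfolding eventually_sequentially by auto
  let ?m = "m0 + k"
  have "k \<le> r ?m" using strict_mono_imp_increasing[OF r, of ?m] by simp
  obtain y where y: "y \<in> spts B" "agree (r ?m) (x (r ?m)) y" "y \<notin> cdom B i" using x(2)[OF i(1)] by blast
  have "y \<in> W"
  proof (rule k)
    fix n :: int assume n: "\<bar>n\<bar> < int k"
    then have "\<bar>n\<bar> < int (r ?m)" using \<open>k \<le> r ?m\<close> by linarith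
    then have "y n = x (r ?m) n" using y(2) by (simp add: agree_def)
    then show "y n = l n" using m0[of ?m n] n by simp
  qed
  then show False using y W(2) by blast
qed

text \<open>Since \<open>agree k0\<close> is an equivalence relation, \<open>idx\<close> is constant on its classes.\<close>

definition "k0 = (SOME k. \<forall>x\<in>spts B. \<exists>i<nch B. \<forall>y\<in>spts B. agree k x y \<longrightarrow> y \<in> cdom B i)"

definition "idx x = (LEAST i. i < nch B \<and> (\<forall>y\<in>spts B. agree k0 x y \<longrightarrow> y \<in> cdom B i))"

lemma idx_props:
  assumes "x \<in> spts B"
  shows "idx x < nch B" "x \<in> cdom B (idx x)"
proof -
  have "\<forall>x\<in>spts B. \<exists>i<nch B. \<forall>y\<in>spts B. agree k0 x y \<longrightarrow> y \<in> cdom B i"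
    unfolding k0_def by (rule someI_ex[OF lebesgue])
  then have "\<exists>i. i < nch B \<and> (\<forall>y\<in>spts B. agree k0 x y \<longrightarrow> y \<in> cdom B i)" using assms by blast
  note L = LeastI_ex[OF this, folded idx_def]
  show "idx x < nch B" by (rule L[THEN conjunct1])
  show "x \<in> cdom B (idx x)" by (rule L[THEN conjunct2, THEN bspec, OF assms, THEN mp, OF agree_refl])
qed

lemma idx_agree: assumes "agree k0 x y" shows "idx y = idx x"
proof -
  have "agree k0 x z \<longleftrightarrow> agree k0 y z" for z using assms by (simp add: agree_def)
  then show ?thesis by (simp add: idx_def)
qed

text \<open>A global frame. The jump of the chosen chart between different indices is harmless,
  because the points with a given index form an open set.\<close>

definition "G x = chart B (idx x) x"
definition "Gi x = inv (G x)"
definition "Gp u = (proj B u, Gi (proj B u) u)"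

lemma G_bij: "x \<in> spts B \<Longrightarrow> bij_betw (G x) UNIV (fiber B x)"
  unfolding G_def by (rule chart_props(1)[OF idx_props])

lemma G_0: "x \<in> spts B \<Longrightarrow> G x 0 = vzero B x"
  unfolding G_def by (rule chart_props(2)[OF idx_props])

lemma G_add: "x \<in> spts B \<Longrightarrow> G x (v + w) = vadd B (G x v) (G x w)"
  unfolding G_def by (rule chart_props(3)[OF idx_props])

lemma G_scale: "x \<in> spts B \<Longrightarrow> G x (c *\<^sub>R v) = vscale B c (G x v)"
  unfolding G_def by (rule chart_props(4)[OF idx_props])

lemma G_diff: "x \<in> spts B \<Longrightarrow> G x (v - w) = vsub B (G x v) (G x w)"
  using G_add[of x v "(- 1) *\<^sub>R w"] G_scale[of x "- 1" w] by (simp add: vsub_def)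

lemma G_fiber: "x \<in> spts B \<Longrightarrow> G x v \<in> fiber B x"
  using bij_betwE[OF G_bij] by blast

lemma G_topspace: "x \<in> spts B \<Longrightarrow> G x v \<in> topspace (tot B)"
  using G_fiber by (auto simp: fiber_def)

lemma proj_G: "x \<in> spts B \<Longrightarrow> proj B (G x v) = x"
  using G_fiber by (auto simp: fiber_def)

lemma Gi_G [simp]: "x \<in> spts B \<Longrightarrow> Gi x (G x v) = v"
  unfolding Gi_def by (rule inv_f_f) (use G_bij in \<open>auto simp: bij_betw_def\<close>)

lemma G_Gi: assumes "x \<in> spts B" "u \<in> fiber B x" shows "G x (Gi x u) = u"
proof -
  have "u \<in> range (G x)" using G_bij[OF assms(1)] assms(2) by (simp add: bij_betw_def)
  then show ?thesis unfolding Gi_def by (rule f_inv_into_f)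
qed

lemma G_inj: "x \<in> spts B \<Longrightarrow> G x v = G x w \<longleftrightarrow> v = w"
  by (metis Gi_G)

lemma proj_spts: "u \<in> topspace (tot B) \<Longrightarrow> proj B u \<in> spts B"
  using continuous_map_image_subset_topspace[OF proj_cont] by auto

lemma in_fiber: "u \<in> topspace (tot B) \<Longrightarrow> u \<in> fiber B (proj B u)"
  by (simp add: fiber_def)

lemma tot_cases:
  assumes "u \<in> topspace (tot B)" obtains x v where "x \<in> spts B" "u = G x v"
  using G_Gi[OF proj_spts in_fiber, OF assms assms] proj_spts[OF assms] that by metis

lemma fiber_cases:
  assumes "x \<in> spts B" "u \<in> fiber B x" obtains v where "u = G x v"
  using G_Gi[OF assms] that by metis

lemma fiber_eq: "x \<in> spts B \<Longrightarrow> fiber B x = range (G x)"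
  using G_bij by (simp add: bij_betw_def)

section \<open>Topology of the trivialization\<close>

lemma prod_top: "prod_topology (subtopology (top_of_set (spts B)) S) (euclidean :: (real ^ 'd) topology)
   = top_of_set ((spts B \<inter> S) \<times> UNIV)"
  by (simp add: subtopology_subtopology prod_topology_subtopology prod_topology_euclidean)

lemma open_idx: "openin (top_of_set (spts B)) {x \<in> spts B. idx x = i}"
proof -
  have "{x \<in> spts B. idx x = i} \<in> clopens B"
  proof (rule clopen_determined[of _ _ k0])
    fix x y assume "x \<in> {x \<in> spts B. idx x = i}" "y \<in> spts B" "\<And>n. \<bar>n\<bar> < int k0 \<Longrightarrow> y n = x n"
    moreover from this(3) have "agree k0 x y" by (simp add: agree_def)
    ultimately show "y \<in> {x \<in> spts B. idx x = i}" using idx_agree by auto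
  qed auto
  then show ?thesis by (simp add: clopens_def)
qed

lemma G_cont: "continuous_map (top_of_set (spts B \<times> UNIV)) (tot B) (\<lambda>(x, v). G x v)"
proof (rule pasting_lemma[where I = "{..<nch B}" and T = "\<lambda>i. {x \<in> spts B. idx x = i} \<times> UNIV"
      and f = "\<lambda>i. \<lambda>(x, v). chart B i x v"])
  fix i assume i: "i \<in> {..<nch B}"
  obtain W where W: "open W" "{x \<in> spts B. idx x = i} = spts B \<inter> W"
    using open_idx[of i] unfolding openin_open by blast
  have "{x \<in> spts B. idx x = i} \<times> (UNIV :: (real ^ 'd) set) = (spts B \<times> UNIV) \<inter> (W \<times> UNIV)"
    unfolding W(2) by blast
  moreover have "open (W \<times> (UNIV :: (real ^ 'd) set))" by (intro open_Times W open_UNIV)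
  ultimately show "openin (top_of_set (spts B \<times> UNIV)) ({x \<in> spts B. idx x = i} \<times> (UNIV :: (real ^ 'd) set))"
    unfolding openin_open by blast
  have "continuous_map (top_of_set ((spts B \<inter> cdom B i) \<times> UNIV))
      (subtopology (tot B) {u \<in> topspace (tot B). proj B u \<in> cdom B i}) (\<lambda>(x, v). chart B i x v)"
    using homeomorphic_imp_continuous_map[OF chart_homeo, of i] i unfolding prod_top by simp
  then have "continuous_map (top_of_set ((spts B \<inter> cdom B i) \<times> UNIV)) (tot B) (\<lambda>(x, v). chart B i x v)"
    by (rule continuous_map_into_fulltopology)
  then have "continuous_map (top_of_set ({x \<in> spts B. idx x = i} \<times> UNIV)) (tot B) (\<lambda>(x, v). chart B i x v)"
    by (rule continuous_map_from_subtopology_mono) (use idx_props in auto)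
  moreover have "(spts B \<times> UNIV) \<inter> ({x \<in> spts B. idx x = i} \<times> UNIV) = {x \<in> spts B. idx x = i} \<times> (UNIV :: (real ^ 'd) set)"
    by blast
  ultimately show "continuous_map (subtopology (top_of_set (spts B \<times> UNIV)) ({x \<in> spts B. idx x = i} \<times> UNIV)) (tot B) (\<lambda>(x, v). chart B i x v)"
    by (simp only: subtopology_subtopology)
next
  fix x :: "biseq \<times> (real ^ 'd)" assume "x \<in> topspace (top_of_set (spts B \<times> UNIV))"
  then have "fst x \<in> spts B" by auto
  then show "\<exists>j. j \<in> {..<nch B} \<and> x \<in> {x \<in> spts B. idx x = j} \<times> UNIV \<and> (case x of (x, v) \<Rightarrow> G x v) = (case x of (x, v) \<Rightarrow> chart B j x v)"
    using idx_props(1)[of "fst x"] by (intro exI[of _ "idx (fst x)"]) (auto simp: G_def split: prod.splits)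
qed auto

text \<open>On the piece with index \<open>i\<close> the inverse of the chart homeomorphism
  coincides with \<open>Gp\<close>. The pieces are open in the total space since the projection is
  continuous.\<close>

lemma Gp_cont: "continuous_map (tot B) (top_of_set (spts B \<times> UNIV)) Gp"
proof -
  define Q where "Q i g \<longleftrightarrow> continuous_map (subtopology (tot B) {u \<in> topspace (tot B). proj B u \<in> cdom B i}) (top_of_set ((spts B \<inter> cdom B i) \<times> UNIV)) g
     \<and> (\<forall>u\<in>topspace (tot B). proj B u \<in> cdom B i \<longrightarrow> (case g u of (x, v) \<Rightarrow> chart B i x v) = u)" for i g
  have ex: "\<exists>g. Q i g" if i: "i < nch B" for i
  proof -
    obtain g where g: "homeomorphic_maps (top_of_set ((spts B \<inter> cdom B i) \<times> UNIV))
      (subtopology (tot B) {u \<in> topspace (tot B). proj B u \<in> cdom B i}) (\<lambda>(x, v). chart B i x v) g"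
      using chart_homeo[OF i] unfolding prod_top homeomorphic_map_maps by blast
    then show ?thesis unfolding homeomorphic_maps_def Q_def by (intro exI[of _ g]) auto
  qed
  define g where "g i = (SOME g. Q i g)" for i
  have Qg: "Q i (g i)" if "i < nch B" for i
    unfolding g_def by (rule someI_ex[OF ex[OF that]])
  have g: "i < nch B \<Longrightarrow> continuous_map (subtopology (tot B) {u \<in> topspace (tot B). proj B u \<in> cdom B i}) (top_of_set ((spts B \<inter> cdom B i) \<times> UNIV)) (g i)"
    "i < nch B \<Longrightarrow> u \<in> topspace (tot B) \<Longrightarrow> proj B u \<in> cdom B i \<Longrightarrow> (case g i u of (x, v) \<Rightarrow> chart B i x v) = u" for i u
    using Qg[of i] unfolding Q_def by blast+
  have gGp: "g i u = Gp u" if i: "i < nch B" and u: "u \<in> topspace (tot B)" "idx (proj B u) = i" for i u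
  proof -
    have pu: "proj B u \<in> cdom B i" using idx_props(2)[OF proj_spts[OF u(1)]] u(2) by simp
    obtain x v where xv: "g i u = (x, v)" by (cases "g i u")
    have "g i u \<in> (spts B \<inter> cdom B i) \<times> UNIV"
      using continuous_map_image_subset_topspace[OF g(1)[OF i]] u(1) pu by auto
    then have x: "x \<in> cdom B i" "x \<in> spts B" using xv by auto
    have e: "chart B i x v = u" using g(2)[OF i u(1) pu] xv by simp
    have "chart B i x v \<in> fiber B x" using bij_betwE[OF chart_props(1)[OF i x(1)]] by blast
    then have px: "proj B u = x" using e by (simp add: fiber_def)
    then have "G x v = u" using e u(2) by (simp add: G_def)
    then have "Gi x u = v" using Gi_G[OF x(2)] by blast
    then show ?thesis using px xv by (simp add: Gp_def)
  qed
  show ?thesis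
  proof (rule pasting_lemma[where I = "{..<nch B}" and f = g and T = "\<lambda>i. {u \<in> topspace (tot B). proj B u \<in> {x \<in> spts B. idx x = i}}"])
    fix i assume i: "i \<in> {..<nch B}"
    show "openin (tot B) {u \<in> topspace (tot B). proj B u \<in> {x \<in> spts B. idx x = i}}"
      by (rule openin_continuous_map_preimage[OF proj_cont open_idx])
    have "continuous_map (subtopology (tot B) {u \<in> topspace (tot B). proj B u \<in> cdom B i}) (top_of_set (spts B \<times> UNIV)) (g i)"
      using g(1)[of i] i by (auto simp: continuous_map_in_subtopology Pi_iff mem_Times_iff)
    then show "continuous_map (subtopology (tot B) {u \<in> topspace (tot B). proj B u \<in> {x \<in> spts B. idx x = i}}) (top_of_set (spts B \<times> UNIV)) (g i)"
      by (rule continuous_map_from_subtopology_mono) (use idx_props in auto)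
  next
    fix i j u assume "i \<in> {..<nch B}" "j \<in> {..<nch B}" and u: "u \<in> topspace (tot B) \<inter> {u \<in> topspace (tot B). proj B u \<in> {x \<in> spts B. idx x = i}} \<inter> {u \<in> topspace (tot B). proj B u \<in> {x \<in> spts B. idx x = j}}"
    have "i = j" using u by auto
    then show "g i u = g j u" by simp
  next
    fix u assume u: "u \<in> topspace (tot B)"
    let ?i = "idx (proj B u)"
    have "?i < nch B" by (rule idx_props(1)[OF proj_spts[OF u]])
    then show "\<exists>j. j \<in> {..<nch B} \<and> u \<in> {u \<in> topspace (tot B). proj B u \<in> {x \<in> spts B. idx x = j}} \<and> Gp u = g j u"
      using gGp[of ?i u] u proj_spts[OF u] by (intro exI[of _ ?i]) auto
  qed
qed

lemma continuous_in_coords: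
  assumes "continuous_map (tot B) euclideanreal f"
  shows "continuous_on (spts B \<times> UNIV) (\<lambda>p. f (G (fst p) (snd p)))"
proof -
  have "continuous_map (top_of_set (spts B \<times> UNIV)) euclideanreal (f \<circ> (\<lambda>(x, v). G x v))"
    by (rule continuous_map_compose[OF G_cont assms])
  then show ?thesis by (simp add: o_def case_prod_beta)
qed

lemma continuous_from_coords:
  assumes "continuous_on (spts B \<times> UNIV) (\<lambda>p. h (fst p) (snd p))" "\<And>x v. x \<in> spts B \<Longrightarrow> f (G x v) = h x v"
  shows "continuous_map (tot B) euclideanreal f"
proof -
  have "continuous_map (top_of_set (spts B \<times> UNIV)) euclideanreal (\<lambda>p. h (fst p) (snd p))"
    using assms(1) by simp
  from continuous_map_compose[OF Gp_cont this]
  have "continuous_map (tot B) euclideanreal ((\<lambda>p. h (fst p) (snd p)) \<circ> Gp)" .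
  then show ?thesis
  proof (rule continuous_map_eq)
    fix u assume "u \<in> topspace (tot B)"
    then obtain x v where xv: "x \<in> spts B" "u = G x v" by (rule tot_cases)
    then show "((\<lambda>p. h (fst p) (snd p)) \<circ> Gp) u = f u" using assms(2)[OF xv(1)] by (simp add: Gp_def proj_G)
  qed
qed

lemma endomorphism_continuous:
  assumes "continuous_map (tot B) (tot B) f" "\<And>x v. x \<in> spts B \<Longrightarrow> f (G x v) = G (g x) (h x v)" "\<And>x. x \<in> spts B \<Longrightarrow> g x \<in> spts B"
  shows "continuous_on (spts B \<times> UNIV) (\<lambda>p. h (fst p) (snd p))"
proof -
  have "continuous_map (top_of_set (spts B \<times> UNIV)) (top_of_set (spts B \<times> UNIV)) (Gp \<circ> (f \<circ> (\<lambda>(x, v). G x v)))"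
    by (intro continuous_map_compose[OF continuous_map_compose[OF G_cont assms(1)] Gp_cont])
  then have "continuous_on (spts B \<times> UNIV) (Gp \<circ> (f \<circ> (\<lambda>(x, v). G x v)))"
    by (simp add: continuous_map_in_subtopology)
  then have "continuous_on (spts B \<times> UNIV) (\<lambda>p. snd ((Gp \<circ> (f \<circ> (\<lambda>(x, v). G x v))) p))"
    by (rule continuous_on_snd)
  then show ?thesis
  proof (rule continuous_on_eq)
    fix p :: "biseq \<times> (real ^ 'd)" assume "p \<in> spts B \<times> UNIV"
    then have "fst p \<in> spts B" by auto
    then show "snd ((Gp \<circ> (f \<circ> (\<lambda>(x, v). G x v))) p) = h (fst p) (snd p)"
      by (simp add: case_prod_beta assms Gp_def proj_G)
  qed
qed

text \<open>Within one fiber, convergence in the total space is convergence of coordinate vectors.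
  Limits are therefore unique, and the descriptions by \<open>THE\<close> in the holonomies can be
  evaluated.\<close>

lemma limitin_G_iff:
  assumes y: "y \<in> spts B"
  shows "limitin (tot B) (\<lambda>n::nat. G y (v n)) w sequentially \<longleftrightarrow> (\<exists>l. w = G y l \<and> v \<longlonglongrightarrow> l)"
proof
  assume *: "limitin (tot B) (\<lambda>n. G y (v n)) w sequentially"
  have "limitin (top_of_set (spts B \<times> UNIV)) (Gp \<circ> (\<lambda>n. G y (v n))) (Gp w) sequentially"
    by (rule continuous_map_limit[OF Gp_cont *])
  then have T: "((\<lambda>n. (y, v n)) \<longlongrightarrow> Gp w) sequentially"
    unfolding limitin_subtopology by (simp add: o_def Gp_def proj_G y)
  have pw: "proj B w = y" using tendsto_fst[OF T] by (auto simp: Gp_def tendsto_biseq_iff fun_eq_iff)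
  have lim: "v \<longlonglongrightarrow> Gi y w" using tendsto_snd[OF T] by (simp add: Gp_def pw)
  have "w \<in> topspace (tot B)" using * by (simp add: limitin_def)
  then have "w = G y (Gi y w)" using G_Gi[OF y] in_fiber pw by metis
  then show "\<exists>l. w = G y l \<and> v \<longlonglongrightarrow> l" using lim by blast
next
  assume "\<exists>l. w = G y l \<and> v \<longlonglongrightarrow> l"
  then obtain l where l: "w = G y l" "v \<longlonglongrightarrow> l" by blast
  have "((\<lambda>n. (y, v n)) \<longlongrightarrow> (y, l)) sequentially" by (intro tendsto_Pair tendsto_const l)
  then have "limitin (top_of_set (spts B \<times> UNIV)) (\<lambda>n. (y, v n)) (y, l) sequentially"
    unfolding limitin_subtopology using y by simp
  from continuous_map_limit[OF G_cont this]
  show "limitin (tot B) (\<lambda>n. G y (v n)) w sequentially" by (simp add: o_def l(1))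
qed

lemma the_limit:
  assumes "y \<in> spts B" "v \<longlonglongrightarrow> l"
  shows "(THE w. limitin (tot B) (\<lambda>n::nat. G y (v n)) w sequentially) = G y l"
  using assms(2) by (intro the_equality) (auto simp: limitin_G_iff[OF assms(1)] dest: LIMSEQ_unique)

section \<open>Linear maps between fibers as matrices\<close>

lemma bounded_linear_coords:
  assumes x: "x \<in> spts B" and y: "y \<in> spts B" and L: "fiber_linear B x y L"
  shows "bounded_linear (\<lambda>v. Gi y (L (G x v)))"
proof -
  have im: "L (G x v) \<in> fiber B y" for v using L G_fiber[OF x] unfolding fiber_linear_def by blast
  have "linear (\<lambda>v. Gi y (L (G x v)))"
  proof (rule linearI)
    fix v w c
    have "L (vadd B (G x v) (G x w)) = vadd B (L (G x v)) (L (G x w))"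
      "L (vscale B c (G x v)) = vscale B c (L (G x v))"
      using L G_fiber[OF x] unfolding fiber_linear_def by blast+
    then have a: "L (G x (v + w)) = vadd B (L (G x v)) (L (G x w))" "L (G x (c *\<^sub>R v)) = vscale B c (L (G x v))"
      by (simp_all only: G_add[OF x] G_scale[OF x])
    have "Gi y (L (G x (v + w))) = Gi y (G y (Gi y (L (G x v)) + Gi y (L (G x w))))"
      by (simp only: a G_add[OF y] G_Gi[OF y im])
    then show "Gi y (L (G x (v + w))) = Gi y (L (G x v)) + Gi y (L (G x w))" by (simp only: Gi_G[OF y])
    have "Gi y (L (G x (c *\<^sub>R v))) = Gi y (G y (c *\<^sub>R Gi y (L (G x v))))"
      by (simp only: a G_scale[OF y] G_Gi[OF y im])
    then show "Gi y (L (G x (c *\<^sub>R v))) = c *\<^sub>R Gi y (L (G x v))" by (simp only: Gi_G[OF y])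
  qed
  then show ?thesis by (simp only: linear_conv_bounded_linear)
qed

definition mat_of :: "biseq \<Rightarrow> biseq \<Rightarrow> ('e \<Rightarrow> 'e) \<Rightarrow> 'd mat" where
  "mat_of y x L = Blinfun (\<lambda>v. Gi y (L (G x v)))"

lemma mat_of_apply:
  assumes "x \<in> spts B" "y \<in> spts B" "fiber_linear B x y L"
  shows "blinfun_apply (mat_of y x L) v = Gi y (L (G x v))"
  unfolding mat_of_def by (simp add: bounded_linear_Blinfun_apply[OF bounded_linear_coords[OF assms]])

lemma G_mat_of:
  assumes "x \<in> spts B" "y \<in> spts B" "fiber_linear B x y L"
  shows "G y (blinfun_apply (mat_of y x L) v) = L (G x v)"
  unfolding mat_of_apply[OF assms]
  using assms(3) G_fiber[OF assms(1)] by (intro G_Gi assms) (auto simp: fiber_linear_def)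

end

section \<open>Automorphisms in coordinates\<close>

lemma cpr_norm_le:
  assumes "\<And>x. x \<in> spts B \<Longrightarrow> norm (A x) \<le> K" "x \<in> spts B" shows "norm (cpr 1 A n x) \<le> K ^ n"
proof (induction n)
  case (Suc n)
  have "norm (A (shift (1 * int n) x)) \<le> K" using assms by simp
  from norm_compose_le[OF this Suc] show ?case by simp
qed simp

lemma cpi_norm_le:
  assumes "\<And>x. x \<in> spts B \<Longrightarrow> norm (A x) \<le> K" "x \<in> spts B" shows "norm (cpi 1 A n x) \<le> K ^ n"
proof (induction n)
  case (Suc n)
  have "norm (A (shift (1 * int n) x)) \<le> K" using assms by simp
  from norm_compose_le[OF Suc this] show ?case by (simp add: mult.commute)
qed simp

lemma cpr_perturb:
  fixes A :: "biseq \<Rightarrow> 'd::finite mat"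
  assumes "0 < \<epsilon>" "\<And>x. x \<in> spts B \<Longrightarrow> norm (A x) \<le> K"
  shows "\<exists>\<delta>>0. \<forall>A'. (\<forall>x\<in>spts B. norm (A' x) \<le> K \<and> norm (A' x - A x) \<le> \<delta>) \<longrightarrow>
     (\<forall>x\<in>spts B. norm (cpr 1 A' n x - cpr 1 A n x) \<le> \<epsilon>)"
  using assms(1)
proof (induction n arbitrary: \<epsilon>)
  case 0
  then show ?case by (auto intro!: exI[of _ 1])
next
  case (Suc n)
  \<comment> \<open>\<open>L - 1\<close> adds the weights of the two terms into which the difference
    of the products splits. The absolute values cover a \<open>K\<close> of unknown sign.\<close>
  define L where "L = \<bar>K\<bar> ^ n + \<bar>K\<bar> + 1"
  have L: "L > 0" by (simp add: L_def add_nonneg_pos)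
  then have "\<epsilon> / (2 * L) > 0" using Suc.prems by simp
  from Suc.IH[OF this] obtain \<delta> where \<delta>: "\<delta> > 0" "\<And>A'. (\<forall>x\<in>spts B. norm (A' x) \<le> K \<and> norm (A' x - A x) \<le> \<delta>) \<Longrightarrow>
     (\<forall>x\<in>spts B. norm (cpr 1 A' n x - cpr 1 A n x) \<le> \<epsilon> / (2 * L))" by blast
  have bdA: "norm (cpr 1 A n x) \<le> \<bar>K\<bar> ^ n" if "x \<in> spts B" for x
  proof (induction n)
    case (Suc n)
    have "norm (A (shift (1 * int n) x)) \<le> \<bar>K\<bar>" using assms(2)[of "shift (1 * int n) x"] that by auto
    from norm_compose_le[OF this Suc] show ?case by simp
  qed simp
  show ?case
  proof (intro exI[of _ "min \<delta> (\<epsilon> / (2 * L))"] conjI allI impI ballI)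
    show "0 < min \<delta> (\<epsilon> / (2 * L))" using \<delta>(1) \<open>\<epsilon> / (2 * L) > 0\<close> by simp
    fix A' x assume A': "\<forall>x\<in>spts B. norm (A' x) \<le> K \<and> norm (A' x - A x) \<le> min \<delta> (\<epsilon> / (2 * L))" and x: "x \<in> spts B"
    let ?y = "shift (1 * int n) x"
    have y: "?y \<in> spts B" using x by simp
    have 1: "norm (cpr 1 A' n x - cpr 1 A n x) \<le> \<epsilon> / (2 * L)" using \<delta>(2)[of A'] A' x by simp
    have "norm (A' ?y) \<le> K \<and> norm (A' ?y - A ?y) \<le> min \<delta> (\<epsilon> / (2 * L))" using A' y by blast
    then have 2: "norm (A' ?y - A ?y) \<le> \<epsilon> / (2 * L)" "norm (A' ?y) \<le> \<bar>K\<bar>" by linarith+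
    have "cpr 1 A' (Suc n) x - cpr 1 A (Suc n) x = (A' ?y o\<^sub>L (cpr 1 A' n x - cpr 1 A n x)) + ((A' ?y - A ?y) o\<^sub>L cpr 1 A n x)"
      by (simp add: compose_diff_left compose_diff_right)
    then have "norm (cpr 1 A' (Suc n) x - cpr 1 A (Suc n) x) \<le> norm (A' ?y o\<^sub>L (cpr 1 A' n x - cpr 1 A n x)) + norm ((A' ?y - A ?y) o\<^sub>L cpr 1 A n x)"
      by (simp only: norm_triangle_ineq)
    also have "\<dots> \<le> \<bar>K\<bar> * (\<epsilon> / (2 * L)) + \<epsilon> / (2 * L) * \<bar>K\<bar> ^ n"
      by (intro add_mono norm_compose_le 1 2 bdA x)
    also have "\<dots> = (L - 1) * (\<epsilon> / (2 * L))" by (simp add: L_def algebra_simps add_divide_distrib)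
    also have "\<dots> \<le> L * (\<epsilon> / (2 * L))" using \<open>\<epsilon> / (2 * L) > 0\<close> by (intro mult_right_mono) auto
    also have "\<dots> \<le> \<epsilon>" using L Suc.prems by simp
    finally show "norm (cpr 1 A' (Suc n) x - cpr 1 A (Suc n) x) \<le> \<epsilon>" .
  qed
qed

lemma cpi_perturb:
  fixes A :: "biseq \<Rightarrow> 'd::finite mat"
  assumes "0 < \<epsilon>" "\<And>x. x \<in> spts B \<Longrightarrow> norm (A x) \<le> K"
  shows "\<exists>\<delta>>0. \<forall>A'. (\<forall>x\<in>spts B. norm (A' x) \<le> K \<and> norm (A' x - A x) \<le> \<delta>) \<longrightarrow>
     (\<forall>x\<in>spts B. norm (cpi 1 A' n x - cpi 1 A n x) \<le> \<epsilon>)"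
  using assms(1)
proof (induction n arbitrary: \<epsilon>)
  case 0
  then show ?case by (auto intro!: exI[of _ 1])
next
  case (Suc n)
  define L where "L = \<bar>K\<bar> ^ n + \<bar>K\<bar> + 1"
  have L: "L > 0" by (simp add: L_def add_nonneg_pos)
  then have "\<epsilon> / (2 * L) > 0" using Suc.prems by simp
  from Suc.IH[OF this] obtain \<delta> where \<delta>: "\<delta> > 0" "\<And>A'. (\<forall>x\<in>spts B. norm (A' x) \<le> K \<and> norm (A' x - A x) \<le> \<delta>) \<Longrightarrow>
     (\<forall>x\<in>spts B. norm (cpi 1 A' n x - cpi 1 A n x) \<le> \<epsilon> / (2 * L))" by blast
  have bdA: "norm (cpi 1 A n x) \<le> \<bar>K\<bar> ^ n" if "x \<in> spts B" for x
  proof (induction n)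
    case (Suc n)
    have "norm (A (shift (1 * int n) x)) \<le> \<bar>K\<bar>" using assms(2)[of "shift (1 * int n) x"] that by auto
    from norm_compose_le[OF Suc this] show ?case by (simp add: mult.commute)
  qed simp
  show ?case
  proof (intro exI[of _ "min \<delta> (\<epsilon> / (2 * L))"] conjI allI impI ballI)
    show "0 < min \<delta> (\<epsilon> / (2 * L))" using \<delta>(1) \<open>\<epsilon> / (2 * L) > 0\<close> by simp
    fix A' x assume A': "\<forall>x\<in>spts B. norm (A' x) \<le> K \<and> norm (A' x - A x) \<le> min \<delta> (\<epsilon> / (2 * L))" and x: "x \<in> spts B"
    let ?y = "shift (1 * int n) x"
    have y: "?y \<in> spts B" using x by simp
    have 1: "norm (cpi 1 A' n x - cpi 1 A n x) \<le> \<epsilon> / (2 * L)" using \<delta>(2)[of A'] A' x by simp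
    have "norm (A' ?y) \<le> K \<and> norm (A' ?y - A ?y) \<le> min \<delta> (\<epsilon> / (2 * L))" using A' y by blast
    then have 2: "norm (A' ?y - A ?y) \<le> \<epsilon> / (2 * L)" "norm (A' ?y) \<le> \<bar>K\<bar>" by linarith+
    have "cpi 1 A' (Suc n) x - cpi 1 A (Suc n) x = ((cpi 1 A' n x - cpi 1 A n x) o\<^sub>L A' ?y) + (cpi 1 A n x o\<^sub>L (A' ?y - A ?y))"
      by (simp add: compose_diff_left compose_diff_right)
    then have "norm (cpi 1 A' (Suc n) x - cpi 1 A (Suc n) x) \<le> norm ((cpi 1 A' n x - cpi 1 A n x) o\<^sub>L A' ?y) + norm (cpi 1 A n x o\<^sub>L (A' ?y - A ?y))"
      by (simp only: norm_triangle_ineq)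
    also have "\<dots> \<le> \<epsilon> / (2 * L) * \<bar>K\<bar> + \<bar>K\<bar> ^ n * (\<epsilon> / (2 * L))"
      by (intro add_mono norm_compose_le 1 2 bdA x)
    also have "\<dots> = (L - 1) * (\<epsilon> / (2 * L))" by (simp add: L_def algebra_simps add_divide_distrib)
    also have "\<dots> \<le> L * (\<epsilon> / (2 * L))" using \<open>\<epsilon> / (2 * L) > 0\<close> by (intro mult_right_mono) auto
    also have "\<dots> \<le> \<epsilon>" using L Suc.prems by simp
    finally show "norm (cpi 1 A' (Suc n) x - cpi 1 A (Suc n) x) \<le> \<epsilon>" .
  qed
qed

text \<open>Bunching is detected at a single time, hence robust.\<close>

lemma bunch_iterate:
  fixes A Ai :: "biseq \<Rightarrow> 'd::finite mat"
  assumes K: "1 \<le> K" and nA: "\<And>x. x \<in> spts B \<Longrightarrow> norm (A x) \<le> K" "\<And>x. x \<in> spts B \<Longrightarrow> norm (Ai x) \<le> K"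
    and N: "N \<ge> 1" "\<And>x. x \<in> spts B \<Longrightarrow> norm (cpr 1 A N x) * norm (cpi 1 Ai N x) \<le> q ^ N" and q: "1 \<le> q"
    and x: "x \<in> spts B"
  shows "norm (cpr 1 A n x) * norm (cpi 1 Ai n x) \<le> K ^ (2 * N) * q ^ n"
  using x
proof (induction n arbitrary: x rule: less_induct)
  case (less n)
  note bd = cpr_norm_le[OF nA(1) less.prems] cpi_norm_le[OF nA(2) less.prems]
  show ?case
  proof (cases "n < N")
    case True
    have "norm (cpr 1 A n x) * norm (cpi 1 Ai n x) \<le> K ^ n * K ^ n" using K by (intro mult_mono bd) auto
    also have "\<dots> = K ^ (2 * n)" by (simp add: mult_2 power_add)
    also have "\<dots> \<le> K ^ (2 * N)" using K True by (intro power_increasing) auto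
    also have "\<dots> = K ^ (2 * N) * 1" by simp
    also have "\<dots> \<le> K ^ (2 * N) * q ^ n" using K q by (intro mult_left_mono one_le_power) auto
    finally show ?thesis .
  next
    case False
    define k where "k = n - N"
    have n: "n = k + N" "k < n" using False N(1) by (auto simp: k_def)
    let ?y = "shift (1 * int N) x"
    have "norm (cpr 1 A n x) * norm (cpi 1 Ai n x) \<le> (norm (cpr 1 A k ?y) * norm (cpr 1 A N x)) * (norm (cpi 1 Ai N x) * norm (cpi 1 Ai k ?y))"
      unfolding n(1) cpr_add cpi_add by (intro mult_mono norm_blinfun_compose) auto
    also have "\<dots> = (norm (cpr 1 A k ?y) * norm (cpi 1 Ai k ?y)) * (norm (cpr 1 A N x) * norm (cpi 1 Ai N x))"
      by simp
    also have "\<dots> \<le> (K ^ (2 * N) * q ^ k) * q ^ N"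
      using less.prems K q by (intro mult_mono less.IH n N(2)) auto
    also have "\<dots> = K ^ (2 * N) * q ^ n" by (simp add: n(1) power_add)
    finally show ?thesis .
  qed
qed

text \<open>At one sufficiently large time \<open>N\<close> the bound with the slightly larger base
  \<open>q\<close> holds with a factor 1/2 to spare. This margin survives small changes of the
  \<open>N\<close> matrices involved, and \<open>bunch_iterate\<close> extends the bound to all
  times.\<close>

lemma bunch_family:
  fixes A Ai :: "biseq \<Rightarrow> 'd::finite mat"
  assumes K: "1 \<le> K" and nA: "\<And>x. x \<in> spts B \<Longrightarrow> norm (A x) \<le> K" "\<And>x. x \<in> spts B \<Longrightarrow> norm (Ai x) \<le> K"
    and bunch: "\<And>x n. x \<in> spts B \<Longrightarrow> norm (cpr 1 A n x) * norm (cpi 1 Ai n x) \<le> Cf * q0 ^ n"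
    and q0: "0 < q0" "q0 < Q" and Q: "1 < Q"
  shows "\<exists>\<delta>>0. \<exists>q Cb. 0 < q \<and> q < Q \<and> 1 \<le> Cb \<and> (\<forall>A' Ai'.
     (\<forall>x\<in>spts B. norm (A' x) \<le> K \<and> norm (A' x - A x) \<le> \<delta>) \<and> (\<forall>x\<in>spts B. norm (Ai' x) \<le> K \<and> norm (Ai' x - Ai x) \<le> \<delta>) \<longrightarrow>
     (\<forall>x\<in>spts B. \<forall>n. norm (cpr 1 A' n x) * norm (cpi 1 Ai' n x) \<le> Cb * q ^ n))"
proof -
  \<comment> \<open>The room above \<open>q0\<close> absorbs \<open>Cf\<close> and the perturbation;
    \<open>q > 1\<close> lets incomplete blocks be covered by a constant.\<close>
  obtain q where q: "max q0 1 < q" "q < Q" using dense[of "max q0 1" Q] q0 Q by auto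
  have "(\<lambda>n. Cf * (q0 / q) ^ n) \<longlonglongrightarrow> Cf * 0"
    using q q0 by (intro tendsto_mult tendsto_const LIMSEQ_power_zero) auto
  then have "(\<lambda>n. Cf * (q0 / q) ^ n) \<longlonglongrightarrow> 0" by simp
  then have "\<forall>\<^sub>F n in sequentially. Cf * (q0 / q) ^ n < 1 / 2" by (rule order_tendstoD) simp
  then obtain N0 where N0: "\<And>n. n \<ge> N0 \<Longrightarrow> Cf * (q0 / q) ^ n < 1 / 2" unfolding eventually_sequentially by blast
  define N where "N = N0 + 1"
  have qN: "1 \<le> q ^ N" using q by (intro one_le_power) auto
  have base: "norm (cpr 1 A N x) * norm (cpi 1 Ai N x) \<le> q ^ N / 2" if "x \<in> spts B" for x
  proof -
    have "Cf * (q0 / q) ^ N < 1 / 2" by (rule N0) (simp add: N_def)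
    then have "Cf * q0 ^ N \<le> q ^ N / 2" using q by (simp add: power_divide field_simps)
    with bunch[OF that, of N] show ?thesis by linarith
  qed
  \<comment> \<open>Each of the three error terms below is then at most 1/8, while half of
    \<open>q ^ N\<close> is to spare.\<close>
  define \<epsilon> where "\<epsilon> = 1 / (8 * K ^ N)"
  have KN: "1 \<le> K ^ N" using K by (rule one_le_power)
  have "1 \<le> 8 * K ^ N" using KN by linarith
  then have "1 / (8 * K ^ N) \<le> 1 / 1" using KN by (intro divide_left_mono) linarith+
  then have \<epsilon>: "0 < \<epsilon>" "\<epsilon> \<le> 1" "\<epsilon> * K ^ N = 1 / 8" using K unfolding \<epsilon>_def by simp_all
  obtain \<delta>1 where \<delta>1: "\<delta>1 > 0" "\<And>A'. (\<forall>x\<in>spts B. norm (A' x) \<le> K \<and> norm (A' x - A x) \<le> \<delta>1) \<Longrightarrow>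
     (\<forall>x\<in>spts B. norm (cpr 1 A' N x - cpr 1 A N x) \<le> \<epsilon>)" using cpr_perturb[where n = N and B = B and A = A and K = K and \<epsilon> = \<epsilon>, OF \<epsilon>(1) nA(1)] by blast
  obtain \<delta>2 where \<delta>2: "\<delta>2 > 0" "\<And>A'. (\<forall>x\<in>spts B. norm (A' x) \<le> K \<and> norm (A' x - Ai x) \<le> \<delta>2) \<Longrightarrow>
     (\<forall>x\<in>spts B. norm (cpi 1 A' N x - cpi 1 Ai N x) \<le> \<epsilon>)" using cpi_perturb[where n = N and B = B and A = Ai and K = K and \<epsilon> = \<epsilon>, OF \<epsilon>(1) nA(2)] by blast
  note bd = cpr_norm_le[OF nA(1)] cpi_norm_le[OF nA(2)]
  show ?thesis
  proof (rule exI[of _ "min \<delta>1 \<delta>2"], rule conjI, goal_cases)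
    case 2
    show ?case
  proof (rule exI[of _ q], rule exI[of _ "K ^ (2 * N)"], intro conjI allI impI ballI)
    show "0 < q" "q < Q" "1 \<le> K ^ (2 * N)" using \<delta>1(1) \<delta>2(1) q K by auto
    fix A' Ai' x n
    assume as: "(\<forall>x\<in>spts B. norm (A' x) \<le> K \<and> norm (A' x - A x) \<le> min \<delta>1 \<delta>2) \<and> (\<forall>x\<in>spts B. norm (Ai' x) \<le> K \<and> norm (Ai' x - Ai x) \<le> min \<delta>1 \<delta>2)"
      and x: "x \<in> spts B"
    have "norm (cpr 1 A' N y) * norm (cpi 1 Ai' N y) \<le> q ^ N" if y: "y \<in> spts B" for y
    proof -
      have p: "norm (cpr 1 A' N y - cpr 1 A N y) \<le> \<epsilon>" "norm (cpi 1 Ai' N y - cpi 1 Ai N y) \<le> \<epsilon>"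
        using \<delta>1(2)[of A'] \<delta>2(2)[of Ai'] as y by simp_all
      have 1: "norm (cpr 1 A' N y) \<le> norm (cpr 1 A N y) + \<epsilon>" "norm (cpi 1 Ai' N y) \<le> norm (cpi 1 Ai N y) + \<epsilon>"
        using p norm_triangle_sub[of "cpr 1 A' N y" "cpr 1 A N y"] norm_triangle_sub[of "cpi 1 Ai' N y" "cpi 1 Ai N y"] by linarith+
      then have "norm (cpr 1 A' N y) * norm (cpi 1 Ai' N y) \<le> (norm (cpr 1 A N y) + \<epsilon>) * (norm (cpi 1 Ai N y) + \<epsilon>)"
        using \<epsilon>(1) by (intro mult_mono) auto
      also have "\<dots> = norm (cpr 1 A N y) * norm (cpi 1 Ai N y) + \<epsilon> * norm (cpr 1 A N y) + \<epsilon> * norm (cpi 1 Ai N y) + \<epsilon> * \<epsilon>"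
        by (simp add: algebra_simps)
      also have "\<dots> \<le> q ^ N / 2 + \<epsilon> * K ^ N + \<epsilon> * K ^ N + \<epsilon> * K ^ N"
        using \<epsilon> KN y by (intro add_mono base y mult_left_mono bd) auto
      also have "\<dots> \<le> q ^ N" using qN \<epsilon>(3) by simp
      finally show ?thesis .
    qed
    then show "norm (cpr 1 A' n x) * norm (cpi 1 Ai' n x) \<le> K ^ (2 * N) * q ^ n"
      using as q x by (intro bunch_iterate K) (auto simp: N_def)
  qed
  qed (use \<delta>1(1) \<delta>2(1) in simp)
qed

context vbundle
begin

abbreviation "bap f x \<equiv> blinfun_apply f x"

lemma finsler_props:
  assumes "finsler_norm B f" "x \<in> spts B"
  shows "0 \<le> f (G x v)" "f (G x v) = 0 \<longleftrightarrow> v = 0" "f (G x (c *\<^sub>R v)) = \<bar>c\<bar> * f (G x v)"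
    "f (G x (v + w)) \<le> f (G x v) + f (G x w)"
proof -
  have *: "0 \<le> f u \<and> (f u = 0 \<longleftrightarrow> u = vzero B x) \<and> (\<forall>c. f (vscale B c u) = \<bar>c\<bar> * f u) \<and>
        (\<forall>v\<in>fiber B x. f (vadd B u v) \<le> f u + f v)" if "u \<in> fiber B x" for u
    using assms that unfolding finsler_norm_def by blast
  note m = G_fiber[OF assms(2)]
  show "0 \<le> f (G x v)" using *[OF m] by blast
  show "f (G x v) = 0 \<longleftrightarrow> v = 0" using *[OF m, of v] G_0[OF assms(2)] G_inj[OF assms(2)] by metis
  show "f (G x (c *\<^sub>R v)) = \<bar>c\<bar> * f (G x v)" unfolding G_scale[OF assms(2)] using *[OF m] by blast
  show "f (G x (v + w)) \<le> f (G x v) + f (G x w)" unfolding G_add[OF assms(2)] using *[OF m] m by blast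
qed

lemma compact_sphere_bundle: "compact (spts B \<times> sphere (0 :: real ^ 'd) 1)"
  by (intro compact_Times compact_spts) simp

lemma sphere_bundle_nonempty: "spts B \<times> sphere (0 :: real ^ 'd) 1 \<noteq> {}"
proof -
  obtain e :: "real ^ 'd" where "norm e = 1" using norm_Basis nonempty_Basis by (metis ex_in_conv)
  then show ?thesis using nonempty by (auto simp: dist_norm)
qed

lemma comparable_on_sphere:
  fixes h :: "biseq \<Rightarrow> real ^ 'd \<Rightarrow> real"
  assumes c: "continuous_on (spts B \<times> UNIV) (\<lambda>p. h (fst p) (snd p))"
    and pos: "\<And>x v. x \<in> spts B \<Longrightarrow> v \<noteq> 0 \<Longrightarrow> 0 < h x v"
    and sc: "\<And>x v c. x \<in> spts B \<Longrightarrow> h x (c *\<^sub>R v) = \<bar>c\<bar> * h x v"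
  shows "\<exists>C\<ge>1. \<forall>x\<in>spts B. \<forall>v. h x v \<le> C * norm v \<and> norm v \<le> C * h x v"
proof -
  have c': "continuous_on (spts B \<times> sphere 0 1) (\<lambda>p. h (fst p) (snd p))"
    by (rule continuous_on_subset[OF c]) auto
  from continuous_attains_sup[OF compact_sphere_bundle sphere_bundle_nonempty c']
  obtain p where p: "p \<in> spts B \<times> sphere 0 1" "\<And>y. y \<in> spts B \<times> sphere 0 1 \<Longrightarrow> h (fst y) (snd y) \<le> h (fst p) (snd p)" by blast
  from continuous_attains_inf[OF compact_sphere_bundle sphere_bundle_nonempty c']
  obtain p' where p': "p' \<in> spts B \<times> sphere 0 1" "\<And>y. y \<in> spts B \<times> sphere 0 1 \<Longrightarrow> h (fst p') (snd p') \<le> h (fst y) (snd y)" by blast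
  define s where "s = h (fst p) (snd p)"
  define i where "i = h (fst p') (snd p')"
  have i0: "0 < i" unfolding i_def using p'(1) by (intro pos) auto
  have s0: "0 < s" unfolding s_def using p(1) by (intro pos) auto
  define C where "C = s + 1 / i + 1"
  have C: "1 \<le> C" "s \<le> C" "1 / i \<le> C" using i0 s0 by (auto simp: C_def)
  have "h x v \<le> C * norm v \<and> norm v \<le> C * h x v" if x: "x \<in> spts B" for x v
  proof (cases "v = 0")
    case True
    then show ?thesis using sc[OF x, of 0 0] by simp
  next
    case False
    define w where "w = v /\<^sub>R norm v"
    have w: "norm w = 1" "v = norm v *\<^sub>R w" using False by (auto simp: w_def)
    have hv: "h x v = norm v * h x w" using sc[OF x, of "norm v" w] w(2) by simp
    have wm: "(x, w) \<in> spts B \<times> sphere 0 1" using x w by (simp add: dist_norm)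
    have "h x w \<le> s" "i \<le> h x w" using p(2)[OF wm] p'(2)[OF wm] by (simp_all add: s_def i_def)
    then have "h x w \<le> C" "1 \<le> C * h x w"
    proof -
      show "h x w \<le> C" using \<open>h x w \<le> s\<close> C(2) by linarith
      have "1 = 1 / i * i" using i0 by simp
      also have "\<dots> \<le> C * h x w" using \<open>i \<le> h x w\<close> C i0 by (intro mult_mono) auto
      finally show "1 \<le> C * h x w" .
    qed
    then have "norm v * h x w \<le> norm v * C" "norm v * 1 \<le> norm v * (C * h x w)" by (intro mult_left_mono; simp)+
    then show ?thesis unfolding hv by (simp add: mult_ac)
  qed
  then show ?thesis using C(1) by blast
qed

lemma finsler_comparable:
  assumes "finsler_norm B f"
  shows "\<exists>C\<ge>1. \<forall>x\<in>spts B. \<forall>v. f (G x v) \<le> C * norm v \<and> norm v \<le> C * f (G x v)"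
proof (rule comparable_on_sphere)
  show "continuous_on (spts B \<times> UNIV) (\<lambda>p. f (G (fst p) (snd p)))"
    using assms by (intro continuous_in_coords) (simp add: finsler_norm_def)
  show "0 < f (G x v)" if "x \<in> spts B" "v \<noteq> 0" for x v
    using finsler_props(1,2)[OF assms that(1), of v] that(2) by linarith
qed (rule finsler_props(3)[OF assms])

text \<open>Uniform continuity on the compact sphere bundle, extended to all vectors by homogeneity.
  In a counterexample the base points agree on ever longer blocks, hence have a common limit along a
  subsequence.\<close>

lemma unif_on_sphere:
  fixes h :: "biseq \<Rightarrow> real ^ 'd \<Rightarrow> real"
  assumes c: "continuous_on (spts B \<times> UNIV) (\<lambda>p. h (fst p) (snd p))"
    and sc: "\<And>x v c. x \<in> spts B \<Longrightarrow> h x (c *\<^sub>R v) = \<bar>c\<bar> * h x v" and \<epsilon>: "0 < \<epsilon>"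
  shows "\<exists>\<delta>>0. \<forall>x\<in>spts B. \<forall>y\<in>spts B. sdist B x y < \<delta> \<longrightarrow> (\<forall>v. \<bar>h x v - h y v\<bar> \<le> \<epsilon> * norm v)"
proof (rule ccontr)
  assume neg: "\<not> ?thesis"
  have "\<exists>x y v. x \<in> spts B \<and> y \<in> spts B \<and> norm v = 1 \<and> agree k x y \<and> \<epsilon> < \<bar>h x v - h y v\<bar>" for k
  proof -
    have "\<not> (\<forall>x\<in>spts B. \<forall>y\<in>spts B. sdist B x y < exp (- rate B * real k) \<longrightarrow> (\<forall>v. \<bar>h x v - h y v\<bar> \<le> \<epsilon> * norm v))"
      using neg by (metis exp_gt_zero)
    then obtain x y v where xyv: "x \<in> spts B" "y \<in> spts B" "sdist B x y < exp (- rate B * real k)" "\<not> \<bar>h x v - h y v\<bar> \<le> \<epsilon> * norm v"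
      by blast
    have v0: "v \<noteq> 0"
    proof
      assume "v = 0"
      then show False using xyv(4) sc[OF xyv(1), of 0 0] sc[OF xyv(2), of 0 0] by simp
    qed
    define w where "w = v /\<^sub>R norm v"
    have w: "norm w = 1" "v = norm v *\<^sub>R w" using v0 by (auto simp: w_def)
    have "h x v - h y v = norm v * (h x w - h y w)"
      using sc[OF xyv(1), of "norm v" w] sc[OF xyv(2), of "norm v" w] w(2) by (simp add: right_diff_distrib)
    then have "norm v * \<epsilon> < norm v * \<bar>h x w - h y w\<bar>" using xyv(4) by (simp add: abs_mult not_le mult.commute)
    then have "\<epsilon> < \<bar>h x w - h y w\<bar>" using v0 by simp
    moreover have "agree k x y" using not_agree_sdist[OF rate_pos, of k x y] xyv(3) by linarith
    ultimately show ?thesis using xyv w by blast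
  qed
  then obtain X Y V where XYV: "\<And>k. X k \<in> spts B" "\<And>k. Y k \<in> spts B" "\<And>k. norm (V k) = 1"
    "\<And>k. agree k (X k) (Y k)" "\<And>k. \<epsilon> < \<bar>h (X k) (V k) - h (Y k) (V k)\<bar>" by metis
  have "seq_compact (spts B \<times> sphere (0 :: real ^ 'd) 1)" by (rule compact_imp_seq_compact[OF compact_sphere_bundle])
  moreover have "\<forall>k. (X k, V k) \<in> spts B \<times> sphere 0 1" using XYV by simp
  ultimately obtain l r where l: "l \<in> spts B \<times> sphere (0 :: real ^ 'd) 1" and r: "strict_mono r"
    and lim: "((\<lambda>k. (X k, V k)) \<circ> r) \<longlonglongrightarrow> l" unfolding seq_compact_def by meson
  obtain x v where lxv: "l = (x, v)" by (cases l)
  have x: "x \<in> spts B" using l lxv by simp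
  have limX: "(\<lambda>k. X (r k)) \<longlonglongrightarrow> x" using tendsto_fst[OF lim] by (simp add: lxv o_def)
  have limV: "(\<lambda>k. V (r k)) \<longlonglongrightarrow> v" using tendsto_snd[OF lim] by (simp add: lxv o_def)
  have limY: "(\<lambda>k. Y (r k)) \<longlonglongrightarrow> x" unfolding tendsto_biseq_iff
  proof
    fix n :: int
    have "\<forall>\<^sub>F k in sequentially. X (r k) n = x n" using limX by (simp add: tendsto_biseq_iff)
    then show "\<forall>\<^sub>F k in sequentially. Y (r k) n = x n"
      using eventually_ge_at_top[of "nat (\<bar>n\<bar> + 1)"]
    proof eventually_elim
      case (elim k)
      have "\<bar>n\<bar> < int (r k)" using elim(2) strict_mono_imp_increasing[OF r, of k] by linarith
      then show ?case using XYV(4)[of "r k"] elim(1) by (simp add: agree_def)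
    qed
  qed
  have h1: "(\<lambda>k. h (X (r k)) (V (r k))) \<longlonglongrightarrow> h x v"
    using continuous_on_tendsto_compose[OF c tendsto_Pair[OF limX limV]] x XYV(1) by simp
  have h2: "(\<lambda>k. h (Y (r k)) (V (r k))) \<longlonglongrightarrow> h x v"
    using continuous_on_tendsto_compose[OF c tendsto_Pair[OF limY limV]] x XYV(2) by simp
  have "(\<lambda>k. \<bar>h (X (r k)) (V (r k)) - h (Y (r k)) (V (r k))\<bar>) \<longlonglongrightarrow> \<bar>h x v - h x v\<bar>"
    by (intro tendsto_rabs tendsto_diff h1 h2)
  then have "\<epsilon> \<le> \<bar>h x v - h x v\<bar>"
    by (rule tendsto_lowerbound) (auto intro!: always_eventually less_imp_le[OF XYV(5)])
  then show False using \<epsilon> by simp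
qed

text \<open>Points that differ in a central block of fixed length are at a distance bounded from
  below, so that for them any bounded error is a Hoelder error.\<close>

lemma far_dist:
  assumes "\<not> agree k x y"
  shows "1 \<le> exp (rate B * real k) powr hexp B * sdist B x y powr hexp B"
proof -
  have "1 \<le> exp (rate B * real k) * sdist B x y"
    using mult_left_mono[OF not_agree_sdist[OF rate_pos assms], of "exp (rate B * real k)"]
    by (simp add: exp_minus)
  then have "1 powr hexp B \<le> (exp (rate B * real k) * sdist B x y) powr hexp B"
    using hexp_pos by (intro powr_mono2) auto
  then show ?thesis by (simp add: powr_mult)
qed

text \<open>There are finitely many pairs of charts; summing the absolute values of their constants
  gives a common nonnegative one.\<close>

lemma holder_opE:
  assumes "\<And>i j. i < nch B \<Longrightarrow> j < nch B \<Longrightarrow> holder_op \<theta> (\<rho> :: 'p \<Rightarrow> 'p \<Rightarrow> real) (S i j) (g i j :: 'p \<Rightarrow> real ^ 'd \<Rightarrow> real ^ 'd)" "\<And>p q. 0 \<le> \<rho> p q"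
  shows "\<exists>C\<ge>0. \<forall>i<nch B. \<forall>j<nch B. \<forall>p\<in>S i j. \<forall>q\<in>S i j. onorm (\<lambda>v. g i j p v - g i j q v) \<le> C * \<rho> p q powr \<theta>"
proof -
  have "\<forall>ij. \<exists>C. fst ij < nch B \<longrightarrow> snd ij < nch B \<longrightarrow> (\<forall>p\<in>S (fst ij) (snd ij). \<forall>q\<in>S (fst ij) (snd ij).
     onorm (\<lambda>v. g (fst ij) (snd ij) p v - g (fst ij) (snd ij) q v) \<le> C * \<rho> p q powr \<theta>)"
    using assms(1) unfolding holder_op_def by blast
  from choice[OF this] obtain C where C: "\<And>ij p q. fst ij < nch B \<Longrightarrow> snd ij < nch B \<Longrightarrow> p \<in> S (fst ij) (snd ij) \<Longrightarrow> q \<in> S (fst ij) (snd ij) \<Longrightarrow>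
     onorm (\<lambda>v. g (fst ij) (snd ij) p v - g (fst ij) (snd ij) q v) \<le> C ij * \<rho> p q powr \<theta>" by blast
  define D where "D = (\<Sum>ij\<in>{..<nch B} \<times> {..<nch B}. \<bar>C ij\<bar>)"
  have "onorm (\<lambda>v. g i j p v - g i j q v) \<le> D * \<rho> p q powr \<theta>"
    if "i < nch B" "j < nch B" "p \<in> S i j" "q \<in> S i j" for i j p q
  proof -
    have "C (i, j) \<le> \<bar>C (i, j)\<bar>" by simp
    also have "\<dots> \<le> D" unfolding D_def using that by (intro member_le_sum) auto
    finally have "C (i, j) * \<rho> p q powr \<theta> \<le> D * \<rho> p q powr \<theta>" by (rule mult_right_mono) simp
    with C[of "(i, j)" p q] that show ?thesis by simp
  qed
  moreover have "0 \<le> D" unfolding D_def by (intro sum_nonneg) auto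
  ultimately show ?thesis by blast
qed

subsection \<open>Transport maps\<close>

definition "J y x = mat_of y x (transp B y x)"

lemma transp_linear: "x \<in> spts B \<Longrightarrow> y \<in> spts B \<Longrightarrow> fiber_linear B x y (transp B y x)"
  using tf unfolding transport_family_def by blast

lemma transp_G: "x \<in> spts B \<Longrightarrow> y \<in> spts B \<Longrightarrow> transp B y x (G x v) = G y (bap (J y x) v)"
  unfolding J_def by (rule G_mat_of[OF _ _ transp_linear, symmetric])

lemma J_self: assumes "x \<in> spts B" shows "J x x = id_blinfun"
proof (rule blinfun_eqI)
  fix v
  have "transp B x x (G x v) = G x v" using tf G_fiber[OF assms] assms unfolding transport_family_def by blast
  then show "bap (J x x) v = bap id_blinfun v" using transp_G[OF assms assms, of v] G_inj[OF assms] by simp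
qed

lemma norm_blinfun_diff_onorm: "norm (f - g) = onorm (\<lambda>v. bap f v - bap g v)" for f g :: "'d mat"
  by (simp add: norm_blinfun.rep_eq minus_blinfun.rep_eq)

text \<open>Points in one class of \<open>agree k0\<close> use the same chart, and
  \<open>J y x\<close> is compared with \<open>J x x\<close>, the identity. For other pairs
  boundedness suffices by \<open>far_dist\<close>.\<close>

lemma J_holder: "\<exists>Cj\<ge>0. \<forall>x\<in>spts B. \<forall>y\<in>spts B. norm (J y x - id_blinfun) \<le> Cj * sdist B x y powr hexp B"
proof -
  define \<rho> where "\<rho> = (\<lambda>(x, y) (x', y'). max (sdist B x x') (sdist B y y'))"
  define g where "g i j = (\<lambda>(x, y) v. inv (chart B j y) (transp B y x (chart B i x v)))" for i j
  have h: "holder_op (hexp B) \<rho> (cdom B i \<times> cdom B j) (g i j)" if "i < nch B" "j < nch B" for i j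
    using tf that unfolding transport_family_def \<rho>_def g_def by blast
  have \<rho>0: "0 \<le> \<rho> p q" for p q by (simp add: \<rho>_def case_prod_beta le_max_iff_disj)
  from holder_opE[of "hexp B" \<rho> "\<lambda>i j. cdom B i \<times> cdom B j" g, OF h \<rho>0] obtain C where
    C: "C \<ge> 0" "\<And>i j p q. i < nch B \<Longrightarrow> j < nch B \<Longrightarrow> p \<in> cdom B i \<times> cdom B j \<Longrightarrow> q \<in> cdom B i \<times> cdom B j \<Longrightarrow>
       onorm (\<lambda>v. g i j p v - g i j q v) \<le> C * \<rho> p q powr hexp B" by blast
  have gJ: "g (idx x) (idx y) (x, y) v = bap (J y x) v" if "x \<in> spts B" "y \<in> spts B" for x y v
    unfolding J_def mat_of_apply[OF that transp_linear[OF that]] by (simp add: g_def Gi_def G_def)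
  have main: "norm (J y x - J y' x') \<le> C * max (sdist B x x') (sdist B y y') powr hexp B"
    if s: "x \<in> spts B" "y \<in> spts B" "x' \<in> spts B" "y' \<in> spts B" and e: "idx x' = idx x" "idx y' = idx y" for x y x' y'
  proof -
    have "norm (J y x - J y' x') = onorm (\<lambda>v. g (idx x) (idx y) (x, y) v - g (idx x) (idx y) (x', y') v)"
      unfolding norm_blinfun_diff_onorm gJ[OF s(1,2), symmetric] gJ[OF s(3,4), symmetric] e ..
    also have "\<dots> \<le> C * \<rho> (x, y) (x', y') powr hexp B"
      using idx_props[OF s(1)] idx_props[OF s(2)] idx_props(2)[OF s(3)] idx_props(2)[OF s(4)] e by (intro C(2)) auto
    finally show ?thesis by (simp add: \<rho>_def)
  qed
  \<comment> \<open>One point for each index. As distances are at most 1, every \<open>J y x\<close>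
    lies within \<open>C\<close> of one of finitely many representatives, which bounds them
    all.\<close>
  define rep where "rep i = (SOME x. x \<in> spts B \<and> idx x = i)" for i
  have rep: "rep (idx x) \<in> spts B" "idx (rep (idx x)) = idx x" if "x \<in> spts B" for x
    using someI[of "\<lambda>z. z \<in> spts B \<and> idx z = idx x" x] that unfolding rep_def by auto
  define b where "b = (\<Sum>ij\<in>{..<nch B} \<times> {..<nch B}. norm (J (rep (snd ij)) (rep (fst ij))))"
  have b0: "0 \<le> b" unfolding b_def by (intro sum_nonneg) auto
  have bd: "norm (J y x) \<le> b + C" if s: "x \<in> spts B" "y \<in> spts B" for x y
  proof -
    have "norm (J y x - J (rep (idx y)) (rep (idx x))) \<le> C * max (sdist B x (rep (idx x))) (sdist B y (rep (idx y))) powr hexp B"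
      using s rep by (intro main) auto
    also have "\<dots> \<le> C * 1 powr hexp B"
      using C(1) hexp_pos sdist_le_1[OF rate_pos] by (intro mult_left_mono powr_mono2) (auto simp: le_max_iff_disj)
    finally have "norm (J y x - J (rep (idx y)) (rep (idx x))) \<le> C" by simp
    moreover have "norm (J (rep (idx y)) (rep (idx x))) \<le> b"
      unfolding b_def using member_le_sum[of "(idx x, idx y)" "{..<nch B} \<times> {..<nch B}" "\<lambda>ij. norm (J (rep (snd ij)) (rep (fst ij)))"]
        idx_props(1)[OF s(1)] idx_props(1)[OF s(2)] by simp
    ultimately show ?thesis using norm_triangle_sub[of "J y x" "J (rep (idx y)) (rep (idx x))"] by linarith
  qed
  define E where "E = exp (rate B * real k0) powr hexp B"
  have "norm (J y x - id_blinfun) \<le> (C + (b + C + 1) * E) * sdist B x y powr hexp B" if s: "x \<in> spts B" "y \<in> spts B" for x y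
  proof (cases "agree k0 x y")
    case True
    have "norm (J y x - J x x) \<le> C * max (sdist B x x) (sdist B y x) powr hexp B"
      using s idx_agree[OF True] by (intro main) auto
    then have "norm (J y x - id_blinfun) \<le> C * sdist B x y powr hexp B" using J_self[OF s(1)] sdist_sym[of B x y] by (simp add: max_def)
    also have "\<dots> \<le> (C + (b + C + 1) * E) * sdist B x y powr hexp B"
      using b0 C(1) by (intro mult_right_mono) (auto simp: E_def)
    finally show ?thesis .
  next
    case False
    have "norm (J y x - id_blinfun) \<le> norm (J y x) + norm (id_blinfun :: 'd mat)" by (rule norm_triangle_ineq4)
    then have "norm (J y x - id_blinfun) \<le> (b + C + 1) * 1" using bd[OF s] by simp
    also have "\<dots> \<le> (b + C + 1) * (E * sdist B x y powr hexp B)"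
      unfolding E_def using b0 C(1) by (intro mult_left_mono far_dist False) auto
    also have "\<dots> \<le> (C + (b + C + 1) * E) * sdist B x y powr hexp B"
      using C(1) by (simp add: algebra_simps)
    finally show ?thesis .
  qed
  moreover have "0 \<le> C + (b + C + 1) * E" using b0 C(1) by (simp add: E_def)
  ultimately show ?thesis by blast
qed

subsection \<open>Matrices of automorphisms\<close>

definition "Am \<Phi> x = mat_of (shift 1 x) x \<Phi>"
definition "Aim \<Phi> x = mat_of x (shift 1 x) (ainv B \<Phi>)"

lemma aut_linear: "automorphism B \<Phi> \<Longrightarrow> x \<in> spts B \<Longrightarrow> fiber_linear B x (shift 1 x) \<Phi>"
  unfolding automorphism_def by blast

lemma aut_bij: "automorphism B \<Phi> \<Longrightarrow> x \<in> spts B \<Longrightarrow> bij_betw \<Phi> (fiber B x) (fiber B (shift 1 x))"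
  unfolding automorphism_def by blast

lemma aut_G: "automorphism B \<Phi> \<Longrightarrow> x \<in> spts B \<Longrightarrow> \<Phi> (G x v) = G (shift 1 x) (bap (Am \<Phi> x) v)"
  unfolding Am_def by (rule G_mat_of[OF _ _ aut_linear, symmetric]) auto

lemma aut_inj:
  assumes a: "automorphism B \<Phi>" shows "inj_on \<Phi> (topspace (tot B))"
proof (rule inj_onI)
  fix u w assume u: "u \<in> topspace (tot B)" and w: "w \<in> topspace (tot B)" and e: "\<Phi> u = \<Phi> w"
  have "shift 1 (proj B u) = shift 1 (proj B w)" using a u w e unfolding automorphism_def by metis
  then have "shift (- 1) (shift 1 (proj B u)) = shift (- 1) (shift 1 (proj B w))" by simp
  then have p: "proj B u = proj B w" by simp
  have "inj_on \<Phi> (fiber B (proj B u))" using aut_bij[OF a proj_spts[OF u]] by (rule bij_betw_imp_inj_on)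
  then show "u = w" using e in_fiber[OF u] in_fiber[OF w] p by (auto dest: inj_onD)
qed

lemma ainv_eq: "automorphism B \<Phi> \<Longrightarrow> u \<in> topspace (tot B) \<Longrightarrow> ainv B \<Phi> (\<Phi> u) = u"
  unfolding ainv_def by (rule inv_into_f_f[OF aut_inj])

lemma fiber_topspace: "u \<in> fiber B x \<Longrightarrow> u \<in> topspace (tot B)"
  by (simp add: fiber_def)

lemma fiber_closed:
  assumes "x \<in> spts B" "u \<in> fiber B x" "w \<in> fiber B x"
  shows "vadd B u w \<in> fiber B x" "vscale B c u \<in> fiber B x"
proof -
  obtain v where v: "u = G x v" by (rule fiber_cases[OF assms(1,2)])
  obtain v' where v': "w = G x v'" by (rule fiber_cases[OF assms(1,3)])
  show "vadd B u w \<in> fiber B x" unfolding v v' G_add[OF assms(1), symmetric] by (rule G_fiber[OF assms(1)])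
  show "vscale B c u \<in> fiber B x" unfolding v G_scale[OF assms(1), symmetric] by (rule G_fiber[OF assms(1)])
qed

lemma ainv_linear:
  assumes a: "automorphism B \<Phi>" and x: "x \<in> spts B"
  shows "fiber_linear B (shift 1 x) x (ainv B \<Phi>)"
proof -
  have pre: "\<exists>w\<in>fiber B x. u = \<Phi> w" if "u \<in> fiber B (shift 1 x)" for u
    using aut_bij[OF a x] that unfolding bij_betw_def by blast
  have inv: "ainv B \<Phi> (\<Phi> w) = w" if "w \<in> fiber B x" for w using ainv_eq[OF a fiber_topspace[OF that]] .
  have lin: "\<Phi> (vadd B u v) = vadd B (\<Phi> u) (\<Phi> v)" "\<Phi> (vscale B c u) = vscale B c (\<Phi> u)"
    if "u \<in> fiber B x" "v \<in> fiber B x" for u v c using aut_linear[OF a x] that unfolding fiber_linear_def by blast+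
  show ?thesis
    unfolding fiber_linear_def
  proof (intro conjI ballI allI subsetI)
    fix w assume "w \<in> ainv B \<Phi> ` fiber B (shift 1 x)"
    then obtain u where u: "u \<in> fiber B (shift 1 x)" "w = ainv B \<Phi> u" by blast
    obtain u' where "u' \<in> fiber B x" "u = \<Phi> u'" using pre[OF u(1)] by blast
    then show "w \<in> fiber B x" using inv u(2) by simp
  next
    fix u v assume u: "u \<in> fiber B (shift 1 x)" and v: "v \<in> fiber B (shift 1 x)"
    obtain u' where u': "u' \<in> fiber B x" "u = \<Phi> u'" using pre[OF u] by blast
    obtain v' where v': "v' \<in> fiber B x" "v = \<Phi> v'" using pre[OF v] by blast
    show "ainv B \<Phi> (vadd B u v) = vadd B (ainv B \<Phi> u) (ainv B \<Phi> v)"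
      unfolding u'(2) v'(2) lin(1)[OF u'(1) v'(1), symmetric] inv[OF u'(1)] inv[OF v'(1)]
      by (rule inv[OF fiber_closed(1)[OF x u'(1) v'(1)]])
  next
    fix c u assume u: "u \<in> fiber B (shift 1 x)"
    obtain u' where u': "u' \<in> fiber B x" "u = \<Phi> u'" using pre[OF u] by blast
    show "ainv B \<Phi> (vscale B c u) = vscale B c (ainv B \<Phi> u)"
      unfolding u'(2) lin(2)[OF u'(1) u'(1), symmetric] inv[OF u'(1)]
      by (rule inv[OF fiber_closed(2)[OF x u'(1) u'(1)]])
  qed
qed

lemma ainv_G: "automorphism B \<Phi> \<Longrightarrow> x \<in> spts B \<Longrightarrow> ainv B \<Phi> (G (shift 1 x) v) = G x (bap (Aim \<Phi> x) v)"
  unfolding Aim_def by (rule G_mat_of[OF _ _ ainv_linear, symmetric]) auto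

lemma Aim_Am: assumes "automorphism B \<Phi>" "x \<in> spts B" shows "Aim \<Phi> x o\<^sub>L Am \<Phi> x = id_blinfun"
proof (rule blinfun_eqI)
  fix v
  have "G x (bap (Aim \<Phi> x) (bap (Am \<Phi> x) v)) = ainv B \<Phi> (\<Phi> (G x v))"
    by (simp only: ainv_G[OF assms, symmetric] aut_G[OF assms])
  also have "\<dots> = G x v" by (rule ainv_eq[OF assms(1) G_topspace[OF assms(2)]])
  finally show "bap (Aim \<Phi> x o\<^sub>L Am \<Phi> x) v = bap id_blinfun v" using G_inj[OF assms(2)] by simp
qed

lemma Am_Aim: assumes a: "automorphism B \<Phi>" and x: "x \<in> spts B" shows "Am \<Phi> x o\<^sub>L Aim \<Phi> x = id_blinfun"
proof (rule blinfun_eqI)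
  fix v
  have s: "shift 1 x \<in> spts B" using x by simp
  have "G (shift 1 x) v \<in> \<Phi> ` fiber B x" using aut_bij[OF a x] G_fiber[OF s, of v] by (simp add: bij_betw_def)
  then obtain w where w: "w \<in> fiber B x" "G (shift 1 x) v = \<Phi> w" by blast
  have "G (shift 1 x) (bap (Am \<Phi> x) (bap (Aim \<Phi> x) v)) = \<Phi> (ainv B \<Phi> (G (shift 1 x) v))"
    by (simp only: ainv_G[OF a x] aut_G[OF a x])
  also have "\<dots> = G (shift 1 x) v" unfolding w(2) by (simp only: ainv_eq[OF a fiber_topspace[OF w(1)]])
  finally show "bap (Am \<Phi> x o\<^sub>L Aim \<Phi> x) v = bap id_blinfun v" using G_inj[OF s] by simp
qed

text \<open>Compactness of the sphere bundle bounds the image of unit vectors from above and from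
  below; the lower bound is the bound for the inverse.\<close>

lemma Am_bounded:
  assumes a: "automorphism B \<Phi>"
  shows "\<exists>K\<ge>1. \<forall>x\<in>spts B. norm (Am \<Phi> x) \<le> K \<and> norm (Aim \<Phi> x) \<le> K"
proof -
  have "continuous_map (tot B) (tot B) \<Phi>" using a unfolding automorphism_def by blast
  then have c: "continuous_on (spts B \<times> UNIV) (\<lambda>p. bap (Am \<Phi> (fst p)) (snd p))"
    by (rule endomorphism_continuous[where g = "shift 1"]) (auto intro: aut_G[OF a])
  have "\<exists>C\<ge>1. \<forall>x\<in>spts B. \<forall>v. norm (bap (Am \<Phi> x) v) \<le> C * norm v \<and> norm v \<le> C * norm (bap (Am \<Phi> x) v)"
  proof (rule comparable_on_sphere)
    show "continuous_on (spts B \<times> UNIV) (\<lambda>p. norm (bap (Am \<Phi> (fst p)) (snd p)))" by (rule continuous_on_norm[OF c])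
    show "0 < norm (bap (Am \<Phi> x) v)" if "x \<in> spts B" "v \<noteq> 0" for x v
      using compose_eq1[OF Aim_Am[OF a that(1)], of v] that(2) by auto
  qed (simp add: blinfun.scaleR_right)
  then obtain C where C: "C \<ge> 1" "\<And>x v. x \<in> spts B \<Longrightarrow> norm (bap (Am \<Phi> x) v) \<le> C * norm v"
    "\<And>x v. x \<in> spts B \<Longrightarrow> norm v \<le> C * norm (bap (Am \<Phi> x) v)" by blast
  have "norm (Am \<Phi> x) \<le> C \<and> norm (Aim \<Phi> x) \<le> C" if x: "x \<in> spts B" for x
  proof
    show "norm (Am \<Phi> x) \<le> C" using C by (intro norm_blinfun_bound) (auto simp: x)
    show "norm (Aim \<Phi> x) \<le> C"
    proof (rule norm_blinfun_bound)
      show "norm (bap (Aim \<Phi> x) v) \<le> C * norm v" for v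
        using C(3)[OF x, of "bap (Aim \<Phi> x) v"] compose_eq1[OF Am_Aim[OF a x], of v] by simp
    qed (use C in simp)
  qed
  then show ?thesis using C(1) by blast
qed

text \<open>The resolvent identity expresses the difference of inverses by the difference of the
  matrices.\<close>

lemma Aim_holder:
  assumes a: "automorphism B \<Phi>" and s: "x \<in> spts B" "y \<in> spts B"
    and b: "norm (Aim \<Phi> x) \<le> K" "norm (Aim \<Phi> y) \<le> K" "norm (Am \<Phi> x - Am \<Phi> y) \<le> c"
  shows "norm (Aim \<Phi> x - Aim \<Phi> y) \<le> K * (c * K)"
proof -
  have "Aim \<Phi> x - Aim \<Phi> y = Aim \<Phi> x o\<^sub>L ((Am \<Phi> y - Am \<Phi> x) o\<^sub>L Aim \<Phi> y)"
    by (simp add: compose_diff_left compose_diff_right Am_Aim[OF a s(2)] compose_assoc[symmetric] Aim_Am[OF a s(1)])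
  then show ?thesis using b by (simp only:) (intro norm_compose_le, auto simp: norm_minus_commute)
qed

lemma Am_holder:
  assumes "holder_automorphism B \<Phi>"
  shows "\<exists>H\<ge>0. \<forall>x\<in>spts B. \<forall>y\<in>spts B. norm (Am \<Phi> x - Am \<Phi> y) \<le> H * sdist B x y powr hexp B"
proof -
  have a: "automorphism B \<Phi>" using assms unfolding holder_automorphism_def by blast
  obtain K where K: "K \<ge> 1" "\<And>x. x \<in> spts B \<Longrightarrow> norm (Am \<Phi> x) \<le> K" using Am_bounded[OF a] by blast
  define g where "g i j = (\<lambda>x v. inv (chart B j (shift 1 x)) (\<Phi> (chart B i x v)))" for i j
  have h: "holder_op (hexp B) (sdist B) {x \<in> cdom B i. shift 1 x \<in> cdom B j} (g i j)" if "i < nch B" "j < nch B" for i j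
    using assms that unfolding holder_automorphism_def g_def by blast
  from holder_opE[of "hexp B" "sdist B" "\<lambda>i j. {x \<in> cdom B i. shift 1 x \<in> cdom B j}" g, OF h sdist_nonneg] obtain C where
    C: "C \<ge> 0" "\<And>i j p q. i < nch B \<Longrightarrow> j < nch B \<Longrightarrow> p \<in> {x \<in> cdom B i. shift 1 x \<in> cdom B j} \<Longrightarrow> q \<in> {x \<in> cdom B i. shift 1 x \<in> cdom B j} \<Longrightarrow>
       onorm (\<lambda>v. g i j p v - g i j q v) \<le> C * sdist B p q powr hexp B" by blast
  have gA: "g (idx x) (idx (shift 1 x)) x v = bap (Am \<Phi> x) v" if x: "x \<in> spts B" for x v
  proof -
    have s: "shift 1 x \<in> spts B" using x by simp
    show ?thesis unfolding Am_def mat_of_apply[OF x s aut_linear[OF a x]] by (simp add: g_def Gi_def G_def)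
  qed
  \<comment> \<open>Agreement to order \<open>Suc k0\<close> ensures that the shifted points still
    agree to order \<open>k0\<close>, so that the charts at source and target both coincide.\<close>
  define E where "E = exp (rate B * real (Suc k0)) powr hexp B"
  have "norm (Am \<Phi> x - Am \<Phi> y) \<le> (C + 2 * K * E) * sdist B x y powr hexp B" if s: "x \<in> spts B" "y \<in> spts B" for x y
  proof (cases "agree (Suc k0) x y")
    case True
    have e: "idx y = idx x" "idx (shift 1 y) = idx (shift 1 x)"
      using idx_agree[OF agree_mono[OF True]] idx_agree[OF agree_shift[OF True]] by auto
    have s': "shift 1 x \<in> spts B" "shift 1 y \<in> spts B" using s by auto
    have "norm (Am \<Phi> x - Am \<Phi> y) = onorm (\<lambda>v. g (idx x) (idx (shift 1 x)) x v - g (idx x) (idx (shift 1 x)) y v)"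
      unfolding norm_blinfun_diff_onorm gA[OF s(1), symmetric] gA[OF s(2), symmetric] e ..
    also have "\<dots> \<le> C * sdist B x y powr hexp B"
      using idx_props[OF s(1)] idx_props[OF s'(1)] idx_props(2)[OF s(2)] idx_props(2)[OF s'(2)] e by (intro C(2)) auto
    also have "\<dots> \<le> (C + 2 * K * E) * sdist B x y powr hexp B"
      using K(1) by (intro mult_right_mono) (auto simp: E_def)
    finally show ?thesis .
  next
    case False
    have "norm (Am \<Phi> x - Am \<Phi> y) \<le> norm (Am \<Phi> x) + norm (Am \<Phi> y)" by (rule norm_triangle_ineq4)
    then have "norm (Am \<Phi> x - Am \<Phi> y) \<le> 2 * K * 1" using K(2)[OF s(1)] K(2)[OF s(2)] by simp
    also have "\<dots> \<le> 2 * K * (E * sdist B x y powr hexp B)"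
      unfolding E_def using K(1) by (intro mult_left_mono far_dist False) auto
    also have "\<dots> \<le> (C + 2 * K * E) * sdist B x y powr hexp B"
      using C(1) by (simp add: algebra_simps)
    finally show ?thesis .
  qed
  moreover have "0 \<le> C + 2 * K * E" using K(1) C(1) by (simp add: E_def)
  ultimately show ?thesis by blast
qed

end

context vbundle
begin

lemma rnorm_finsler: "finsler_norm B (rnorm B)"
  using riem unfolding riemannian_norm_def by blast

definition "Nn x v = rnorm B (G x v)"

lemma Nn_comparable: "\<exists>C\<ge>1. \<forall>x\<in>spts B. \<forall>v. Nn x v \<le> C * norm v \<and> norm v \<le> C * Nn x v"
  unfolding Nn_def by (rule finsler_comparable[OF rnorm_finsler])

text \<open>A fixed choice that depends on the bundle alone and is therefore common to all
  automorphisms.\<close>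

definition "C0 = (SOME C. 1 \<le> C \<and> (\<forall>x\<in>spts B. \<forall>v. Nn x v \<le> C * norm v \<and> norm v \<le> C * Nn x v))"

lemma C0: "1 \<le> C0" "x \<in> spts B \<Longrightarrow> Nn x v \<le> C0 * norm v" "x \<in> spts B \<Longrightarrow> norm v \<le> C0 * Nn x v"
proof -
  have "\<exists>C. 1 \<le> C \<and> (\<forall>x\<in>spts B. \<forall>v. Nn x v \<le> C * norm v \<and> norm v \<le> C * Nn x v)"
    using Nn_comparable by blast
  from someI_ex[OF this, folded C0_def]
  show "1 \<le> C0" "x \<in> spts B \<Longrightarrow> Nn x v \<le> C0 * norm v" "x \<in> spts B \<Longrightarrow> norm v \<le> C0 * Nn x v" by blast+
qed

lemma Nn_nn: "x \<in> spts B \<Longrightarrow> 0 \<le> Nn x v"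
  unfolding Nn_def by (rule finsler_props(1)[OF rnorm_finsler])

text \<open>The supremum defining \<open>fnorm\<close> behaves as an operator norm as soon as it is bounded.\<close>

lemma fnorm_set: "x \<in> spts B \<Longrightarrow> {u \<in> fiber B x. f u \<le> 1} = G x ` {v. f (G x v) \<le> 1}"
  by (auto simp: fiber_eq)

lemma fnorm_le:
  assumes x: "x \<in> spts B" and f: "finsler_norm B f" and c: "0 \<le> c" and L: "\<And>v. f (L (G x v)) \<le> c * f (G x v)"
  shows "fnorm B f x L \<le> c"
  unfolding fnorm_def
proof (rule cSUP_least)
  show "{u \<in> fiber B x. f u \<le> 1} \<noteq> {}"
    unfolding fnorm_set[OF x] using finsler_props(2)[OF f x, of 0] by (auto intro!: exI[of _ 0])
  fix u assume u: "u \<in> {u \<in> fiber B x. f u \<le> 1}"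
  then obtain v where v: "u = G x v" "f (G x v) \<le> 1" unfolding fnorm_set[OF x] by blast
  have "f (L u) \<le> c * f (G x v)" unfolding v(1) by (rule L)
  also have "\<dots> \<le> c * 1" using c v(2) by (intro mult_left_mono) auto
  finally show "f (L u) \<le> c" by simp
qed

lemma le_fnorm:
  assumes x: "x \<in> spts B" and f: "finsler_norm B f" and L: "\<And>v. f (L (G x v)) \<le> c * f (G x v)"
    and sc: "\<And>a v. f (L (G x (a *\<^sub>R v))) = \<bar>a\<bar> * f (L (G x v))"
  shows "f (L (G x v)) \<le> fnorm B f x L * f (G x v)"
proof (cases "v = 0")
  case True
  then have "f (L (G x v)) = 0" using sc[of 0 v] by simp
  moreover have "f (G x v) = 0" using True finsler_props(2)[OF f x, of v] by simp
  ultimately show ?thesis by simp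
next
  case False
  define s where "s = f (G x v)"
  have s: "0 < s" using finsler_props(1,2)[OF f x, of v] False unfolding s_def by linarith
  let ?w = "(1 / s) *\<^sub>R v"
  have w: "f (G x ?w) = 1" using finsler_props(3)[OF f x, of "1 / s" v] s by (simp add: s_def)
  have bdd: "bdd_above ((\<lambda>u. f (L u)) ` {u \<in> fiber B x. f u \<le> 1})"
  proof (rule bdd_aboveI2)
    fix u assume "u \<in> {u \<in> fiber B x. f u \<le> 1}"
    then obtain z where z: "u = G x z" "f (G x z) \<le> 1" unfolding fnorm_set[OF x] by blast
    have "f (L u) \<le> c * f (G x z)" unfolding z(1) by (rule L)
    also have "\<dots> \<le> \<bar>c\<bar> * 1" using z(2) finsler_props(1)[OF f x, of z] by (intro mult_mono) auto
    finally show "f (L u) \<le> \<bar>c\<bar>" by simp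
  qed
  have "f (L (G x ?w)) \<le> fnorm B f x L"
    unfolding fnorm_def by (rule cSUP_upper[OF _ bdd]) (use G_fiber[OF x] w in simp)
  then have "(1 / s) * f (L (G x v)) \<le> fnorm B f x L" using sc[of "1 / s" v] s by simp
  then show ?thesis using s unfolding s_def[symmetric] by (simp add: field_simps)
qed

lemma fnorm_nn:
  assumes x: "x \<in> spts B" and f: "finsler_norm B f" and L: "\<And>v. f (L (G x v)) \<le> c * f (G x v)"
    and sc: "\<And>a v. f (L (G x (a *\<^sub>R v))) = \<bar>a\<bar> * f (L (G x v))" and nn: "\<And>v. 0 \<le> f (L (G x v))"
  shows "0 \<le> fnorm B f x L"
proof -
  obtain e :: "real ^ 'd" where "norm e = 1" using norm_Basis nonempty_Basis by (metis ex_in_conv)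
  then have "e \<noteq> 0" by auto
  then have p: "0 < f (G x e)" using finsler_props(1,2)[OF f x, of e] by linarith
  have "0 \<le> fnorm B f x L * f (G x e)" using le_fnorm[OF x f L sc, of e] nn[of e] by linarith
  then show ?thesis using p by (simp add: zero_le_mult_iff)
qed

subsection \<open>Bunching in coordinates\<close>

text \<open>Uniformity comes from a ratio that is continuous in the point and in two unit vectors,
  so that continuity of \<open>bol\<close> never enters. Its maximum \<open>q\<close> is attained
  and is at most \<open>bol\<close> at the maximizing point, hence strictly below the bunching
  threshold.\<close>

lemma bunched_coords:
  assumes fb: "fiber_bunched B \<Phi>"
  shows "\<exists>q Cf. 0 < q \<and> q < exp (rate B * hexp B) \<and>
    (\<forall>x\<in>spts B. \<forall>n. norm (cpr 1 (Am \<Phi>) n x) * norm (cpi 1 (Aim \<Phi>) n x) \<le> Cf * q ^ n)"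
proof -
  obtain f where f: "finsler_norm B f" and bol: "\<And>x. x \<in> spts B \<Longrightarrow> ln (bol B f \<Phi> x) < hexp B * rate B"
    using fb unfolding fiber_bunched_def riemannian_norm_def by blast
  have ha: "holder_automorphism B \<Phi>" using fb unfolding fiber_bunched_def by blast
  then have a: "automorphism B \<Phi>" unfolding holder_automorphism_def by blast
  let ?A = "Am \<Phi>" and ?Ai = "Aim \<Phi>"
  define h where "h x v = f (G x v)" for x v
  note hp = finsler_props[OF f, folded h_def]
  obtain Ch where Ch: "Ch \<ge> 1" "\<And>x v. x \<in> spts B \<Longrightarrow> h x v \<le> Ch * norm v" "\<And>x v. x \<in> spts B \<Longrightarrow> norm v \<le> Ch * h x v"
    using finsler_comparable[OF f, folded h_def] by blast
  obtain K where K: "K \<ge> 1" "\<And>x. x \<in> spts B \<Longrightarrow> norm (?A x) \<le> K" "\<And>x. x \<in> spts B \<Longrightarrow> norm (?Ai x) \<le> K"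
    using Am_bounded[OF a] by blast
  obtain H where H: "\<And>x y. x \<in> spts B \<Longrightarrow> y \<in> spts B \<Longrightarrow> norm (?A x - ?A y) \<le> H * sdist B x y powr hexp B"
    using Am_holder[OF ha] by blast
  have Hi: "norm (?Ai x - ?Ai y) \<le> K * (H * K) * sdist B x y powr hexp B" if "x \<in> spts B" "y \<in> spts B" for x y
    using Aim_holder[OF a that K(3)[OF that(1)] K(3)[OF that(2)] H[OF that]] by (simp add: mult_ac)
  have cA: "continuous_on (spts B) ?A" by (rule holder_imp_continuous_on[OF rate_pos hexp_pos H])
  have cAi: "continuous_on (spts B) ?Ai" by (rule holder_imp_continuous_on[OF rate_pos hexp_pos Hi])
  have ch: "continuous_on (spts B \<times> UNIV) (\<lambda>p. h (fst p) (snd p))"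
    unfolding h_def using f by (intro continuous_in_coords) (simp add: finsler_norm_def)
  have hT: "\<Phi> (G x v) = G (shift 1 x) (bap (?A x) v)" "ainv B \<Phi> (G (shift 1 x) v) = G x (bap (?Ai x) v)" if "x \<in> spts B" for x v
    using aut_G[OF a that] ainv_G[OF a that] by blast+
  have h_le: "h y w \<le> (Ch * K' * Ch) * h x v" if "x \<in> spts B" "y \<in> spts B" "norm w \<le> K' * norm v" "0 \<le> K'" for x y v w K'
  proof -
    have "h y w \<le> Ch * norm w" by (rule Ch(2)[OF that(2)])
    also have "\<dots> \<le> Ch * (K' * norm v)" using that Ch(1) by (intro mult_left_mono) auto
    also have "\<dots> \<le> Ch * (K' * (Ch * h x v))" using that Ch by (intro mult_left_mono) auto
    finally show ?thesis by (simp add: mult.assoc)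
  qed
  have bd1: "f (\<Phi> (G x v)) \<le> (Ch * K * Ch) * f (G x v)" if x: "x \<in> spts B" for x v
    unfolding hT(1)[OF x] h_def[symmetric] using x K by (intro h_le norm_apply_le) auto
  have bd2: "f (ainv B \<Phi> (G (shift 1 x) v)) \<le> (Ch * K * Ch) * f (G (shift 1 x) v)" if x: "x \<in> spts B" for x v
    unfolding hT(2)[OF x] h_def[symmetric] using x K by (intro h_le norm_apply_le) auto
  have sc1: "f (\<Phi> (G x (c *\<^sub>R v))) = \<bar>c\<bar> * f (\<Phi> (G x v))" if x: "x \<in> spts B" for x v c
    unfolding hT(1)[OF x] h_def[symmetric] blinfun.scaleR_right using x by (intro hp) simp
  have sc2: "f (ainv B \<Phi> (G (shift 1 x) (c *\<^sub>R v))) = \<bar>c\<bar> * f (ainv B \<Phi> (G (shift 1 x) v))" if x: "x \<in> spts B" for x v c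
    unfolding hT(2)[OF x] h_def[symmetric] blinfun.scaleR_right using x by (intro hp) simp
  have up: "h (shift 1 x) (bap (?A x) v) * h x (bap (?Ai x) w) \<le> bol B f \<Phi> x * (h x v * h (shift 1 x) w)"
    if x: "x \<in> spts B" for x v w
  proof -
    have s: "shift 1 x \<in> spts B" using x by simp
    have 1: "h (shift 1 x) (bap (?A x) v) \<le> fnorm B f x \<Phi> * h x v"
      using le_fnorm[OF x f bd1[OF x] sc1[OF x], of v] unfolding hT(1)[OF x] h_def .
    have 2: "h x (bap (?Ai x) w) \<le> fnorm B f (shift 1 x) (ainv B \<Phi>) * h (shift 1 x) w"
      using le_fnorm[OF s f bd2[OF x] sc2[OF x], of w] unfolding hT(2)[OF x] h_def .
    have "h (shift 1 x) (bap (?A x) v) * h x (bap (?Ai x) w) \<le> (fnorm B f x \<Phi> * h x v) * (fnorm B f (shift 1 x) (ainv B \<Phi>) * h (shift 1 x) w)"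
      using hp(1)[OF x] hp(1)[OF s] by (intro mult_mono 1 2 order_trans[OF _ 1]) auto
    then show ?thesis by (simp add: bol_def mult_ac)
  qed
  \<comment> \<open>compactness turns the pointwise strict bound into a uniform one\<close>
  define R where "R = (\<lambda>(x, v, w). h (shift 1 x) (bap (?A x) v) * h x (bap (?Ai x) w) / (h x v * h (shift 1 x) w))"
  let ?S = "spts B \<times> sphere (0 :: real ^ 'd) 1 \<times> sphere (0 :: real ^ 'd) 1"
  have cS: "compact ?S" by (intro compact_Times compact_spts) simp_all
  have neS: "?S \<noteq> {}" using sphere_bundle_nonempty by auto
  have hpos: "0 < h x v" if "x \<in> spts B" "v \<noteq> 0" for x v
    using hp(1,2)[OF that(1), of v] that(2) by linarith
  have comp: "continuous_on ?S (\<lambda>p. h (\<alpha> p) (\<beta> p))"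
    if "continuous_on ?S \<alpha>" "continuous_on ?S \<beta>" "\<And>p. p \<in> ?S \<Longrightarrow> \<alpha> p \<in> spts B" for \<alpha> \<beta>
    using continuous_on_compose2[OF ch continuous_on_Pair[OF that(1,2)]] that(3) by auto
  have cf: "continuous_on ?S fst" "continuous_on ?S (\<lambda>p. fst (snd p))" "continuous_on ?S (\<lambda>p. snd (snd p))"
    by (intro continuous_intros)+
  have cs: "continuous_on ?S (\<lambda>p. shift 1 (fst p))"
    by (rule continuous_on_compose2[OF continuous_on_shift[where S = UNIV] cf(1)]) simp
  have cAf: "continuous_on ?S (\<lambda>p. ?A (fst p))" "continuous_on ?S (\<lambda>p. ?Ai (fst p))"
    by (rule continuous_on_compose2[OF cA cf(1)], force, rule continuous_on_compose2[OF cAi cf(1)], force)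
  have "continuous_on ?S (\<lambda>p. h (shift 1 (fst p)) (bap (?A (fst p)) (fst (snd p))) * h (fst p) (bap (?Ai (fst p)) (snd (snd p))) / (h (fst p) (fst (snd p)) * h (shift 1 (fst p)) (snd (snd p))))"
  proof (intro continuous_on_divide continuous_on_mult comp cf cs bounded_bilinear.continuous_on[OF bounded_bilinear_blinfun_apply] cAf ballI)
    show "h (fst p) (fst (snd p)) * h (shift 1 (fst p)) (snd (snd p)) \<noteq> 0" if "p \<in> ?S" for p
    proof -
      have "0 < h (fst p) (fst (snd p))" "0 < h (shift 1 (fst p)) (snd (snd p))" using that by (auto intro!: hpos)
      then show ?thesis by simp
    qed
  qed auto
  then have "continuous_on ?S R" unfolding R_def case_prod_beta .
  from continuous_attains_sup[OF cS neS this] obtain p where p: "p \<in> ?S" "\<And>y. y \<in> ?S \<Longrightarrow> R y \<le> R p" by blast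
  obtain x0 v0 w0 where p0: "p = (x0, v0, w0)" by (cases p) auto
  have x0: "x0 \<in> spts B" "norm v0 = 1" "norm w0 = 1" using p(1) p0 by auto
  then have nz: "v0 \<noteq> 0" "w0 \<noteq> 0" by auto
  have s0: "shift 1 x0 \<in> spts B" using x0 by simp
  define q where "q = R p"
  have Anz: "bap (?A x) v \<noteq> 0" "bap (?Ai x) v \<noteq> 0" if "x \<in> spts B" "v \<noteq> 0" for x v
    using compose_eq1[OF Aim_Am[OF a that(1)], of v] compose_eq1[OF Am_Aim[OF a that(1)], of v] that(2) by auto
  have den: "0 < h x0 v0 * h (shift 1 x0) w0" using hpos[OF x0(1) nz(1)] hpos[OF s0 nz(2)] by simp
  have q0: "0 < q" unfolding q_def p0 R_def
    using den hpos[OF s0 Anz(1)[OF x0(1) nz(1)]] hpos[OF x0(1) Anz(2)[OF x0(1) nz(2)]] by simp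
  have "q \<le> bol B f \<Phi> x0" unfolding q_def p0 R_def using up[OF x0(1), of v0 w0] den by (simp add: pos_divide_le_eq)
  moreover have "bol B f \<Phi> x0 < exp (hexp B * rate B)"
  proof -
    have "0 < bol B f \<Phi> x0" using q0 \<open>q \<le> bol B f \<Phi> x0\<close> by linarith
    then show ?thesis using bol[OF x0(1)] by (metis exp_less_cancel_iff exp_ln)
  qed
  ultimately have q1: "q < exp (rate B * hexp B)" by (simp add: mult.commute)
  have step: "h (shift 1 x) (bap (?A x) v) * h x (bap (?Ai x) w) \<le> q * (h x v * h (shift 1 x) w)" if x: "x \<in> spts B" for x v w
  proof (cases "v = 0 \<or> w = 0")
    case True
    have s: "shift 1 x \<in> spts B" using x by simp
    have "h y 0 = 0" if "y \<in> spts B" for y using hp(2)[OF that, of 0] by simp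
    then show ?thesis using True x s by auto
  next
    case False
    define v' where "v' = v /\<^sub>R norm v"
    define w' where "w' = w /\<^sub>R norm w"
    have v': "norm v' = 1" "v = norm v *\<^sub>R v'" and w': "norm w' = 1" "w = norm w *\<^sub>R w'" using False by (auto simp: v'_def w'_def)
    have s: "shift 1 x \<in> spts B" using x by simp
    have "(x, v', w') \<in> ?S" using x v' w' by simp
    from p(2)[OF this] have "h (shift 1 x) (bap (?A x) v') * h x (bap (?Ai x) w') / (h x v' * h (shift 1 x) w') \<le> q"
      by (simp add: q_def R_def)
    moreover have "0 < h x v' * h (shift 1 x) w'" using hpos[OF x, of v'] hpos[OF s, of w'] v' w' by fastforce
    ultimately have "h (shift 1 x) (bap (?A x) v') * h x (bap (?Ai x) w') \<le> q * (h x v' * h (shift 1 x) w')"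
      by (simp add: pos_divide_le_eq)
    then have "(norm v * norm w) * (h (shift 1 x) (bap (?A x) v') * h x (bap (?Ai x) w')) \<le> (norm v * norm w) * (q * (h x v' * h (shift 1 x) w'))"
      by (intro mult_left_mono) auto
    moreover have "h (shift 1 x) (bap (?A x) v) = norm v * h (shift 1 x) (bap (?A x) v')"
      using hp(3)[OF s, of "norm v" "bap (?A x) v'"] v'(2) by (metis abs_norm_cancel blinfun.scaleR_right)
    moreover have "h x (bap (?Ai x) w) = norm w * h x (bap (?Ai x) w')"
      using hp(3)[OF x, of "norm w" "bap (?Ai x) w'"] w'(2) by (metis abs_norm_cancel blinfun.scaleR_right)
    moreover have "h x v = norm v * h x v'" using hp(3)[OF x, of "norm v" v'] v'(2) by simp
    moreover have "h (shift 1 x) w = norm w * h (shift 1 x) w'" using hp(3)[OF s, of "norm w" w'] w'(2) by simp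
    ultimately show ?thesis by (simp add: mult_ac)
  qed
  \<comment> \<open>The inequality for \<open>n\<close> steps is multiplied by the one for a single
    step; the norms of the intermediate vectors occur on both sides and cancel.\<close>
  have iter: "h (shift (int n) x) (bap (cpr 1 ?A n x) v) * h x (bap (cpi 1 ?Ai n x) w) \<le> q ^ n * (h x v * h (shift (int n) x) w)"
    if x: "x \<in> spts B" for x v w n
  proof (induction n arbitrary: w)
    case (Suc n)
    let ?z = "shift (int n) x" and ?z' = "shift (int (Suc n)) x"
    have z: "?z \<in> spts B" "?z' \<in> spts B" using x by auto
    have zz: "shift 1 ?z = ?z'" by simp
    let ?p = "bap (cpr 1 ?A n x) v" and ?w = "bap (?Ai ?z) w"
    have e: "bap (cpr 1 ?A (Suc n) x) v = bap (?A ?z) ?p" "bap (cpi 1 ?Ai (Suc n) x) w = bap (cpi 1 ?Ai n x) ?w" by simp_all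
    have 1: "h ?z ?p * h x (bap (cpi 1 ?Ai n x) ?w) \<le> q ^ n * (h x v * h ?z ?w)" by (rule Suc.IH)
    have 2: "h ?z' (bap (?A ?z) ?p) * h ?z ?w \<le> q * (h ?z ?p * h ?z' w)" using step[OF z(1), of ?p w] unfolding zz .
    show ?case
      unfolding e
    proof (cases "?p = 0 \<or> ?w = 0")
      case True
      have h0: "h y 0 = 0" if "y \<in> spts B" for y using hp(2)[OF that, of 0] by simp
      have "h ?z' (bap (?A ?z) ?p) * h x (bap (cpi 1 ?Ai n x) ?w) = 0" using True h0[OF x] h0[OF z(2)] by auto
      moreover have "0 \<le> q ^ Suc n * (h x v * h ?z' w)" using q0 hp(1)[OF x] hp(1)[OF z(2)] by simp
      ultimately show "h ?z' (bap (?A ?z) ?p) * h x (bap (cpi 1 ?Ai n x) ?w) \<le> q ^ Suc n * (h x v * h ?z' w)" by linarith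
    next
      case False
      have pos: "0 < h ?z ?p * h ?z ?w" using False hpos[OF z(1)] by simp
      have "(h ?z ?p * h x (bap (cpi 1 ?Ai n x) ?w)) * (h ?z' (bap (?A ?z) ?p) * h ?z ?w) \<le> (q ^ n * (h x v * h ?z ?w)) * (q * (h ?z ?p * h ?z' w))"
        using q0 hp(1)[OF x] hp(1)[OF z(1)] hp(1)[OF z(2)] by (intro mult_mono 1 2) auto
      then have "(h ?z' (bap (?A ?z) ?p) * h x (bap (cpi 1 ?Ai n x) ?w)) * (h ?z ?p * h ?z ?w) \<le> (q ^ Suc n * (h x v * h ?z' w)) * (h ?z ?p * h ?z ?w)"
        by (simp add: mult_ac)
      then show "h ?z' (bap (?A ?z) ?p) * h x (bap (cpi 1 ?Ai n x) ?w) \<le> q ^ Suc n * (h x v * h ?z' w)" using pos by (rule mult_right_le_imp_le)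
    qed
  qed simp
  \<comment> \<open>Two initial and two image vectors are each compared once with the Euclidean
    norm, whence \<open>Ch ^ 4\<close>. The operator norms are then extracted one vector at a
    time.\<close>
  have "norm (cpr 1 ?A n x) * norm (cpi 1 ?Ai n x) \<le> Ch ^ 4 * q ^ n" if x: "x \<in> spts B" for x n
  proof -
    have z: "shift (int n) x \<in> spts B" using x by simp
    have vw: "norm (bap (cpr 1 ?A n x) v) * norm (bap (cpi 1 ?Ai n x) w) \<le> Ch ^ 4 * q ^ n * norm v * norm w" for v w
    proof -
      have "norm (bap (cpr 1 ?A n x) v) * norm (bap (cpi 1 ?Ai n x) w) \<le> (Ch * h (shift (int n) x) (bap (cpr 1 ?A n x) v)) * (Ch * h x (bap (cpi 1 ?Ai n x) w))"
        using Ch(1) hp(1)[OF z] by (intro mult_mono Ch(3) x z) auto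
      also have "\<dots> = Ch ^ 2 * (h (shift (int n) x) (bap (cpr 1 ?A n x) v) * h x (bap (cpi 1 ?Ai n x) w))" by (simp add: power2_eq_square mult_ac)
      also have "\<dots> \<le> Ch ^ 2 * (q ^ n * (h x v * h (shift (int n) x) w))" using Ch(1) by (intro mult_left_mono iter x) auto
      also have "\<dots> \<le> Ch ^ 2 * (q ^ n * ((Ch * norm v) * (Ch * norm w)))"
        using Ch(1) q0 hp(1)[OF z] by (intro mult_left_mono mult_mono Ch(2) x z) auto
      also have "\<dots> = Ch ^ 4 * q ^ n * norm v * norm w" by (simp add: power2_eq_square power4_eq_xxxx mult_ac)
      finally show ?thesis .
    qed
    have c0: "0 \<le> Ch ^ 4 * q ^ n" using Ch(1) q0 by simp
    have "norm (cpr 1 ?A n x) * norm (bap (cpi 1 ?Ai n x) w) \<le> Ch ^ 4 * q ^ n * norm w" for w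
    proof (cases "norm (bap (cpi 1 ?Ai n x) w) = 0")
      case True
      then show ?thesis using c0 by simp
    next
      case False
      let ?k = "norm (bap (cpi 1 ?Ai n x) w)"
      have "norm (cpr 1 ?A n x) \<le> Ch ^ 4 * q ^ n * norm w / ?k"
      proof (rule norm_blinfun_bound)
        show "0 \<le> Ch ^ 4 * q ^ n * norm w / ?k" using c0 by simp
        show "norm (bap (cpr 1 ?A n x) v) \<le> Ch ^ 4 * q ^ n * norm w / ?k * norm v" for v
          using vw[of v w] False by (simp add: field_simps)
      qed
      then show ?thesis using False by (simp add: field_simps)
    qed
    note l2 = this
    show ?thesis
    proof (cases "norm (cpr 1 ?A n x) = 0")
      case True
      then show ?thesis using c0 by simp
    next
      case False
      let ?k = "norm (cpr 1 ?A n x)"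
      have "norm (cpi 1 ?Ai n x) \<le> Ch ^ 4 * q ^ n / ?k"
      proof (rule norm_blinfun_bound)
        show "0 \<le> Ch ^ 4 * q ^ n / ?k" using c0 by simp
        show "norm (bap (cpi 1 ?Ai n x) v) \<le> Ch ^ 4 * q ^ n / ?k * norm v" for v
          using l2[of v] False by (simp add: field_simps)
      qed
      then show ?thesis using False by (simp add: field_simps)
    qed
  qed
  then show ?thesis using q0 q1 by blast
qed

end

section \<open>Families of spannable automorphisms\<close>

context vbundle
begin

lemma fnorm_mat:
  assumes x: "x \<in> spts B" and y: "y \<in> spts B" and L: "\<And>v. L (G x v) = G y (bap X v)"
  shows "norm X \<le> C0 ^ 2 * fnorm B (rnorm B) x L" "fnorm B (rnorm B) x L \<le> C0 ^ 2 * norm X"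
    "rnorm B (L (G x v)) \<le> fnorm B (rnorm B) x L * rnorm B (G x v)" "0 \<le> fnorm B (rnorm B) x L"
proof -
  have bd: "rnorm B (L (G x v)) \<le> (C0 ^ 2 * norm X) * rnorm B (G x v)" for v
  proof -
    have "Nn y (bap X v) \<le> C0 * norm (bap X v)" by (rule C0(2)[OF y])
    also have "\<dots> \<le> C0 * (norm X * norm v)" using C0(1) by (intro mult_left_mono norm_blinfun) auto
    also have "\<dots> \<le> C0 * (norm X * (C0 * Nn x v))" using C0(1) by (intro mult_left_mono C0(3) x) auto
    finally show ?thesis unfolding L by (simp add: Nn_def power2_eq_square mult_ac)
  qed
  have sc: "rnorm B (L (G x (a *\<^sub>R v))) = \<bar>a\<bar> * rnorm B (L (G x v))" for a v
    unfolding L blinfun.scaleR_right by (rule finsler_props(3)[OF rnorm_finsler y])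
  have nn: "0 \<le> rnorm B (L (G x v))" for v unfolding L by (rule finsler_props(1)[OF rnorm_finsler y])
  show le: "rnorm B (L (G x v)) \<le> fnorm B (rnorm B) x L * rnorm B (G x v)" for v
    by (rule le_fnorm[OF x rnorm_finsler bd sc])
  show nn': "0 \<le> fnorm B (rnorm B) x L" by (rule fnorm_nn[OF x rnorm_finsler bd sc nn])
  show "fnorm B (rnorm B) x L \<le> C0 ^ 2 * norm X"
    using C0(1) by (intro fnorm_le[OF x rnorm_finsler _ bd]) simp
  show "norm X \<le> C0 ^ 2 * fnorm B (rnorm B) x L"
  proof (rule norm_blinfun_bound)
    show "0 \<le> C0 ^ 2 * fnorm B (rnorm B) x L" using nn' by simp
    fix v
    have "norm (bap X v) \<le> C0 * Nn y (bap X v)" by (rule C0(3)[OF y])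
    also have "Nn y (bap X v) \<le> fnorm B (rnorm B) x L * Nn x v" using le[of v] unfolding L by (simp add: Nn_def)
    also have "\<dots> \<le> fnorm B (rnorm B) x L * (C0 * norm v)" using nn' by (intro mult_left_mono C0(2) x)
    finally show "norm (bap X v) \<le> C0 ^ 2 * fnorm B (rnorm B) x L * norm v"
      using C0(1) by (simp add: power2_eq_square mult_ac)
  qed
qed

text \<open>The bound \<open>k\<close> is qualitative: it makes the supremum in
  \<open>c0norm\<close> a genuine one and does not enter the estimate.\<close>

lemma c0norm_mat:
  assumes L: "\<And>x v. x \<in> spts B \<Longrightarrow> L (G x v) = G (\<tau> x) (bap (X x) v)" and \<tau>: "\<And>x. x \<in> spts B \<Longrightarrow> \<tau> x \<in> spts B"
    and bd: "\<And>x. x \<in> spts B \<Longrightarrow> norm (X x) \<le> k" and x: "x \<in> spts B"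
  shows "norm (X x) \<le> C0 ^ 2 * c0norm B L"
proof -
  have "bdd_above ((\<lambda>x. fnorm B (rnorm B) x L) ` spts B)"
  proof (rule bdd_aboveI2)
    fix x assume x: "x \<in> spts B"
    have "fnorm B (rnorm B) x L \<le> C0 ^ 2 * norm (X x)" by (rule fnorm_mat(2)[OF x \<tau>[OF x] L[OF x]])
    also have "\<dots> \<le> C0 ^ 2 * k" by (intro mult_left_mono bd x) simp
    finally show "fnorm B (rnorm B) x L \<le> C0 ^ 2 * k" .
  qed
  then have "fnorm B (rnorm B) x L \<le> c0norm B L" unfolding c0norm_def by (intro cSUP_upper x)
  then have "C0 ^ 2 * fnorm B (rnorm B) x L \<le> C0 ^ 2 * c0norm B L" by (intro mult_left_mono) auto
  with fnorm_mat(1)[OF x \<tau>[OF x] L[OF x]] show ?thesis by linarith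
qed

lemma c0dist_mat:
  assumes a: "automorphism B \<Phi>" "automorphism B \<Psi>" and x: "x \<in> spts B"
  shows "norm (Am \<Psi> x - Am \<Phi> x) \<le> C0 ^ 2 * c0dist B \<Psi> \<Phi>"
proof -
  obtain K where K: "\<And>x. x \<in> spts B \<Longrightarrow> norm (Am \<Phi> x) \<le> K" using Am_bounded[OF a(1)] by blast
  obtain K' where K': "\<And>x. x \<in> spts B \<Longrightarrow> norm (Am \<Psi> x) \<le> K'" using Am_bounded[OF a(2)] by blast
  show ?thesis unfolding c0dist_def
  proof (rule c0norm_mat[where \<tau> = "shift 1" and X = "\<lambda>x. Am \<Psi> x - Am \<Phi> x" and k = "K' + K"])
    fix x assume x: "x \<in> spts B"
    then have s: "shift 1 x \<in> spts B" by simp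
    show "vsub B (\<Psi> (G x v)) (\<Phi> (G x v)) = G (shift 1 x) (bap (Am \<Psi> x - Am \<Phi> x) v)" for v
      unfolding aut_G[OF a(1) x] aut_G[OF a(2) x] G_diff[OF s, symmetric] by (simp add: blinfun.diff_left)
    show "shift 1 x \<in> spts B" by (rule s)
    show "norm (Am \<Psi> x - Am \<Phi> x) \<le> K' + K"
      using norm_triangle_ineq4[of "Am \<Psi> x" "Am \<Phi> x"] K[OF x] K'[OF x] by linarith
  qed (rule x)
qed

lemma AutD:
  assumes "\<Psi> \<in> Aut B K"
  shows "holder_automorphism B \<Psi>" "automorphism B \<Psi>" "holder_aut_norm B 1 \<Psi> \<le> ereal K"
    "holder_aut_norm B (- 1) (ainv B \<Psi>) \<le> ereal K"
  using assms unfolding Aut_def holder_automorphism_def by blast+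

lemma Aut_bounds:
  assumes \<Psi>: "\<Psi> \<in> Aut B K" and x: "x \<in> spts B"
  shows "norm (Am \<Psi> x) \<le> C0 ^ 2 * K" "norm (Aim \<Psi> x) \<le> C0 ^ 2 * K"
proof -
  note D = AutD[OF \<Psi>]
  obtain k where k: "\<And>x. x \<in> spts B \<Longrightarrow> norm (Am \<Psi> x) \<le> k" "\<And>x. x \<in> spts B \<Longrightarrow> norm (Aim \<Psi> x) \<le> k"
    using Am_bounded[OF D(2)] by blast
  have c: "c0norm B \<Psi> \<le> K" "c0norm B (ainv B \<Psi>) \<le> K" using D(3,4) unfolding holder_aut_norm_def by simp_all
  have "norm (Am \<Psi> x) \<le> C0 ^ 2 * c0norm B \<Psi>"
    by (rule c0norm_mat[where \<tau> = "shift 1" and k = k]) (use aut_G[OF D(2)] k(1) x in auto)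
  also have "\<dots> \<le> C0 ^ 2 * K" by (intro mult_left_mono c) simp
  finally show "norm (Am \<Psi> x) \<le> C0 ^ 2 * K" .
  have i: "ainv B \<Psi> (G z v) = G (shift (- 1) z) (bap (Aim \<Psi> (shift (- 1) z)) v)" if "z \<in> spts B" for z v
    using ainv_G[OF D(2), of "shift (- 1) z" v] that by simp
  have s: "shift 1 x \<in> spts B" using x by simp
  have "norm (Aim \<Psi> (shift (- 1) (shift 1 x))) \<le> C0 ^ 2 * c0norm B (ainv B \<Psi>)"
    by (rule c0norm_mat[where \<tau> = "shift (- 1)" and k = k and X = "\<lambda>z. Aim \<Psi> (shift (- 1) z)", OF i _ _ s]) (simp_all add: k(2))
  then have "norm (Aim \<Psi> x) \<le> C0 ^ 2 * c0norm B (ainv B \<Psi>)" by simp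
  also have "\<dots> \<le> C0 ^ 2 * K" by (intro mult_left_mono c) simp
  finally show "norm (Aim \<Psi> x) \<le> C0 ^ 2 * K" .
qed

text \<open>The norm on \<open>Aut\<close> measures how far the automorphism is from commuting with
  the transport maps. Replacing these by the identity on either side costs Hoelder errors controlled
  by \<open>Cj\<close>, so the resulting constant depends on \<open>K\<close> and the bundle
  only.\<close>

lemma Aut_holder:
  assumes \<Psi>: "\<Psi> \<in> Aut B K" and K: "1 \<le> K" and x: "x \<in> spts B" and y: "y \<in> spts B"
    and Cj: "0 \<le> Cj" "\<And>x y. x \<in> spts B \<Longrightarrow> y \<in> spts B \<Longrightarrow> norm (J y x - id_blinfun) \<le> Cj * sdist B x y powr hexp B"
  shows "norm (Am \<Psi> x - Am \<Psi> y) \<le> (C0 ^ 2 * K + (C0 ^ 2 * K) * Cj * (exp (rate B) powr hexp B + 1)) * sdist B x y powr hexp B"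
proof (cases "x = y")
  case False
  note D = AutD[OF \<Psi>]
  let ?Tx = "shift 1 x" and ?Ty = "shift 1 y" and ?d = "sdist B x y powr hexp B"
  have s: "?Tx \<in> spts B" "?Ty \<in> spts B" using x y by auto
  have dpos: "0 < ?d" using False by (simp add: sdist_def)
  let ?L = "\<lambda>u. vsub B (transp B ?Ty ?Tx (\<Psi> u)) (\<Psi> (transp B y x u))"
  let ?X = "(J ?Ty ?Tx o\<^sub>L Am \<Psi> x) - (Am \<Psi> y o\<^sub>L J y x)"
  have L: "?L (G x v) = G ?Ty (bap ?X v)" for v
    unfolding aut_G[OF D(2) x] transp_G[OF s] transp_G[OF x y] aut_G[OF D(2) y] G_diff[OF s(2), symmetric]
    by (simp add: blinfun.diff_left)
  have "ereal (fnorm B (rnorm B) x ?L / ?d) \<le> ereal K"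
  proof -
    have "ereal (fnorm B (rnorm B) x ?L / ?d) \<le> (SUP (x, y)\<in>{(x, y). x \<in> spts B \<and> y \<in> spts B \<and> x \<noteq> y}.
        ereal (fnorm B (rnorm B) x
            (\<lambda>u. vsub B (transp B (shift 1 y) (shift 1 x) (\<Psi> u)) (\<Psi> (transp B y x u)))
          / sdist B x y powr hexp B))"
      by (rule SUP_upper2[of "(x, y)"]) (use x y False in auto)
    also have "\<dots> \<le> holder_aut_norm B 1 \<Psi>" unfolding holder_aut_norm_def by simp
    finally show ?thesis using D(3) by (rule order_trans)
  qed
  then have "fnorm B (rnorm B) x ?L \<le> K * ?d" using dpos by (simp add: pos_divide_le_eq)
  then have "C0 ^ 2 * fnorm B (rnorm B) x ?L \<le> C0 ^ 2 * (K * ?d)" by (intro mult_left_mono) auto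
  with fnorm_mat(1)[OF x s(2) L] have nX: "norm ?X \<le> C0 ^ 2 * K * ?d" by (simp add: mult.assoc)
  have b: "norm (Am \<Psi> x) \<le> C0 ^ 2 * K" "norm (Am \<Psi> y) \<le> C0 ^ 2 * K" using Aut_bounds[OF \<Psi>] x y by auto
  have "sdist B ?Tx ?Ty powr hexp B \<le> (exp (rate B * real_of_int \<bar>1\<bar>) * sdist B x y) powr hexp B"
    using hexp_pos by (intro powr_mono2 sdist_shift_le rate_pos) auto
  also have "\<dots> = exp (rate B) powr hexp B * ?d" by (simp add: powr_mult)
  finally have dT: "sdist B ?Tx ?Ty powr hexp B \<le> exp (rate B) powr hexp B * ?d" .
  have nJ: "norm (J ?Ty ?Tx - id_blinfun) \<le> Cj * (exp (rate B) powr hexp B * ?d)"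
    using Cj(2)[OF s] mult_left_mono[OF dT Cj(1)] by linarith
  have "Am \<Psi> x - Am \<Psi> y = (?X + (Am \<Psi> y o\<^sub>L (J y x - id_blinfun))) - ((J ?Ty ?Tx - id_blinfun) o\<^sub>L Am \<Psi> x)"
    by (simp add: compose_diff_left compose_diff_right)
  then have "norm (Am \<Psi> x - Am \<Psi> y) \<le> norm (?X + (Am \<Psi> y o\<^sub>L (J y x - id_blinfun))) + norm ((J ?Ty ?Tx - id_blinfun) o\<^sub>L Am \<Psi> x)"
    by (simp only: norm_triangle_ineq4)
  also have "norm (?X + (Am \<Psi> y o\<^sub>L (J y x - id_blinfun))) \<le> norm ?X + norm (Am \<Psi> y o\<^sub>L (J y x - id_blinfun))"
    by (rule norm_triangle_ineq)
  also have "norm ?X \<le> C0 ^ 2 * K * ?d" by (rule nX)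
  also have "norm (Am \<Psi> y o\<^sub>L (J y x - id_blinfun)) \<le> (C0 ^ 2 * K) * (Cj * ?d)" by (intro norm_compose_le b Cj x y)
  also have "norm ((J ?Ty ?Tx - id_blinfun) o\<^sub>L Am \<Psi> x) \<le> (Cj * (exp (rate B) powr hexp B * ?d)) * (C0 ^ 2 * K)"
    by (intro norm_compose_le b nJ)
  finally show ?thesis by (simp add: algebra_simps)
qed simp

text \<open>\<open>K * (H * K)\<close> is the Hoelder constant that the resolvent identity gives for
  the inverses; it dominates \<open>H\<close> because \<open>K\<close> is at least 1.\<close>

lemma cocyc_of_bounds:
  assumes a: "automorphism B \<Phi>" and K: "1 \<le> K" and nA: "\<And>x. x \<in> spts B \<Longrightarrow> norm (Am \<Phi> x) \<le> K" "\<And>x. x \<in> spts B \<Longrightarrow> norm (Aim \<Phi> x) \<le> K"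
    and H: "0 \<le> H" "\<And>x y. x \<in> spts B \<Longrightarrow> y \<in> spts B \<Longrightarrow> norm (Am \<Phi> x - Am \<Phi> y) \<le> H * sdist B x y powr hexp B"
    and b: "\<And>x n. x \<in> spts B \<Longrightarrow> norm (cpr 1 (Am \<Phi>) n x) * norm (cpi 1 (Aim \<Phi>) n x) \<le> Cb * q ^ n"
    and q: "0 < q" "q < exp (rate B * hexp B)" "1 \<le> Cb"
  shows "cocyc B (Am \<Phi>) (Aim \<Phi>) K (K * (H * K)) Cb q (hexp B)"
proof (intro cocyc.intro halfc.intro)
  have "q * exp (- rate B * hexp B) < exp (rate B * hexp B) * exp (- rate B * hexp B)"
    using q by (intro mult_strict_right_mono) auto
  then show "q * exp (- rate B * hexp B) < 1" by (simp add: exp_add[symmetric])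
  fix x y assume xy: "x \<in> spts B" "y \<in> spts B"
  show "norm (Aim \<Phi> x - Aim \<Phi> y) \<le> K * (H * K) * sdist B x y powr hexp B"
    using Aim_holder[OF a xy nA(2)[OF xy(1)] nA(2)[OF xy(2)] H(2)[OF xy]] by (simp add: mult_ac)
  have "H * 1 \<le> H * (K * K)" using K H(1) mult_mono[of 1 K 1 K] by (intro mult_left_mono) auto
  then have "H * sdist B x y powr hexp B \<le> K * (H * K) * sdist B x y powr hexp B"
    by (intro mult_right_mono) (auto simp: mult_ac)
  with H(2)[OF xy] show "norm (Am \<Phi> x - Am \<Phi> y) \<le> K * (H * K) * sdist B x y powr hexp B" by linarith
qed (use assms rate_pos hexp_pos Am_Aim[OF a] Aim_Am[OF a] in auto)

lemma spann_of_cocyc: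
  assumes "cocyc B (Am \<Phi>) (Aim \<Phi>) K Hc Cb q (hexp B)" "1 \<le> D" "unif_span B (Am \<Phi>) (Aim \<Phi>) m D"
  shows "spann B (Am \<Phi>) (Aim \<Phi>) K Hc Cb q (hexp B) m D C0 Nn"
proof (intro spann.intro spann_axioms.intro)
  show "\<exists>\<delta>>0. \<forall>x\<in>spts B. \<forall>y\<in>spts B. sdist B x y < \<delta> \<longrightarrow> (\<forall>v. \<bar>Nn x v - Nn y v\<bar> \<le> \<epsilon> * norm v)" if "\<epsilon> > 0" for \<epsilon>
  proof (rule unif_on_sphere[OF _ _ that])
    show "continuous_on (spts B \<times> UNIV) (\<lambda>p. Nn (fst p) (snd p))"
      unfolding Nn_def using rnorm_finsler by (intro continuous_in_coords) (simp add: finsler_norm_def)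
  qed (simp add: Nn_def finsler_props(3)[OF rnorm_finsler])
qed (use assms nonempty C0 in \<open>auto simp: Nn_def finsler_props(3,4)[OF rnorm_finsler]\<close>)

subsection \<open>Holonomies in coordinates\<close>

lemma pow_G:
  assumes a: "automorphism B \<Phi>" and x: "x \<in> spts B"
  shows "(\<Phi> ^^ n) (G x v) = G (shift (int n) x) (bap (cpr 1 (Am \<Phi>) n x) v)"
proof (induction n)
  case (Suc n)
  have s: "shift (int n) x \<in> spts B" using x by simp
  show ?case using Suc aut_G[OF a s] by simp
qed simp

lemma ainv_pow_G:
  assumes a: "automorphism B \<Phi>" and x: "x \<in> spts B"
  shows "(ainv B \<Phi> ^^ n) (G (shift (int n) x) v) = G x (bap (cpi 1 (Aim \<Phi>) n x) v)"
proof (induction n arbitrary: v)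
  case (Suc n)
  have s: "shift (int n) x \<in> spts B" using x by simp
  have "(ainv B \<Phi> ^^ Suc n) (G (shift (int (Suc n)) x) v) = (ainv B \<Phi> ^^ n) (ainv B \<Phi> (G (shift 1 (shift (int n) x)) v))"
    by (simp add: funpow_swap1)
  also have "\<dots> = (ainv B \<Phi> ^^ n) (G (shift (int n) x) (bap (Aim \<Phi> (shift (int n) x)) v))" by (simp only: ainv_G[OF a s])
  finally show ?case using Suc by simp
qed simp

lemma apow_pos: "apow B \<Phi> (int n) = \<Phi> ^^ n"
  by (simp add: apow_def)

lemma apow_neg: "apow B \<Phi> (- int n) = ainv B \<Phi> ^^ n"
  by (cases "n = 0") (simp_all add: apow_def)

text \<open>Along two orbits that approach each other at an admissible rate, the transport matrices
  are Hoelder close to the identity, so \<open>hol_via_transport\<close> identifies the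
  limit.\<close>

lemma Hs_coords:
  assumes a: "automorphism B \<Phi>" and co: "cocyc B (Am \<Phi>) (Aim \<Phi>) K Hc Cb q (hexp B)" and ad: "adm B 1 (hexp B) F x y"
  shows "Hs B \<Phi> y x (G x v) = G y (bap (hol 1 (Am \<Phi>) (Aim \<Phi>) y x) v)"
proof -
  interpret c: cocyc B "Am \<Phi>" "Aim \<Phi>" K Hc Cb q "hexp B" by (rule co)
  obtain Cj where Cj: "0 \<le> Cj" "\<And>x y. x \<in> spts B \<Longrightarrow> y \<in> spts B \<Longrightarrow> norm (J y x - id_blinfun) \<le> Cj * sdist B x y powr hexp B"
    using J_holder by blast
  have xy: "x \<in> spts B" "y \<in> spts B" "0 \<le> F" using ad by (auto simp: adm_def)
  let ?J = "\<lambda>n. J (shift (int n) y) (shift (int n) x)"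
  have ap: "hol_approx B \<Phi> y x (int n) (G x v) = G y (bap (cpi 1 (Aim \<Phi>) n y o\<^sub>L (?J n o\<^sub>L cpr 1 (Am \<Phi>) n x)) v)" for n
  proof -
    have s: "shift (int n) x \<in> spts B" "shift (int n) y \<in> spts B" using xy by auto
    show ?thesis unfolding hol_approx_def apow_pos apow_neg pow_G[OF a xy(1)] transp_G[OF s] ainv_pow_G[OF a xy(2)] by simp
  qed
  have nJ: "norm (?J n - id_blinfun) \<le> (Cj * F) * exp (- rate B * hexp B) ^ n" for n
  proof -
    have "sdist B (shift (int n) x) (shift (int n) y) powr hexp B \<le> F * exp (- rate B * hexp B) ^ n"
      using ad unfolding adm_def by (metis mult_1)
    then have "Cj * sdist B (shift (int n) x) (shift (int n) y) powr hexp B \<le> Cj * (F * exp (- rate B * hexp B) ^ n)"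
      using Cj(1) by (rule mult_left_mono)
    with Cj(2)[of "shift (int n) x" "shift (int n) y"] xy show ?thesis by simp
  qed
  have "(\<lambda>n. cpi 1 (Aim \<Phi>) n y o\<^sub>L (?J n o\<^sub>L cpr 1 (Am \<Phi>) n x)) \<longlonglongrightarrow> hol 1 (Am \<Phi>) (Aim \<Phi>) y x"
    by (rule c.S.hol_via_transport[OF ad _ nJ]) (use Cj(1) xy(3) in simp)
  then have "(\<lambda>n. bap (cpi 1 (Aim \<Phi>) n y o\<^sub>L (?J n o\<^sub>L cpr 1 (Am \<Phi>) n x)) v) \<longlonglongrightarrow> bap (hol 1 (Am \<Phi>) (Aim \<Phi>) y x) v"
    by (intro bounded_bilinear.tendsto[OF bounded_bilinear_blinfun_apply] tendsto_const)
  then show ?thesis unfolding Hs_def ap by (rule the_limit[OF xy(2)])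
qed

lemma Hu_coords:
  assumes a: "automorphism B \<Phi>" and co: "cocyc B (Am \<Phi>) (Aim \<Phi>) K Hc Cb q (hexp B)" and ad: "adm B (- 1) (hexp B) F x y"
  shows "Hu B \<Phi> y x (G x v) = G y (bap (hol (- 1) (\<lambda>x. Aim \<Phi> (shift (- 1) x)) (\<lambda>x. Am \<Phi> (shift (- 1) x)) y x) v)"
proof -
  interpret c: cocyc B "Am \<Phi>" "Aim \<Phi>" K Hc Cb q "hexp B" by (rule co)
  obtain Cj where Cj: "0 \<le> Cj" "\<And>x y. x \<in> spts B \<Longrightarrow> y \<in> spts B \<Longrightarrow> norm (J y x - id_blinfun) \<le> Cj * sdist B x y powr hexp B"
    using J_holder by blast
  have xy: "x \<in> spts B" "y \<in> spts B" "0 \<le> F" using ad by (auto simp: adm_def)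
  let ?J = "\<lambda>n. J (shift (- int n) y) (shift (- int n) x)"
  have ap: "hol_approx B \<Phi> y x (- int n) (G x v) = G y (bap (cpi (- 1) c.Bui n y o\<^sub>L (?J n o\<^sub>L cpr (- 1) c.Bu n x)) v)" for n
  proof -
    have s: "shift (- int n) x \<in> spts B" "shift (- int n) y \<in> spts B" using xy by auto
    have 1: "(ainv B \<Phi> ^^ n) (G x v) = G (shift (- int n) x) (bap (cpr (- 1) c.Bu n x) v)"
      unfolding c.cpr_backward using ainv_pow_G[OF a s(1), of n v] by simp
    have 2: "(\<Phi> ^^ n) (G (shift (- int n) y) w) = G y (bap (cpi (- 1) c.Bui n y) w)" for w
      unfolding c.cpi_backward using pow_G[OF a s(2), of n w] by simp
    show ?thesis unfolding hol_approx_def apow_neg minus_minus apow_pos 1 transp_G[OF s] 2 by simp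
  qed
  have nJ: "norm (?J n - id_blinfun) \<le> (Cj * F) * exp (- rate B * hexp B) ^ n" for n
  proof -
    have "sdist B (shift (- 1 * int n) x) (shift (- 1 * int n) y) powr hexp B \<le> F * exp (- rate B * hexp B) ^ n"
      using ad unfolding adm_def by blast
    then have "Cj * sdist B (shift (- int n) x) (shift (- int n) y) powr hexp B \<le> Cj * (F * exp (- rate B * hexp B) ^ n)"
      using Cj(1) by (intro mult_left_mono) auto
    with Cj(2)[of "shift (- int n) x" "shift (- int n) y"] xy show ?thesis by simp
  qed
  have "(\<lambda>n. cpi (- 1) c.Bui n y o\<^sub>L (?J n o\<^sub>L cpr (- 1) c.Bu n x)) \<longlonglongrightarrow> hol (- 1) c.Bu c.Bui y x"
    by (rule c.U.hol_via_transport[OF ad _ nJ]) (use Cj(1) xy(3) in simp)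
  then have "(\<lambda>n. bap (cpi (- 1) c.Bui n y o\<^sub>L (?J n o\<^sub>L cpr (- 1) c.Bu n x)) v) \<longlonglongrightarrow> bap (hol (- 1) c.Bu c.Bui y x) v"
    by (intro bounded_bilinear.tendsto[OF bounded_bilinear_blinfun_apply] tendsto_const)
  then show ?thesis unfolding Hu_def ap by (rule the_limit[OF xy(2)])
qed

lemma lincomb_coords:
  assumes y: "y \<in> spts B" and v: "\<And>i. i \<in> set l \<Longrightarrow> v i = G y (w i)"
  shows "foldr (\<lambda>i z. vadd B (vscale B (c i) (v i)) z) l (vzero B y) = G y (\<Sum>i\<leftarrow>l. c i *\<^sub>R w i)"
  using v by (induction l) (simp_all add: G_0[OF y] G_add[OF y] G_scale[OF y])

lemma fiber_basis_spans:
  assumes y: "y \<in> spts B" and b: "fiber_basis B y v" and v: "\<And>i. i < CARD('d) \<Longrightarrow> v i = G y (w i)"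
  shows "\<exists>c. z = (\<Sum>i<CARD('d). c i *\<^sub>R w i)"
proof -
  have "\<forall>u\<in>fiber B y. \<exists>c. foldr (\<lambda>i z. vadd B (vscale B (c i) (v i)) z) [0..<CARD('d)] (vzero B y) = u"
    using b unfolding fiber_basis_def Let_def by blast
  then obtain c where "foldr (\<lambda>i z. vadd B (vscale B (c i) (v i)) z) [0..<CARD('d)] (vzero B y) = G y z"
    using G_fiber[OF y, of z] by blast
  moreover have "foldr (\<lambda>i z. vadd B (vscale B (c i) (v i)) z) [0..<CARD('d)] (vzero B y) = G y (\<Sum>i\<leftarrow>[0..<CARD('d)]. c i *\<^sub>R w i)"
    by (rule lincomb_coords[OF y]) (use v in simp)
  ultimately have "z = (\<Sum>i\<leftarrow>[0..<CARD('d)]. c i *\<^sub>R w i)" using G_inj[OF y] by metis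
  then have "z = (\<Sum>i<CARD('d). c i *\<^sub>R w i)" by (simp add: interv_sum_list_conv_sum_set_nat atLeast0LessThan)
  then show ?thesis by blast
qed

lemma spannable_coords:
  assumes sp: "spannable B \<Phi>" and a: "automorphism B \<Phi>" and co: "cocyc B (Am \<Phi>) (Aim \<Phi>) K Hc Cb q (hexp B)"
    and x: "x \<in> spts B" and y: "y \<in> spts B" and u: "u \<noteq> 0"
  shows "\<exists>p k. (\<forall>i<CARD('d). p i \<in> Wu B x \<and> shift (int (k i)) (p i) \<in> Ws B y) \<and>
      (\<forall>w. \<exists>c. w = (\<Sum>i<CARD('d). c i *\<^sub>R bap (hol 1 (Am \<Phi>) (Aim \<Phi>) y (shift (int (k i)) (p i)))
        (bap (cpr 1 (Am \<Phi>) (k i) (p i)) (bap (hol (- 1) (\<lambda>x. Aim \<Phi> (shift (- 1) x)) (\<lambda>x. Am \<Phi> (shift (- 1) x)) (p i) x) u))))"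
proof -
  have "G x u \<in> fiber B x" "G x u \<noteq> vzero B x" using G_fiber[OF x] G_0[OF x] G_inj[OF x] u by metis+
  then obtain p k where p: "\<And>i. i < CARD('d) \<Longrightarrow> p i \<in> Wu B x \<and> shift (int (k i)) (p i) \<in> Ws B y"
    and b: "fiber_basis B y (\<lambda>i. Hs B \<Phi> y (shift (int (k i)) (p i)) ((\<Phi> ^^ k i) (Hu B \<Phi> (p i) x (G x u))))"
    using sp x y unfolding spannable_def by blast
  have v: "Hs B \<Phi> y (shift (int (k i)) (p i)) ((\<Phi> ^^ k i) (Hu B \<Phi> (p i) x (G x u)))
     = G y (bap (hol 1 (Am \<Phi>) (Aim \<Phi>) y (shift (int (k i)) (p i)))
        (bap (cpr 1 (Am \<Phi>) (k i) (p i)) (bap (hol (- 1) (\<lambda>x. Aim \<Phi> (shift (- 1) x)) (\<lambda>x. Am \<Phi> (shift (- 1) x)) (p i) x) u)))"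
    if i: "i < CARD('d)" for i
  proof -
    have ps: "p i \<in> spts B" "shift (int (k i)) (p i) \<in> spts B" using p[OF i] by (auto simp: Wu_def Ws_def)
    obtain m1 where m1: "\<forall>n\<le>- int m1. p i n = x n" using Wu_level[OF rate_pos] p[OF i] by blast
    obtain m2 where m2: "\<forall>n\<ge>int m2. shift (int (k i)) (p i) n = y n" using Ws_level[OF rate_pos] p[OF i] by blast
    have m2': "\<forall>n\<ge>int m2. y n = shift (int (k i)) (p i) n" using m2 by simp
    note ad1 = adm_unstable_level[OF rate_pos hexp_pos x ps(1) m1]
    note ad2 = adm_stable_level[OF rate_pos hexp_pos ps(2) y m2']
    show ?thesis unfolding Hu_coords[OF a co ad1] pow_G[OF a ps(1)] Hs_coords[OF a co ad2] ..
  qed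
  show ?thesis using p fiber_basis_spans[OF y b v] by blast
qed

text \<open>Since \<open>\<Phi>\<close> may lie outside \<open>Aut B K\<close>, each constant
  combines its own value for \<open>\<Phi>\<close> with the one that \<open>K\<close> imposes on the
  perturbations. With these fixed, bunching and uniform spannability each supply a radius of
  validity.\<close>

lemma spann_family:
  assumes sp: "spannable B \<Phi>" and K: "1 \<le> K"
  shows "\<exists>Kc Hc Cb q m D \<delta>. 0 < \<delta> \<and> spann B (Am \<Phi>) (Aim \<Phi>) Kc Hc Cb q (hexp B) m D C0 Nn \<and>
    (\<forall>\<Psi>\<in>Aut B K. c0dist B \<Psi> \<Phi> < \<delta> \<longrightarrow> spann B (Am \<Psi>) (Aim \<Psi>) Kc Hc Cb q (hexp B) m D C0 Nn)"
proof -
  have fb: "fiber_bunched B \<Phi>" using sp unfolding spannable_def by blast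
  then have ha: "holder_automorphism B \<Phi>" unfolding fiber_bunched_def by blast
  then have a: "automorphism B \<Phi>" unfolding holder_automorphism_def by blast
  obtain Cj where Cj: "0 \<le> Cj" "\<And>x y. x \<in> spts B \<Longrightarrow> y \<in> spts B \<Longrightarrow> norm (J y x - id_blinfun) \<le> Cj * sdist B x y powr hexp B"
    using J_holder by blast
  obtain K1 where K1: "1 \<le> K1" "\<And>x. x \<in> spts B \<Longrightarrow> norm (Am \<Phi> x) \<le> K1" "\<And>x. x \<in> spts B \<Longrightarrow> norm (Aim \<Phi> x) \<le> K1"
    using Am_bounded[OF a] by blast
  obtain H1 where H1: "0 \<le> H1" "\<And>x y. x \<in> spts B \<Longrightarrow> y \<in> spts B \<Longrightarrow> norm (Am \<Phi> x - Am \<Phi> y) \<le> H1 * sdist B x y powr hexp B"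
    using Am_holder[OF ha] by blast
  define Kc where "Kc = max K1 (C0 ^ 2 * K)"
  have Kc: "1 \<le> Kc" "K1 \<le> Kc" "C0 ^ 2 * K \<le> Kc" using K1(1) by (auto simp: Kc_def)
  define H2 where "H2 = C0 ^ 2 * K + (C0 ^ 2 * K) * Cj * (exp (rate B) powr hexp B + 1)"
  have H2: "0 \<le> H2" unfolding H2_def using K Cj(1) by simp
  define H where "H = H1 + H2"
  have H: "0 \<le> H" "H1 \<le> H" "H2 \<le> H" using H1(1) H2 by (auto simp: H_def)
  obtain q0 Cf where q0: "0 < q0" "q0 < exp (rate B * hexp B)"
    and bu: "\<And>x n. x \<in> spts B \<Longrightarrow> norm (cpr 1 (Am \<Phi>) n x) * norm (cpi 1 (Aim \<Phi>) n x) \<le> Cf * q0 ^ n"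
    using bunched_coords[OF fb] by blast
  have Q: "1 < exp (rate B * hexp B)" using rate_pos hexp_pos by simp
  have nA: "norm (Am \<Phi> x) \<le> Kc" "norm (Aim \<Phi> x) \<le> Kc" if "x \<in> spts B" for x
    using K1(2,3)[OF that] Kc(2) by linarith+
  obtain \<delta>1 q Cb where d1: "0 < \<delta>1" and q: "0 < q" "q < exp (rate B * hexp B)" "1 \<le> Cb"
    and fam: "\<And>A' Ai'. (\<forall>x\<in>spts B. norm (A' x) \<le> Kc \<and> norm (A' x - Am \<Phi> x) \<le> \<delta>1) \<and> (\<forall>x\<in>spts B. norm (Ai' x) \<le> Kc \<and> norm (Ai' x - Aim \<Phi> x) \<le> \<delta>1) \<Longrightarrow>
     (\<forall>x\<in>spts B. \<forall>n. norm (cpr 1 A' n x) * norm (cpi 1 Ai' n x) \<le> Cb * q ^ n)"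
    using bunch_family[OF Kc(1) nA bu q0 Q] by blast
  define Hc where "Hc = Kc * (H * Kc)"
  have co: "cocyc B (Am \<Phi>) (Aim \<Phi>) Kc Hc Cb q (hexp B)"
    unfolding Hc_def
  proof (rule cocyc_of_bounds[OF a Kc(1) nA H(1) _ _ q])
    show "norm (Am \<Phi> x - Am \<Phi> y) \<le> H * sdist B x y powr hexp B" if "x \<in> spts B" "y \<in> spts B" for x y
      using H1(2)[OF that] mult_right_mono[OF H(2), of "sdist B x y powr hexp B"] by simp
    show "norm (cpr 1 (Am \<Phi>) n x) * norm (cpi 1 (Aim \<Phi>) n x) \<le> Cb * q ^ n" if "x \<in> spts B" for x n
      using fam[of "Am \<Phi>" "Aim \<Phi>"] nA d1 that by simp
  qed
  interpret c: cocyc B "Am \<Phi>" "Aim \<Phi>" Kc Hc Cb q "hexp B" by (rule co)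
  obtain m D \<delta>2 where D: "1 \<le> D" "0 < \<delta>2" and us: "\<And>A' Ai'. cocyc B A' Ai' Kc Hc Cb q (hexp B) \<Longrightarrow>
    (\<forall>x\<in>spts B. norm (A' x - Am \<Phi> x) \<le> \<delta>2 \<and> norm (Ai' x - Aim \<Phi> x) \<le> \<delta>2) \<Longrightarrow> unif_span B A' Ai' m D"
    using c.uniformly_spannable[OF spannable_coords[OF sp a co]] by blast
  define \<delta>3 where "\<delta>3 = min \<delta>1 \<delta>2"
  have d3: "0 < \<delta>3" "\<delta>3 \<le> \<delta>1" "\<delta>3 \<le> \<delta>2" using d1 D(2) by (auto simp: \<delta>3_def)
  \<comment> \<open>\<open>C0 ^ 2\<close> converts the distance of automorphisms into one of
    matrices, and \<open>Kc * Kc\<close> is lost in passing to the inverses.\<close>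
  define \<delta> where "\<delta> = \<delta>3 / (C0 ^ 2 * (Kc * Kc))"
  have KK: "1 \<le> Kc * Kc" using mult_mono[OF Kc(1) Kc(1)] Kc(1) by simp
  have C02: "0 < C0 ^ 2" using C0(1) by simp
  have Kc0: "0 < Kc" using Kc(1) by simp
  have d: "0 < \<delta>" unfolding \<delta>_def using d3(1) C02 Kc0 by (intro divide_pos_pos mult_pos_pos)
  have "spann B (Am \<Psi>) (Aim \<Psi>) Kc Hc Cb q (hexp B) m D C0 Nn" if \<Psi>: "\<Psi> \<in> Aut B K" and cl: "c0dist B \<Psi> \<Phi> < \<delta>" for \<Psi>
  proof -
    note a' = AutD(2)[OF \<Psi>]
    have nA': "norm (Am \<Psi> x) \<le> Kc" "norm (Aim \<Psi> x) \<le> Kc" if "x \<in> spts B" for x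
      using Aut_bounds[OF \<Psi> that] Kc(3) by linarith+
    have e: "C0 ^ 2 * \<delta> * (Kc * Kc) = \<delta>3" unfolding \<delta>_def using C02 Kc0 by simp
    have cl1: "norm (Am \<Psi> x - Am \<Phi> x) \<le> C0 ^ 2 * \<delta>" if "x \<in> spts B" for x
      using c0dist_mat[OF a a' that] mult_left_mono[OF less_imp_le[OF cl], of "C0 ^ 2"] by simp
    have "C0 ^ 2 * \<delta> * 1 \<le> C0 ^ 2 * \<delta> * (Kc * Kc)" using KK d by (intro mult_left_mono) auto
    then have cA: "norm (Am \<Psi> x - Am \<Phi> x) \<le> \<delta>3" if "x \<in> spts B" for x using cl1[OF that] e by linarith
    have cAi: "norm (Aim \<Psi> x - Aim \<Phi> x) \<le> \<delta>3" if x: "x \<in> spts B" for x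
    proof -
      have "Aim \<Psi> x - Aim \<Phi> x = Aim \<Psi> x o\<^sub>L ((Am \<Phi> x - Am \<Psi> x) o\<^sub>L Aim \<Phi> x)"
        by (simp add: compose_diff_left compose_diff_right Am_Aim[OF a x] compose_assoc[symmetric] Aim_Am[OF a' x])
      also have "norm \<dots> \<le> Kc * ((C0 ^ 2 * \<delta>) * Kc)"
        using cl1[OF x] by (intro norm_compose_le nA nA' x) (simp add: norm_minus_commute)
      finally show ?thesis using e by (simp add: mult_ac)
    qed
    have co': "cocyc B (Am \<Psi>) (Aim \<Psi>) Kc Hc Cb q (hexp B)"
      unfolding Hc_def
    proof (rule cocyc_of_bounds[OF a' Kc(1) nA' H(1) _ _ q])
      show "norm (Am \<Psi> x - Am \<Psi> y) \<le> H * sdist B x y powr hexp B" if "x \<in> spts B" "y \<in> spts B" for x y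
        using Aut_holder[OF \<Psi> K that Cj, folded H2_def] mult_right_mono[OF H(3), of "sdist B x y powr hexp B"] by simp
      show "norm (cpr 1 (Am \<Psi>) n x) * norm (cpi 1 (Aim \<Psi>) n x) \<le> Cb * q ^ n" if "x \<in> spts B" for x n
        using fam[of "Am \<Psi>" "Aim \<Psi>"] nA' cA cAi d3(2) that by (meson order_trans)
    qed
    have "unif_span B (Am \<Psi>) (Aim \<Psi>) m D"
      by (rule us[OF co']) (use cA cAi d3(3) in \<open>meson order_trans\<close>)
    then show ?thesis by (rule spann_of_cocyc[OF co' D(1)])
  qed
  moreover have "spann B (Am \<Phi>) (Aim \<Phi>) Kc Hc Cb q (hexp B) m D C0 Nn"
    by (rule spann_of_cocyc[OF co D(1) us[OF co]]) (use D(2) in simp)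
  ultimately show ?thesis using d by blast
qed

end

section \<open>The Barabanov norm on the bundle\<close>

text \<open>\<open>lim\<close> is a description of the limit, and both sequences satisfy the same
  description even where neither converges. No exceptional set has to be discussed.\<close>

lemma lim_eq_of_null_diff:
  fixes X Y :: "nat \<Rightarrow> real"
  assumes "(\<lambda>n. X n - Y n) \<longlonglongrightarrow> 0" shows "lim X = lim Y"
proof -
  have "X \<longlonglongrightarrow> L \<longleftrightarrow> Y \<longlonglongrightarrow> L" for L
  proof
    assume "X \<longlonglongrightarrow> L"
    from tendsto_diff[OF this assms] show "Y \<longlonglongrightarrow> L" by simp
  next
    assume "Y \<longlonglongrightarrow> L"
    from tendsto_add[OF assms this] show "X \<longlonglongrightarrow> L" by simp
  qed
  then show ?thesis by (simp add: lim_def)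
qed

locale spannable_bundle = vbundle B + s: spann B "vbundle.Am B \<Phi>" "vbundle.Aim B \<Phi>" K Hc Cb q "hexp B" m D "vbundle.C0 B" "vbundle.Nn B"
  for B :: "('e, 'd::finite) hbundle" and \<Phi> :: "'e \<Rightarrow> 'e" and K Hc Cb q m D +
  assumes aut: "automorphism B \<Phi>"
begin

lemma Hu_G:
  assumes "x \<in> spts B" "y \<in> Wu_loc B x" shows "Hu B \<Phi> y x (G x v) = G y (bap (s.HU y x) v)"
  by (rule Hu_coords[OF aut s.cocyc_axioms s.adm_Wu[OF assms]])

lemma Hs_G:
  assumes "x \<in> spts B" "y \<in> Ws_loc B x" shows "Hs B \<Phi> y x (G x v) = G y (bap (s.HS y x) v)"
  by (rule Hs_coords[OF aut s.cocyc_axioms s.adm_Ws[OF assms]])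

lemma WWu_loc_G:
  assumes x: "x \<in> spts B" shows "WWu_loc B \<Phi> (G x v) = (\<lambda>y. G y (bap (s.HU y x) v)) ` Wu_loc B x"
proof -
  have "WWu_loc B \<Phi> (G x v) = (\<lambda>y. Hu B \<Phi> y x (G x v)) ` Wu_loc B x"
    unfolding WWu_loc_def proj_G[OF x] by blast
  also have "\<dots> = (\<lambda>y. G y (bap (s.HU y x) v)) ` Wu_loc B x" by (rule image_cong[OF refl Hu_G[OF x]])
  finally show ?thesis .
qed

text \<open>The two operator norms differ by a factor of at most \<open>C0 ^ 2\<close>, which
  disappears in the averaged logarithm.\<close>

lemma lyap1_eq:
  assumes \<mu>: "\<mu> \<in> invariant_measures B" shows "lyap1 B \<Phi> \<mu> = s.lyap \<mu>"
  unfolding lyap1_def s.lyap_def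
proof (rule Bochner_Integration.integral_cong[OF refl])
  fix x assume "x \<in> space \<mu>"
  then have x: "x \<in> spts B" using invariant_measuresD(2)[OF rate_pos \<mu>] by simp
  define c where "c = ln (C0 ^ 2)"
  have C02: "0 < C0 ^ 2" using C0(1) by simp
  have b: "norm (1 / real n * ln (fnorm B (rnorm B) x (\<Phi> ^^ n)) - s.F n x / real n) \<le> c * (1 / real n)" for n
  proof -
    have y: "shift (int n) x \<in> spts B" using x by simp
    note fm = fnorm_mat[OF x y pow_G[OF aut x, of n]]
    have An: "0 < norm (cpr 1 (Am \<Phi>) n x)" by (rule s.norm_An_pos[OF x])
    have fp: "0 < fnorm B (rnorm B) x (\<Phi> ^^ n)"
    proof -
      have "0 < C0 ^ 2 * fnorm B (rnorm B) x (\<Phi> ^^ n)" using An fm(1) by linarith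
      then show ?thesis using C02 by (simp add: zero_less_mult_iff)
    qed
    have "ln (norm (cpr 1 (Am \<Phi>) n x)) \<le> c + ln (fnorm B (rnorm B) x (\<Phi> ^^ n))"
      unfolding c_def by (rule s.ln_le_of_le[OF An C02 fp fm(1)])
    moreover have "ln (fnorm B (rnorm B) x (\<Phi> ^^ n)) \<le> c + ln (norm (cpr 1 (Am \<Phi>) n x))"
      unfolding c_def by (rule s.ln_le_of_le[OF fp C02 An fm(2)])
    ultimately have d: "\<bar>ln (fnorm B (rnorm B) x (\<Phi> ^^ n)) - s.F n x\<bar> \<le> c" by (simp add: s.F_def abs_le_iff)
    have e: "1 / real n * ln (fnorm B (rnorm B) x (\<Phi> ^^ n)) - s.F n x / real n = (ln (fnorm B (rnorm B) x (\<Phi> ^^ n)) - s.F n x) * (1 / real n)"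
      by (simp add: diff_divide_distrib)
    show ?thesis unfolding e real_norm_def abs_mult using d by (simp add: mult_right_mono divide_right_mono)
  qed
  show "lim (\<lambda>n. 1 / real n * ln (fnorm B (rnorm B) x (\<Phi> ^^ n))) = lim (\<lambda>n. s.F n x / real n)"
    by (rule lim_eq_of_null_diff, rule Lim_null_comparison[OF always_eventually[OF allI[OF b]] tendsto_mult_right_zero[OF lim_1_over_n]])
qed

lemma max_lyap_coords: "max_lyap B \<Phi> = s.b"
  unfolding max_lyap_def s.max_lyap_eq[symmetric] by (rule SUP_cong[OF refl lyap1_eq])

lemma sup_WWu:
  assumes x: "x \<in> spts B"
  shows "(SUP w\<in>WWu_loc B \<Phi> (G x v). ereal (rnorm B ((\<Phi> ^^ n) w))) = ereal (s.Sn n x v)"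
proof -
  have val: "rnorm B ((\<Phi> ^^ n) (G y (bap (s.HU y x) v))) = s.val n x v y" if "y \<in> Wu_loc B x" for y
    unfolding s.val_def Nn_def pow_G[OF aut Wu_locD(1)[OF that]] ..
  have "(SUP w\<in>WWu_loc B \<Phi> (G x v). ereal (rnorm B ((\<Phi> ^^ n) w))) = (SUP y\<in>Wu_loc B x. ereal (s.val n x v y))"
    unfolding WWu_loc_G[OF x] image_image using val by (intro SUP_cong) auto
  also have "\<dots> = ereal (s.Sn n x v)"
  proof (rule antisym)
    show "(SUP y\<in>Wu_loc B x. ereal (s.val n x v y)) \<le> ereal (s.Sn n x v)"
      by (rule SUP_least) (simp add: s.val_le_Sn[OF x])
    show "ereal (s.Sn n x v) \<le> (SUP y\<in>Wu_loc B x. ereal (s.val n x v y))"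
    proof (rule ereal_le_epsilon2)
      fix e :: real assume e: "0 < e"
      have "\<exists>y\<in>Wu_loc B x. s.Sn n x v - e < s.val n x v y"
      proof (rule ccontr)
        assume "\<not> ?thesis"
        then have "s.Sn n x v \<le> s.Sn n x v - e" by (intro s.Sn_le x) (auto simp: not_less)
        with e show False by simp
      qed
      then obtain y where y: "y \<in> Wu_loc B x" "s.Sn n x v - e < s.val n x v y" by blast
      have "ereal (s.Sn n x v) \<le> ereal (s.val n x v y) + ereal e" using y(2) by simp
      also have "\<dots> \<le> (SUP y\<in>Wu_loc B x. ereal (s.val n x v y)) + ereal e"
        by (intro add_right_mono SUP_upper y(1))
      finally show "ereal (s.Sn n x v) \<le> (SUP y\<in>Wu_loc B x. ereal (s.val n x v y)) + ereal e" .
    qed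
  qed
  finally show ?thesis .
qed

lemma ebnorm_G: assumes x: "x \<in> spts B" shows "ebnorm B \<Phi> (G x v) = ereal (s.bn x v)"
  unfolding ebnorm_def sup_WWu[OF x] max_lyap_coords s.bn_def limsup_eq_rl[OF s.En_bdd[OF x], symmetric]
  by (simp add: s.En_def)

lemma bnorm_G: "x \<in> spts B \<Longrightarrow> bnorm B \<Phi> (G x v) = s.bn x v"
  by (simp add: bnorm_def ebnorm_G)

lemma ebnorm_finite: "u \<in> topspace (tot B) \<Longrightarrow> \<bar>ebnorm B \<Phi> u\<bar> \<noteq> \<infinity>"
  by (erule tot_cases) (simp add: ebnorm_G)

text \<open>Uniform continuity in the base for a fixed vector is combined with Lipschitz continuity
  in the vector, whose constant \<open>Cu\<close> is common to all fibers.\<close>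

lemma bn_continuous: "continuous_on (spts B \<times> UNIV) (\<lambda>p. s.bn (fst p) (snd p))"
  unfolding continuous_on_def
proof
  fix p :: "biseq \<times> (real ^ 'd)" assume "p \<in> spts B \<times> UNIV"
  then obtain x v where p: "p = (x, v)" and x: "x \<in> spts B" by auto
  show "((\<lambda>p. s.bn (fst p) (snd p)) \<longlongrightarrow> s.bn (fst p) (snd p)) (at p within spts B \<times> UNIV)"
  proof (rule tendstoI)
    fix \<epsilon> :: real assume \<epsilon>: "0 < \<epsilon>"
    define e where "e = \<epsilon> / (2 * (norm v + 1))"
    have nv: "0 < norm v + 1" by (simp add: add_nonneg_pos)
    have e: "0 < e" unfolding e_def using \<epsilon> nv by simp
    obtain \<delta> where \<delta>: "0 < \<delta>" "\<And>x x' u. x \<in> spts B \<Longrightarrow> x' \<in> spts B \<Longrightarrow> sdist B x x' < \<delta> \<Longrightarrow> \<bar>s.bn x u - s.bn x' u\<bar> \<le> e * norm u"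
      using s.bn_uniform[OF e] by blast
    have t: "((\<lambda>z. z) \<longlongrightarrow> p) (at p within spts B \<times> UNIV)" by (rule tendsto_ident_at)
    have t1: "((\<lambda>z. sdist B (fst z) x) \<longlongrightarrow> 0) (at p within spts B \<times> UNIV)"
      using sdist_tendsto_0[OF rate_pos tendsto_fst[OF t]] by (simp add: p)
    have "((\<lambda>z. s.Cu * norm (snd z - v)) \<longlongrightarrow> s.Cu * norm (v - v)) (at p within spts B \<times> UNIV)"
      using tendsto_snd[OF t] by (intro tendsto_intros) (simp add: p)
    then have t2: "((\<lambda>z. s.Cu * norm (snd z - v)) \<longlongrightarrow> 0) (at p within spts B \<times> UNIV)" by simp
    have ev1: "\<forall>\<^sub>F z in at p within spts B \<times> UNIV. sdist B (fst z) x < \<delta>" by (rule order_tendstoD(2)[OF t1 \<delta>(1)])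
    have ev2: "\<forall>\<^sub>F z in at p within spts B \<times> UNIV. s.Cu * norm (snd z - v) < \<epsilon> / 2" by (rule order_tendstoD(2)[OF t2]) (use \<epsilon> in simp)
    have ev3: "\<forall>\<^sub>F z in at p within spts B \<times> UNIV. z \<in> spts B \<times> UNIV" by (simp add: eventually_at_filter)
    show "\<forall>\<^sub>F z in at p within spts B \<times> UNIV. dist (s.bn (fst z) (snd z)) (s.bn (fst p) (snd p)) < \<epsilon>"
      using ev1 ev2 ev3
    proof eventually_elim
      case (elim z)
      then have z: "fst z \<in> spts B" by auto
      have 1: "\<bar>s.bn (fst z) v - s.bn x v\<bar> \<le> e * norm v" using \<delta>(2)[OF z x elim(1)] .
      have "e * norm v \<le> e * (norm v + 1)" using e by simp
      also have "\<dots> = \<epsilon> / 2" unfolding e_def using nv by (simp add: divide_simps)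
      finally have 2: "e * norm v \<le> \<epsilon> / 2" .
      have "s.bn (fst z) (snd z) \<le> s.bn (fst z) v + s.Cu * norm (snd z - v)" "s.bn (fst z) v \<le> s.bn (fst z) (snd z) + s.Cu * norm (v - snd z)"
        by (rule s.bn_diff_le[OF z])+
      then have "\<bar>s.bn (fst z) (snd z) - s.bn (fst z) v\<bar> \<le> s.Cu * norm (snd z - v)" by (simp add: abs_le_iff norm_minus_commute)
      with 1 2 elim(2) show ?case unfolding dist_real_def p by simp
    qed
  qed
qed

lemma bn_eq_0: assumes "x \<in> spts B" shows "s.bn x v = 0 \<longleftrightarrow> v = 0"
  using s.bn_ge[OF assms, of v] s.bn_le[OF assms, of v] s.bn_nn[OF assms, of v] by auto

lemma bnorm_finsler: "finsler_norm B (bnorm B \<Phi>)"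
  unfolding finsler_norm_def
proof (intro conjI ballI allI)
  show "continuous_map (tot B) euclideanreal (bnorm B \<Phi>)"
    by (rule continuous_from_coords[OF bn_continuous bnorm_G])
  fix x u assume x: "x \<in> spts B" and u: "u \<in> fiber B x"
  obtain v where v: "u = G x v" by (rule fiber_cases[OF x u])
  show "0 \<le> bnorm B \<Phi> u" unfolding v bnorm_G[OF x] by (rule s.bn_nn[OF x])
  show "bnorm B \<Phi> u = 0 \<longleftrightarrow> u = vzero B x" unfolding v bnorm_G[OF x] bn_eq_0[OF x] G_0[OF x, symmetric] G_inj[OF x] ..
  show "bnorm B \<Phi> (vscale B c u) = \<bar>c\<bar> * bnorm B \<Phi> u" for c
    unfolding v G_scale[OF x, symmetric] bnorm_G[OF x] by (rule s.bn_scale[OF x])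
  fix w assume w: "w \<in> fiber B x"
  obtain v' where v': "w = G x v'" by (rule fiber_cases[OF x w])
  show "bnorm B \<Phi> (vadd B u w) \<le> bnorm B \<Phi> u + bnorm B \<Phi> w"
    unfolding v v' G_add[OF x, symmetric] bnorm_G[OF x] by (rule s.bn_add[OF x])
qed

lemma bnorm_aut_le: "x \<in> spts B \<Longrightarrow> bnorm B \<Phi> (\<Phi> (G x v)) \<le> exp s.b * bnorm B \<Phi> (G x v)"
  using s.bn_A_le[of x v] by (simp add: aut_G[OF aut] bnorm_G)

lemma nonzero_vector: obtains v :: "real ^ 'd" where "v \<noteq> 0"
proof -
  obtain e :: "real ^ 'd" where "norm e = 1" using norm_Basis nonempty_Basis by (metis ex_in_conv)
  then have "e \<noteq> 0" by auto
  then show ?thesis by (rule that)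
qed

text \<open>The upper bound holds in every fiber, and a calibrated vector attains it at some point
  of a local unstable set.\<close>

lemma sup_fnorm: "(SUP x\<in>spts B. fnorm B (bnorm B \<Phi>) x \<Phi>) = exp s.b"
proof (rule antisym)
  have le: "fnorm B (bnorm B \<Phi>) x \<Phi> \<le> exp s.b" if "x \<in> spts B" for x
    by (rule fnorm_le[OF that bnorm_finsler _ bnorm_aut_le[OF that]]) simp
  then show "(SUP x\<in>spts B. fnorm B (bnorm B \<Phi>) x \<Phi>) \<le> exp s.b" by (intro cSUP_least nonempty)
  obtain x where x: "x \<in> spts B" using nonempty by blast
  obtain v :: "real ^ 'd" where v: "v \<noteq> 0" by (rule nonzero_vector)
  obtain y where y: "y \<in> Wu_loc B x" "s.bn (shift 1 y) (bap (Am \<Phi> y) (bap (s.HU y x) v)) = exp s.b * s.bn x v"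
    using s.bn_calibrated[OF x] by blast
  have ys: "y \<in> spts B" by (rule Wu_locD(1)[OF y(1)])
  let ?w = "bap (s.HU y x) v"
  have sc: "bnorm B \<Phi> (\<Phi> (G y (a *\<^sub>R w))) = \<bar>a\<bar> * bnorm B \<Phi> (\<Phi> (G y w))" for a w
    unfolding aut_G[OF aut ys] blinfun.scaleR_right by (rule finsler_props(3)[OF bnorm_finsler]) (use ys in simp)
  have "bnorm B \<Phi> (\<Phi> (G y ?w)) \<le> fnorm B (bnorm B \<Phi>) y \<Phi> * bnorm B \<Phi> (G y ?w)"
    by (rule le_fnorm[OF ys bnorm_finsler bnorm_aut_le[OF ys] sc])
  moreover have "bnorm B \<Phi> (\<Phi> (G y ?w)) = exp s.b * s.bn x v"
    unfolding aut_G[OF aut ys] using y(2) ys by (simp add: bnorm_G)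
  moreover have "bnorm B \<Phi> (G y ?w) = s.bn x v" unfolding bnorm_G[OF ys] by (rule s.bn_HU[OF x y(1)])
  ultimately have "exp s.b * s.bn x v \<le> fnorm B (bnorm B \<Phi>) y \<Phi> * s.bn x v" by simp
  moreover have "0 < s.bn x v" using bn_eq_0[OF x, of v] v s.bn_nn[OF x, of v] by linarith
  ultimately have "exp s.b \<le> fnorm B (bnorm B \<Phi>) y \<Phi>" by (rule mult_right_le_imp_le)
  also have "\<dots> \<le> (SUP x\<in>spts B. fnorm B (bnorm B \<Phi>) x \<Phi>)"
    by (rule cSUP_upper[OF ys]) (rule bdd_aboveI2[OF le])
  finally show "exp s.b \<le> (SUP x\<in>spts B. fnorm B (bnorm B \<Phi>) x \<Phi>)" .
qed

lemma bnorm_extremal: "extremal_norm B \<Phi> (bnorm B \<Phi>)"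
  unfolding extremal_norm_def sup_fnorm max_lyap_coords using bnorm_finsler by simp

lemma bnorm_barabanov: "barabanov_norm B \<Phi> (bnorm B \<Phi>)"
  unfolding barabanov_norm_def
proof (intro conjI ballI bnorm_extremal)
  fix u v assume u: "u \<in> topspace (tot B)" and v: "v \<in> WWu_loc B \<Phi> u"
  obtain x w where xw: "x \<in> spts B" "u = G x w" by (rule tot_cases[OF u])
  obtain y where y: "y \<in> Wu_loc B x" "v = G y (bap (s.HU y x) w)" using v unfolding xw(2) WWu_loc_G[OF xw(1)] by blast
  show "bnorm B \<Phi> u = bnorm B \<Phi> v"
    unfolding xw(2) y(2) bnorm_G[OF xw(1)] bnorm_G[OF Wu_locD(1)[OF y(1)]] by (rule s.bn_HU[OF xw(1) y(1), symmetric])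
next
  fix u assume u: "u \<in> topspace (tot B)"
  obtain x w where xw: "x \<in> spts B" "u = G x w" by (rule tot_cases[OF u])
  obtain y where y: "y \<in> Wu_loc B x" "s.bn (shift 1 y) (bap (Am \<Phi> y) (bap (s.HU y x) w)) = exp s.b * s.bn x w"
    using s.bn_calibrated[OF xw(1)] by blast
  have ys: "y \<in> spts B" by (rule Wu_locD(1)[OF y(1)])
  have "bnorm B \<Phi> (\<Phi> (G y (bap (s.HU y x) w))) = exp s.b * bnorm B \<Phi> (G y (bap (s.HU y x) w))"
    unfolding aut_G[OF aut ys] using y(2) ys s.bn_HU[OF xw(1) y(1), of w] by (simp add: bnorm_G)
  then show "\<exists>v\<in>WWu_loc B \<Phi> u. bnorm B \<Phi> (\<Phi> v) = exp (max_lyap B \<Phi>) * bnorm B \<Phi> v"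
    unfolding xw(2) WWu_loc_G[OF xw(1)] max_lyap_coords using y(1) by blast
qed

lemma bnorm_comparable: "comparable_norm B (bnorm B \<Phi>) (C0 * (C0 * s.Ck) + C0 * s.Cu)"
  unfolding comparable_norm_def
proof (intro ballI conjI)
  fix u assume u: "u \<in> topspace (tot B)"
  obtain x v where xv: "x \<in> spts B" "u = G x v" by (rule tot_cases[OF u])
  \<comment> \<open>The first summand serves the lower and the second the upper comparison. Both are
    at least 1, so the sum exceeds 1, as is required of \<open>C4\<close>.\<close>
  let ?C = "C0 * (C0 * s.Ck) + C0 * s.Cu"
  have pos: "0 \<le> C0 * (C0 * s.Ck)" "0 \<le> C0 * s.Cu" using C0(1) s.Ck_ge1 s.Cu_ge1 by simp_all
  have C: "0 < ?C" using C0(1) s.Ck_ge1 s.Cu_ge1 by (intro add_nonneg_pos pos) simp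
  have r: "rnorm B u = Nn x v" by (simp add: Nn_def xv(2))
  have "Nn x v \<le> C0 * norm v" by (rule C0(2)[OF xv(1)])
  also have "\<dots> \<le> C0 * (C0 * s.Ck * s.bn x v)" using C0(1) by (intro mult_left_mono s.bn_ge[OF xv(1)]) auto
  also have "\<dots> = C0 * (C0 * s.Ck) * s.bn x v" by simp
  also have "\<dots> \<le> ?C * s.bn x v" using pos by (intro mult_right_mono s.bn_nn[OF xv(1)]) auto
  finally have "rnorm B u \<le> ?C * s.bn x v" by (simp add: r)
  then show "inverse ?C * rnorm B u \<le> bnorm B \<Phi> u" unfolding xv(2) bnorm_G[OF xv(1)] using C by (simp add: field_simps)
  have "s.bn x v \<le> s.Cu * norm v" by (rule s.bn_le[OF xv(1)])
  also have "\<dots> \<le> s.Cu * (C0 * Nn x v)" using s.Cu_ge1 by (intro mult_left_mono C0(3) xv(1)) auto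
  also have "\<dots> = C0 * s.Cu * Nn x v" by simp
  also have "\<dots> \<le> ?C * Nn x v" using pos by (intro mult_right_mono Nn_nn xv(1)) auto
  finally show "bnorm B \<Phi> u \<le> ?C * rnorm B u" unfolding r unfolding xv(2) bnorm_G[OF xv(1)] .
qed

lemma comm_of_estimate:
  assumes h: "holonomy_estimate B \<Phi> \<theta>u C" and x: "x \<in> spts B" and x': "x' \<in> Ws_loc B x"
  shows "s.comm_le (C0 ^ 2 * (C * sdist B x x' powr \<theta>u)) x x'"
  unfolding s.comm_le_def
proof
  fix y assume y: "y \<in> Wu_loc B x"
  define y' where "y' = bracket x' y"
  have y': "y' \<in> Wu_loc B x'" "y' \<in> Ws_loc B y" unfolding y'_def using s.bracket_quad[OF x x' y] by auto
  have sp: "x' \<in> spts B" "y \<in> spts B" "y' \<in> spts B" using x' y y' by (auto dest: Wu_locD Ws_locD)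
  let ?X = "(s.HS y' y o\<^sub>L s.HU y x) - (s.HU y' x' o\<^sub>L s.HS x' x)"
  let ?L = "\<lambda>u. vsub B (Hs B \<Phi> y' y (Hu B \<Phi> y x u)) (Hu B \<Phi> y' x' (Hs B \<Phi> x' x u))"
  have L: "?L (G x v) = G y' (bap ?X v)" for v
    unfolding Hu_G[OF x y] Hs_G[OF sp(2) y'(2)] Hs_G[OF x x'] Hu_G[OF sp(1) y'(1)] G_diff[OF sp(3), symmetric]
    by (simp add: blinfun.diff_left)
  have "quadruple B x x' y y'" unfolding y'_def by (rule quadruple_bracket[OF x x' y])
  then have "fnorm B (rnorm B) x ?L \<le> C * sdist B x x' powr \<theta>u" using h unfolding holonomy_estimate_def by blast
  then have "C0 ^ 2 * fnorm B (rnorm B) x ?L \<le> C0 ^ 2 * (C * sdist B x x' powr \<theta>u)" by (intro mult_left_mono) auto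
  with fnorm_mat(1)[OF x sp(3) L] show "norm ((s.HS (bracket x' y) y o\<^sub>L s.HU y x) - (s.HU (bracket x' y) x' o\<^sub>L s.HS x' x)) \<le> C0 ^ 2 * (C * sdist B x x' powr \<theta>u)"
    unfolding y'_def by linarith
qed

text \<open>Points with different symbols at 0 are at distance 1, where a crude bound is enough.
  Otherwise \<open>bn_compare\<close> applies with the holonomy estimate as defect of commutation;
  the errors of order \<open>hexp B\<close> are absorbed since \<open>\<theta>u\<close> is not
  larger and distances are at most 1.\<close>

lemma bnorm_transport:
  assumes h: "holonomy_estimate B \<Phi> \<theta>u C" and C: "0 < C" and th: "0 < \<theta>u" "\<theta>u \<le> hexp B"
    and Cj: "0 \<le> Cj" "\<And>x y. x \<in> spts B \<Longrightarrow> y \<in> spts B \<Longrightarrow> norm (J y x - id_blinfun) \<le> Cj * sdist B x y powr hexp B"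
  shows "transport_bound B (bnorm B \<Phi>) \<theta>u ((s.Cu * Cj + s.C7 * (C0 ^ 2 * C + 1)) * (C0 * s.Ck) + (s.Cu * (1 + Cj) * (C0 * s.Ck) + 1))"
  unfolding transport_bound_def
proof (intro ballI)
  fix x x' assume x: "x \<in> spts B" and x': "x' \<in> spts B"
  let ?d = "sdist B x x' powr \<theta>u"
  define A1 where "A1 = (s.Cu * Cj + s.C7 * (C0 ^ 2 * C + 1)) * (C0 * s.Ck)"
  define A2 where "A2 = s.Cu * (1 + Cj) * (C0 * s.Ck)"
  have ps: "0 \<le> s.Cu" "0 \<le> s.C7" "0 \<le> C0 * s.Ck" using s.Cu_ge1 s.C7_nn C0(1) s.Ck_ge1 by simp_all
  have A0: "0 \<le> A1" "0 \<le> A2" unfolding A1_def A2_def using ps Cj(1) C by simp_all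
  let ?f = "bnorm B \<Phi>" and ?L = "transp B x' x"
  have fL: "?f (?L (G x v)) = s.bn x' (bap (J x' x) v)" for v unfolding transp_G[OF x x'] by (rule bnorm_G[OF x'])
  have sc: "?f (?L (G x (a *\<^sub>R v))) = \<bar>a\<bar> * ?f (?L (G x v))" for a v unfolding fL blinfun.scaleR_right by (rule s.bn_scale[OF x'])
  have J1: "norm (J x' x) \<le> 1 + Cj"
  proof -
    have "norm (J x' x - id_blinfun) \<le> Cj * 1"
      using Cj(2)[OF x x'] mult_left_mono[OF s.powr_sdist_le_1[of x x'] Cj(1)] by linarith
    then show ?thesis using norm_triangle_sub[of "J x' x" "id_blinfun :: 'd mat"] by simp
  qed
  have crude: "?f (?L (G x v)) \<le> A2 * ?f (G x v)" for v
  proof -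
    have "s.bn x' (bap (J x' x) v) \<le> s.Cu * norm (bap (J x' x) v)" by (rule s.bn_le[OF x'])
    also have "\<dots> \<le> s.Cu * ((1 + Cj) * norm v)" by (intro mult_left_mono norm_apply_le J1 ps)
    also have "\<dots> \<le> s.Cu * ((1 + Cj) * (C0 * s.Ck * s.bn x v))" using Cj(1) by (intro mult_left_mono s.bn_ge[OF x] ps) auto
    finally show ?thesis unfolding fL bnorm_G[OF x] by (simp add: A2_def mult_ac)
  qed
  have "\<bar>fnorm B ?f x ?L - 1\<bar> \<le> (A1 + (A2 + 1)) * ?d"
  proof (cases "x 0 = x' 0")
    case False
    have "fnorm B ?f x ?L \<le> A2" by (rule fnorm_le[OF x bnorm_finsler A0(2) crude])
    moreover have "0 \<le> fnorm B ?f x ?L"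
      by (rule fnorm_nn[OF x bnorm_finsler crude sc]) (simp add: fL s.bn_nn[OF x'])
    ultimately have "\<bar>fnorm B ?f x ?L - 1\<bar> \<le> A2 + 1" by linarith
    also have "\<dots> \<le> A1 + (A2 + 1)" using A0 by simp
    finally show ?thesis using sdist_eq_1_imp[of B x x', OF rate_pos False] by simp
  next
    case True
    have d01: "0 \<le> sdist B x x'" "sdist B x x' \<le> 1" using sdist_le_1[OF rate_pos] by auto
    have dd: "sdist B x x' powr hexp B \<le> ?d" using th d01 by (intro powr_mono') auto
    define \<eta> where "\<eta> = C0 ^ 2 * (C * ?d)"
    have \<eta>0: "0 \<le> \<eta>" unfolding \<eta>_def using C by simp
    \<comment> \<open>Stated for a generic pair, as it is used in both directions. The bracket is no
      farther from \<open>z'\<close> than \<open>z\<close> is, so the holonomy estimate between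
      bracket and \<open>z'\<close> is controlled by the original distance.\<close>
    have cmp: "s.bn z v \<le> s.bn z' v + s.C7 * ((C0 ^ 2 * C + 1) * ?d) * norm v"
      if z: "z \<in> spts B" "z' \<in> spts B" "z 0 = z' 0" and dz: "sdist B z z' = sdist B x x'" for z z' v
    proof -
      have b: "bracket z z' \<in> Ws_loc B z'" "bracket z z' \<in> spts B" using bracket_local[OF z] by (auto dest: Ws_locD)
      then have zb: "z' \<in> Ws_loc B (bracket z z')" using z(2) by (auto simp: Ws_loc_def)
      have "sdist B (bracket z z') z' powr \<theta>u \<le> ?d"
        using sdist_bracket_le(2)[OF rate_pos z] dz th(1) by (intro powr_mono2) auto
      then have "C0 ^ 2 * (C * sdist B (bracket z z') z' powr \<theta>u) \<le> \<eta>"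
        unfolding \<eta>_def using C by (intro mult_left_mono) auto
      then have "s.comm_le \<eta> (bracket z z') z'"
        using comm_of_estimate[OF h b(2) zb] unfolding s.comm_le_def by (meson order_trans)
      from s.bn_compare[OF z \<eta>0 this, of v]
      have "s.bn z v \<le> s.bn z' v + s.C7 * (\<eta> + sdist B z z' powr hexp B) * norm v" .
      also have "s.C7 * (\<eta> + sdist B z z' powr hexp B) * norm v \<le> s.C7 * ((C0 ^ 2 * C + 1) * ?d) * norm v"
        unfolding dz \<eta>_def using dd by (intro mult_right_mono mult_left_mono ps) (auto simp: algebra_simps)
      finally show ?thesis by simp
    qed
    have close: "\<bar>s.bn x' (bap (J x' x) v) - s.bn x v\<bar> \<le> A1 * ?d * s.bn x v" for v
    proof -
      have "\<bar>s.bn x' v - s.bn x v\<bar> \<le> s.C7 * ((C0 ^ 2 * C + 1) * ?d) * norm v"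
        using cmp[OF x x' True refl, of v] cmp[OF x' x True[symmetric] sdist_sym, of v] by (simp add: abs_le_iff)
      moreover have "\<bar>s.bn x' (bap (J x' x) v) - s.bn x' v\<bar> \<le> s.Cu * (Cj * ?d * norm v)"
      proof -
        have "norm (J x' x - id_blinfun) \<le> Cj * ?d" using Cj(2)[OF x x'] mult_left_mono[OF dd Cj(1)] by linarith
        from norm_apply_le[OF this, of v] have n: "norm (bap (J x' x) v - v) \<le> Cj * ?d * norm v" by (simp add: blinfun.diff_left)
        have "s.bn x' (bap (J x' x) v) \<le> s.bn x' v + s.Cu * norm (bap (J x' x) v - v)" "s.bn x' v \<le> s.bn x' (bap (J x' x) v) + s.Cu * norm (v - bap (J x' x) v)"
          by (rule s.bn_diff_le[OF x'])+
        then have "\<bar>s.bn x' (bap (J x' x) v) - s.bn x' v\<bar> \<le> s.Cu * norm (bap (J x' x) v - v)" by (simp add: abs_le_iff norm_minus_commute)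
        also have "\<dots> \<le> s.Cu * (Cj * ?d * norm v)" by (intro mult_left_mono n ps)
        finally show ?thesis .
      qed
      ultimately have "\<bar>s.bn x' (bap (J x' x) v) - s.bn x v\<bar> \<le> (s.Cu * Cj + s.C7 * (C0 ^ 2 * C + 1)) * ?d * norm v"
        by (simp add: algebra_simps)
      also have "\<dots> \<le> (s.Cu * Cj + s.C7 * (C0 ^ 2 * C + 1)) * ?d * (C0 * s.Ck * s.bn x v)"
        using ps Cj(1) C by (intro mult_left_mono s.bn_ge[OF x]) auto
      finally show ?thesis by (simp add: A1_def mult_ac)
    qed
    have up: "?f (?L (G x v)) \<le> (1 + A1 * ?d) * ?f (G x v)" for v
      using close[of v] unfolding fL bnorm_G[OF x] by (simp add: abs_le_iff algebra_simps)
    have u: "fnorm B ?f x ?L \<le> 1 + A1 * ?d"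
      by (rule fnorm_le[OF x bnorm_finsler _ up]) (use A0 in simp)
    obtain v :: "real ^ 'd" where v: "v \<noteq> 0" by (rule nonzero_vector)
    have p: "0 < s.bn x v" using bn_eq_0[OF x, of v] v s.bn_nn[OF x, of v] by linarith
    have "(1 - A1 * ?d) * s.bn x v \<le> s.bn x' (bap (J x' x) v)" using close[of v] by (simp add: abs_le_iff algebra_simps)
    also have "\<dots> \<le> fnorm B ?f x ?L * s.bn x v" using le_fnorm[OF x bnorm_finsler crude sc, of v] unfolding fL bnorm_G[OF x] .
    finally have "1 - A1 * ?d \<le> fnorm B ?f x ?L" using p by (rule mult_right_le_imp_le)
    with u have "\<bar>fnorm B ?f x ?L - 1\<bar> \<le> A1 * ?d" by (simp add: abs_le_iff)
    also have "\<dots> \<le> (A1 + (A2 + 1)) * ?d" using A0 by (intro mult_right_mono) auto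
    finally show ?thesis .
  qed
  then show "\<bar>fnorm B ?f x ?L - 1\<bar> \<le> ((s.Cu * Cj + s.C7 * (C0 ^ 2 * C + 1)) * (C0 * s.Ck) + (s.Cu * (1 + Cj) * (C0 * s.Ck) + 1)) * ?d"
    by (simp only: A1_def A2_def)
qed

text \<open>By invariance of the norm, local unstable holonomies are isometries and have operator
  norm exactly 1.\<close>

lemma bnorm_unstable: "unstable_holonomy_bound B \<Phi> (bnorm B \<Phi>) 1"
  unfolding unstable_holonomy_bound_def
proof (intro ballI)
  fix x x' assume x: "x \<in> spts B" and x': "x' \<in> Wu_loc B x"
  let ?f = "bnorm B \<Phi>" and ?L = "Hu B \<Phi> x' x"
  have xs': "x' \<in> spts B" by (rule Wu_locD(1)[OF x'])
  have eq: "?f (?L (G x v)) = ?f (G x v)" for v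
    unfolding Hu_G[OF x x'] bnorm_G[OF x] bnorm_G[OF xs'] by (rule s.bn_HU[OF x x'])
  have le: "?f (?L (G x v)) \<le> 1 * ?f (G x v)" for v by (simp add: eq)
  have sc: "?f (?L (G x (a *\<^sub>R v))) = \<bar>a\<bar> * ?f (?L (G x v))" for a v unfolding eq by (rule finsler_props(3)[OF bnorm_finsler x])
  have u: "fnorm B ?f x ?L \<le> 1" by (rule fnorm_le[OF x bnorm_finsler _ le]) simp
  obtain v :: "real ^ 'd" where v: "v \<noteq> 0" by (rule nonzero_vector)
  have p: "0 < ?f (G x v)" using finsler_props(1,2)[OF bnorm_finsler x, of v] v by linarith
  have "1 * ?f (G x v) \<le> fnorm B ?f x ?L * ?f (G x v)" using le_fnorm[OF x bnorm_finsler le sc, of v] by (simp add: eq)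
  then have "1 \<le> fnorm B ?f x ?L" using p by (rule mult_right_le_imp_le)
  with u show "\<bar>fnorm B ?f x ?L - 1\<bar> \<le> 1 * sdist B x x' powr max (hexp B) 1" by simp
qed

end

context vbundle
begin

lemma uniform_barabanov:
  assumes sp: "spannable B \<Phi>" and K: "1 \<le> K" and \<kappa>: "kappa_exponent B \<kappa>u" and th: "theta_u_exponent B \<Phi> K \<kappa>u \<theta>u"
  shows "\<exists>C4>1. \<exists>C5>0. \<exists>C6>0.
        comparable_norm B (bnorm B \<Phi>) C4 \<and>
        transport_bound B (bnorm B \<Phi>) \<theta>u C5 \<and>
        unstable_holonomy_bound B \<Phi> (bnorm B \<Phi>) C6 \<and>
        (\<Phi> \<in> Aut B K \<longrightarrow>
          (\<exists>\<delta>>0. \<forall>\<Psi>\<in>Aut B K. c0dist B \<Psi> \<Phi> < \<delta> \<longrightarrow>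
            (\<exists>f. extremal_norm B \<Psi> f \<and>
               comparable_norm B f C4 \<and>
               transport_bound B f \<theta>u C5 \<and>
               unstable_holonomy_bound B \<Psi> f C6)))"
proof -
  have a: "automorphism B \<Phi>"
    using sp unfolding spannable_def fiber_bunched_def holder_automorphism_def by blast
  obtain Kc Hc Cb q m D \<delta>1 where d1: "0 < \<delta>1" and s0: "spann B (Am \<Phi>) (Aim \<Phi>) Kc Hc Cb q (hexp B) m D C0 Nn"
    and fam: "\<And>\<Psi>. \<Psi> \<in> Aut B K \<Longrightarrow> c0dist B \<Psi> \<Phi> < \<delta>1 \<Longrightarrow> spann B (Am \<Psi>) (Aim \<Psi>) Kc Hc Cb q (hexp B) m D C0 Nn"
    using spann_family[OF sp K] by blast
  have "\<theta>u \<le> hexp B * \<kappa>u" and t0: "0 < \<theta>u" using th unfolding theta_u_exponent_def by blast+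
  moreover have "hexp B * \<kappa>u \<le> hexp B * 1" using \<kappa> hexp_pos unfolding kappa_exponent_def by (intro mult_left_mono) auto
  ultimately have t1: "\<theta>u \<le> hexp B" by simp
  obtain C \<delta>2 where C: "0 < C" and hC: "holonomy_estimate B \<Phi> \<theta>u C" and d2: "0 < \<delta>2"
    and hfam: "\<And>\<Psi>. \<Psi> \<in> Aut B K \<Longrightarrow> c0dist B \<Psi> \<Phi> < \<delta>2 \<Longrightarrow> holonomy_estimate B \<Psi> \<theta>u C"
    using th unfolding theta_u_exponent_def by blast
  obtain Cj where Cj: "0 \<le> Cj" "\<And>x y. x \<in> spts B \<Longrightarrow> y \<in> spts B \<Longrightarrow> norm (J y x - id_blinfun) \<le> Cj * sdist B x y powr hexp B"
    using J_holder by blast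
  interpret b: spannable_bundle B \<Phi> Kc Hc Cb q m D
    by (intro spannable_bundle.intro vbundle_axioms s0 spannable_bundle_axioms.intro a)
  let ?C4 = "C0 * (C0 * b.s.Ck) + C0 * b.s.Cu"
  let ?C5 = "(b.s.Cu * Cj + b.s.C7 * (C0 ^ 2 * C + 1)) * (C0 * b.s.Ck) + (b.s.Cu * (1 + Cj) * (C0 * b.s.Ck) + 1)"
  have one: "1 \<le> C0 * (C0 * b.s.Ck)" "1 \<le> C0 * b.s.Cu"
    using mult_mono[OF C0(1) mult_mono[OF C0(1) b.s.Ck_ge1]] mult_mono[OF C0(1) b.s.Cu_ge1] C0(1) b.s.Ck_ge1 b.s.Cu_ge1 by simp_all
  have C4: "1 < ?C4" using one by linarith
  have "0 \<le> (b.s.Cu * Cj + b.s.C7 * (C0 ^ 2 * C + 1)) * (C0 * b.s.Ck)" "0 \<le> b.s.Cu * (1 + Cj) * (C0 * b.s.Ck)"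
    using b.s.Cu_ge1 b.s.C7_nn C0(1) b.s.Ck_ge1 Cj(1) C by simp_all
  then have C5: "0 < ?C5" by linarith
  have nearby: "\<exists>f. extremal_norm B \<Psi> f \<and> comparable_norm B f ?C4 \<and> transport_bound B f \<theta>u ?C5 \<and> unstable_holonomy_bound B \<Psi> f 1"
    if \<Psi>: "\<Psi> \<in> Aut B K" and cl: "c0dist B \<Psi> \<Phi> < min \<delta>1 \<delta>2" for \<Psi>
  proof -
    have cl': "c0dist B \<Psi> \<Phi> < \<delta>1" "c0dist B \<Psi> \<Phi> < \<delta>2" using cl by simp_all
    \<comment> \<open>The same numbers as for \<open>\<Phi>\<close>: the constants of this
      interpretation are literally those of \<open>b\<close>, which is what makes \<open>?C4\<close>
      and \<open>?C5\<close> common to both.\<close>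
    interpret p: spannable_bundle B \<Psi> Kc Hc Cb q m D
      by (intro spannable_bundle.intro vbundle_axioms fam[OF \<Psi> cl'(1)] spannable_bundle_axioms.intro AutD(2)[OF \<Psi>])
    show ?thesis
      using p.bnorm_extremal p.bnorm_comparable p.bnorm_transport[OF hfam[OF \<Psi> cl'(2)] C t0 t1 Cj] p.bnorm_unstable by blast
  qed
  have near: "\<exists>\<delta>>0. \<forall>\<Psi>\<in>Aut B K. c0dist B \<Psi> \<Phi> < \<delta> \<longrightarrow>
     (\<exists>f. extremal_norm B \<Psi> f \<and> comparable_norm B f ?C4 \<and> transport_bound B f \<theta>u ?C5 \<and> unstable_holonomy_bound B \<Psi> f 1)"
    by (intro exI[of _ "min \<delta>1 \<delta>2"] conjI ballI impI nearby) (use d1 d2 in auto)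
  show ?thesis
    by (rule exI[of _ ?C4], rule conjI[OF C4], rule exI[of _ ?C5], rule conjI[OF C5], rule exI[of _ 1], rule conjI[OF zero_less_one],
        intro conjI impI b.bnorm_comparable b.bnorm_transport[OF hC C t0 t1 Cj] b.bnorm_unstable near)
qed

end

theorem theorem5p7:
  fixes B :: "('e, 'd::finite) hbundle" and \<Phi> :: "'e \<Rightarrow> 'e"
  assumes "bundle_setting B"
    and "spannable B \<Phi>"
  shows "(\<forall>u\<in>topspace (tot B). \<bar>ebnorm B \<Phi> u\<bar> \<noteq> \<infinity>) \<and>
    barabanov_norm B \<Phi> (bnorm B \<Phi>) \<and>
    (\<forall>K \<kappa>u \<theta>u. 1 \<le> K \<and> kappa_exponent B \<kappa>u \<and> theta_u_exponent B \<Phi> K \<kappa>u \<theta>u \<longrightarrow>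
      (\<exists>C4>1. \<exists>C5>0. \<exists>C6>0.
        comparable_norm B (bnorm B \<Phi>) C4 \<and>
        transport_bound B (bnorm B \<Phi>) \<theta>u C5 \<and>
        unstable_holonomy_bound B \<Phi> (bnorm B \<Phi>) C6 \<and>
        (\<Phi> \<in> Aut B K \<longrightarrow>
          (\<exists>\<delta>>0. \<forall>\<Psi>\<in>Aut B K. c0dist B \<Psi> \<Phi> < \<delta> \<longrightarrow>
            (\<exists>f. extremal_norm B \<Psi> f \<and>
               comparable_norm B f C4 \<and>
               transport_bound B f \<theta>u C5 \<and>
               unstable_holonomy_bound B \<Psi> f C6)))))"
proof -
  interpret vbundle B by (rule vbundle.intro[OF assms(1)])
  have a: "automorphism B \<Phi>"
    using assms(2) unfolding spannable_def fiber_bunched_def holder_automorphism_def by blast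
  \<comment> \<open>Only the statement about \<open>\<Phi>\<close> itself is taken from the family,
    here with \<open>K = 1\<close>.\<close>
  obtain Kc Hc Cb q m D where "spann B (Am \<Phi>) (Aim \<Phi>) Kc Hc Cb q (hexp B) m D C0 Nn"
    using spann_family[OF assms(2) order_refl] by blast
  then interpret b: spannable_bundle B \<Phi> Kc Hc Cb q m D
    by (intro spannable_bundle.intro vbundle_axioms spannable_bundle_axioms.intro a)
  show ?thesis
    by (intro conjI ballI b.ebnorm_finite b.bnorm_barabanov allI impI; (elim conjE)?; (rule uniform_barabanov[OF assms(2)])?; assumption?)
qed

end
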